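(* Let $D^k\subset\mathbb R^d$ be a quasi-regular element with representative size $h=\operatorname{diam}(D^k)$. Let $N\ge0$, let $\bm W\in\big(W^{N+1,\infty}(D^k)\big)^{d\times d}$ be a pointwise symmetric positive-definite matrix weight with $0<w_{\min}\le\|\bm W(\bm x)\|_2\le w_{\max}<\infty$ and $0<\tilde w_{\min}\le\|\bm W^{-1}(\bm x)\|_2\le\tilde w_{\max}<\infty$ for all $\bm x$, and let $\bm v\in\big(W^{N+1,2}(D^k)\big)^d$. Then $$\big\|\bm v-\bm W^{-1}\Pi_N(\bm W\bm v)\big\|_{L^2(D^k)}\le C\,h^{N+1}\,\big\|\sqrt J\big\|_{L^\infty(D^k)}\Big\|\frac1{\sqrt J}\Big\|_{L^\infty(D^k)}\tilde w_{\max}\,\|\bm W\|_{N+1,2,\infty}\,\|\bm v\|_{W^{N+1,2}(D^k)},$$ where the constant $C$ is independent of $h$, $\bm W$ and $\bm v$.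
   Context: $D^k$ is the image of a reference simplex $\widehat D$ under a smooth invertible map $\bm\Phi^k$ with Jacobian determinant $J$ (positive). $P^N(D^k)$ denotes functions $u$ on $D^k$ with $u\circ\bm\Phi^k\in P^N(\widehat D)$, polynomials of total degree at most $N$. $\Pi_N$ is the $L^2(D^k)$-orthogonal projection onto $P^N(D^k)$, applied componentwise to vector-valued functions. Quasi-regular: the standard scaling argument applies to the map, i.e. there is a constant $C_0$, independent of $h$, such that $\|D^{\bm\alpha}\bm\Phi^k\|_{L^\infty(\widehat D)}\le C_0h^{|\bm\alpha|}$ for $1\le|\bm\alpha|\le N+1$; the constant $C$ of the claim may depend on $N$, $d$ and $C_0$. (Affine elements of size $h$ satisfy this.) Norms: for vector functions, $\|\bm v\|_{W^{k,p}}^p=\sum_i\|\bm v_i\|_{W^{k,p}}^p$. For matrix weights, $\|\bm W\|_{k,p,\infty}^p=\sum_{|\bm\alpha|\le k}\sup_{\bm x}\|D^{\bm\alpha}\bm W(\bm x)\|_p^p$, where $D^{\bm\alpha}$ acts entrywise and $\|\cdot\|_p$ is the induced matrix $p$-norm; $\|\cdot\|_2$ is the spectral norm. *)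

theory Defs
  imports "HOL-Analysis.Analysis" "HOL-Probability.Essential_Supremum"
begin

definition mi_order :: "nat ^ 'n \<Rightarrow> nat" where
  "mi_order \<alpha> = (\<Sum>i\<in>UNIV. \<alpha> $ i)"

lemma finite_mi_order_le: "finite {\<alpha> :: nat ^ 'n. mi_order \<alpha> \<le> k}"
proof (rule finite_subset)
  show "{\<alpha> :: nat ^ 'n. mi_order \<alpha> \<le> k} \<subseteq> vec_lambda ` (UNIV \<rightarrow>\<^sub>E {..k})"
  proof
    fix \<alpha> :: "nat ^ 'n"
    assume "\<alpha> \<in> {\<alpha>. mi_order \<alpha> \<le> k}"
    then have "\<alpha> $ i \<le> k" for i
      unfolding mi_order_def
      by (metis (mono_tags) UNIV_I finite mem_Collect_eq member_le_sum order_trans zero_le)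
    then have "(\<lambda>i. \<alpha> $ i) \<in> UNIV \<rightarrow>\<^sub>E {..k}" by auto
    then show "\<alpha> \<in> vec_lambda ` (UNIV \<rightarrow>\<^sub>E {..k})"
      by (metis image_eqI vec_nth_inverse)
  qed
  show "finite (vec_lambda ` ((UNIV :: 'n set) \<rightarrow>\<^sub>E {..k}))"
    by (simp add: finite_PiE)
qed

definition partial :: "'n::finite \<Rightarrow> (real ^ 'n \<Rightarrow> 'b::real_normed_vector) \<Rightarrow> real ^ 'n \<Rightarrow> 'b" where
  "partial i f x = frechet_derivative f (at x) (axis i 1)"

text \<open>\<open>C\<^sup>\<infinity>\<close> on an open set: every iterated partial derivative exists and is
  (Frechet) differentiable, hence continuous.\<close>
definition smooth_on :: "(real ^ 'n::finite) set \<Rightarrow> (real ^ 'n \<Rightarrow> 'b::real_normed_vector) \<Rightarrow> bool" where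
  "smooth_on U f \<longleftrightarrow> open U \<and> (\<forall>is. (foldr partial is f) differentiable_on U)"

text \<open>The index type carries no order, so \<open>mi_partial\<close> fixes some enumeration of the
  directions; for smooth functions the result does not depend on it.\<close>
definition directions :: "'n::finite list" where
  "directions = (SOME is. distinct is \<and> set is = UNIV)"

definition mi_partial :: "nat ^ 'n::finite \<Rightarrow> (real ^ 'n \<Rightarrow> 'b::real_normed_vector) \<Rightarrow> real ^ 'n \<Rightarrow> 'b" where
  "mi_partial \<alpha> f = foldr (\<lambda>i. partial i ^^ (\<alpha> $ i)) directions f"

definition L2_space :: "(real ^ 'n::finite) set \<Rightarrow> (real ^ 'n \<Rightarrow> real) set" where
  "L2_space S = {f \<in> borel_measurable (lebesgue_on S). integrable (lebesgue_on S) (\<lambda>x. (f x)\<^sup>2)}"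

definition Linf_space :: "(real ^ 'n::finite) set \<Rightarrow> (real ^ 'n \<Rightarrow> real) set" where
  "Linf_space S = {f \<in> borel_measurable (lebesgue_on S). \<exists>c. AE x in lebesgue_on S. \<bar>f x\<bar> \<le> c}"

text \<open>For vector-valued \<open>f\<close> this is the square root of the sum of the squared norms of the components.\<close>
definition L2_norm :: "(real ^ 'n::finite) set \<Rightarrow> (real ^ 'n \<Rightarrow> 'b::real_normed_vector) \<Rightarrow> real" where
  "L2_norm S f = sqrt (LINT x|lebesgue_on S. (norm (f x))\<^sup>2)"

text \<open>Only meaningful for measurable, essentially bounded \<open>f\<close> (an infinite essential supremum is
  sent to 0).\<close>
definition Linf_norm :: "(real ^ 'n::finite) set \<Rightarrow> (real ^ 'n \<Rightarrow> 'b::real_normed_vector) \<Rightarrow> real" where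
  "Linf_norm S f = real_of_ereal (esssup (lebesgue_on S) (\<lambda>x. ereal (norm (f x))))"

definition test_function :: "(real ^ 'n::finite) set \<Rightarrow> (real ^ 'n \<Rightarrow> real) \<Rightarrow> bool" where
  "test_function U \<phi> \<longleftrightarrow> smooth_on UNIV \<phi> \<and> (\<exists>K. compact K \<and> K \<subseteq> U \<and> (\<forall>x. x \<notin> K \<longrightarrow> \<phi> x = 0))"

definition locally_integrable_on :: "(real ^ 'n::finite \<Rightarrow> real) \<Rightarrow> (real ^ 'n) set \<Rightarrow> bool"
    (infixr \<open>locally'_integrable'_on\<close> 46) where
  "f locally_integrable_on U \<longleftrightarrow> (\<forall>K. compact K \<and> K \<subseteq> U \<longrightarrow> f absolutely_integrable_on K)"

definition is_weak_partial ::
    "(real ^ 'n::finite) set \<Rightarrow> nat ^ 'n \<Rightarrow> (real ^ 'n \<Rightarrow> real) \<Rightarrow> (real ^ 'n \<Rightarrow> real) \<Rightarrow> bool" where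
  "is_weak_partial U \<alpha> u g \<longleftrightarrow>
     u locally_integrable_on U \<and> g locally_integrable_on U \<and>
     (\<forall>\<phi>. test_function U \<phi> \<longrightarrow>
        (LINT x|lebesgue_on U. u x * mi_partial \<alpha> \<phi> x) =
          (- 1) ^ mi_order \<alpha> * (LINT x|lebesgue_on U. g x * \<phi> x))"

text \<open>A representative of the weak derivative, which is unique up to null sets.\<close>
definition weak_partial :: "(real ^ 'n::finite) set \<Rightarrow> nat ^ 'n \<Rightarrow> (real ^ 'n \<Rightarrow> real) \<Rightarrow> real ^ 'n \<Rightarrow> real" where
  "weak_partial U \<alpha> u = (SOME g. is_weak_partial U \<alpha> u g)"

text \<open>\<open>sobolev (L2_space U) U k\<close> is \<open>W\<^sup>k\<^sup>,\<^sup>2(U)\<close>, and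
  \<open>sobolev (Linf_space U) U k\<close> is \<open>W\<^sup>k\<^sup>,\<^sup>\<infinity>(U)\<close>, for open \<open>U\<close>.\<close>
definition sobolev :: "(real ^ 'n::finite \<Rightarrow> real) set \<Rightarrow> (real ^ 'n) set \<Rightarrow> nat \<Rightarrow> (real ^ 'n \<Rightarrow> real) set" where
  "sobolev X U k = {u. \<forall>\<alpha>. mi_order \<alpha> \<le> k \<longrightarrow> (\<exists>g\<in>X. is_weak_partial U \<alpha> u g)}"

definition sobolev_norm :: "(real ^ 'n::finite) set \<Rightarrow> nat \<Rightarrow> (real ^ 'n \<Rightarrow> real) \<Rightarrow> real" where
  "sobolev_norm U k u = sqrt (\<Sum>\<alpha> | mi_order \<alpha> \<le> k. (L2_norm U (weak_partial U \<alpha> u))\<^sup>2)"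

definition sobolev_norm_vec :: "(real ^ 'n::finite) set \<Rightarrow> nat \<Rightarrow> (real ^ 'n \<Rightarrow> real ^ 'm::finite) \<Rightarrow> real" where
  "sobolev_norm_vec U k v = sqrt (\<Sum>i\<in>UNIV. (sobolev_norm U k (\<lambda>x. v x $ i))\<^sup>2)"

definition spectral_norm :: "real ^ 'm::finite ^ 'm \<Rightarrow> real" where
  "spectral_norm A = onorm ((*v) A)"

definition spd_matrix :: "real ^ 'm::finite ^ 'm \<Rightarrow> bool" where
  "spd_matrix A \<longleftrightarrow> transpose A = A \<and> (\<forall>\<xi>. \<xi> \<noteq> 0 \<longrightarrow> \<xi> \<bullet> (A *v \<xi>) > 0)"

definition weak_partial_mat ::
    "(real ^ 'n::finite) set \<Rightarrow> nat ^ 'n \<Rightarrow> (real ^ 'n \<Rightarrow> real ^ 'm::finite ^ 'm) \<Rightarrow> real ^ 'n \<Rightarrow> real ^ 'm ^ 'm" where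
  "weak_partial_mat U \<alpha> W x = (\<chi> i j. weak_partial U \<alpha> (\<lambda>y. W y $ i $ j) x)"

text \<open>\<open>\<parallel>W\<parallel>\<^sub>k\<^sub>,\<^sub>2\<^sub>,\<^sub>\<infinity>\<close>. Weak derivatives being defined almost everywhere, the supremum over
  \<open>x\<close> is the essential one.\<close>
definition weight_norm :: "(real ^ 'n::finite) set \<Rightarrow> nat \<Rightarrow> (real ^ 'n \<Rightarrow> real ^ 'm::finite ^ 'm) \<Rightarrow> real" where
  "weight_norm U k W =
     sqrt (\<Sum>\<alpha> | mi_order \<alpha> \<le> k. (Linf_norm U (\<lambda>x. spectral_norm (weak_partial_mat U \<alpha> W x)))\<^sup>2)"

definition jacobian :: "(real ^ 'n::finite \<Rightarrow> real ^ 'n) \<Rightarrow> real ^ 'n \<Rightarrow> real" where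
  "jacobian \<Phi> x = det (matrix (frechet_derivative \<Phi> (at x)))"

text \<open>Smoothness on the closed simplex \<open>S\<close> means smoothness on some open neighbourhood of it.\<close>
definition element_map :: "(real ^ 'n::finite) set \<Rightarrow> (real ^ 'n \<Rightarrow> real ^ 'n) \<Rightarrow> bool" where
  "element_map S \<Phi> \<longleftrightarrow>
     (\<exists>U. S \<subseteq> U \<and> smooth_on U \<Phi>) \<and> inj_on \<Phi> S \<and> (\<forall>x\<in>S. jacobian \<Phi> x > 0)"

text \<open>The Jacobian determinant as a function on the physical element \<open>\<Phi> ` S\<close>.\<close>
definition element_jacobian ::
    "(real ^ 'n::finite) set \<Rightarrow> (real ^ 'n \<Rightarrow> real ^ 'n) \<Rightarrow> real ^ 'n \<Rightarrow> real" where
  "element_jacobian S \<Phi> y = jacobian \<Phi> (inv_into S \<Phi> y)"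

definition quasi_regular ::
    "nat \<Rightarrow> real \<Rightarrow> (real ^ 'n::finite) set \<Rightarrow> (real ^ 'n \<Rightarrow> real ^ 'n) \<Rightarrow> bool" where
  "quasi_regular N C\<^sub>0 S \<Phi> \<longleftrightarrow>
     (\<forall>\<alpha>. 1 \<le> mi_order \<alpha> \<and> mi_order \<alpha> \<le> N + 1 \<longrightarrow>
        Linf_norm S (mi_partial \<alpha> \<Phi>) \<le> C\<^sub>0 * diameter (\<Phi> ` S) ^ mi_order \<alpha>)"

definition polys :: "nat \<Rightarrow> (real ^ 'n::finite \<Rightarrow> real) set" where
  "polys N = {p. \<exists>c. p = (\<lambda>x. \<Sum>\<alpha> | mi_order \<alpha> \<le> N. c \<alpha> * (\<Prod>i\<in>UNIV. (x $ i) ^ (\<alpha> $ i)))}"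

definition mapped_polys ::
    "nat \<Rightarrow> (real ^ 'n::finite) set \<Rightarrow> (real ^ 'n \<Rightarrow> real ^ 'n) \<Rightarrow> (real ^ 'n \<Rightarrow> real) set" where
  "mapped_polys N S \<Phi> = {u. \<exists>p\<in>polys N. \<forall>x\<in>S. u (\<Phi> x) = p x}"

text \<open>The choice is unique on \<open>\<Phi> ` S\<close>; values outside the element are irrelevant.\<close>
definition L2_proj ::
    "nat \<Rightarrow> (real ^ 'n::finite) set \<Rightarrow> (real ^ 'n \<Rightarrow> real ^ 'n) \<Rightarrow> (real ^ 'n \<Rightarrow> real) \<Rightarrow> real ^ 'n \<Rightarrow> real" where
  "L2_proj N S \<Phi> u =
     (SOME q. q \<in> mapped_polys N S \<Phi> \<and>
        (\<forall>p\<in>mapped_polys N S \<Phi>. (LINT x|lebesgue_on (\<Phi> ` S). (u x - q x) * p x) = 0))"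

definition L2_proj_vec ::
    "nat \<Rightarrow> (real ^ 'n::finite) set \<Rightarrow> (real ^ 'n \<Rightarrow> real ^ 'n) \<Rightarrow> (real ^ 'n \<Rightarrow> real ^ 'm::finite) \<Rightarrow> real ^ 'n \<Rightarrow> real ^ 'm" where
  "L2_proj_vec N S \<Phi> v x = (\<chi> i. L2_proj N S \<Phi> (\<lambda>y. v y $ i) x)"

end

theory Submission imports Defs begin

text \<open>Since \<open>v - W\<^sup>-\<^sup>1 \<Pi>\<^sub>N (W v) = W\<^sup>-\<^sup>1 (W v - \<Pi>\<^sub>N (W v))\<close>, it suffices to bound the projection error of each
  component \<open>u = \<Sum>\<^sub>j W\<^sub>i\<^sub>j v\<^sub>j\<close>, and \<open>\<Pi>\<^sub>N u\<close> is the best approximation of \<open>u\<close> from \<open>P\<^sup>N(D\<^sup>k)\<close>. A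
  derivative of \<open>u \<circ> \<Phi>\<close> of order \<open>N + 1\<close> is a sum of products of derivatives of \<open>W\<close>, of \<open>v\<close> and of
  \<open>\<Phi>\<close> in which the factors from \<open>\<Phi>\<close> contribute \<open>h\<^sup>N\<^sup>+\<^sup>1\<close> altogether, so a Taylor polynomial of
  \<open>u \<circ> \<Phi>\<close> at a well-chosen point has the required \<open>L\<^sup>2\<close> error; changing variables to the reference
  element and back costs the factors \<open>\<surd>J\<close> and \<open>1 / \<surd>J\<close>.

  No Leibniz or chain rule for weak derivatives is needed: \<open>W\<close> and \<open>v\<close> are mollified, and the
  argument is applied to smooth functions on the images of convex compact sets that exhaust the
  interior of the reference element. The constants do not depend on these sets, and because
  \<open>P\<^sup>N(D\<^sup>k)\<close> is finite-dimensional, the error of the projection on the whole element inherits the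
  bound.\<close>

subsection \<open>Iterated partial derivatives\<close>

text \<open>The reference element has a fixed size, so Taylor's formula on it yields only a
  constant: every power of \<open>h\<close> stems from \<open>quasi_regular\<close>. Hence pointwise
  bounds are weighted, an order-\<open>j\<close> derivative being allowed the size
  \<open>h ^ j\<close>. A mollified Sobolev function has the right derivatives only at points
  farther from the boundary than the mollification radius, which confines the estimate to compact
  parts. The approximating polynomials are found separately for each part and each accuracy, and
  nothing is known about their convergence. What carries the bound over to the whole element is that
  in a finite-dimensional space the mass outside a large part is a small fraction of the total mass,
  uniformly over the space. A second obstacle is the product: weights are bounded, but
  \<open>v\<close> is only square integrable, so mollified products converge in \<open>L2\<close>
  only after a truncation of \<open>v\<close>. Derivatives, weak derivatives and projections are
  defined by choice, and \<open>Linf_norm\<close> sends an infinite value to 0. Uniqueness,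
  existence and finiteness must therefore be proved before the norms in the claim carry
  information.\<close>

lemma partial_cong:
  assumes "open U" "x \<in> U" "\<And>z. z \<in> U \<Longrightarrow> f z = g z"
  shows "partial i f x = partial i g x"
proof -
  \<comment> \<open>\<open>frechet_derivative\<close> is a choice among all derivatives. Both
    functions have the same derivatives at \<open>x\<close>, so the choices agree even where neither
    function is differentiable.\<close>
  have "(f has_derivative D) (at x) = (g has_derivative D) (at x)" for D
    using has_derivative_transform_within_open[of f D x UNIV U g]
      has_derivative_transform_within_open[of g D x UNIV U f] assms by auto
  then show ?thesis unfolding partial_def frechet_derivative_def by simp
qed

lemma partial_has_derivative:
  assumes "(f has_derivative D) (at x)"
  shows "partial i f x = D (axis i 1)"
  unfolding partial_def using frechet_derivative_at[OF assms] by simp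

lemma has_derivative_partial:
  fixes f :: "real ^ 'n::finite \<Rightarrow> 'b::real_normed_vector"
  assumes "f differentiable (at x)"
  shows "(f has_derivative (\<lambda>h. \<Sum>i\<in>UNIV. h $ i *\<^sub>R partial i f x)) (at x)"
proof -
  have D: "(f has_derivative frechet_derivative f (at x)) (at x)"
    using assms frechet_derivative_works by blast
  then have lin: "linear (frechet_derivative f (at x))"
    using has_derivative_linear by blast
  have "frechet_derivative f (at x) = (\<lambda>h. \<Sum>i\<in>UNIV. h $ i *\<^sub>R partial i f x)"
  proof
    fix h :: "real ^ 'n"
    have "frechet_derivative f (at x) h = frechet_derivative f (at x) (\<Sum>i\<in>UNIV. h $ i *\<^sub>R axis i 1)"
      using basis_expansion[of h] by (simp add: scalar_mult_eq_scaleR)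
    also have "\<dots> = (\<Sum>i\<in>UNIV. h $ i *\<^sub>R partial i f x)"
      unfolding partial_def linear_sum[OF lin] by (simp add: linear_scale[OF lin])
    finally show "frechet_derivative f (at x) h = (\<Sum>i\<in>UNIV. h $ i *\<^sub>R partial i f x)" .
  qed
  with D show ?thesis by simp
qed

lemma partial_eq_sum:
  fixes f :: "real ^ 'n::finite \<Rightarrow> 'b::real_normed_vector"
  assumes "(f has_derivative (\<lambda>h. \<Sum>i\<in>UNIV. h $ i *\<^sub>R D i)) (at x)"
  shows "partial i f x = D i"
proof -
  have "(\<Sum>j\<in>UNIV. (axis i 1 :: real ^ 'n) $ j *\<^sub>R D j) = (\<Sum>j\<in>UNIV. if j = i then D i else 0)"
    by (intro sum.cong) (auto simp: axis_def)
  then show ?thesis using partial_has_derivative[OF assms, of i] by simp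
qed

text \<open>A finite-order version of \<open>smooth_on\<close>, recursive in the order so that
  product and chain rule follow by induction on \<open>k\<close>. It expresses \<open>k\<close>-fold
  differentiability rather than membership in C^k.\<close>

primrec ck :: "(real ^ 'n::finite) set \<Rightarrow> nat \<Rightarrow> (real ^ 'n \<Rightarrow> real) \<Rightarrow> bool" where
  "ck U 0 f \<longleftrightarrow> True"
| "ck U (Suc k) f \<longleftrightarrow> f differentiable_on U \<and> (\<forall>i. ck U k (partial i f))"

text \<open>The recursion of \<open>ck\<close> differentiates \<open>f\<close> first, whereas
  \<open>foldr\<close> applies the head of the list last; lists are therefore split at their last
  element.\<close>

lemma ck_foldr:
  "ck U k f \<longleftrightarrow> (\<forall>is. length is < k \<longrightarrow> foldr partial is f differentiable_on U)"
proof (induction k arbitrary: f)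
  case 0 then show ?case by simp
next
  case (Suc k)
  have "(\<forall>is. length is < Suc k \<longrightarrow> foldr partial is f differentiable_on U) \<longleftrightarrow>
    f differentiable_on U \<and> (\<forall>i is. length is < k \<longrightarrow> foldr partial is (partial i f) differentiable_on U)"
    (is "?L \<longleftrightarrow> ?R")
  proof
    assume L: ?L
    have "f differentiable_on U" using L[rule_format, of "[]"] by simp
    moreover have "foldr partial is (partial i f) differentiable_on U" if "length is < k" for i "is"
      using L[rule_format, of "is @ [i]"] that by simp
    ultimately show ?R by blast
  next
    assume R: ?R
    show ?L
    proof (intro allI impI)
      fix "is" :: "'a list" assume l: "length is < Suc k"
      show "foldr partial is f differentiable_on U"
      proof (cases "is" rule: rev_cases)
        case Nil then show ?thesis using R by simp
      next
        case (snoc js j) then show ?thesis using R l by simp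
      qed
    qed
  qed
  then show ?case using Suc by simp
qed

lemma smooth_on_ck: "smooth_on U f \<longleftrightarrow> open U \<and> (\<forall>k. ck U k f)" for f :: "real ^ 'n::finite \<Rightarrow> real"
  unfolding smooth_on_def ck_foldr by blast

lemma ck_mono: "ck U k f \<Longrightarrow> j \<le> k \<Longrightarrow> ck U j f"
  unfolding ck_foldr by auto

lemma differentiable_on_cong_open:
  assumes "open U" "\<And>z. z \<in> U \<Longrightarrow> f z = g z" "f differentiable_on U"
  shows "g differentiable_on U"
  unfolding differentiable_on_def
proof
  fix x assume x: "x \<in> U"
  then obtain D where "(f has_derivative D) (at x within U)"
    using assms(3) unfolding differentiable_on_def differentiable_def by blast
  then have "(g has_derivative D) (at x within U)"
    by (rule has_derivative_transform[OF x, rotated]) (use assms(2) in auto)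
  then show "g differentiable (at x within U)" unfolding differentiable_def by blast
qed

lemma ck_cong:
  assumes "open U" "\<And>z. z \<in> U \<Longrightarrow> f z = g z" "ck U k f"
  shows "ck U k g"
  using assms(2,3)
proof (induction k arbitrary: f g)
  case (Suc k)
  have "ck U k (partial i g)" for i
    using Suc.IH[of "partial i f" "partial i g"] partial_cong[OF assms(1)] Suc.prems by auto
  moreover have "g differentiable_on U"
    using Suc.prems differentiable_on_cong_open[OF assms(1), of f g] by auto
  ultimately show ?case by simp
qed simp

lemma foldr_partial_cong:
  assumes "open U" "\<And>z. z \<in> U \<Longrightarrow> f z = g z" "x \<in> U"
  shows "foldr partial is f x = foldr partial is g x"
  using assms(3)
proof (induction "is" arbitrary: x)
  case (Cons i "is")
  then show ?case using partial_cong[OF assms(1) Cons.prems, of "foldr partial is f" "foldr partial is g" i] by simp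
qed (use assms in simp)

lemma differentiable_on_openD: "f differentiable_on U \<Longrightarrow> open U \<Longrightarrow> x \<in> U \<Longrightarrow> f differentiable (at x)"
  using differentiable_on_eq_differentiable_at by blast

context
  fixes U :: "(real ^ 'n::finite) set" and x
  assumes U: "open U" "x \<in> U"
begin

lemma partial_add:
  fixes f g :: "real ^ 'n \<Rightarrow> real"
  assumes "f differentiable_on U" "g differentiable_on U"
  shows "partial i (\<lambda>z. f z + g z) x = partial i f x + partial i g x"
  by (rule partial_eq_sum, rule has_derivative_eq_rhs[OF has_derivative_add[OF has_derivative_partial has_derivative_partial]])
     (use assms U in \<open>auto intro: differentiable_on_openD simp: sum.distrib algebra_simps\<close>)

lemma partial_mult:
  fixes f g :: "real ^ 'n \<Rightarrow> real"
  assumes "f differentiable_on U" "g differentiable_on U"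
  shows "partial i (\<lambda>z. f z * g z) x = partial i f x * g x + f x * partial i g x"
  by (rule partial_eq_sum, rule has_derivative_eq_rhs[OF has_derivative_mult[OF has_derivative_partial has_derivative_partial]])
     (use assms U in \<open>auto intro: differentiable_on_openD simp: sum.distrib sum_distrib_left sum_distrib_right algebra_simps\<close>)

lemma partial_compose:
  fixes g :: "real ^ 'm::finite \<Rightarrow> real" and \<Phi> :: "real ^ 'n \<Rightarrow> real ^ 'm"
  assumes "\<And>j. (\<lambda>z. \<Phi> z $ j) differentiable_on U" "g differentiable_on V" "open V" "\<Phi> x \<in> V"
  shows "(\<lambda>z. g (\<Phi> z)) differentiable (at x)"
    and "partial i (\<lambda>z. g (\<Phi> z)) x = (\<Sum>j\<in>UNIV. partial j g (\<Phi> x) * partial i (\<lambda>z. \<Phi> z $ j) x)"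
proof -
  let ?D = "\<lambda>h. \<chi> j. \<Sum>i\<in>UNIV. h $ i *\<^sub>R partial i (\<lambda>z. \<Phi> z $ j) x"
  have D: "((\<lambda>z. \<Phi> z) has_derivative ?D) (at x)"
    unfolding has_derivative_componentwise_within[of \<Phi>]
  proof
    fix b :: "real ^ 'm" assume "b \<in> Basis"
    then obtain j where b: "b = axis j 1" by (auto simp: Basis_vec_def)
    show "((\<lambda>z. \<Phi> z \<bullet> b) has_derivative (\<lambda>h. ?D h \<bullet> b)) (at x)"
      using has_derivative_partial[OF differentiable_on_openD[OF assms(1)[of j] U]]
      unfolding b by (simp add: inner_axis)
  qed
  have "(g has_derivative (\<lambda>h. \<Sum>j\<in>UNIV. h $ j *\<^sub>R partial j g (\<Phi> x))) (at (\<Phi> x))"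
    using has_derivative_partial[OF differentiable_on_openD[OF assms(2-4)]] .
  from has_derivative_compose[OF D this]
  have C: "((\<lambda>z. g (\<Phi> z)) has_derivative (\<lambda>h. \<Sum>j\<in>UNIV. ?D h $ j *\<^sub>R partial j g (\<Phi> x))) (at x)" .
  then show "(\<lambda>z. g (\<Phi> z)) differentiable (at x)" unfolding differentiable_def by blast
  have "(\<Sum>j\<in>UNIV. ?D h $ j *\<^sub>R partial j g (\<Phi> x)) =
     (\<Sum>i\<in>UNIV. h $ i *\<^sub>R (\<Sum>j\<in>UNIV. partial j g (\<Phi> x) * partial i (\<lambda>z. \<Phi> z $ j) x))" for h
    by (simp add: sum_distrib_left sum_distrib_right mult_ac) (rule sum.swap)
  with C have "((\<lambda>z. g (\<Phi> z)) has_derivative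
     (\<lambda>h. \<Sum>i\<in>UNIV. h $ i *\<^sub>R (\<Sum>j\<in>UNIV. partial j g (\<Phi> x) * partial i (\<lambda>z. \<Phi> z $ j) x))) (at x)" by simp
  then show "partial i (\<lambda>z. g (\<Phi> z)) x = (\<Sum>j\<in>UNIV. partial j g (\<Phi> x) * partial i (\<lambda>z. \<Phi> z $ j) x)"
    by (rule partial_eq_sum)
qed

end

lemma partial_const [simp]: "partial i (\<lambda>z. c) = (\<lambda>z. 0)"
  by (rule ext) (simp add: partial_has_derivative[where D = "\<lambda>_. 0"])

lemma ck_const: "ck U k (\<lambda>z. c)"
  by (induction k arbitrary: c) auto

lemma ck_add: "open U \<Longrightarrow> ck U k f \<Longrightarrow> ck U k g \<Longrightarrow> ck U k (\<lambda>z. f z + g z)"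
proof (induction k arbitrary: f g)
  case (Suc k)
  have "ck U k (partial i (\<lambda>z. f z + g z))" for i
    by (rule ck_cong[OF Suc.prems(1), of "\<lambda>z. partial i f z + partial i g z"])
       (use Suc in \<open>auto simp: partial_add intro!: Suc.IH\<close>)
  then show ?case using Suc.prems by (auto intro: differentiable_on_add)
qed simp

lemma ck_sum: "finite I \<Longrightarrow> open U \<Longrightarrow> (\<And>i. i \<in> I \<Longrightarrow> ck U k (f i)) \<Longrightarrow> ck U k (\<lambda>z. \<Sum>i\<in>I. f i z)"
  by (induction rule: finite_induct) (auto intro: ck_add ck_const)

lemma ck_mult: "open U \<Longrightarrow> ck U k f \<Longrightarrow> ck U k g \<Longrightarrow> ck U k (\<lambda>z. f z * g z)"
proof (induction k arbitrary: f g)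
  case (Suc k)
  have k: "ck U k f" "ck U k g" using Suc.prems ck_mono[of U "Suc k"] by auto
  have "ck U k (partial i (\<lambda>z. f z * g z))" for i
    by (rule ck_cong[OF Suc.prems(1), of "\<lambda>z. partial i f z * g z + f z * partial i g z"])
       (use Suc k in \<open>auto simp: partial_mult intro!: ck_add Suc.IH\<close>)
  then show ?case using Suc.prems by (auto intro: differentiable_on_mult)
qed simp

lemma ck_compose:
  fixes g :: "real ^ 'm::finite \<Rightarrow> real" and \<Phi> :: "real ^ 'n::finite \<Rightarrow> real ^ 'm"
  assumes "open U" "open V" "\<Phi> ` U \<subseteq> V" "\<And>j. ck U k (\<lambda>z. \<Phi> z $ j)" "ck V k g"
  shows "ck U k (\<lambda>z. g (\<Phi> z))"
  using assms(4,5)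
proof (induction k arbitrary: g)
  case (Suc k)
  have k: "ck U k (\<lambda>z. \<Phi> z $ j)" for j using Suc.prems ck_mono[of U "Suc k"] by auto
  have "ck U k (partial i (\<lambda>z. g (\<Phi> z)))" for i
  proof (rule ck_cong[OF assms(1)])
    show "(\<Sum>j\<in>UNIV. partial j g (\<Phi> z) * partial i (\<lambda>z. \<Phi> z $ j) z) = partial i (\<lambda>z. g (\<Phi> z)) z"
      if "z \<in> U" for z
      by (rule partial_compose(2)[OF assms(1) that, where V=V, symmetric])
         (use Suc.prems assms(2,3) that in auto)
    have "ck U k (\<lambda>z. partial j g (\<Phi> z))" for j
      by (rule Suc.IH) (use Suc.prems k in auto)
    then show "ck U k (\<lambda>z. \<Sum>j\<in>UNIV. partial j g (\<Phi> z) * partial i (\<lambda>z. \<Phi> z $ j) z)"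
      using Suc.prems assms(1) by (intro ck_sum ck_mult) auto
  qed
  moreover have "(\<lambda>z. g (\<Phi> z)) differentiable_on U"
    unfolding differentiable_on_eq_differentiable_at[OF assms(1)]
  proof
    fix z assume z: "z \<in> U"
    show "(\<lambda>z. g (\<Phi> z)) differentiable (at z)"
      by (rule partial_compose(1)[OF assms(1) z, where V=V])
         (use Suc.prems assms(2,3) z in auto)
  qed
  ultimately show ?case by simp
qed simp

subsection \<open>Weighted pointwise bounds\<close>

text \<open>\<open>bd h x k A r f\<close>: at the point \<open>x\<close>, the derivatives of \<open>f\<close> of order \<open>j \<le> k\<close> are at
  most \<open>A h\<^sup>r\<^sup>+\<^sup>j\<close>.\<close>
primrec bd :: "real \<Rightarrow> real ^ 'n::finite \<Rightarrow> nat \<Rightarrow> real \<Rightarrow> nat \<Rightarrow> (real ^ 'n \<Rightarrow> real) \<Rightarrow> bool" where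
  "bd h x 0 A r f \<longleftrightarrow> \<bar>f x\<bar> \<le> A * h ^ r"
| "bd h x (Suc k) A r f \<longleftrightarrow> \<bar>f x\<bar> \<le> A * h ^ r \<and> (\<forall>i. bd h x k A (Suc r) (partial i f))"

lemma bd_foldr:
  "bd h x k A r f \<longleftrightarrow> (\<forall>is. length is \<le> k \<longrightarrow> \<bar>foldr partial is f x\<bar> \<le> A * h ^ (r + length is))"
proof (induction k arbitrary: f r)
  case 0 then show ?case by simp
next
  case (Suc k)
  let ?P = "\<lambda>is. \<bar>foldr partial is f x\<bar> \<le> A * h ^ (r + length is)"
  have "(\<forall>is. length is \<le> Suc k \<longrightarrow> ?P is) \<longleftrightarrow>
     ?P [] \<and> (\<forall>i is. length is \<le> k \<longrightarrow> ?P (is @ [i]))" (is "?L \<longleftrightarrow> ?R")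
  proof
    assume R: ?R
    show ?L
    proof (intro allI impI)
      fix "is" :: "'a list" assume l: "length is \<le> Suc k"
      show "?P is"
        using R l by (cases "is" rule: rev_cases) auto
    qed
  next
    assume L: ?L
    show ?R
    proof (intro conjI allI impI)
      show "?P []" using L by (metis list.size(3) zero_le)
      fix i :: 'a and "is" :: "'a list" assume "length is \<le> k"
      then show "?P (is @ [i])" using L by (intro L[rule_format]) simp
    qed
  qed
  then show ?case using Suc by simp
qed

lemma bd_mono: "bd h x k A r f \<Longrightarrow> j \<le> k \<Longrightarrow> bd h x j A r f"
  unfolding bd_foldr by auto

lemma bd_weaken: "bd h x k A r f \<Longrightarrow> 0 \<le> h \<Longrightarrow> A \<le> B \<Longrightarrow> bd h x k B r f"
  unfolding bd_foldr by (meson mult_right_mono order_trans zero_le_power)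

lemma bd_cong:
  assumes "open U" "x \<in> U" "\<And>z. z \<in> U \<Longrightarrow> f z = g z" "bd h x k A r f"
  shows "bd h x k A r g"
  using assms(4) foldr_partial_cong[OF assms(1,3,2)] unfolding bd_foldr by simp

lemma bd_nonneg:
  assumes "bd h x k A r f" "0 < h"
  shows "0 \<le> A"
proof -
  have "\<bar>f x\<bar> \<le> A * h ^ r" using assms(1) by (cases k) auto
  then have "0 \<le> A * h ^ r" by linarith
  with zero_less_power[OF assms(2), of r] show ?thesis by (simp add: zero_le_mult_iff)
qed

lemma bd_zero: "0 \<le> h \<Longrightarrow> 0 \<le> A \<Longrightarrow> bd h x k A r (\<lambda>z. 0)"
  by (induction k arbitrary: r) auto

context
  fixes U :: "(real ^ 'n::finite) set" and x and h :: real
  assumes U: "open U" "x \<in> U" and h: "0 < h"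
begin

lemma bd_add: "ck U k f \<Longrightarrow> ck U k g \<Longrightarrow> bd h x k A r f \<Longrightarrow> bd h x k B r g \<Longrightarrow> bd h x k (A + B) r (\<lambda>z. f z + g z)"
proof (induction k arbitrary: f g r)
  case 0 then show ?case unfolding bd.simps distrib_right by linarith
next
  case (Suc k)
  have "bd h x k (A + B) (Suc r) (partial i (\<lambda>z. f z + g z))" for i
    by (rule bd_cong[OF U, of "\<lambda>z. partial i f z + partial i g z"])
       (use Suc U in \<open>auto simp: partial_add intro!: Suc.IH\<close>)
  moreover have "\<bar>f x + g x\<bar> \<le> (A + B) * h ^ r"
    using Suc.prems unfolding bd.simps distrib_right by linarith
  ultimately show ?case by simp
qed

lemma bd_sum:
  "finite I \<Longrightarrow> (\<And>i. i \<in> I \<Longrightarrow> ck U k (f i)) \<Longrightarrow> (\<And>i. i \<in> I \<Longrightarrow> bd h x k A r (f i)) \<Longrightarrow>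
    bd h x k (real (card I) * A) r (\<lambda>z. \<Sum>i\<in>I. f i z)"
proof (induction rule: finite_induct)
  case empty then show ?case using bd_zero[of h 0] h by simp
next
  case (insert i I)
  then have "bd h x k (A + real (card I) * A) r (\<lambda>z. f i z + (\<Sum>i\<in>I. f i z))"
    by (intro bd_add) (auto intro: ck_sum U)
  then show ?case using insert by (simp add: algebra_simps)
qed

text \<open>Each differentiation turns one product into two, hence the factor \<open>2 ^ k\<close>.
  The exponents of \<open>h\<close> add up because every derivative falls on exactly one
  factor.\<close>

lemma bd_mult:
  "ck U k f \<Longrightarrow> ck U k g \<Longrightarrow> bd h x k A r f \<Longrightarrow> bd h x k B s g \<Longrightarrow>
    bd h x k (2 ^ k * (A * B)) (r + s) (\<lambda>z. f z * g z)"
proof (induction k arbitrary: f g r s)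
  case 0
  then have "\<bar>f x\<bar> * \<bar>g x\<bar> \<le> (A * h ^ r) * (B * h ^ s)"
    unfolding bd.simps by (intro mult_mono) linarith+
  then show ?case by (simp add: abs_mult power_add mult_ac)
next
  case (Suc k)
  have AB: "0 \<le> A" "0 \<le> B" using bd_nonneg Suc.prems h by blast+
  have k: "ck U k f" "ck U k g" using Suc.prems ck_mono[of U "Suc k"] by auto
  have b: "bd h x k A r f" "bd h x k B s g" using Suc.prems(3,4) bd_mono[of h x "Suc k"] by auto
  have "bd h x k (2 ^ Suc k * (A * B)) (Suc (r + s)) (partial i (\<lambda>z. f z * g z))" for i
  proof (rule bd_cong[OF U, of "\<lambda>z. partial i f z * g z + f z * partial i g z"])
    have "bd h x k (2 ^ k * (A * B)) (Suc r + s) (\<lambda>z. partial i f z * g z)"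
      using Suc k b by (intro Suc.IH) auto
    moreover have "bd h x k (2 ^ k * (A * B)) (r + Suc s) (\<lambda>z. f z * partial i g z)"
      using Suc k b by (intro Suc.IH) auto
    ultimately have "bd h x k (2 ^ k * (A * B) + 2 ^ k * (A * B)) (Suc (r + s))
        (\<lambda>z. partial i f z * g z + f z * partial i g z)"
      using Suc.prems k U by (intro bd_add ck_mult) auto
    then show "bd h x k (2 ^ Suc k * (A * B)) (Suc (r + s)) (\<lambda>z. partial i f z * g z + f z * partial i g z)"
      by (simp add: algebra_simps)
  qed (use Suc.prems U in \<open>auto simp: partial_mult\<close>)
  moreover have "\<bar>f x * g x\<bar> \<le> 2 ^ Suc k * (A * B) * h ^ (r + s)"
  proof -
    have "\<bar>f x\<bar> * \<bar>g x\<bar> \<le> (A * h ^ r) * (B * h ^ s)"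
      using Suc.prems unfolding bd.simps by (intro mult_mono) linarith+
    also have "\<dots> = 1 * (A * B * h ^ (r + s))" by (simp add: power_add mult_ac)
    also have "\<dots> \<le> 2 ^ Suc k * (A * B * h ^ (r + s))"
      using AB h by (intro mult_right_mono) (auto simp: one_le_power simp del: power_Suc)
    finally show ?thesis by (simp add: abs_mult mult_ac)
  qed
  ultimately show ?case by simp
qed

end

text \<open>Induction on \<open>k\<close> replaces the formula of Faa di Bruno: a partial derivative
  of the composition is a sum of derivatives of \<open>g\<close> at \<open>\<Phi> z\<close>, covered
  by the induction hypothesis, times first derivatives of \<open>\<Phi>\<close>, which bring one
  power of \<open>h\<close>. The map itself is not small, so bounds are assumed for its derivatives
  of order at least one. Each stage costs the number of summands, the factor \<open>2 ^ l\<close> of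
  \<open>bd_mult\<close> and \<open>C\<close>; the summand 1 keeps the product at least 1, so that
  the value of the composition itself is covered too.\<close>

lemma bd_compose:
  fixes \<Phi> :: "real ^ 'n::finite \<Rightarrow> real ^ 'n" and x :: "real ^ 'n"
  assumes U: "open U" "x \<in> U" "open V" "\<Phi> ` U \<subseteq> V" and h: "0 < h" and C: "0 \<le> C"
  shows "(\<And>j. ck U k (\<lambda>z. \<Phi> z $ j)) \<Longrightarrow> ck V k g \<Longrightarrow> bd 1 (\<Phi> x) k G 0 g \<Longrightarrow>
    (\<And>i j. 0 < k \<Longrightarrow> bd h x (k - 1) C 1 (partial i (\<lambda>z. \<Phi> z $ j))) \<Longrightarrow>
    bd h x k ((\<Prod>l<k. (1 + real CARD('n) * 2 ^ l * C)) * G) 0 (\<lambda>z. g (\<Phi> z))"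
proof (induction k arbitrary: g)
  case 0 then show ?case by simp
next
  case (Suc k)
  define P where "P = (\<Prod>l<k. (1 + real CARD('n) * 2 ^ l * C))"
  have P1: "1 \<le> P" unfolding P_def by (rule prod_ge_1) (use C in auto)
  have G: "0 \<le> G" using bd_nonneg[OF Suc.prems(3)] by simp
  have k: "ck U k (\<lambda>z. \<Phi> z $ j)" for j using Suc.prems(1) ck_mono[of U "Suc k"] by auto
  have kg: "ck V k g" using Suc.prems(2) ck_mono[of V "Suc k"] by auto
  let ?Q = "(1 + real CARD('n) * 2 ^ k * C)"
  have "bd h x k (?Q * P * G) 1 (partial i (\<lambda>z. g (\<Phi> z)))" for i
  proof (rule bd_cong[OF U(1,2), of "\<lambda>z. \<Sum>j\<in>UNIV. partial j g (\<Phi> z) * partial i (\<lambda>z. \<Phi> z $ j) z"])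
    have IH: "bd h x k (P * G) 0 (\<lambda>z. partial j g (\<Phi> z))" for j
      unfolding P_def
    proof (rule Suc.IH)
      \<comment> \<open>For the outer function the weight is 1, so the shifted exponent makes no
        difference.\<close>
      show "bd 1 (\<Phi> x) k G 0 (partial j g)"
      proof -
        have "bd 1 (\<Phi> x) k G (Suc 0) (partial j g)" using Suc.prems(3) by simp
        then show ?thesis unfolding bd_foldr by simp
      qed
      show "bd h x (k - 1) C 1 (partial i (\<lambda>z. \<Phi> z $ j))" if "0 < k" for i j
        using Suc.prems(4)[of i j] bd_mono by fastforce
    qed (use Suc.prems k in auto)
    have ckg: "ck U k (\<lambda>z. partial j g (\<Phi> z))" for j
      by (rule ck_compose[OF U(1) U(3) U(4) k]) (use Suc.prems(2) in simp)
    have "bd h x k (2 ^ k * (P * G * C)) (0 + 1) (\<lambda>z. partial j g (\<Phi> z) * partial i (\<lambda>z. \<Phi> z $ j) z)" for j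
      by (rule bd_mult[OF U(1,2) h])
         (use Suc.prems(1,4) ckg IH in auto)
    then have "bd h x k (real CARD('n) * (2 ^ k * (P * G * C))) 1 (\<lambda>z. \<Sum>j\<in>UNIV. partial j g (\<Phi> z) * partial i (\<lambda>z. \<Phi> z $ j) z)"
      by (intro bd_sum[OF U(1,2) h])
         (use Suc.prems(1) ckg in \<open>auto intro!: ck_mult[OF U(1)]\<close>)
    moreover have "real CARD('n) * (2 ^ k * (P * G * C)) \<le> ?Q * P * G"
      using P1 G by (simp add: algebra_simps)
    ultimately show "bd h x k (?Q * P * G) 1 (\<lambda>z. \<Sum>j\<in>UNIV. partial j g (\<Phi> z) * partial i (\<lambda>z. \<Phi> z $ j) z)"
      using bd_weaken h by (meson less_imp_le)
  qed (use Suc.prems U in \<open>auto intro!: partial_compose(2)[where U=U and V=V, symmetric]\<close>)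
  moreover have "\<bar>g (\<Phi> x)\<bar> \<le> ?Q * P * G"
  proof -
    have "\<bar>g (\<Phi> x)\<bar> \<le> 1 * 1 * G" using Suc.prems by simp
    also have "\<dots> \<le> ?Q * P * G" using P1 G C by (intro mult_mono) auto
    finally show ?thesis .
  qed
  ultimately show ?case by (simp add: P_def mult_ac)
qed

subsection \<open>Symmetry of the partial derivatives\<close>

lemma partial_line:
  fixes f :: "real ^ 'n::finite \<Rightarrow> real"
  assumes "f differentiable (at (x + s *\<^sub>R w))"
  shows "((\<lambda>s. f (x + s *\<^sub>R w)) has_real_derivative (\<Sum>i\<in>UNIV. w $ i * partial i f (x + s *\<^sub>R w))) (at s)"
proof -
  have "((\<lambda>s. x + s *\<^sub>R w) has_derivative (\<lambda>h. h *\<^sub>R w)) (at s)"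
    by (auto intro!: derivative_eq_intros)
  from has_derivative_compose[OF this has_derivative_partial[OF assms]]
  show ?thesis
    unfolding has_field_derivative_def
    by (rule has_derivative_eq_rhs) (auto simp: sum_distrib_left sum_distrib_right mult_ac)
qed

lemma partial_line_axis:
  fixes f :: "real ^ 'n::finite \<Rightarrow> real"
  assumes "f differentiable (at (x + s *\<^sub>R axis i 1))"
  shows "((\<lambda>s. f (x + s *\<^sub>R axis i 1)) has_real_derivative partial i f (x + s *\<^sub>R axis i 1)) (at s)"
proof -
  have "(\<Sum>j\<in>UNIV. axis i 1 $ j * partial j f y) = (\<Sum>j\<in>UNIV. if j = i then partial j f y else 0)" for y
    by (intro sum.cong) (auto simp: axis_def)
  then show ?thesis using partial_line[OF assms] by simp
qed

text \<open>The mean value theorem is applied twice: in direction \<open>i\<close> to the increment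
  of \<open>f\<close> along direction \<open>j\<close>, then in direction \<open>j\<close> to the
  resulting first partial derivative.\<close>

lemma second_difference:
  fixes f :: "real ^ 'n::finite \<Rightarrow> real"
  assumes "ck U 2 f" "open U" "0 < s" "cball x (2 * s) \<subseteq> U"
  obtains a b where "0 < a" "a < s" "0 < b" "b < s"
    "f (x + s *\<^sub>R axis i 1 + s *\<^sub>R axis j 1) - f (x + s *\<^sub>R axis i 1) - f (x + s *\<^sub>R axis j 1) + f x
     = s\<^sup>2 * partial j (partial i f) (x + a *\<^sub>R axis i 1 + b *\<^sub>R axis j 1)"
proof -
  have d: "f differentiable (at z)" "partial i f differentiable (at z)" if "z \<in> U" for z
    using assms(1,2) that by (auto simp: numeral_2_eq_2 intro: differentiable_on_openD)
  have in_U: "x + a *\<^sub>R axis i 1 + b *\<^sub>R axis j 1 \<in> U" if "0 \<le> a" "a \<le> s" "0 \<le> b" "b \<le> s" for a b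
  proof -
    have "norm (a *\<^sub>R axis i (1::real) + b *\<^sub>R (axis j 1 :: real ^ 'n)) \<le> a + b"
      using norm_triangle_ineq[of "a *\<^sub>R axis i (1::real)" "b *\<^sub>R (axis j 1 :: real ^ 'n)"] that by simp
    moreover have "dist x (x + w) = norm w" for w :: "real ^ 'n" by (simp add: dist_norm)
    ultimately have "x + (a *\<^sub>R axis i 1 + b *\<^sub>R axis j 1) \<in> cball x (2 * s)"
      using that by simp
    then show ?thesis using assms(4) by (auto simp: add.assoc)
  qed
  define g where "g = (\<lambda>a. f ((x + s *\<^sub>R axis j 1) + a *\<^sub>R axis i 1) - f (x + a *\<^sub>R axis i 1))"
  have g': "(g has_real_derivative (partial i f ((x + s *\<^sub>R axis j 1) + a *\<^sub>R axis i 1) - partial i f (x + a *\<^sub>R axis i 1))) (at a)"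
    if "0 \<le> a" "a \<le> s" for a
    unfolding g_def using in_U[of a s] in_U[of a 0] that assms(3)
    by (intro DERIV_diff partial_line_axis d) (auto simp: algebra_simps)
  obtain a where a: "0 < a" "a < s"
    and ga: "g s - g 0 = (s - 0) * (partial i f ((x + s *\<^sub>R axis j 1) + a *\<^sub>R axis i 1) - partial i f (x + a *\<^sub>R axis i 1))"
    using MVT2[OF assms(3) g'] by auto
  define k where "k = (\<lambda>b. partial i f ((x + a *\<^sub>R axis i 1) + b *\<^sub>R axis j 1))"
  have k': "(k has_real_derivative (partial j (partial i f) ((x + a *\<^sub>R axis i 1) + b *\<^sub>R axis j 1))) (at b)"
    if "0 \<le> b" "b \<le> s" for b
    unfolding k_def using in_U[of a b] that a
    by (intro partial_line_axis d) auto
  obtain b where b: "0 < b" "b < s"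
    and kb: "k s - k 0 = (s - 0) * partial j (partial i f) ((x + a *\<^sub>R axis i 1) + b *\<^sub>R axis j 1)"
    using MVT2[OF assms(3) k'] by auto
  show thesis
  proof (rule that[OF a b])
    have "g s - g 0 = f (x + s *\<^sub>R axis i 1 + s *\<^sub>R axis j 1) - f (x + s *\<^sub>R axis i 1) - f (x + s *\<^sub>R axis j 1) + f x"
      unfolding g_def by (simp add: algebra_simps)
    moreover have "g s - g 0 = s * (k s - k 0)"
      unfolding ga k_def by (simp add: algebra_simps)
    ultimately show "f (x + s *\<^sub>R axis i 1 + s *\<^sub>R axis j 1) - f (x + s *\<^sub>R axis i 1) - f (x + s *\<^sub>R axis j 1) + f x
     = s\<^sup>2 * partial j (partial i f) (x + a *\<^sub>R axis i 1 + b *\<^sub>R axis j 1)"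
      using kb by (simp add: power2_eq_square)
  qed
qed

text \<open>The second difference is symmetric in \<open>i\<close> and \<open>j\<close>, so both
  mixed derivatives take a common value at points arbitrarily close to \<open>x\<close>. Order 3 in
  \<open>ck\<close> makes the second derivatives differentiable, hence continuous.\<close>

lemma partial_commute:
  fixes f :: "real ^ 'n::finite \<Rightarrow> real"
  assumes f: "ck U 3 f" and U: "open U" "x \<in> U"
  shows "partial i (partial j f) x = partial j (partial i f) x"
proof -
  have cont: "isCont (partial k (partial l f)) x" for k l
    using f U differentiable_on_openD[of "partial k (partial l f)" U x]
    by (auto simp: numeral_3_eq_3 intro: differentiable_imp_continuous_within)
  have f2: "ck U 2 f" using ck_mono[OF f] by simp
  have "\<bar>partial i (partial j f) x - partial j (partial i f) x\<bar> \<le> e" if "0 < e" for e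
  proof -
    obtain d1 where d1: "d1 > 0" "\<And>y. dist y x < d1 \<Longrightarrow> \<bar>partial i (partial j f) y - partial i (partial j f) x\<bar> < e / 2"
      using cont[of i j] \<open>0 < e\<close> unfolding continuous_at_eps_delta dist_real_def by (meson half_gt_zero)
    obtain d2 where d2: "d2 > 0" "\<And>y. dist y x < d2 \<Longrightarrow> \<bar>partial j (partial i f) y - partial j (partial i f) x\<bar> < e / 2"
      using cont[of j i] \<open>0 < e\<close> unfolding continuous_at_eps_delta dist_real_def by (meson half_gt_zero)
    obtain r where r: "r > 0" "cball x r \<subseteq> U" using U open_contains_cball by blast
    define s where "s = min r (min d1 d2) / 3"
    have s: "0 < s" "2 * s < r" "2 * s < d1" "2 * s < d2" using r d1 d2 by (auto simp: s_def)
    have sub: "cball x (2 * s) \<subseteq> U" using r s by (meson cball_subset_cball_iff less_imp_le order_trans subset_cball)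
    have near: "dist (x + a *\<^sub>R axis k 1 + b *\<^sub>R axis l 1) x < 2 * s"
      if "0 < a" "a < s" "0 < b" "b < s" for a b and k l :: 'n
    proof -
      have "norm (a *\<^sub>R axis k (1::real) + b *\<^sub>R (axis l 1 :: real ^ 'n)) \<le> a + b"
        using norm_triangle_ineq[of "a *\<^sub>R axis k (1::real)" "b *\<^sub>R (axis l 1 :: real ^ 'n)"] that by simp
      then show ?thesis using that by (simp add: dist_norm add.assoc)
    qed
    obtain a b where ab: "0 < a" "a < s" "0 < b" "b < s"
      "f (x + s *\<^sub>R axis i 1 + s *\<^sub>R axis j 1) - f (x + s *\<^sub>R axis i 1) - f (x + s *\<^sub>R axis j 1) + f x
       = s\<^sup>2 * partial j (partial i f) (x + a *\<^sub>R axis i 1 + b *\<^sub>R axis j 1)"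
      using second_difference[OF f2 U(1) s(1) sub, of i j] by metis
    obtain a' b' where ab': "0 < a'" "a' < s" "0 < b'" "b' < s"
      "f (x + s *\<^sub>R axis j 1 + s *\<^sub>R axis i 1) - f (x + s *\<^sub>R axis j 1) - f (x + s *\<^sub>R axis i 1) + f x
       = s\<^sup>2 * partial i (partial j f) (x + a' *\<^sub>R axis j 1 + b' *\<^sub>R axis i 1)"
      using second_difference[OF f2 U(1) s(1) sub, of j i] by metis
    have "s\<^sup>2 * partial j (partial i f) (x + a *\<^sub>R axis i 1 + b *\<^sub>R axis j 1)
        = s\<^sup>2 * partial i (partial j f) (x + a' *\<^sub>R axis j 1 + b' *\<^sub>R axis i 1)"
      using ab(5) ab'(5) by (simp add: algebra_simps)
    then have eq: "partial j (partial i f) (x + a *\<^sub>R axis i 1 + b *\<^sub>R axis j 1)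
        = partial i (partial j f) (x + a' *\<^sub>R axis j 1 + b' *\<^sub>R axis i 1)" using s by simp
    have "\<bar>partial j (partial i f) (x + a *\<^sub>R axis i 1 + b *\<^sub>R axis j 1) - partial j (partial i f) x\<bar> < e / 2"
      using d2(2) near[OF ab(1-4), of i j] s(4) by (meson less_trans)
    moreover have "\<bar>partial i (partial j f) (x + a' *\<^sub>R axis j 1 + b' *\<^sub>R axis i 1) - partial i (partial j f) x\<bar> < e / 2"
      using d1(2) near[OF ab'(1-4), of j i] s(3) by (meson less_trans)
    ultimately show ?thesis using eq by linarith
  qed
  then have "\<bar>partial i (partial j f) x - partial j (partial i f) x\<bar> \<le> 0"
    by (rule field_le_epsilon) simp
  then show ?thesis by simp
qed

lemma ck_partial_foldr: "(\<And>k. ck U k f) \<Longrightarrow> ck U k (foldr partial is f)"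
  unfolding ck_foldr
proof (intro allI impI)
  fix js
  assume *: "\<And>k. \<forall>is. length is < k \<longrightarrow> foldr partial is f differentiable_on U"
  show "foldr partial js (foldr partial is f) differentiable_on U"
    using *[of "Suc (length (js @ is))", rule_format, of "js @ is"] by simp
qed

lemma foldr_partial_move:
  fixes f :: "real ^ 'n::finite \<Rightarrow> real"
  assumes f: "\<And>k. ck U k f" and U: "open U"
  shows "x \<in> U \<Longrightarrow> foldr partial (xs @ i # ys) f x = foldr partial (i # xs @ ys) f x"
proof (induction xs arbitrary: x)
  case (Cons j xs)
  have "foldr partial (j # xs @ i # ys) f x = partial j (foldr partial (xs @ i # ys) f) x" by simp
  also have "\<dots> = partial j (partial i (foldr partial (xs @ ys) f)) x"
    using partial_cong[OF U Cons.prems, of "foldr partial (xs @ i # ys) f" "partial i (foldr partial (xs @ ys) f)"]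
      Cons.IH by simp
  also have "\<dots> = partial i (partial j (foldr partial (xs @ ys) f)) x"
    by (rule partial_commute[OF ck_partial_foldr[OF f] U Cons.prems])
  finally show ?case by simp
qed simp

lemma foldr_partial_mset:
  fixes f :: "real ^ 'n::finite \<Rightarrow> real"
  assumes f: "\<And>k. ck U k f" and U: "open U"
  shows "mset is = mset js \<Longrightarrow> x \<in> U \<Longrightarrow> foldr partial is f x = foldr partial js f x"
proof (induction "is" arbitrary: js x)
  case (Cons i "is")
  then have "i \<in> set js" by (metis list.set_intros(1) mset_eq_setD)
  then obtain xs ys where js: "js = xs @ i # ys" by (meson split_list)
  have "mset is = mset (xs @ ys)" using Cons.prems(1) by (simp add: js)
  then have "foldr partial is f z = foldr partial (xs @ ys) f z" if "z \<in> U" for z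
    using Cons.IH that by blast
  then have "foldr partial (i # is) f x = foldr partial (i # xs @ ys) f x"
    using partial_cong[OF U Cons.prems(2), of "foldr partial is f" "foldr partial (xs @ ys) f" i] by simp
  then show ?case using foldr_partial_move[OF f U Cons.prems(2)] js by simp
qed simp

text \<open>Lists of directions fit recursive differentiation better than multi-indices and are used
  in all estimates. Several lists represent one multi-index; by symmetry of the derivatives they all
  give the same function.\<close>

definition mi_of_list :: "'n::finite list \<Rightarrow> nat ^ 'n" where
  "mi_of_list is = (\<chi> i. count (mset is) i)"

lemma mi_order_mi_of_list: "mi_order (mi_of_list is) = length is"
proof -
  have "length is = size (mset is)" by simp
  also have "\<dots> = (\<Sum>i\<in>set_mset (mset is). count (mset is) i)" by (rule size_multiset_overloaded_eq)
  also have "\<dots> = (\<Sum>i\<in>UNIV. count (mset is) i)"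
    by (intro sum.mono_neutral_left) (auto simp: not_in_iff)
  finally show ?thesis by (simp add: mi_order_def mi_of_list_def)
qed

definition list_of_mi :: "nat ^ 'n::finite \<Rightarrow> 'n list" where
  "list_of_mi \<alpha> = concat (map (\<lambda>i. replicate (\<alpha> $ i) i) directions)"

lemma directions: "distinct (directions :: 'n::finite list)" "set (directions :: 'n list) = UNIV"
proof -
  obtain xs :: "'n list" where "set xs = UNIV" "distinct xs"
    using finite_distinct_list[of "UNIV :: 'n set"] by auto
  then have "\<exists>is :: 'n list. distinct is \<and> set is = UNIV" by blast
  from someI_ex[OF this] show "distinct (directions :: 'n list)" "set (directions :: 'n list) = UNIV"
    unfolding directions_def by auto
qed

lemma count_list_of_mi: "count (mset (list_of_mi \<alpha>)) i = \<alpha> $ i"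
proof -
  have *: "distinct xs \<Longrightarrow> count (mset (concat (map (\<lambda>i. replicate (\<alpha> $ i) i) xs))) i = (if i \<in> set xs then \<alpha> $ i else 0)" for xs
    by (induction xs) auto
  show ?thesis unfolding list_of_mi_def using *[OF directions(1)] directions(2) by auto
qed

lemma mi_of_list_of_mi [simp]: "mi_of_list (list_of_mi \<alpha>) = \<alpha>"
  by (simp add: mi_of_list_def vec_eq_iff count_list_of_mi)

lemma foldr_replicate_partial: "foldr partial (replicate n i) f = (partial i ^^ n) f"
  by (induction n) auto

lemma mi_partial_list_of_mi: "mi_partial \<alpha> f = foldr partial (list_of_mi \<alpha>) f"
proof -
  have "foldr (\<lambda>i. partial i ^^ (\<alpha> $ i)) xs f = foldr partial (concat (map (\<lambda>i. replicate (\<alpha> $ i) i) xs)) f" for xs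
    by (induction xs) (auto simp: foldr_replicate_partial)
  then show ?thesis by (simp add: mi_partial_def list_of_mi_def)
qed

text \<open>From here on the arbitrary enumeration \<open>directions\<close> inside
  \<open>mi_partial\<close> no longer matters: any list with the right multiplicities may be
  used.\<close>

lemma mi_partial_eq_foldr:
  fixes f :: "real ^ 'n::finite \<Rightarrow> real"
  assumes f: "\<And>k. ck U k f" and U: "open U" "x \<in> U"
  shows "mi_partial (mi_of_list is) f x = foldr partial is f x"
  unfolding mi_partial_list_of_mi
  by (rule foldr_partial_mset[OF f U(1) _ U(2)])
     (simp add: multiset_eq_iff count_list_of_mi, simp add: mi_of_list_def)

text \<open>\<open>quasi_regular\<close> bounds derivatives of the vector-valued map, while the
  chain rule is carried out by components; this links the two.\<close>

lemma foldr_partial_vec_nth: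
  fixes \<Phi> :: "real ^ 'n::finite \<Rightarrow> real ^ 'm::finite"
  assumes "smooth_on U \<Phi>" "x \<in> U"
  shows "foldr partial is \<Phi> x $ j = foldr partial is (\<lambda>z. \<Phi> z $ j) x"
  using assms(2)
proof (induction "is" arbitrary: x)
  case (Cons i "is")
  have U: "open U" using assms(1) by (simp add: smooth_on_def)
  let ?F = "foldr partial is \<Phi>"
  have "?F differentiable (at x)"
    using assms(1) Cons.prems U by (auto simp: smooth_on_def intro: differentiable_on_openD)
  then obtain D where D: "(?F has_derivative D) (at x)" unfolding differentiable_def by blast
  have "((\<lambda>z. ?F z $ j) has_derivative (\<lambda>h. D h $ j)) (at x)"
    by (rule bounded_linear.has_derivative[OF bounded_linear_vec_nth D])
  then have "partial i (\<lambda>z. ?F z $ j) x = partial i ?F x $ j"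
    using partial_has_derivative D by metis
  moreover have "partial i (\<lambda>z. ?F z $ j) x = partial i (foldr partial is (\<lambda>z. \<Phi> z $ j)) x"
    by (rule partial_cong[OF U Cons.prems]) (use Cons.IH in auto)
  ultimately show ?case by simp
qed simp

lemma smooth_on_vec_nth:
  fixes \<Phi> :: "real ^ 'n::finite \<Rightarrow> real ^ 'm::finite"
  assumes "smooth_on U \<Phi>"
  shows "smooth_on U (\<lambda>z. \<Phi> z $ j)"
  unfolding smooth_on_def
proof (intro conjI allI)
  show U: "open U" using assms by (simp add: smooth_on_def)
  fix "is"
  have "foldr partial is \<Phi> differentiable_on U" using assms by (simp add: smooth_on_def)
  then have "(\<lambda>z. foldr partial is \<Phi> z $ j) differentiable_on U"
    unfolding differentiable_on_def differentiable_def by (blast intro: bounded_linear.has_derivative[OF bounded_linear_vec_nth])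
  then show "foldr partial is (\<lambda>z. \<Phi> z $ j) differentiable_on U"
    by (rule differentiable_on_cong_open[OF U, rotated]) (use foldr_partial_vec_nth[OF assms] in auto)
qed

subsection \<open>Polynomials of bounded total degree\<close>

definition monom_at :: "nat ^ 'n::finite \<Rightarrow> real ^ 'n \<Rightarrow> real" where
  "monom_at \<alpha> x = (\<Prod>i\<in>UNIV. (x $ i) ^ (\<alpha> $ i))"

lemma polys_eq: "polys N = {p. \<exists>c. p = (\<lambda>x. \<Sum>\<alpha> | mi_order \<alpha> \<le> N. c \<alpha> * monom_at \<alpha> x)}"
  by (simp add: polys_def monom_at_def)

lemma polys_add: "p \<in> polys N \<Longrightarrow> q \<in> polys N \<Longrightarrow> (\<lambda>x. p x + q x) \<in> polys N"
proof -
  assume "p \<in> polys N" "q \<in> polys N"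
  then obtain a b where "p = (\<lambda>x. \<Sum>\<alpha> | mi_order \<alpha> \<le> N. a \<alpha> * monom_at \<alpha> x)"
    "q = (\<lambda>x. \<Sum>\<alpha> | mi_order \<alpha> \<le> N. b \<alpha> * monom_at \<alpha> x)" unfolding polys_eq by auto
  then have "(\<lambda>x. p x + q x) = (\<lambda>x. \<Sum>\<alpha> | mi_order \<alpha> \<le> N. (a \<alpha> + b \<alpha>) * monom_at \<alpha> x)"
    by (simp add: sum.distrib algebra_simps)
  then show ?thesis unfolding polys_eq by auto
qed

lemma polys_cmul: "p \<in> polys N \<Longrightarrow> (\<lambda>x. k * p x) \<in> polys N"
proof -
  assume "p \<in> polys N"
  then obtain a where "p = (\<lambda>x. \<Sum>\<alpha> | mi_order \<alpha> \<le> N. a \<alpha> * monom_at \<alpha> x)"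
    unfolding polys_eq by auto
  then have "(\<lambda>x. k * p x) = (\<lambda>x. \<Sum>\<alpha> | mi_order \<alpha> \<le> N. (k * a \<alpha>) * monom_at \<alpha> x)"
    by (simp add: sum_distrib_left algebra_simps)
  then show ?thesis unfolding polys_eq by auto
qed

lemma monom_at_polys:
  assumes "mi_order \<alpha> \<le> N"
  shows "monom_at \<alpha> \<in> polys N"
proof -
  have "monom_at \<alpha> = (\<lambda>x. \<Sum>\<beta> | mi_order \<beta> \<le> N. (if \<beta> = \<alpha> then 1 else 0) * monom_at \<beta> x)"
  proof
    fix x
    have "(\<Sum>\<beta> | mi_order \<beta> \<le> N. (if \<beta> = \<alpha> then 1 else 0) * monom_at \<beta> x)
        = (\<Sum>\<beta> | mi_order \<beta> \<le> N. if \<beta> = \<alpha> then monom_at \<beta> x else 0)"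
      by (intro sum.cong) auto
    then show "monom_at \<alpha> x = (\<Sum>\<beta> | mi_order \<beta> \<le> N. (if \<beta> = \<alpha> then 1 else 0) * monom_at \<beta> x)"
      using assms by (simp add: finite_mi_order_le)
  qed
  then show ?thesis unfolding polys_eq by auto
qed

lemma polys_zero: "(\<lambda>x. 0) \<in> polys N"
  unfolding polys_def by (auto intro!: exI[of _ "\<lambda>_. 0"])

lemma polys_sum: "finite I \<Longrightarrow> (\<And>i. i \<in> I \<Longrightarrow> f i \<in> polys N) \<Longrightarrow> (\<lambda>x. \<Sum>i\<in>I. f i x) \<in> polys N"
  by (induction rule: finite_induct) (auto intro: polys_add polys_zero)

lemma polys_linear_combI:
  "finite I \<Longrightarrow> (\<And>i. i \<in> I \<Longrightarrow> f i \<in> polys N) \<Longrightarrow> (\<lambda>x. \<Sum>i\<in>I. c i * f i x) \<in> polys N"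
  by (intro polys_sum polys_cmul)

lemma polys_mono:
  assumes "p \<in> polys M" "M \<le> N"
  shows "p \<in> polys N"
proof -
  obtain a where p: "p = (\<lambda>x. \<Sum>\<alpha> | mi_order \<alpha> \<le> M. a \<alpha> * monom_at \<alpha> x)"
    using assms(1) unfolding polys_eq by auto
  show ?thesis unfolding p
    by (intro polys_linear_combI finite_mi_order_le monom_at_polys) (use assms(2) in auto)
qed

lemma polys_coord_mult:
  fixes p :: "real ^ 'n::finite \<Rightarrow> real"
  assumes "p \<in> polys N"
  shows "(\<lambda>x. (x $ i - b) * p x) \<in> polys (Suc N)"
proof -
  obtain a where p: "p = (\<lambda>x. \<Sum>\<alpha> | mi_order \<alpha> \<le> N. a \<alpha> * monom_at \<alpha> x)"
    using assms unfolding polys_eq by auto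
  define up :: "nat ^ 'n \<Rightarrow> nat ^ 'n" where "up \<alpha> = (\<chi> j. if j = i then Suc (\<alpha> $ j) else \<alpha> $ j)" for \<alpha>
  have up: "monom_at (up \<alpha>) x = x $ i * monom_at \<alpha> x" for \<alpha> x
  proof -
    have "monom_at (up \<alpha>) x = (\<Prod>j\<in>UNIV. (if j = i then x $ j else 1) * (x $ j) ^ (\<alpha> $ j))"
      unfolding monom_at_def up_def by (intro prod.cong) auto
    then show ?thesis by (simp add: prod.distrib monom_at_def)
  qed
  have ord: "mi_order (up \<alpha>) = Suc (mi_order \<alpha>)" for \<alpha>
  proof -
    have "mi_order (up \<alpha>) = (\<Sum>j\<in>UNIV. (if j = i then 1 else 0) + \<alpha> $ j)"
      unfolding mi_order_def up_def by (intro sum.cong) auto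
    then show ?thesis by (simp add: sum.distrib mi_order_def)
  qed
  have "(\<lambda>x. (\<Sum>\<alpha> | mi_order \<alpha> \<le> N. a \<alpha> * monom_at (up \<alpha>) x) + (- b) * p x) \<in> polys (Suc N)"
    by (intro polys_add polys_cmul polys_linear_combI finite_mi_order_le monom_at_polys polys_mono[OF assms])
       (auto simp: ord)
  moreover have "(\<lambda>x. (x $ i - b) * p x) = (\<lambda>x. (\<Sum>\<alpha> | mi_order \<alpha> \<le> N. a \<alpha> * monom_at (up \<alpha>) x) + (- b) * p x)"
  proof
    fix x
    have "(\<Sum>\<alpha> | mi_order \<alpha> \<le> N. a \<alpha> * monom_at (up \<alpha>) x) = x $ i * p x"
      by (simp add: up p sum_distrib_left mult_ac)
    then show "(x $ i - b) * p x = (\<Sum>\<alpha> | mi_order \<alpha> \<le> N. a \<alpha> * monom_at (up \<alpha>) x) + (- b) * p x"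
      by (simp add: algebra_simps)
  qed
  ultimately show ?thesis by simp
qed

lemma polys_prod_list: "(\<lambda>x. prod_list (map (\<lambda>i. (x - y) $ i) is)) \<in> polys (length is)"
proof (induction "is")
  case Nil
  have "(\<lambda>x :: real ^ 'a. 1 :: real) = monom_at 0" by (simp add: monom_at_def fun_eq_iff)
  then show ?case using monom_at_polys[of "0 :: nat ^ 'a" 0] by (simp add: mi_order_def)
next
  case (Cons i "is")
  then show ?case using polys_coord_mult[OF Cons.IH, of i "y $ i"] by simp
qed

lemma continuous_on_polys: "p \<in> polys N \<Longrightarrow> continuous_on S p"
  unfolding polys_def by (auto intro!: continuous_intros)

subsection \<open>Taylor polynomials\<close>

lemma finite_lists_length: "finite {is :: 'n::finite list. length is = k}"
  using finite_lists_length_eq[of "UNIV :: 'n set" k] by simp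

text \<open>For smooth \<open>f\<close>, the \<open>k\<close>-th derivative of \<open>s\<close>
  \<mapsto> \<open>f (z + s *\<^sub>R w)\<close> at 0. Summing over lists instead of multi-indices
  avoids multinomial coefficients.\<close>

definition dirD :: "(real ^ 'n::finite \<Rightarrow> real) \<Rightarrow> real ^ 'n \<Rightarrow> nat \<Rightarrow> real ^ 'n \<Rightarrow> real" where
  "dirD f w k z = (\<Sum>is | length is = k. prod_list (map (\<lambda>i. w $ i) is) * foldr partial is f z)"

text \<open>Multiplied by the \<open>k\<close>-th power of the norm of \<open>w\<close>, this
  dominates \<open>dirD f w k z\<close>; the direction is thereby separated from the
  derivatives.\<close>

definition absD :: "nat \<Rightarrow> (real ^ 'n::finite \<Rightarrow> real) \<Rightarrow> real ^ 'n \<Rightarrow> real" where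
  "absD k f z = (\<Sum>is | length is = k. \<bar>foldr partial is f z\<bar>)"

definition taylor_at :: "nat \<Rightarrow> (real ^ 'n::finite \<Rightarrow> real) \<Rightarrow> real ^ 'n \<Rightarrow> real ^ 'n \<Rightarrow> real" where
  "taylor_at N f y x = (\<Sum>k\<le>N. dirD f (x - y) k y / fact k)"

lemma taylor_at_polys: "taylor_at N f y \<in> polys N"
proof -
  have P: "(\<lambda>x. \<Sum>is | length is = k. foldr partial is f y * prod_list (map (\<lambda>i. (x - y) $ i) is)) \<in> polys N"
    if "k \<le> N" for k
    by (intro polys_linear_combI finite_lists_length polys_mono[OF polys_prod_list]) (use that in auto)
  have "(\<lambda>x. \<Sum>k\<le>N. (1 / fact k) * (\<Sum>is | length is = k. foldr partial is f y * prod_list (map (\<lambda>i. (x - y) $ i) is))) \<in> polys N"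
    by (rule polys_linear_combI) (use P in auto)
  moreover have "taylor_at N f y = (\<lambda>x. \<Sum>k\<le>N. (1 / fact k) * (\<Sum>is | length is = k. foldr partial is f y * prod_list (map (\<lambda>i. (x - y) $ i) is)))"
    unfolding taylor_at_def dirD_def by (simp add: fun_eq_iff mult.commute del: vector_minus_component)
  ultimately show ?thesis by simp
qed

lemma smooth_on_foldr_differentiable:
  fixes f :: "real ^ 'n::finite \<Rightarrow> real"
  shows "smooth_on U f \<Longrightarrow> z \<in> U \<Longrightarrow> foldr partial is f differentiable (at z)"
  unfolding smooth_on_def by (blast intro: differentiable_on_openD)

lemma smooth_on_foldr_continuous:
  fixes f :: "real ^ 'n::finite \<Rightarrow> real"
  shows "smooth_on U f \<Longrightarrow> continuous_on U (foldr partial is f)"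
  unfolding smooth_on_def by (blast intro: differentiable_imp_continuous_on)

lemma dirD_line:
  fixes f :: "real ^ 'n::finite \<Rightarrow> real"
  assumes "smooth_on U f" "y + s *\<^sub>R w \<in> U"
  shows "((\<lambda>s. dirD f w k (y + s *\<^sub>R w)) has_real_derivative dirD f w (Suc k) (y + s *\<^sub>R w)) (at s)"
proof -
  let ?L = "\<lambda>k. {is :: 'n list. length is = k}"
  have "((\<lambda>s. dirD f w k (y + s *\<^sub>R w)) has_real_derivative
     (\<Sum>is\<in>?L k. prod_list (map (\<lambda>i. w $ i) is) * (\<Sum>i\<in>UNIV. w $ i * partial i (foldr partial is f) (y + s *\<^sub>R w)))) (at s)"
    unfolding dirD_def
    by (intro DERIV_sum DERIV_cmult partial_line smooth_on_foldr_differentiable[OF assms])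
  moreover have "(\<Sum>is\<in>?L k. prod_list (map (\<lambda>i. w $ i) is) * (\<Sum>i\<in>UNIV. w $ i * partial i (foldr partial is f) (y + s *\<^sub>R w)))
     = dirD f w (Suc k) (y + s *\<^sub>R w)"
  proof -
    have eq: "?L (Suc k) = (\<lambda>(i, is). i # is) ` (UNIV \<times> ?L k)"
      by (auto simp: length_Suc_conv image_iff)
    have inj: "inj_on (\<lambda>(i, is). i # is) (UNIV \<times> ?L k)" by (auto simp: inj_on_def)
    have "dirD f w (Suc k) (y + s *\<^sub>R w) =
       (\<Sum>(i, is)\<in>UNIV \<times> ?L k. prod_list (map (\<lambda>i. w $ i) is) * (w $ i * partial i (foldr partial is f) (y + s *\<^sub>R w)))"
      unfolding dirD_def eq sum.reindex[OF inj] by (intro sum.cong) (auto simp: mult_ac)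
    also have "\<dots> = (\<Sum>i\<in>UNIV. \<Sum>is\<in>?L k. prod_list (map (\<lambda>i. w $ i) is) * (w $ i * partial i (foldr partial is f) (y + s *\<^sub>R w)))"
      by (rule sum.cartesian_product[symmetric])
    also have "\<dots> = (\<Sum>is\<in>?L k. \<Sum>i\<in>UNIV. prod_list (map (\<lambda>i. w $ i) is) * (w $ i * partial i (foldr partial is f) (y + s *\<^sub>R w)))"
      by (rule sum.swap)
    finally show ?thesis by (simp add: sum_distrib_left)
  qed
  ultimately show ?thesis by simp
qed

lemma abs_prod_list_le:
  fixes w :: "real ^ 'n::finite"
  assumes "norm w \<le> \<rho>"
  shows "\<bar>prod_list (map (\<lambda>i. w $ i) is)\<bar> \<le> \<rho> ^ length is"
proof (induction "is")
  case (Cons i "is")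
  have "\<bar>w $ i\<bar> \<le> \<rho>" using component_le_norm_cart[of w i] assms by simp
  then have "\<bar>w $ i\<bar> * \<bar>prod_list (map (\<lambda>i. w $ i) is)\<bar> \<le> \<rho> * \<rho> ^ length is"
    using Cons.IH by (intro mult_mono) auto
  then show ?case by (simp add: abs_mult)
qed simp

text \<open>The variance of \<open>g\<close> on the unit interval is nonnegative.\<close>

lemma square_integral_le:
  fixes g :: "real \<Rightarrow> real"
  assumes "continuous_on {0..1} g"
  shows "(integral {0..1} g)\<^sup>2 \<le> integral {0..1} (\<lambda>s. (g s)\<^sup>2)"
proof -
  define m where "m = integral {0..1} g"
  have g: "g integrable_on {0..1}" and g2: "(\<lambda>s. (g s)\<^sup>2) integrable_on {0..1}"
    using assms by (auto intro!: integrable_continuous_interval continuous_intros)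
  have "0 \<le> integral {0..1} (\<lambda>s. (g s - m)\<^sup>2)"
    using assms by (intro integral_nonneg integrable_continuous_interval continuous_intros) auto
  also have "(\<lambda>s. (g s - m)\<^sup>2) = (\<lambda>s. (g s)\<^sup>2 - (2 * m) * g s + m\<^sup>2)"
    by (simp add: power2_eq_square algebra_simps fun_eq_iff)
  also have "integral {0..1} (\<lambda>s. (g s)\<^sup>2 - (2 * m) * g s + m\<^sup>2) = integral {0..1} (\<lambda>s. (g s)\<^sup>2) - 2 * m * m + m\<^sup>2"
  proof (rule integral_unique)
    have "((\<lambda>s. (g s)\<^sup>2 - (2 * m) * g s + m\<^sup>2) has_integral (integral {0..1} (\<lambda>s. (g s)\<^sup>2) - (2 * m) * m + (1 - 0) *\<^sub>R m\<^sup>2)) {0..1}"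
      using integrable_integral[OF g] integrable_integral[OF g2] has_integral_const_real[of "m\<^sup>2" 0 1]
      unfolding m_def[symmetric]
      by (intro has_integral_add has_integral_diff has_integral_mult_right) auto
    then show "((\<lambda>s. (g s)\<^sup>2 - (2 * m) * g s + m\<^sup>2) has_integral (integral {0..1} (\<lambda>s. (g s)\<^sup>2) - 2 * m * m + m\<^sup>2)) {0..1}" by simp
  qed
  finally show ?thesis unfolding m_def[symmetric] by (simp add: power2_eq_square)
qed

text \<open>This is the integral form of the remainder on the segment from \<open>y\<close> to
  \<open>x\<close>. Its kernel \<open>(1 - s) ^ N / fact N\<close> is at most 1, and the square
  passes under the integral by \<open>square_integral_le\<close>. With nonnegative integrals the
  bound can later be integrated over \<open>x\<close> and \<open>y\<close> by Tonelli.\<close>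

lemma taylor_remainder:
  fixes f :: "real ^ 'n::finite \<Rightarrow> real"
  assumes f: "smooth_on U f" and K: "convex K" "K \<subseteq> U" "x \<in> K" "y \<in> K" and \<rho>: "norm (x - y) \<le> \<rho>"
  shows "ennreal ((f x - taylor_at N f y x)\<^sup>2) \<le>
    ennreal (\<rho> ^ (2 * Suc N)) * (\<integral>\<^sup>+s. ennreal ((absD (Suc N) f (y + s *\<^sub>R (x - y)))\<^sup>2) * indicator {0..1} s \<partial>lborel)"
proof -
  define w where "w = x - y"
  have line: "y + s *\<^sub>R w \<in> U" if "s \<in> {0..1}" for s
  proof -
    have "y + s *\<^sub>R w = (1 - s) *\<^sub>R y + s *\<^sub>R x" by (simp add: w_def algebra_simps)
    then show ?thesis using K that convexD_alt[OF K(1,4,3), of s] by auto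
  qed
  have \<rho>0: "0 \<le> \<rho>" using \<rho> norm_ge_zero order_trans by blast
  let ?D = "\<lambda>k s. dirD f w k (y + s *\<^sub>R w)"
  let ?i = "\<lambda>s. ((1 - s) ^ (Suc N - 1) / fact (Suc N - 1)) *\<^sub>R ?D (Suc N) s"
  have T: "f x = (\<Sum>k<Suc N. ((1 - 0) ^ k / fact k) *\<^sub>R ?D k 0) + integral {0..1} ?i"
  and Ti: "?i integrable_on {0..1}"
  proof -
    have D0: "?D 0 s = f (y + s *\<^sub>R w)" for s by (simp add: dirD_def)
    have der: "(?D m has_vector_derivative ?D (Suc m) t) (at t within {0..1})"
      if "m < Suc N" "0 \<le> t" "t \<le> 1" for m t
      using dirD_line[OF f line, of t m] that
      by (auto simp: has_real_derivative_iff_has_vector_derivative[symmetric] intro: has_field_derivative_at_within)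
    have "f (y + 1 *\<^sub>R w) = (\<Sum>k<Suc N. ((1 - 0) ^ k / fact k) *\<^sub>R ?D k 0) + integral {0..1} ?i"
      by (rule Taylor_integral[where f = "\<lambda>s. f (y + s *\<^sub>R w)" and Df = ?D]) (use D0 der in auto)
    then show "f x = (\<Sum>k<Suc N. ((1 - 0) ^ k / fact k) *\<^sub>R ?D k 0) + integral {0..1} ?i" by (simp add: w_def)
    show "?i integrable_on {0..1}"
      by (rule Taylor_integrable[where f = "\<lambda>s. f (y + s *\<^sub>R w)" and Df = ?D]) (use D0 der in auto)
  qed
  have "(\<Sum>k<Suc N. ((1 - 0) ^ k / fact k) *\<^sub>R ?D k 0) = taylor_at N f y x"
    by (simp add: taylor_at_def w_def lessThan_Suc_atMost)
  then have R: "f x - taylor_at N f y x = integral {0..1} ?i" using T by simp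
  define g where "g s = \<rho> ^ Suc N * absD (Suc N) f (y + s *\<^sub>R w)" for s
  have cont: "continuous_on {0..1} (\<lambda>s. absD (Suc N) f (y + s *\<^sub>R w))"
    unfolding absD_def
    by (intro continuous_on_sum continuous_on_rabs continuous_on_compose2[OF smooth_on_foldr_continuous[OF f]] continuous_intros)
       (use line in auto)
  have contg: "continuous_on {0..1} g" unfolding g_def by (intro continuous_intros cont)
  have "norm (integral {0..1} ?i) \<le> integral {0..1} g"
  proof (rule integral_norm_bound_integral[OF Ti integrable_continuous_interval[OF contg]])
    fix s :: real assume s: "s \<in> {0..1}"
    have "\<bar>?D (Suc N) s\<bar> \<le> (\<Sum>is | length is = Suc N. \<bar>prod_list (map (\<lambda>i. w $ i) is) * foldr partial is f (y + s *\<^sub>R w)\<bar>)"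
      unfolding dirD_def by (rule sum_abs)
    also have "\<dots> \<le> (\<Sum>is | length is = Suc N. \<rho> ^ Suc N * \<bar>foldr partial is f (y + s *\<^sub>R w)\<bar>)"
    proof (rule sum_mono)
      fix "is" :: "'n list" assume "is \<in> {is. length is = Suc N}"
      then show "\<bar>prod_list (map (\<lambda>i. w $ i) is) * foldr partial is f (y + s *\<^sub>R w)\<bar> \<le> \<rho> ^ Suc N * \<bar>foldr partial is f (y + s *\<^sub>R w)\<bar>"
        using abs_prod_list_le[OF \<rho>[folded w_def], of "is"] by (simp add: abs_mult mult_right_mono)
    qed
    also have "\<dots> = g s" unfolding g_def absD_def by (simp add: sum_distrib_left)
    finally have D: "\<bar>?D (Suc N) s\<bar> \<le> g s" .
    have "\<bar>(1 - s) ^ N / fact N\<bar> \<le> 1"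
    proof -
      have "(1 - s) ^ N \<le> 1" using s by (intro power_le_one) auto
      also have "(1::real) \<le> fact N" by simp
      finally show ?thesis using s by (simp add: divide_le_eq_1)
    qed
    from mult_mono[OF this D] show "norm (?i s) \<le> g s" by (simp add: abs_mult)
  qed
  then have "\<bar>integral {0..1} ?i\<bar>\<^sup>2 \<le> (integral {0..1} g)\<^sup>2"
    unfolding real_norm_def by (rule power_mono) simp
  then have "(f x - taylor_at N f y x)\<^sup>2 \<le> (integral {0..1} g)\<^sup>2"
    unfolding R power2_abs .
  also have "\<dots> \<le> integral {0..1} (\<lambda>s. (g s)\<^sup>2)" by (rule square_integral_le[OF contg])
  finally have "ennreal ((f x - taylor_at N f y x)\<^sup>2) \<le> ennreal (integral {0..1} (\<lambda>s. (g s)\<^sup>2))"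
    by (rule ennreal_leI)
  also have "\<dots> = (\<integral>\<^sup>+s. ennreal ((g s)\<^sup>2) * indicator {0..1} s \<partial>lborel)"
  proof -
    have "((\<lambda>s. (g s)\<^sup>2) has_integral integral {0..1} (\<lambda>s. (g s)\<^sup>2)) {0..1}"
      using contg by (intro integrable_integral integrable_continuous_interval continuous_intros)
    from nn_integral_has_integral_lebesgue[OF _ this]
    have "(\<integral>\<^sup>+s. ennreal (indicat_real {0..1} s * (g s)\<^sup>2) \<partial>lborel) = ennreal (integral {0..1} (\<lambda>s. (g s)\<^sup>2))" by simp
    moreover have "ennreal (indicat_real {0..1} s * (g s)\<^sup>2) = ennreal ((g s)\<^sup>2) * indicator {0..1} s" for s
      by (auto simp: indicator_def)
    ultimately show ?thesis by simp
  qed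
  also have "\<dots> = (\<integral>\<^sup>+s. ennreal (\<rho> ^ (2 * Suc N)) * (ennreal ((absD (Suc N) f (y + s *\<^sub>R w))\<^sup>2) * indicator {0..1} s) \<partial>lborel)"
    unfolding g_def using \<rho>0 by (simp add: power_mult_distrib ennreal_mult power_mult[symmetric] mult_ac del: power_Suc)
  also have "\<dots> = ennreal (\<rho> ^ (2 * Suc N)) * (\<integral>\<^sup>+s. ennreal ((absD (Suc N) f (y + s *\<^sub>R w))\<^sup>2) * indicator {0..1} s \<partial>lborel)"
  proof (rule nn_integral_cmult)
    have "(\<lambda>s. indicator {0..1} s *\<^sub>R (absD (Suc N) f (y + s *\<^sub>R w))\<^sup>2) \<in> borel_measurable lborel"
    proof -
      have "(\<lambda>s. indicator {0..1} s *\<^sub>R (absD (Suc N) f (y + s *\<^sub>R w))\<^sup>2) \<in> borel_measurable borel"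
        by (intro borel_measurable_continuous_on_indicator continuous_intros cont) simp
      then show ?thesis by simp
    qed
    then have "(\<lambda>s. ennreal (indicator {0..1} s *\<^sub>R (absD (Suc N) f (y + s *\<^sub>R w))\<^sup>2)) \<in> borel_measurable lborel" by simp
    moreover have "ennreal (indicator {0..1} s *\<^sub>R (absD (Suc N) f (y + s *\<^sub>R w))\<^sup>2) = ennreal ((absD (Suc N) f (y + s *\<^sub>R w))\<^sup>2) * indicator {0..1} s" for s
      by (auto simp: indicator_def)
    ultimately show "(\<lambda>s. ennreal ((absD (Suc N) f (y + s *\<^sub>R w))\<^sup>2) * indicator {0..1} s) \<in> borel_measurable lborel" by (simp only:)
  qed
  finally show ?thesis by (simp add: w_def)
qed

subsection \<open>Polynomial approximation of smooth functions on a convex compact set\<close>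

lemma nn_integral_affine:
  fixes H :: "'a::euclidean_space \<Rightarrow> ennreal"
  assumes [measurable]: "H \<in> borel_measurable borel" and c: "c \<noteq> 0"
  shows "ennreal (\<bar>c\<bar> ^ DIM('a)) * (\<integral>\<^sup>+x. H (t + c *\<^sub>R x) \<partial>lborel) = (\<integral>\<^sup>+x. H x \<partial>lborel)"
proof -
  have "(\<integral>\<^sup>+x. H x \<partial>lborel) = (\<integral>\<^sup>+x. H x \<partial>density (distr lborel borel (\<lambda>x. t + c *\<^sub>R x)) (\<lambda>_. ennreal (\<bar>c\<bar> ^ DIM('a))))"
    using lborel_affine[OF c, of t] by simp
  also have "\<dots> = ennreal (\<bar>c\<bar> ^ DIM('a)) * (\<integral>\<^sup>+x. H (t + c *\<^sub>R x) \<partial>lborel)"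
    by (simp add: nn_integral_density nn_integral_distr nn_integral_cmult)
  finally show ?thesis by simp
qed

text \<open>The substitution costs the Jacobian factor \<open>1 / c ^ DIM('a)\<close>, which is at
  most \<open>2 ^ DIM('a)\<close>.\<close>

lemma nn_integral_affine_le:
  fixes H :: "'a::euclidean_space \<Rightarrow> ennreal"
  assumes [measurable]: "H \<in> borel_measurable borel" and c: "1 / 2 \<le> c"
  shows "(\<integral>\<^sup>+x. H (t + c *\<^sub>R x) \<partial>lborel) \<le> 2 ^ DIM('a) * (\<integral>\<^sup>+x. H x \<partial>lborel)"
proof -
  have "1 \<le> (2 * c) ^ DIM('a)" using c by (intro one_le_power) auto
  then have "1 \<le> ennreal ((2 * c) ^ DIM('a))" by (simp add: ennreal_ge_1)
  also have "ennreal ((2 * c) ^ DIM('a)) = 2 ^ DIM('a) * ennreal (\<bar>c\<bar> ^ DIM('a))"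
    using c by (simp add: power_mult_distrib ennreal_mult flip: ennreal_power)
  finally have "1 * (\<integral>\<^sup>+x. H (t + c *\<^sub>R x) \<partial>lborel) \<le> (2 ^ DIM('a) * ennreal (\<bar>c\<bar> ^ DIM('a))) * (\<integral>\<^sup>+x. H (t + c *\<^sub>R x) \<partial>lborel)"
    by (rule mult_right_mono) simp
  also have "\<dots> = 2 ^ DIM('a) * (\<integral>\<^sup>+x. H x \<partial>lborel)"
    using nn_integral_affine[OF assms(1), of c t] c by (simp add: mult.assoc)
  finally show ?thesis by simp
qed

text \<open>If \<open>G\<close> exceeded \<open>A\<close> on all of \<open>K\<close>, the integral
  of \<open>G - A\<close> over \<open>K\<close> would vanish although the integrand is positive on a
  set of positive measure. The finiteness conditions permit cancelling the integral of
  \<open>A\<close>.\<close>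

lemma exists_le_average:
  assumes [measurable]: "G \<in> borel_measurable M" "K \<in> sets M"
    and le: "(\<integral>\<^sup>+y. G y * indicator K y \<partial>M) \<le> A * emeasure M K"
    and K: "emeasure M K \<noteq> 0" "emeasure M K \<noteq> \<infinity>" and A: "A \<noteq> \<infinity>"
  shows "\<exists>y\<in>K. G y \<le> A"
proof (rule ccontr)
  assume "\<not> ?thesis"
  then have gt: "A < G y" if "y \<in> K" for y using that by (auto simp: not_le)
  have "(\<integral>\<^sup>+y. G y * indicator K y \<partial>M) = (\<integral>\<^sup>+y. (G y - A) * indicator K y + A * indicator K y \<partial>M)"
    using gt by (intro nn_integral_cong) (auto simp: indicator_def diff_add_cancel_ennreal less_imp_le)
  also have "\<dots> = (\<integral>\<^sup>+y. (G y - A) * indicator K y \<partial>M) + A * emeasure M K"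
    by (subst nn_integral_add) (auto simp: nn_integral_cmult_indicator)
  finally have "(\<integral>\<^sup>+y. (G y - A) * indicator K y \<partial>M) + A * emeasure M K \<le> 0 + A * emeasure M K"
    using le by simp
  then have "(\<integral>\<^sup>+y. (G y - A) * indicator K y \<partial>M) = 0"
    using K(2) A ennreal_add_left_cancel_le[of "A * emeasure M K" _ 0]
    by (auto simp: ennreal_mult_eq_top_iff add.commute)
  then have "AE y in M. (G y - A) * indicator K y = 0"
    by (subst (asm) nn_integral_0_iff_AE) auto
  then have "AE y in M. y \<notin> K"
    by (rule AE_mp) (intro AE_I2, use gt in \<open>force simp: indicator_def diff_eq_0_iff_ennreal not_le[symmetric] split: if_splits\<close>)
  moreover have "{y \<in> space M. y \<in> K} = K" using sets.sets_into_space[OF assms(2)] by auto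
  ultimately have "emeasure M K = 0" using emeasure_eq_0_AE[of "\<lambda>y. y \<in> K" M] by simp
  with K(1) show False by simp
qed

text \<open>Instead of averaging the Taylor polynomials at the points \<open>y \<in> K\<close>, one good \<open>y\<close> is picked.
  On the segment from \<open>y\<close> to \<open>x\<close>, the half closer to \<open>x\<close> is handled by a change of variables
  in \<open>x\<close>, the other half by one in \<open>y\<close>.\<close>
lemma smooth_poly_approx:
  fixes f :: "real ^ 'n::finite \<Rightarrow> real"
  assumes f: "smooth_on U f" and K: "compact K" "convex K" "K \<subseteq> U" "emeasure lborel K \<noteq> 0"
    and \<rho>: "\<And>x y. x \<in> K \<Longrightarrow> y \<in> K \<Longrightarrow> norm (x - y) \<le> \<rho>"
  shows "\<exists>p\<in>polys N. (\<integral>\<^sup>+x. ennreal ((f x - p x)\<^sup>2) * indicator K x \<partial>lborel) \<le>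
    ennreal (\<rho> ^ (2 * Suc N)) * 2 ^ CARD('n) * (\<integral>\<^sup>+x. ennreal ((absD (Suc N) f x)\<^sup>2) * indicator K x \<partial>lborel)"
proof -
  have Km[measurable]: "K \<in> sets borel" using K(1) by (simp add: borel_compact)
  have Kfin: "emeasure lborel K < \<infinity>" using K(1) emeasure_compact_finite by auto
  define H where "H z = ennreal ((absD (Suc N) f z)\<^sup>2) * indicator K z" for z
  have cont: "continuous_on K (absD (Suc N) f)"
    unfolding absD_def
    by (intro continuous_on_sum continuous_on_rabs continuous_on_subset[OF smooth_on_foldr_continuous[OF f] K(3)])
  have Hm[measurable]: "H \<in> borel_measurable borel"
  proof -
    have "(\<lambda>z. indicator K z *\<^sub>R (absD (Suc N) f z)\<^sup>2) \<in> borel_measurable borel"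
      by (intro borel_measurable_continuous_on_indicator Km continuous_intros cont)
    then have "(\<lambda>z. ennreal (indicator K z *\<^sub>R (absD (Suc N) f z)\<^sup>2)) \<in> borel_measurable borel" by simp
    moreover have "H = (\<lambda>z. ennreal (indicator K z *\<^sub>R (absD (Suc N) f z)\<^sup>2))"
      by (auto simp: H_def indicator_def)
    ultimately show ?thesis by simp
  qed
  define I where "I = (\<integral>\<^sup>+x. H x \<partial>lborel)"
  \<comment> \<open>Picking a good \<open>y\<close> by \<open>exists_le_average\<close> requires a
    finite average.\<close>
  have Ifin: "I \<noteq> \<infinity>"
  proof -
    have "compact (absD (Suc N) f ` K)" using compact_continuous_image[OF cont K(1)] .
    then obtain B where B: "\<bar>absD (Suc N) f x\<bar> \<le> B" if "x \<in> K" for x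
      using compact_imp_bounded bounded_iff by (metis imageI real_norm_def)
    have "I \<le> (\<integral>\<^sup>+x. ennreal (B\<^sup>2) * indicator K x \<partial>lborel)"
      unfolding I_def H_def
    proof (intro nn_integral_mono)
      fix x
      have "(absD (Suc N) f x)\<^sup>2 \<le> B\<^sup>2" if "x \<in> K" using B[OF that] by (metis abs_ge_zero power2_abs power_mono)
      then show "ennreal ((absD (Suc N) f x)\<^sup>2) * indicator K x \<le> ennreal (B\<^sup>2) * indicator K x"
        by (auto simp: indicator_def ennreal_leI)
    qed
    also have "\<dots> < \<infinity>" using Kfin by (simp add: nn_integral_cmult_indicator ennreal_mult_less_top)
    finally show ?thesis by simp
  qed
  define c where "c = ennreal (\<rho> ^ (2 * Suc N))"
  define P where "P y = (\<integral>\<^sup>+x. \<integral>\<^sup>+s. H (y + s *\<^sub>R (x - y)) * indicator {0..1} s * indicator K x \<partial>lborel \<partial>lborel)" for y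
  have Pm[measurable]: "P \<in> borel_measurable lborel" unfolding P_def by measurable
  have remainder: "(\<integral>\<^sup>+x. ennreal ((f x - taylor_at N f y x)\<^sup>2) * indicator K x \<partial>lborel) \<le> c * P y" if y: "y \<in> K" for y
  proof -
    have "(\<integral>\<^sup>+x. ennreal ((f x - taylor_at N f y x)\<^sup>2) * indicator K x \<partial>lborel) \<le>
       (\<integral>\<^sup>+x. c * (\<integral>\<^sup>+s. H (y + s *\<^sub>R (x - y)) * indicator {0..1} s * indicator K x \<partial>lborel) \<partial>lborel)"
    proof (intro nn_integral_mono)
      fix x
      show "ennreal ((f x - taylor_at N f y x)\<^sup>2) * indicator K x \<le> c * (\<integral>\<^sup>+s. H (y + s *\<^sub>R (x - y)) * indicator {0..1} s * indicator K x \<partial>lborel)"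
      proof (cases "x \<in> K")
        case True
        have "y + s *\<^sub>R (x - y) \<in> K" if "s \<in> {0..1}" for s
        proof -
          have "y + s *\<^sub>R (x - y) = (1 - s) *\<^sub>R y + s *\<^sub>R x" by (simp add: algebra_simps)
          then show ?thesis using that convexD_alt[OF K(2) y True, of s] by auto
        qed
        then have "(\<integral>\<^sup>+s. H (y + s *\<^sub>R (x - y)) * indicator {0..1} s * indicator K x \<partial>lborel)
          = (\<integral>\<^sup>+s. ennreal ((absD (Suc N) f (y + s *\<^sub>R (x - y)))\<^sup>2) * indicator {0..1} s \<partial>lborel)"
          using True by (intro nn_integral_cong) (auto simp: H_def indicator_def)
        then show ?thesis
          using taylor_remainder[OF f K(2,3) True y \<rho>[OF True y], of N] True by (simp add: c_def)
      qed simp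
    qed
    also have "\<dots> = c * P y"
      unfolding P_def by (subst nn_integral_cmult) auto
    finally show ?thesis .
  qed
  have "(\<integral>\<^sup>+y. P y * indicator K y \<partial>lborel) \<le> (2 ^ CARD('n) * I) * emeasure lborel K"
  proof -
    \<comment> \<open>Tonelli brings the parameter \<open>s\<close> of the segment outermost, so
      that a bound for each fixed \<open>s\<close> suffices and the substitution may depend on
      \<open>s\<close>.\<close>
    define Q where "Q s = (\<integral>\<^sup>+y. \<integral>\<^sup>+x. H (y + s *\<^sub>R (x - y)) * indicator K x * indicator K y \<partial>lborel \<partial>lborel)" for s :: real
    have "(\<integral>\<^sup>+y. P y * indicator K y \<partial>lborel)
      = (\<integral>\<^sup>+y. \<integral>\<^sup>+x. \<integral>\<^sup>+s. H (y + s *\<^sub>R (x - y)) * indicator {0..1} s * indicator K x * indicator K y \<partial>lborel \<partial>lborel \<partial>lborel)"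
      unfolding P_def by (simp add: nn_integral_multc)
    also have "\<dots> = (\<integral>\<^sup>+y. \<integral>\<^sup>+s. \<integral>\<^sup>+x. H (y + s *\<^sub>R (x - y)) * indicator {0..1} s * indicator K x * indicator K y \<partial>lborel \<partial>lborel \<partial>lborel)"
      by (intro nn_integral_cong lborel_pair.Fubini') measurable
    also have "\<dots> = (\<integral>\<^sup>+s. \<integral>\<^sup>+y. \<integral>\<^sup>+x. H (y + s *\<^sub>R (x - y)) * indicator {0..1} s * indicator K x * indicator K y \<partial>lborel \<partial>lborel \<partial>lborel)"
      by (intro lborel_pair.Fubini') measurable
    also have "\<dots> = (\<integral>\<^sup>+s. Q s * indicator {0..1} s \<partial>lborel)"
      unfolding Q_def by (subst nn_integral_multc[symmetric], measurable)+ (simp add: mult_ac)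
    also have "\<dots> \<le> (\<integral>\<^sup>+s. ((2 ^ CARD('n) * I) * emeasure lborel K) * indicator {0..1} (s::real) \<partial>lborel)"
    proof (intro nn_integral_mono)
      fix s :: real
      have "Q s \<le> (2 ^ CARD('n) * I) * emeasure lborel K" if s: "0 \<le> s" "s \<le> 1"
      proof (cases "1 / 2 \<le> s")
        case True
        have "Q s \<le> (\<integral>\<^sup>+y. (2 ^ CARD('n) * I) * indicator K y \<partial>lborel)"
          unfolding Q_def
        proof (intro nn_integral_mono)
          fix y :: "real ^ 'n"
          have "(\<integral>\<^sup>+x. H (y + s *\<^sub>R (x - y)) * indicator K x * indicator K y \<partial>lborel) \<le> (\<integral>\<^sup>+x. H ((1 - s) *\<^sub>R y + s *\<^sub>R x) * indicator K y \<partial>lborel)"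
            by (intro nn_integral_mono) (auto simp: indicator_def algebra_simps)
          also have "\<dots> = (\<integral>\<^sup>+x. H ((1 - s) *\<^sub>R y + s *\<^sub>R x) \<partial>lborel) * indicator K y"
            by (subst nn_integral_multc) auto
          also have "\<dots> \<le> (2 ^ CARD('n) * I) * indicator K y"
            using nn_integral_affine_le[OF Hm True, of "(1 - s) *\<^sub>R y"] by (intro mult_right_mono) (auto simp: I_def)
          finally show "(\<integral>\<^sup>+x. H (y + s *\<^sub>R (x - y)) * indicator K x * indicator K y \<partial>lborel) \<le> (2 ^ CARD('n) * I) * indicator K y" .
        qed
        then show ?thesis by (simp add: nn_integral_cmult_indicator)
      next
        case False
        have "Q s = (\<integral>\<^sup>+x. \<integral>\<^sup>+y. H (y + s *\<^sub>R (x - y)) * indicator K x * indicator K y \<partial>lborel \<partial>lborel)"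
          unfolding Q_def by (intro lborel_pair.Fubini') measurable
        also have "\<dots> \<le> (\<integral>\<^sup>+x. (2 ^ CARD('n) * I) * indicator K x \<partial>lborel)"
        proof (intro nn_integral_mono)
          fix x :: "real ^ 'n"
          have "(\<integral>\<^sup>+y. H (y + s *\<^sub>R (x - y)) * indicator K x * indicator K y \<partial>lborel) \<le> (\<integral>\<^sup>+y. H (s *\<^sub>R x + (1 - s) *\<^sub>R y) * indicator K x \<partial>lborel)"
            by (intro nn_integral_mono) (auto simp: indicator_def algebra_simps)
          also have "\<dots> = (\<integral>\<^sup>+y. H (s *\<^sub>R x + (1 - s) *\<^sub>R y) \<partial>lborel) * indicator K x"
            by (subst nn_integral_multc) auto
          also have "\<dots> \<le> (2 ^ CARD('n) * I) * indicator K x"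
            using nn_integral_affine_le[OF Hm, of "1 - s" "s *\<^sub>R x"] False by (intro mult_right_mono) (auto simp: I_def)
          finally show "(\<integral>\<^sup>+y. H (y + s *\<^sub>R (x - y)) * indicator K x * indicator K y \<partial>lborel) \<le> (2 ^ CARD('n) * I) * indicator K x" .
        qed
        finally show ?thesis by (simp add: nn_integral_cmult_indicator)
      qed
      then show "Q s * indicator {0..1} s \<le> ((2 ^ CARD('n) * I) * emeasure lborel K) * indicator {0..1} s"
        by (auto simp: indicator_def)
    qed
    also have "\<dots> = (2 ^ CARD('n) * I) * emeasure lborel K" by (simp add: nn_integral_cmult_indicator)
    finally show ?thesis .
  qed
  then obtain y where y: "y \<in> K" "P y \<le> 2 ^ CARD('n) * I"
  proof -
    have "2 ^ CARD('n) * I \<noteq> \<infinity>"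
      using Ifin by (auto simp: ennreal_mult_eq_top_iff power_eq_top_ennreal)
    then show thesis
      using exists_le_average[of P lborel K "2 ^ CARD('n) * I"] K(4) Kfin \<open>_ \<le> (2 ^ CARD('n) * I) * emeasure lborel K\<close> that
      by (auto simp: less_top)
  qed
  have "(\<integral>\<^sup>+x. ennreal ((f x - taylor_at N f y x)\<^sup>2) * indicator K x \<partial>lborel) \<le> c * (2 ^ CARD('n) * I)"
    using remainder[OF y(1)] mult_left_mono[OF y(2), of c] by (meson order_trans zero_le)
  then show ?thesis
    using taylor_at_polys[of N f y] unfolding I_def H_def c_def by (auto simp: mult.assoc)
qed

subsection \<open>Mollifiers\<close>

text \<open>The \<open>k\<close>-th derivative of \<open>t \<mapsto> exp (- 1 / t)\<close>, extended by zero to \<open>t \<le> 0\<close>, is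
  \<open>P\<^sub>k (1 / t) exp (- 1 / t)\<close> with the polynomials \<open>P\<^sub>k\<close> below.\<close>
primrec flat_poly :: "nat \<Rightarrow> real poly" where
  "flat_poly 0 = 1"
| "flat_poly (Suc k) = [:0, 0, 1:] * (flat_poly k - pderiv (flat_poly k))"

definition flat :: "nat \<Rightarrow> real \<Rightarrow> real" where
  "flat k t = (if t \<le> 0 then 0 else poly (flat_poly k) (inverse t) * exp (- inverse t))"

lemma poly_exp_tendsto_0: "((\<lambda>x. poly q x * exp (- x)) \<longlongrightarrow> (0::real)) at_top"
proof -
  have "((\<lambda>x. \<Sum>i\<le>degree q. coeff q i * (x ^ i / exp x)) \<longlongrightarrow> 0) at_top"
    by (intro tendsto_null_sum tendsto_mult_right_zero tendsto_power_div_exp_0)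
  moreover have "(\<lambda>x. \<Sum>i\<le>degree q. coeff q i * (x ^ i / exp x)) = (\<lambda>x. poly q x * exp (- x))"
    by (simp add: fun_eq_iff poly_altdef sum_distrib_right exp_minus divide_inverse mult.assoc)
  ultimately show ?thesis by simp
qed

lemma flat_has_derivative: "(flat k has_real_derivative flat (Suc k) t) (at t)"
proof -
  consider "t < 0" | "t = 0" | "0 < t" by linarith
  then show ?thesis
  proof cases
    case 1
    have "((\<lambda>_. 0) has_real_derivative 0) (at t)" by simp
    then have "(flat k has_real_derivative 0) (at t)"
      by (rule DERIV_cong_ev[THEN iffD1, rotated 3])
         (use 1 in \<open>auto simp: flat_def intro!: eventually_mono[OF eventually_nhds_in_open[of "{..<0}" t]]\<close>)
    then show ?thesis using 1 by (simp add: flat_def)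
  next
    case 3
    let ?g = "\<lambda>t. poly (flat_poly k) (inverse t) * exp (- inverse t)"
    have "(?g has_real_derivative flat (Suc k) t) (at t)"
      using 3 unfolding flat_def
      by (auto intro!: derivative_eq_intros simp: power2_eq_square algebra_simps)
    then show ?thesis
      by (rule DERIV_cong_ev[THEN iffD1, rotated 3])
         (use 3 in \<open>auto simp: flat_def intro!: eventually_mono[OF eventually_nhds_in_open[of "{0<..}" t]]\<close>)
  next
    case 2
    have "((\<lambda>h. flat k h / h) \<longlongrightarrow> 0) (at_left 0)"
      by (rule tendsto_eventually) (auto simp: flat_def eventually_at_left_field intro: exI[of _ "-1"])
    moreover have "((\<lambda>h. flat k h / h) \<longlongrightarrow> 0) (at_right 0)"
    proof -
      \<comment> \<open>The quotient \<open>flat k h / h\<close> is evaluated at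
        \<open>x = inverse h\<close>; division by \<open>h\<close> becomes one more factor
        \<open>x\<close>, supplied by the polynomial \<open>[:0, 1:]\<close>.\<close>
      have "((\<lambda>h. poly ([:0, 1:] * flat_poly k) (inverse h) * exp (- inverse h)) \<longlongrightarrow> 0) (at_right 0)"
        using filterlim_compose[OF poly_exp_tendsto_0 filterlim_inverse_at_top_right] .
      then show ?thesis
        by (rule Lim_transform_eventually)
           (auto simp: flat_def eventually_at_right_field field_simps intro: exI[of _ 1])
    qed
    ultimately have "((\<lambda>h. flat k h / h) \<longlongrightarrow> 0) (at 0)" by (simp add: filterlim_at_split)
    then show ?thesis using 2 by (simp add: DERIV_def flat_def)
  qed
qed

lemma flat_0_nonneg: "0 \<le> flat 0 t" and flat_0_pos: "0 < t \<Longrightarrow> 0 < flat 0 t"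
  and flat_0_zero: "t \<le> 0 \<Longrightarrow> flat 0 t = 0"
  by (auto simp: flat_def)

text \<open>Differentiation maps this family of functions into itself, changing only
  \<open>c\<close> and \<open>k\<close>, so the induction runs with both arbitrary.\<close>

lemma ck_flat_coord: "ck UNIV n (\<lambda>x :: real ^ 'n::finite. c * flat k (a + b * x $ i))"
proof (induction n arbitrary: c k)
  case (Suc n)
  have D: "((\<lambda>x :: real ^ 'n. c * flat k (a + b * x $ i)) has_derivative
      (\<lambda>h. \<Sum>j\<in>UNIV. h $ j *\<^sub>R (if j = i then (c * b) * flat (Suc k) (a + b * x $ i) else 0))) (at x)" for x
  proof -
    have "((\<lambda>x :: real ^ 'n. a + b * x $ i) has_derivative (\<lambda>h. b * h $ i)) (at x)"
      by (auto intro!: derivative_eq_intros bounded_linear.has_derivative[OF bounded_linear_vec_nth])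
    from has_derivative_compose[OF this flat_has_derivative[unfolded has_field_derivative_def]]
    have "((\<lambda>x :: real ^ 'n. c * flat k (a + b * x $ i)) has_derivative
      (\<lambda>h. c * (flat (Suc k) (a + b * x $ i) * (b * h $ i)))) (at x)"
      by (intro has_derivative_mult_right)
    moreover have "(\<Sum>j\<in>UNIV. h $ j *\<^sub>R (if j = i then (c * b) * flat (Suc k) (a + b * x $ i) else 0))
       = (\<Sum>j\<in>UNIV. if j = i then h $ i * ((c * b) * flat (Suc k) (a + b * x $ i)) else 0)" for h :: "real ^ 'n"
      by (intro sum.cong) auto
    ultimately show ?thesis by (simp add: mult_ac)
  qed
  have "ck UNIV n (partial j (\<lambda>x :: real ^ 'n. c * flat k (a + b * x $ i)))" for j
  proof -
    have "partial j (\<lambda>x :: real ^ 'n. c * flat k (a + b * x $ i)) =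
        (\<lambda>x. (if j = i then c * b else 0) * flat (Suc k) (a + b * x $ i))"
      using partial_eq_sum[OF D] by (auto simp: fun_eq_iff)
    then show ?thesis using Suc.IH by simp
  qed
  moreover have "(\<lambda>x :: real ^ 'n. c * flat k (a + b * x $ i)) differentiable_on UNIV"
    using D unfolding differentiable_on_def differentiable_def by auto
  ultimately show ?case by simp
qed simp

lemma ck_prod:
  fixes f :: "'i \<Rightarrow> real ^ 'n::finite \<Rightarrow> real"
  shows "finite I \<Longrightarrow> open U \<Longrightarrow> (\<And>i. i \<in> I \<Longrightarrow> ck U k (f i)) \<Longrightarrow> ck U k (\<lambda>z. \<Prod>i\<in>I. f i z)"
  by (induction rule: finite_induct) (auto intro: ck_mult ck_const)

text \<open>Any smooth probability density supported in the closed ball of radius \<epsilon>, not a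
  rescaled standard kernel. The convergence results hold for all such densities of small radius, so
  one kernel can serve several functions at once.\<close>

definition mollifier :: "real \<Rightarrow> (real ^ 'n::finite \<Rightarrow> real) \<Rightarrow> bool" where
  "mollifier \<epsilon> \<eta> \<longleftrightarrow> smooth_on UNIV \<eta> \<and> (\<forall>x. 0 \<le> \<eta> x) \<and> (\<forall>x. \<epsilon> < norm x \<longrightarrow> \<eta> x = 0) \<and>
     integrable lborel \<eta> \<and> integral\<^sup>L lborel \<eta> = 1"

lemma smooth_on_continuous: "smooth_on U f \<Longrightarrow> continuous_on U f"
  for f :: "real ^ 'n::finite \<Rightarrow> 'b::real_normed_vector"
  unfolding smooth_on_def by (metis differentiable_imp_continuous_on foldr_Nil id_apply)

lemma integrable_continuous_compact_support:
  fixes f :: "'a::euclidean_space \<Rightarrow> real"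
  assumes "continuous_on UNIV f" "\<And>x. R < norm x \<Longrightarrow> f x = 0"
  shows "integrable lborel f"
proof -
  have "integrable lborel (\<lambda>x. indicator (cball 0 R) x *\<^sub>R f x)"
    by (intro borel_integrable_compact continuous_on_subset[OF assms(1)]) auto
  moreover have "(\<lambda>x. indicator (cball 0 R) x *\<^sub>R f x) = f"
    using assms(2) by (force simp: indicator_def fun_eq_iff)
  ultimately show ?thesis by simp
qed

lemma open_null_imp_empty:
  fixes S :: "'a::euclidean_space set"
  assumes "open S" "AE x in lebesgue. x \<notin> S"
  shows "S = {}"
proof -
  have "S \<in> null_sets lebesgue"
    using assms(2) AE_iff_null_sets[of S lebesgue] lebesgue_openin[of UNIV S] assms(1) by auto
  then show ?thesis using open_not_negligible[OF assms(1)] negligible_iff_null_sets by blast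
qed

lemma mollifier_exists:
  assumes "0 < \<epsilon>"
  shows "\<exists>\<eta> :: real ^ 'n::finite \<Rightarrow> real. mollifier \<epsilon> \<eta>"
proof -
  \<comment> \<open>The bump is a product of one-dimensional bumps supported in the cube of
    half-width \<delta>. That cube lies in the ball of radius \<epsilon>, since the Euclidean norm
    is at most the sum of the absolute coordinates.\<close>
  define \<delta> where "\<delta> = \<epsilon> / real CARD('n)"
  have \<delta>: "0 < \<delta>" using assms by (simp add: \<delta>_def)
  define g :: "real ^ 'n \<Rightarrow> real" where
    "g x = (\<Prod>i\<in>UNIV. (1 * flat 0 (1 + (1 / \<delta>) * x $ i)) * (1 * flat 0 (1 + (- 1 / \<delta>) * x $ i)))" for x
  have ck: "ck UNIV k g" for k
    unfolding g_def by (intro ck_prod ck_mult ck_flat_coord) auto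
  then have sm: "smooth_on UNIV g" by (simp add: smooth_on_ck)
  have nonneg: "0 \<le> g x" for x unfolding g_def by (intro prod_nonneg) (auto simp: flat_0_nonneg)
  have pos: "0 < g 0" unfolding g_def by (intro prod_pos) (auto simp: flat_0_pos)
  have zero: "g x = 0" if "\<epsilon> < norm x" for x
  proof -
    obtain i where i: "\<delta> \<le> \<bar>x $ i\<bar>"
    proof (rule ccontr)
      assume "\<not> thesis"
      then have "\<bar>x $ i\<bar> \<le> \<delta>" for i using that by (meson linear)
      then have "(\<Sum>i\<in>UNIV. \<bar>x $ i\<bar>) \<le> (\<Sum>i\<in>(UNIV::'n set). \<delta>)" by (intro sum_mono)
      also have "\<dots> = \<epsilon>" by (simp add: \<delta>_def)
      finally show False using \<open>\<epsilon> < norm x\<close> norm_le_l1_cart[of x] by linarith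
    qed
    then have "1 + (1 / \<delta>) * x $ i \<le> 0 \<or> 1 + (- 1 / \<delta>) * x $ i \<le> 0"
      using \<delta> by (auto simp: abs_if field_simps split: if_splits)
    then have "(1 * flat 0 (1 + (1 / \<delta>) * x $ i)) * (1 * flat 0 (1 + (- 1 / \<delta>) * x $ i)) = 0"
      using flat_0_zero by auto
    then show ?thesis unfolding g_def by (intro prod_zero) auto
  qed
  have cont: "continuous_on UNIV g" using smooth_on_continuous[OF sm] .
  have int: "integrable lborel g" by (rule integrable_continuous_compact_support[OF cont zero])
  define m where "m = integral\<^sup>L lborel g"
  have m: "0 < m"
  proof -
    \<comment> \<open>A continuous nonnegative function with integral zero vanishes off a null set
      and therefore everywhere, but \<open>g 0\<close> is positive.\<close>
    have "m \<noteq> 0"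
    proof
      assume "m = 0"
      then have "AE x in lborel. g x = 0"
        using integral_nonneg_eq_0_iff_AE[OF int] nonneg by (simp add: m_def)
      moreover have "open {x. g x \<noteq> 0}" by (intro open_Collect_neq cont continuous_on_const)
      ultimately have "{x. g x \<noteq> 0} = {}"
        by (intro open_null_imp_empty AE_completion) auto
      then show False using pos by auto
    qed
    moreover have "0 \<le> m" unfolding m_def using nonneg by simp
    ultimately show ?thesis by simp
  qed
  have "ck UNIV k (\<lambda>x. (1 / m) * g x)" for k by (intro ck_mult ck_const ck) auto
  then have "mollifier \<epsilon> (\<lambda>x. (1 / m) * g x)"
    unfolding mollifier_def using zero nonneg m int by (auto simp: smooth_on_ck m_def)
  then show ?thesis by blast
qed

subsection \<open>Convolution with a smooth kernel\<close>

definition conv :: "(real ^ 'n::finite \<Rightarrow> real) \<Rightarrow> (real ^ 'n \<Rightarrow> real) \<Rightarrow> real ^ 'n \<Rightarrow> real" where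
  "conv b \<phi> x = (LINT y|lborel. b y * \<phi> (x - y))"

lemma foldr_partial_const_0: "foldr partial is (\<lambda>x. 0) = (\<lambda>x. 0)"
  by (induction "is") auto

lemma foldr_partial_support:
  fixes \<phi> :: "real ^ 'n::finite \<Rightarrow> real"
  assumes "\<And>x. R < norm x \<Longrightarrow> \<phi> x = 0" "R < norm x"
  shows "foldr partial is \<phi> x = 0"
proof -
  have "open {x :: real ^ 'n. R < norm x}" by (intro open_Collect_less continuous_intros)
  from foldr_partial_cong[OF this, of \<phi> "\<lambda>_. 0" x "is"] assms
  show ?thesis by (simp add: foldr_partial_const_0)
qed

lemma compact_support_bounded:
  fixes f :: "real ^ 'n::finite \<Rightarrow> real"
  assumes "continuous_on UNIV f" "\<And>x. R < norm x \<Longrightarrow> f x = 0"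
  obtains M where "0 \<le> M" "\<And>x. \<bar>f x\<bar> \<le> M"
proof -
  have "compact (f ` cball 0 R)" by (intro compact_continuous_image continuous_on_subset[OF assms(1)]) auto
  then obtain M where M: "\<And>x. x \<in> cball 0 R \<Longrightarrow> \<bar>f x\<bar> \<le> M"
    using compact_imp_bounded bounded_iff by (metis imageI real_norm_def)
  have "\<bar>f x\<bar> \<le> max M 0" for x
    using M[of x] assms(2)[of x] by (cases "R < norm x") auto
  then show thesis by (intro that[of "max M 0"]) auto
qed

lemma smooth_on_foldr: "smooth_on U f \<Longrightarrow> smooth_on U (foldr partial is f)"
  unfolding smooth_on_def by (metis foldr_append o_apply)

lemma taylor_at_1:
  fixes f :: "real ^ 'n::finite \<Rightarrow> real"
  shows "taylor_at 1 f y x = f y + (\<Sum>i\<in>UNIV. (x - y) $ i * partial i f y)"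
proof -
  have 0: "{is :: 'n list. length is = 0} = {[]}" by auto
  have 1: "{is :: 'n list. length is = 1} = (\<lambda>i. [i]) ` UNIV" by (auto simp: length_Suc_conv image_iff)
  have inj: "inj (\<lambda>i :: 'n. [i])" by (auto simp: inj_on_def)
  have "dirD f (x - y) 0 y = f y" unfolding dirD_def 0 by simp
  moreover have "dirD f (x - y) 1 y = (\<Sum>i\<in>UNIV. (x - y) $ i * partial i f y)"
    unfolding dirD_def 1 sum.reindex[OF inj] by simp
  ultimately show ?thesis by (simp add: taylor_at_def numeral_eq_Suc)
qed

text \<open>The second derivatives are continuous with compact support, hence bounded, and the
  first-order Taylor remainder is quadratic uniformly in both points. This uniformity is what lets a
  convolution be differentiated under the integral.\<close>

lemma smooth_compact_support_quadratic:
  fixes \<phi> :: "real ^ 'n::finite \<Rightarrow> real"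
  assumes sm: "smooth_on UNIV \<phi>" and supp: "\<And>x. R < norm x \<Longrightarrow> \<phi> x = 0"
  obtains M where "0 \<le> M" "\<And>x y :: real ^ 'n. \<bar>\<phi> x - \<phi> y - (\<Sum>i\<in>UNIV. (x - y) $ i * partial i \<phi> y)\<bar> \<le> M * (norm (x - y))\<^sup>2"
proof -
  have "continuous_on UNIV (absD 2 \<phi>)" unfolding absD_def
    by (intro continuous_on_sum continuous_on_rabs smooth_on_foldr_continuous[OF sm])
  moreover have "absD 2 \<phi> x = 0" if "R < norm x" for x
    using foldr_partial_support[OF supp that] by (simp add: absD_def)
  ultimately obtain M where M: "0 \<le> M" "\<And>x. \<bar>absD 2 \<phi> x\<bar> \<le> M"
    using compact_support_bounded by blast
  show thesis
  proof (rule that[OF M(1)])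
    fix x y :: "real ^ 'n"
    define \<rho> where "\<rho> = norm (x - y)"
    have "ennreal ((\<phi> x - taylor_at 1 \<phi> y x)\<^sup>2) \<le>
      ennreal (\<rho> ^ (2 * Suc 1)) * (\<integral>\<^sup>+s. ennreal ((absD (Suc 1) \<phi> (y + s *\<^sub>R (x - y)))\<^sup>2) * indicator {0..1} s \<partial>lborel)"
      by (rule taylor_remainder[OF sm, where K = UNIV]) (auto simp: \<rho>_def)
    also have "(\<integral>\<^sup>+s. ennreal ((absD (Suc 1) \<phi> (y + s *\<^sub>R (x - y)))\<^sup>2) * indicator {0..1} s \<partial>lborel)
        \<le> (\<integral>\<^sup>+s. ennreal (M\<^sup>2) * indicator {0..1::real} s \<partial>lborel)"
    proof (intro nn_integral_mono mult_right_mono ennreal_leI)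
      fix s :: real
      show "(absD (Suc 1) \<phi> (y + s *\<^sub>R (x - y)))\<^sup>2 \<le> M\<^sup>2"
        using power_mono[OF M(2)[of "y + s *\<^sub>R (x - y)"], of 2] by (simp add: numeral_2_eq_2)
    qed auto
    also have "\<dots> = ennreal (M\<^sup>2)" by (simp add: nn_integral_cmult_indicator)
    finally have "ennreal ((\<phi> x - taylor_at 1 \<phi> y x)\<^sup>2) \<le> ennreal (\<rho> ^ (2 * Suc 1) * M\<^sup>2)"
      by (simp add: ennreal_mult' mult_left_mono \<rho>_def)
    then have "(\<phi> x - taylor_at 1 \<phi> y x)\<^sup>2 \<le> \<rho> ^ (2 * Suc 1) * M\<^sup>2"
      by (subst (asm) ennreal_le_iff) (auto simp: \<rho>_def)
    also have "\<dots> = (M * \<rho>\<^sup>2)\<^sup>2" by (simp add: power_mult_distrib numeral_eq_Suc)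
    finally have "\<bar>\<phi> x - taylor_at 1 \<phi> y x\<bar> \<le> \<bar>M * \<rho>\<^sup>2\<bar>"
      by (simp only: abs_le_square_iff)
    then have "\<bar>\<phi> x - taylor_at 1 \<phi> y x\<bar> \<le> M * \<rho>\<^sup>2" using M(1) by simp
    then show "\<bar>\<phi> x - \<phi> y - (\<Sum>i\<in>UNIV. (x - y) $ i * partial i \<phi> y)\<bar> \<le> M * (norm (x - y))\<^sup>2"
      unfolding taylor_at_1 \<rho>_def by (simp add: diff_diff_eq)
  qed
qed

context
  fixes b :: "real ^ 'n::finite \<Rightarrow> real"
  assumes b: "integrable lborel b"
begin

lemma conv_integrable:
  assumes "continuous_on UNIV \<phi>" "\<And>x. R < norm x \<Longrightarrow> \<phi> x = 0"
  shows "integrable lborel (\<lambda>y. b y * \<phi> (x - y))"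
proof -
  obtain M where M: "0 \<le> M" "\<And>x. \<bar>\<phi> x\<bar> \<le> M" using compact_support_bounded assms by blast
  have [measurable]: "\<phi> \<in> borel_measurable borel" using assms(1) by (rule borel_measurable_continuous_onI)
  have [measurable]: "b \<in> borel_measurable borel" using b by simp
  show ?thesis
  proof (rule Bochner_Integration.integrable_bound)
    show "integrable lborel (\<lambda>y. M * b y)" using b by simp
    show "AE y in lborel. norm (b y * \<phi> (x - y)) \<le> norm (M * b y)"
    proof (rule AE_I2)
      fix y
      have "\<bar>b y\<bar> * \<bar>\<phi> (x - y)\<bar> \<le> \<bar>b y\<bar> * M" by (intro mult_left_mono M) simp
      then show "norm (b y * \<phi> (x - y)) \<le> norm (M * b y)" using M(1) by (simp add: abs_mult mult.commute)
    qed
  qed measurable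
qed

text \<open>Integrating the uniform quadratic remainder of the kernel against \<open>b\<close>
  bounds the remainder of the convolution by a multiple of the squared increment.\<close>

lemma conv_has_derivative:
  assumes sm: "smooth_on UNIV \<phi>" and supp: "\<And>x. R < norm x \<Longrightarrow> \<phi> x = 0"
  shows "(conv b \<phi> has_derivative (\<lambda>h. \<Sum>i\<in>UNIV. h $ i *\<^sub>R conv b (partial i \<phi>) x)) (at x)"
proof -
  obtain M where M: "0 \<le> M" "\<And>x y. \<bar>\<phi> x - \<phi> y - (\<Sum>i\<in>UNIV. (x - y) $ i * partial i \<phi> y)\<bar> \<le> M * (norm (x - y))\<^sup>2"
    using smooth_compact_support_quadratic[OF sm supp] by blast
  define B where "B = M * (LINT y|lborel. \<bar>b y\<bar>)"
  have int: "integrable lborel (\<lambda>y. b y * \<phi> (x - y))" for x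
    by (rule conv_integrable[OF smooth_on_continuous[OF sm] supp])
  have smi: "smooth_on UNIV (partial i \<phi>)" for i using smooth_on_foldr[OF sm, of "[i]"] by simp
  have suppi: "partial i \<phi> x = 0" if "R < norm x" for i x
  proof -
    have "foldr partial [i] \<phi> x = 0" by (rule foldr_partial_support[OF supp that])
    then show ?thesis by simp
  qed
  have inti: "integrable lborel (\<lambda>y. b y * partial i \<phi> (x - y))" for x i
    by (rule conv_integrable[OF smooth_on_continuous[OF smi] suppi])
  have bound: "\<bar>conv b \<phi> z - conv b \<phi> x - (\<Sum>i\<in>UNIV. (z - x) $ i *\<^sub>R conv b (partial i \<phi>) x)\<bar> \<le> B * (norm (z - x))\<^sup>2" for z
  proof -
    let ?r = "\<lambda>y. \<phi> (z - y) - \<phi> (x - y) - (\<Sum>i\<in>UNIV. (z - x) $ i * partial i \<phi> (x - y))"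
    have eq: "b y * ?r y = b y * \<phi> (z - y) - b y * \<phi> (x - y) - (\<Sum>i\<in>UNIV. (z - x) $ i * (b y * partial i \<phi> (x - y)))" for y
      by (simp add: algebra_simps sum_distrib_left)
    have i1: "integrable lborel (\<lambda>y. b y * ?r y)" unfolding eq
      by (intro Bochner_Integration.integrable_diff Bochner_Integration.integrable_sum integrable_mult_right int inti)
    have e: "conv b \<phi> z - conv b \<phi> x - (\<Sum>i\<in>UNIV. (z - x) $ i *\<^sub>R conv b (partial i \<phi>) x) = (LINT y|lborel. b y * ?r y)"
      unfolding eq conv_def
      by (simp add: int inti Bochner_Integration.integral_diff Bochner_Integration.integral_sum del: vector_minus_component)
    have "\<bar>LINT y|lborel. b y * ?r y\<bar> \<le> (LINT y|lborel. \<bar>b y * ?r y\<bar>)" by (rule integral_abs_bound)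
    also have "\<dots> \<le> (LINT y|lborel. (M * (norm (z - x))\<^sup>2) * \<bar>b y\<bar>)"
    proof (rule integral_mono)
      show "integrable lborel (\<lambda>y. \<bar>b y * ?r y\<bar>)" by (rule integrable_abs[OF i1])
      show "integrable lborel (\<lambda>y. (M * (norm (z - x))\<^sup>2) * \<bar>b y\<bar>)"
        by (intro integrable_mult_right integrable_abs b)
      fix y
      have "z - y - (x - y) = z - x" by simp
      then have "\<bar>?r y\<bar> \<le> M * (norm (z - x))\<^sup>2" using M(2)[of "z - y" "x - y"] by (simp only:)
      then show "\<bar>b y * ?r y\<bar> \<le> (M * (norm (z - x))\<^sup>2) * \<bar>b y\<bar>"
        unfolding abs_mult mult.commute[of "\<bar>b y\<bar>"] by (rule mult_right_mono) simp
    qed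
    also have "\<dots> = B * (norm (z - x))\<^sup>2" by (simp add: B_def)
    finally show ?thesis unfolding e .
  qed
  show ?thesis
  proof (rule has_derivativeI_sandwich[of 1])
    show "bounded_linear (\<lambda>h :: real ^ 'n. \<Sum>i\<in>UNIV. h $ i *\<^sub>R conv b (partial i \<phi>) x)"
      by (intro bounded_linear_sum bounded_linear_scaleR_const bounded_linear_vec_nth)
    show "norm (conv b \<phi> z - conv b \<phi> x - (\<Sum>i\<in>UNIV. (z - x) $ i *\<^sub>R conv b (partial i \<phi>) x)) / norm (z - x) \<le> B * norm (z - x)"
      if "z \<noteq> x" for z
    proof -
      have "norm (conv b \<phi> z - conv b \<phi> x - (\<Sum>i\<in>UNIV. (z - x) $ i *\<^sub>R conv b (partial i \<phi>) x)) / norm (z - x)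
          \<le> (B * (norm (z - x))\<^sup>2) / norm (z - x)"
        unfolding real_norm_def by (intro divide_right_mono bound) simp
      also have "\<dots> = B * norm (z - x)" using that by (simp add: power2_eq_square)
      finally show ?thesis .
    qed
    have "((\<lambda>z. B * norm (z - x)) \<longlongrightarrow> B * norm (x - x)) (at x)" by (intro tendsto_intros)
    then show "((\<lambda>z. B * norm (z - x)) \<longlongrightarrow> 0) (at x)" by simp
  qed simp
qed

lemma foldr_partial_conv:
  assumes sm: "smooth_on UNIV \<phi>" and supp: "\<And>x. R < norm x \<Longrightarrow> \<phi> x = 0"
  shows "foldr partial is (conv b \<phi>) = conv b (foldr partial is \<phi>)"
proof (induction "is")
  case (Cons i "is")
  have "partial i (conv b (foldr partial is \<phi>)) x = conv b (partial i (foldr partial is \<phi>)) x" for x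
    by (rule partial_eq_sum[OF conv_has_derivative[OF smooth_on_foldr[OF sm] foldr_partial_support[OF supp]]])
  then show ?case using Cons.IH by auto
qed simp

lemma conv_smooth:
  assumes sm: "smooth_on UNIV \<phi>" and supp: "\<And>x. R < norm x \<Longrightarrow> \<phi> x = 0"
  shows "smooth_on UNIV (conv b \<phi>)"
  unfolding smooth_on_def
proof (intro conjI allI)
  fix "is"
  have "foldr partial is \<phi> x = 0" if "R < norm x" for x by (rule foldr_partial_support[OF supp that])
  from conv_has_derivative[OF smooth_on_foldr[OF sm] this]
  have "conv b (foldr partial is \<phi>) differentiable_on UNIV"
    unfolding differentiable_on_def differentiable_def by auto
  then show "foldr partial is (conv b \<phi>) differentiable_on UNIV"
    using foldr_partial_conv[OF assms] by simp
qed simp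

end

subsection \<open>Mollification in \<open>L\<^sup>1\<close> and \<open>L\<^sup>2\<close>\<close>

lemma mollifier_nn_integral: "mollifier \<epsilon> \<eta> \<Longrightarrow> (\<integral>\<^sup>+y. ennreal (\<eta> y) \<partial>lborel) = 1"
  unfolding mollifier_def by (simp add: nn_integral_eq_integral)

lemma mollifier_measurable: "mollifier \<epsilon> \<eta> \<Longrightarrow> \<eta> \<in> borel_measurable borel"
  unfolding mollifier_def by auto

lemma nn_integral_translate:
  fixes H :: "'a::euclidean_space \<Rightarrow> ennreal"
  assumes [measurable]: "H \<in> borel_measurable borel"
  shows "(\<integral>\<^sup>+x. H (x - y) \<partial>lborel) = (\<integral>\<^sup>+x. H x \<partial>lborel)"
    "(\<integral>\<^sup>+y. H (x - y) \<partial>lborel) = (\<integral>\<^sup>+x. H x \<partial>lborel)"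
  using nn_integral_affine[OF assms, of 1 "- y"] nn_integral_affine[OF assms, of "-1" "x"]
  by (simp_all add: algebra_simps)

context
  fixes \<epsilon> :: real and \<eta> :: "real ^ 'n::finite \<Rightarrow> real"
  assumes \<eta>: "mollifier \<epsilon> \<eta>"
begin

lemma \<eta>_measurable: "\<eta> \<in> borel_measurable borel"
  using mollifier_measurable[OF \<eta>] .

lemma \<eta>_nonneg: "0 \<le> \<eta> x" using \<eta> by (simp add: mollifier_def)

lemma conv_mollifier_integral: "(\<integral>\<^sup>+y. ennreal (\<eta> (x - y)) \<partial>lborel) = 1"
  using nn_integral_translate(2)[of "\<lambda>y. ennreal (\<eta> y)" x] mollifier_nn_integral[OF \<eta>] \<eta>_measurable by simp

lemma conv_mollifier_const: "conv (\<lambda>y. c) \<eta> x = c"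
proof -
  note [measurable] = \<eta>_measurable
  have m: "(\<lambda>y. \<eta> (x - y)) \<in> borel_measurable lborel" by measurable
  have "integral\<^sup>L lborel (\<lambda>y. \<eta> (x - y)) = 1"
    unfolding integral_eq_nn_integral[OF m AE_I2[OF \<eta>_nonneg]] conv_mollifier_integral by simp
  then show ?thesis by (simp add: conv_def)
qed

lemma conv_mollifier_kernel_integrable: "integrable lborel (\<lambda>y. \<eta> (x - y))"
proof (rule integrableI_nonneg)
  note [measurable] = \<eta>_measurable
  show "(\<lambda>y. \<eta> (x - y)) \<in> borel_measurable lborel" by measurable
qed (use conv_mollifier_integral \<eta>_nonneg in auto)

text \<open>Jensen's inequality for the probability density \<open>y\<close> \<mapsto>
  \<open>\<eta> (x - y)\<close>; for exponent 2 it is Cauchy-Schwarz with the density split into two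
  square roots. Exponent 1 serves the uniqueness of weak derivatives, exponent 2 the error
  estimate.\<close>

lemma conv_power_le:
  assumes [measurable]: "b \<in> borel_measurable borel" and p: "p = 1 \<or> p = (2::nat)"
  shows "ennreal (\<bar>conv b \<eta> x\<bar> ^ p) \<le> (\<integral>\<^sup>+y. ennreal (\<bar>b y\<bar> ^ p) * ennreal (\<eta> (x - y)) \<partial>lborel)"
proof (cases "integrable lborel (\<lambda>y. b y * \<eta> (x - y))")
  case True
  note [measurable] = \<eta>_measurable
  have "ennreal \<bar>conv b \<eta> x\<bar> \<le> ennreal (LINT y|lborel. \<bar>b y * \<eta> (x - y)\<bar>)"
    unfolding conv_def by (intro ennreal_leI integral_abs_bound)
  also have "\<dots> = (\<integral>\<^sup>+y. ennreal \<bar>b y * \<eta> (x - y)\<bar> \<partial>lborel)"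
    using True by (subst nn_integral_eq_integral) auto
  also have "\<dots> = (\<integral>\<^sup>+y. ennreal \<bar>b y\<bar> * ennreal (\<eta> (x - y)) \<partial>lborel)"
    using \<eta>_nonneg by (intro nn_integral_cong) (auto simp: abs_mult ennreal_mult)
  finally have 1: "ennreal \<bar>conv b \<eta> x\<bar> \<le> (\<integral>\<^sup>+y. ennreal \<bar>b y\<bar> * ennreal (\<eta> (x - y)) \<partial>lborel)" .
  show ?thesis
  proof (cases "p = 1")
    case True then show ?thesis using 1 by simp
  next
    case False
    then have p2: "p = 2" using p by simp
    have "ennreal (\<bar>conv b \<eta> x\<bar> ^ 2) = (ennreal \<bar>conv b \<eta> x\<bar>)\<^sup>2" by (simp add: ennreal_power)
    also have "\<dots> \<le> (\<integral>\<^sup>+y. ennreal \<bar>b y\<bar> * ennreal (\<eta> (x - y)) \<partial>lborel)\<^sup>2"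
      by (rule power_mono[OF 1]) simp
    also have "(\<integral>\<^sup>+y. ennreal \<bar>b y\<bar> * ennreal (\<eta> (x - y)) \<partial>lborel)
       = (\<integral>\<^sup>+y. ennreal (\<bar>b y\<bar> * sqrt (\<eta> (x - y))) * ennreal (sqrt (\<eta> (x - y))) \<partial>lborel)"
      using \<eta>_nonneg by (intro nn_integral_cong) (auto simp: ennreal_mult[symmetric] mult.assoc)
    also have "\<dots>\<^sup>2 \<le> (\<integral>\<^sup>+y. ennreal (\<bar>b y\<bar> * sqrt (\<eta> (x - y))) ^ 2 \<partial>lborel) * (\<integral>\<^sup>+y. ennreal (sqrt (\<eta> (x - y))) ^ 2 \<partial>lborel)"
      by (rule Cauchy_Schwarz_nn_integral) measurable
    also have "(\<integral>\<^sup>+y. ennreal (sqrt (\<eta> (x - y))) ^ 2 \<partial>lborel) = 1"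
      using \<eta>_nonneg conv_mollifier_integral by (simp add: ennreal_power)
    also have "(\<integral>\<^sup>+y. ennreal (\<bar>b y\<bar> * sqrt (\<eta> (x - y))) ^ 2 \<partial>lborel) = (\<integral>\<^sup>+y. ennreal (\<bar>b y\<bar> ^ 2) * ennreal (\<eta> (x - y)) \<partial>lborel)"
      using \<eta>_nonneg by (intro nn_integral_cong) (auto simp: ennreal_power power_mult_distrib ennreal_mult)
    finally show ?thesis using p2 by simp
  qed
next
  case False
  \<comment> \<open>The integral of a function that is not integrable is 0 by convention, so the
    inequality holds trivially.\<close>
  then have "conv b \<eta> x = 0" by (simp add: conv_def not_integrable_integral_eq)
  then show ?thesis using p by auto
qed

text \<open>Young's inequality for a kernel of mass one: Jensen at each point, then Tonelli.\<close>

lemma conv_contraction: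
  assumes [measurable]: "b \<in> borel_measurable borel" and p: "p = 1 \<or> p = (2::nat)"
  shows "(\<integral>\<^sup>+x. ennreal (\<bar>conv b \<eta> x\<bar> ^ p) \<partial>lborel) \<le> (\<integral>\<^sup>+y. ennreal (\<bar>b y\<bar> ^ p) \<partial>lborel)"
proof -
  note [measurable] = \<eta>_measurable
  have "(\<integral>\<^sup>+x. ennreal (\<bar>conv b \<eta> x\<bar> ^ p) \<partial>lborel) \<le> (\<integral>\<^sup>+x. \<integral>\<^sup>+y. ennreal (\<bar>b y\<bar> ^ p) * ennreal (\<eta> (x - y)) \<partial>lborel \<partial>lborel)"
    by (intro nn_integral_mono conv_power_le assms)
  also have "\<dots> = (\<integral>\<^sup>+y. \<integral>\<^sup>+x. ennreal (\<bar>b y\<bar> ^ p) * ennreal (\<eta> (x - y)) \<partial>lborel \<partial>lborel)"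
    by (intro lborel_pair.Fubini') measurable
  also have "\<dots> = (\<integral>\<^sup>+y. ennreal (\<bar>b y\<bar> ^ p) \<partial>lborel)"
  proof (intro nn_integral_cong)
    fix y
    have "(\<integral>\<^sup>+x. ennreal (\<bar>b y\<bar> ^ p) * ennreal (\<eta> (x - y)) \<partial>lborel) = ennreal (\<bar>b y\<bar> ^ p) * (\<integral>\<^sup>+x. ennreal (\<eta> (x - y)) \<partial>lborel)"
      by (intro nn_integral_cmult) measurable
    also have "(\<integral>\<^sup>+x. ennreal (\<eta> (x - y)) \<partial>lborel) = 1"
      using nn_integral_translate(1)[of "\<lambda>y. ennreal (\<eta> y)" y] mollifier_nn_integral[OF \<eta>] by simp
    finally show "(\<integral>\<^sup>+x. ennreal (\<bar>b y\<bar> ^ p) * ennreal (\<eta> (x - y)) \<partial>lborel) = ennreal (\<bar>b y\<bar> ^ p)" by simp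
  qed
  finally show ?thesis .
qed

lemma conv_bounded:
  assumes "AE y in lborel. \<bar>b y\<bar> \<le> M" and [measurable]: "b \<in> borel_measurable borel"
  shows "\<bar>conv b \<eta> x\<bar> \<le> M"
proof -
  note [measurable] = \<eta>_measurable
  have le: "AE y in lborel. \<bar>b y * \<eta> (x - y)\<bar> \<le> M * \<eta> (x - y)"
    using assms(1) by eventually_elim (simp add: abs_mult \<eta>_nonneg mult_right_mono)
  have int: "integrable lborel (\<lambda>y. b y * \<eta> (x - y))"
  proof (rule Bochner_Integration.integrable_bound)
    show "integrable lborel (\<lambda>y. M * \<eta> (x - y))" by (intro integrable_mult_right conv_mollifier_kernel_integrable)
    show "AE y in lborel. norm (b y * \<eta> (x - y)) \<le> norm (M * \<eta> (x - y))"
      using le by eventually_elim (auto intro: order_trans[OF _ abs_ge_self])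
  qed measurable
  have "\<bar>conv b \<eta> x\<bar> \<le> (LINT y|lborel. \<bar>b y * \<eta> (x - y)\<bar>)"
    unfolding conv_def by (rule integral_abs_bound)
  also have "\<dots> \<le> (LINT y|lborel. M * \<eta> (x - y))"
    using int le by (intro integral_mono_AE integrable_mult_right conv_mollifier_kernel_integrable) auto
  also have "\<dots> = M" using conv_mollifier_const[of M x] by (simp add: conv_def)
  finally show ?thesis .
qed

lemma conv_cong_near:
  assumes "\<And>y. norm (x - y) \<le> \<epsilon> \<Longrightarrow> b y = c y"
  shows "conv b \<eta> x = conv c \<eta> x"
proof -
  note [measurable] = \<eta>_measurable
  have "b y * \<eta> (x - y) = c y * \<eta> (x - y)" for y
    using assms[of y] \<eta> unfolding mollifier_def by (cases "norm (x - y) \<le> \<epsilon>") auto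
  then show ?thesis unfolding conv_def by (intro Bochner_Integration.integral_cong) auto
qed

end

lemma abs_add_power_le:
  fixes a b :: real
  assumes "p = 1 \<or> p = (2::nat)"
  shows "\<bar>a + b\<bar> ^ p \<le> 2 * (\<bar>a\<bar> ^ p + \<bar>b\<bar> ^ p)"
proof -
  have "(a + b)\<^sup>2 \<le> 2 * (a\<^sup>2 + b\<^sup>2)"
    using sum_squares_bound[of a b] by (simp add: power2_sum)
  then show ?thesis using assms by auto
qed

lemma nn_integral_abs_add_power_le:
  fixes f g :: "'a \<Rightarrow> real"
  assumes [measurable]: "f \<in> borel_measurable M" "g \<in> borel_measurable M" and p: "p = 1 \<or> p = (2::nat)"
    and [measurable]: "A \<in> sets M"
  shows "(\<integral>\<^sup>+x. ennreal (\<bar>f x + g x\<bar> ^ p) * indicator A x \<partial>M) \<le>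
    2 * ((\<integral>\<^sup>+x. ennreal (\<bar>f x\<bar> ^ p) * indicator A x \<partial>M) + (\<integral>\<^sup>+x. ennreal (\<bar>g x\<bar> ^ p) * indicator A x \<partial>M))"
proof -
  have "(\<integral>\<^sup>+x. ennreal (\<bar>f x + g x\<bar> ^ p) * indicator A x \<partial>M) \<le>
      (\<integral>\<^sup>+x. 2 * (ennreal (\<bar>f x\<bar> ^ p) * indicator A x + ennreal (\<bar>g x\<bar> ^ p) * indicator A x) \<partial>M)"
  proof (intro nn_integral_mono)
    fix x
    have "ennreal (\<bar>f x + g x\<bar> ^ p) \<le> ennreal (2 * (\<bar>f x\<bar> ^ p + \<bar>g x\<bar> ^ p))"
      by (intro ennreal_leI abs_add_power_le p)
    also have "\<dots> = 2 * (ennreal (\<bar>f x\<bar> ^ p) + ennreal (\<bar>g x\<bar> ^ p))"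
      by (simp add: ennreal_mult)
    finally show "ennreal (\<bar>f x + g x\<bar> ^ p) * indicator A x \<le> 2 * (ennreal (\<bar>f x\<bar> ^ p) * indicator A x + ennreal (\<bar>g x\<bar> ^ p) * indicator A x)"
      by (auto simp: indicator_def)
  qed
  also have "\<dots> = 2 * ((\<integral>\<^sup>+x. ennreal (\<bar>f x\<bar> ^ p) * indicator A x \<partial>M) + (\<integral>\<^sup>+x. ennreal (\<bar>g x\<bar> ^ p) * indicator A x \<partial>M))"
    by (simp add: nn_integral_cmult nn_integral_add)
  finally show ?thesis .
qed

lemma nn_integral_tendsto_0_small:
  fixes f :: "nat \<Rightarrow> 'a \<Rightarrow> ennreal"
  assumes "\<And>n. f n \<in> borel_measurable M" "w \<in> borel_measurable M" "\<And>n. AE x in M. f n x \<le> w x"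
    "(\<integral>\<^sup>+x. w x \<partial>M) < \<infinity>" "AE x in M. (\<lambda>n. f n x) \<longlonglongrightarrow> 0" "0 < \<delta>"
  shows "\<exists>n. (\<integral>\<^sup>+x. f n x \<partial>M) \<le> ennreal \<delta>"
proof -
  have "(\<lambda>n. \<integral>\<^sup>+x. f n x \<partial>M) \<longlonglongrightarrow> (\<integral>\<^sup>+x. 0 \<partial>M)"
    by (rule nn_integral_dominated_convergence[where w = w]) (use assms in auto)
  then have "(\<lambda>n. \<integral>\<^sup>+x. f n x \<partial>M) \<longlonglongrightarrow> 0" by simp
  then have "eventually (\<lambda>n. (\<integral>\<^sup>+x. f n x \<partial>M) < ennreal \<delta>) sequentially"
    using assms(6) by (intro order_tendstoD(2)) auto
  then show ?thesis by (auto simp: eventually_sequentially dest: less_imp_le)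
qed

section \<open>Density of continuous functions and convergence of mollifications\<close>

definition clamp_real :: "real \<Rightarrow> real \<Rightarrow> real" where "clamp_real m t = max (- m) (min m t)"

lemma clamp_real_bound: "0 \<le> m \<Longrightarrow> \<bar>clamp_real m t\<bar> \<le> m"
  by (auto simp: clamp_real_def)

lemma continuous_clamp_real: "continuous_on S (clamp_real m)"
  unfolding clamp_real_def by (intro continuous_intros)

lemma clamp_approx_Lp:
  fixes b :: "'a::euclidean_space \<Rightarrow> real"
  assumes [measurable]: "b \<in> borel_measurable borel" and p: "0 < p"
    and fin: "(\<integral>\<^sup>+x. ennreal (\<bar>b x\<bar> ^ p) \<partial>lborel) < \<infinity>" and \<delta>: "0 < \<delta>"
  shows "\<exists>n::nat. (\<integral>\<^sup>+x. ennreal (\<bar>b x - clamp_real (real n) (b x)\<bar> ^ p) \<partial>lborel) \<le> ennreal \<delta>"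
proof (rule nn_integral_tendsto_0_small[where w = "\<lambda>x. ennreal (\<bar>b x\<bar> ^ p)"])
  have [measurable]: "clamp_real m \<in> borel_measurable borel" for m
    by (rule borel_measurable_continuous_onI[OF continuous_clamp_real])
  show "(\<lambda>x. ennreal (\<bar>b x - clamp_real (real n) (b x)\<bar> ^ p)) \<in> borel_measurable lborel" for n by measurable
  show "AE x in lborel. (\<lambda>n. ennreal (\<bar>b x - clamp_real (real n) (b x)\<bar> ^ p)) \<longlonglongrightarrow> 0"
  proof (rule AE_I2, rule tendsto_eventually)
    fix x
    obtain N :: nat where "\<bar>b x\<bar> \<le> real N" using real_arch_simple by blast
    then show "\<forall>\<^sub>F n in sequentially. ennreal (\<bar>b x - clamp_real (real n) (b x)\<bar> ^ p) = 0"
      using p by (intro eventually_sequentiallyI[of N]) (auto simp: clamp_real_def zero_power)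
  qed
  show "AE x in lborel. ennreal (\<bar>b x - clamp_real (real n) (b x)\<bar> ^ p) \<le> ennreal (\<bar>b x\<bar> ^ p)" for n
    by (intro AE_I2 ennreal_leI power_mono) (auto simp: clamp_real_def)
qed (use fin \<delta> in auto)

text \<open>Measurability gives continuous functions converging to \<open>b\<close> almost
  everywhere, but without a majorant. Truncating \<open>b\<close> and the approximants at the same
  height \<open>m\<close> provides one on the ball, and dominated convergence applies;
  \<open>m\<close> is chosen beforehand so that truncating \<open>b\<close> costs little.\<close>

lemma continuous_approx_Lp:
  fixes b :: "real ^ 'n::finite \<Rightarrow> real"
  assumes [measurable]: "b \<in> borel_measurable borel" and p: "p = 1 \<or> p = (2::nat)"
    and fin: "(\<integral>\<^sup>+x. ennreal (\<bar>b x\<bar> ^ p) \<partial>lborel) < \<infinity>" and \<delta>: "0 < \<delta>"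
  shows "\<exists>g. continuous_on UNIV g \<and> (\<integral>\<^sup>+x. ennreal (\<bar>b x - g x\<bar> ^ p) * indicator (cball 0 R) x \<partial>lborel) \<le> ennreal \<delta>"
proof -
  have p0: "0 < p" using p by auto
  have [measurable]: "(cball 0 r :: (real ^ 'n) set) \<in> sets borel" for r by simp
  have [measurable]: "clamp_real m \<in> borel_measurable borel" for m
    by (rule borel_measurable_continuous_onI[OF continuous_clamp_real])
  obtain m :: nat where m: "(\<integral>\<^sup>+x. ennreal (\<bar>b x - clamp_real (real m) (b x)\<bar> ^ p) \<partial>lborel) \<le> ennreal (\<delta> / 4)"
    using clamp_approx_Lp[OF assms(1) p0 fin, of "\<delta> / 4"] \<delta> by auto
  have "b measurable_on UNIV"
    by (intro lebesgue_measurable_imp_measurable_on_real) (auto intro: measurable_completion)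
  then obtain Z g where Z: "negligible Z" and g: "\<And>n::nat. continuous_on UNIV (g n)"
    and lim: "\<And>x. x \<notin> Z \<Longrightarrow> (\<lambda>n. g n x) \<longlonglongrightarrow> b x"
    unfolding measurable_on_def by auto
  have [measurable]: "g n \<in> borel_measurable borel" for n by (rule borel_measurable_continuous_onI[OF g])
  have "AE x in lebesgue. x \<notin> Z" using Z negligible_iff_null_sets AE_not_in by blast
  have "\<exists>n. (\<integral>\<^sup>+x. ennreal (\<bar>clamp_real m (b x) - clamp_real m (g n x)\<bar> ^ p) * indicator (cball 0 R) x \<partial>lebesgue) \<le> ennreal (\<delta> / 4)"
  proof (rule nn_integral_tendsto_0_small[where w = "\<lambda>x. ennreal ((2 * real m) ^ p) * indicator (cball 0 R) x"])
    show "AE x in lebesgue. (\<lambda>n. ennreal (\<bar>clamp_real m (b x) - clamp_real m (g n x)\<bar> ^ p) * indicator (cball 0 R) x) \<longlonglongrightarrow> 0"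
      using \<open>AE x in lebesgue. x \<notin> Z\<close>
    proof eventually_elim
      case (elim x)
      have "(\<lambda>n. clamp_real m (g n x)) \<longlonglongrightarrow> clamp_real m (b x)"
        using continuous_on_tendsto_compose[OF continuous_clamp_real[of UNIV m] lim[OF elim]] by simp
      then have "(\<lambda>n. \<bar>clamp_real m (b x) - clamp_real m (g n x)\<bar> ^ p) \<longlonglongrightarrow> \<bar>clamp_real m (b x) - clamp_real m (b x)\<bar> ^ p"
        by (intro tendsto_intros)
      then have "(\<lambda>n. ennreal (\<bar>clamp_real m (b x) - clamp_real m (g n x)\<bar> ^ p)) \<longlonglongrightarrow> 0"
        using p0 by (auto simp: zero_power intro: tendsto_ennrealI[of _ 0, simplified])
      then show ?case by (auto simp: indicator_def)
    qed
    show "AE x in lebesgue. ennreal (\<bar>clamp_real m (b x) - clamp_real m (g n x)\<bar> ^ p) * indicator (cball 0 R) x \<le> ennreal ((2 * real m) ^ p) * indicator (cball 0 R) x" for n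
    proof (intro AE_I2 mult_right_mono ennreal_leI power_mono)
      fix x
      show "\<bar>clamp_real m (b x) - clamp_real m (g n x)\<bar> \<le> 2 * real m"
        using clamp_real_bound[of m "b x"] clamp_real_bound[of m "g n x"] by linarith
    qed auto
    have "emeasure lebesgue (cball 0 R :: (real ^ 'n) set) < \<infinity>"
      using emeasure_compact_finite[of "cball 0 R :: (real ^ 'n) set"] by simp
    then show "(\<integral>\<^sup>+x. ennreal ((2 * real m) ^ p) * indicator (cball 0 R :: (real ^ 'n) set) x \<partial>lebesgue) < \<infinity>"
      by (subst nn_integral_cmult_indicator) (auto simp: ennreal_mult_less_top)
    show "(\<lambda>x. ennreal (\<bar>clamp_real m (b x) - clamp_real m (g n x)\<bar> ^ p) * indicator (cball 0 R) x) \<in> borel_measurable lebesgue" for n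
      by (rule measurable_completion) measurable
    show "(\<lambda>x :: real ^ 'n. ennreal ((2 * real m) ^ p) * indicator (cball 0 R) x) \<in> borel_measurable lebesgue"
      by (rule measurable_completion) measurable
  qed (use \<delta> in auto)
  then obtain n where n: "(\<integral>\<^sup>+x. ennreal (\<bar>clamp_real m (b x) - clamp_real m (g n x)\<bar> ^ p) * indicator (cball 0 R) x \<partial>lborel) \<le> ennreal (\<delta> / 4)"
    by (subst (asm) nn_integral_completion) auto
  have cont: "continuous_on UNIV (\<lambda>x. clamp_real m (g n x))"
    by (rule continuous_on_compose2[OF continuous_clamp_real g]) auto
  have "(\<integral>\<^sup>+x. ennreal (\<bar>(b x - clamp_real m (b x)) + (clamp_real m (b x) - clamp_real m (g n x))\<bar> ^ p) * indicator (cball 0 R) x \<partial>lborel)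
    \<le> 2 * ((\<integral>\<^sup>+x. ennreal (\<bar>b x - clamp_real m (b x)\<bar> ^ p) * indicator (cball 0 R) x \<partial>lborel)
         + (\<integral>\<^sup>+x. ennreal (\<bar>clamp_real m (b x) - clamp_real m (g n x)\<bar> ^ p) * indicator (cball 0 R) x \<partial>lborel))"
    by (rule nn_integral_abs_add_power_le[OF _ _ p]) measurable
  also have "\<dots> \<le> 2 * (ennreal (\<delta> / 4) + ennreal (\<delta> / 4))"
  proof (intro mult_left_mono add_mono n)
    have "(\<integral>\<^sup>+x. ennreal (\<bar>b x - clamp_real m (b x)\<bar> ^ p) * indicator (cball 0 R) x \<partial>lborel) \<le> (\<integral>\<^sup>+x. ennreal (\<bar>b x - clamp_real m (b x)\<bar> ^ p) \<partial>lborel)"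
      by (intro nn_integral_mono) (auto simp: indicator_def)
    then show "(\<integral>\<^sup>+x. ennreal (\<bar>b x - clamp_real m (b x)\<bar> ^ p) * indicator (cball 0 R) x \<partial>lborel) \<le> ennreal (\<delta> / 4)"
      using m by (rule order_trans)
  qed simp
  also have "\<dots> = ennreal \<delta>"
    using \<delta> by (simp add: ennreal_plus[symmetric] del: ennreal_plus flip: ennreal_numeral ennreal_mult)
  finally show ?thesis using cont by (intro exI[of _ "\<lambda>x. clamp_real m (g n x)"]) simp
qed

text \<open>A continuous \<open>g\<close> replaces \<open>b\<close> on a slightly larger ball. The
  mollified difference is controlled by \<open>conv_contraction\<close>, and mollification changes
  \<open>g\<close> little because \<open>g\<close> is uniformly continuous there. The threshold
  \<open>\<epsilon>\<^sub>0\<close> is independent of the kernel.\<close>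

lemma conv_tendsto_Lp:
  fixes b :: "real ^ 'n::finite \<Rightarrow> real"
  assumes b: "integrable lborel b" and p: "p = 1 \<or> p = (2::nat)"
    and fin: "(\<integral>\<^sup>+x. ennreal (\<bar>b x\<bar> ^ p) \<partial>lborel) < \<infinity>" and \<delta>: "0 < \<delta>"
  shows "\<exists>\<epsilon>\<^sub>0>0. \<forall>\<epsilon> \<eta>. \<epsilon> \<le> \<epsilon>\<^sub>0 \<longrightarrow> mollifier \<epsilon> \<eta> \<longrightarrow>
    (\<integral>\<^sup>+x. ennreal (\<bar>conv b \<eta> x - b x\<bar> ^ p) * indicator (cball 0 R) x \<partial>lborel) \<le> ennreal \<delta>"
proof -
  have p0: "0 < p" using p by auto
  have [measurable]: "(cball 0 r :: (real ^ 'n) set) \<in> sets borel" for r by simp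
  have [measurable]: "b \<in> borel_measurable borel" using b by simp
  \<comment> \<open>Three errors of size at most \<delta>/12 arise below. Combining them takes two
    nested inequalities with factor 2, which gives 10\<delta>/12 in total.\<close>
  obtain g where g: "continuous_on UNIV g"
    and gb: "(\<integral>\<^sup>+x. ennreal (\<bar>b x - g x\<bar> ^ p) * indicator (cball 0 (R + 1)) x \<partial>lborel) \<le> ennreal (\<delta> / 12)"
    using continuous_approx_Lp[OF _ p fin, of "\<delta> / 12" "R + 1"] \<delta> by auto
  have [measurable]: "g \<in> borel_measurable borel" using borel_measurable_continuous_onI[OF g] .
  define V where "V = measure lborel (cball 0 R :: (real ^ 'n) set)"
  have V: "emeasure lborel (cball 0 R :: (real ^ 'n) set) = ennreal V"
    unfolding V_def using emeasure_compact_finite[of "cball 0 R :: (real ^ 'n) set"]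
    by (intro emeasure_eq_ennreal_measure) auto
  \<comment> \<open>The permitted oscillation of \<open>g\<close>: being at most 1 it dominates its
    own \<open>p\<close>-th power, and integrated over the ball it contributes at most
    \<delta>/12.\<close>
  define \<kappa> where "\<kappa> = min 1 (\<delta> / (12 * (V + 1)))"
  have V0: "0 \<le> V" by (simp add: V_def)
  have \<kappa>: "0 < \<kappa>" "\<kappa> \<le> 1" "\<kappa> * V \<le> \<delta> / 12"
  proof -
    show "0 < \<kappa>" "\<kappa> \<le> 1" using \<delta> V0 by (auto simp: \<kappa>_def)
    have "\<kappa> * V \<le> \<delta> / (12 * (V + 1)) * (V + 1)"
      using V0 \<delta> by (intro mult_mono) (auto simp: \<kappa>_def)
    also have "\<dots> = \<delta> / 12"
      using V0 nonzero_mult_divide_mult_cancel_right[of "V + 1" \<delta> 12] by simp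
    finally show "\<kappa> * V \<le> \<delta> / 12" .
  qed
  have \<kappa>p: "\<kappa> ^ p \<le> \<kappa>" using \<kappa> p by (auto simp: power2_eq_square mult_le_one mult_left_le)
  have "uniformly_continuous_on (cball 0 (R + 1)) g"
    by (intro compact_uniformly_continuous continuous_on_subset[OF g]) auto
  then obtain d where d: "0 < d" "\<And>x y. x \<in> cball 0 (R + 1) \<Longrightarrow> y \<in> cball 0 (R + 1) \<Longrightarrow> dist y x < d \<Longrightarrow> \<bar>g y - g x\<bar> < \<kappa>"
    using \<kappa>(1) unfolding uniformly_continuous_on_def dist_real_def by metis
  define \<epsilon>\<^sub>0 where "\<epsilon>\<^sub>0 = min 1 (d / 2)"
  show ?thesis
  proof (intro exI[of _ \<epsilon>\<^sub>0] conjI allI impI)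
    show "0 < \<epsilon>\<^sub>0" using d by (simp add: \<epsilon>\<^sub>0_def)
    fix \<epsilon> and \<eta> :: "real ^ 'n \<Rightarrow> real"
    assume \<epsilon>: "\<epsilon> \<le> \<epsilon>\<^sub>0" and \<eta>: "mollifier \<epsilon> \<eta>"
    have [measurable]: "\<eta> \<in> borel_measurable borel" using mollifier_measurable[OF \<eta>] .
    have \<epsilon>1: "\<epsilon> \<le> 1" "\<epsilon> < d" using \<epsilon> d by (auto simp: \<epsilon>\<^sub>0_def)
    \<comment> \<open>From a point of \<open>cball 0 R\<close> a kernel of radius at most 1 reaches
      only \<open>cball 0 (R + 1)\<close>. The cutoff thus leaves those convolutions unchanged, and
      it makes the global contraction estimate usable.\<close>
    define b' where "b' y = (b y - g y) * indicator (cball 0 (R + 1)) y" for y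
    have [measurable]: "b' \<in> borel_measurable borel" unfolding b'_def by measurable
    have b'_int: "integrable lborel b'"
    proof -
      have "integrable lborel (\<lambda>y. indicator (cball 0 (R + 1)) y *\<^sub>R g y)"
        by (intro borel_integrable_compact continuous_on_subset[OF g]) auto
      moreover have "integrable lborel (\<lambda>y. indicator (cball 0 (R + 1)) y *\<^sub>R b y)"
        by (intro integrable_mult_indicator b) auto
      ultimately have "integrable lborel (\<lambda>y. indicator (cball 0 (R + 1)) y *\<^sub>R b y - indicator (cball 0 (R + 1)) y *\<^sub>R g y)"
        by (intro Bochner_Integration.integrable_diff)
      moreover have "(\<lambda>y. indicator (cball 0 (R + 1)) y *\<^sub>R b y - indicator (cball 0 (R + 1)) y *\<^sub>R g y) = b'"
        by (auto simp: b'_def algebra_simps)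
      ultimately show ?thesis by simp
    qed
    have \<eta>c: "continuous_on UNIV \<eta>" and \<eta>s: "\<And>x. \<epsilon> < norm x \<Longrightarrow> \<eta> x = 0"
      using \<eta> smooth_on_continuous by (auto simp: mollifier_def)
    have cb'_m: "conv b' \<eta> \<in> borel_measurable borel"
      unfolding conv_def[abs_def] by measurable
    have cb_m: "conv b \<eta> \<in> borel_measurable borel"
      unfolding conv_def[abs_def] by measurable
    note [measurable] = cb'_m cb_m
    have main: "\<bar>conv b \<eta> x - b x - conv b' \<eta> x + (b x - g x)\<bar> \<le> \<kappa>" if x: "x \<in> cball 0 R" for x
    proof -
      have near: "y \<in> cball 0 (R + 1)" "dist y x < d" if "norm (x - y) \<le> \<epsilon>" for y
      proof -
        have "norm y \<le> norm x + norm (x - y)" using norm_triangle_ineq4[of x "x - y"] by simp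
        then show "y \<in> cball 0 (R + 1)" using x that \<epsilon>1 by auto
        show "dist y x < d" using that \<epsilon>1 by (simp add: dist_norm norm_minus_commute)
      qed
      \<comment> \<open>The deviation of \<open>g\<close> from its value at \<open>x\<close>, cut
        off outside the reach of the kernel so that it is bounded by \<kappa> everywhere.\<close>
      define gx where "gx y = (g y - g x) * indicator (cball 0 (R + 1) \<inter> {y. norm (x - y) \<le> \<epsilon>}) y" for y
      have gxm[measurable]: "gx \<in> borel_measurable borel" unfolding gx_def by measurable
      have gx_le: "\<bar>gx y\<bar> \<le> \<kappa>" for y
        using d(2)[of x y] x near[of y] \<kappa>(1) by (auto simp: gx_def indicator_def)
      have gxi: "integrable lborel (\<lambda>y. gx y * \<eta> (x - y))"
      proof (rule Bochner_Integration.integrable_bound)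
        show "integrable lborel (\<lambda>y. \<kappa> * \<eta> (x - y))" by (intro integrable_mult_right conv_mollifier_kernel_integrable[OF \<eta>])
        show "AE y in lborel. norm (gx y * \<eta> (x - y)) \<le> norm (\<kappa> * \<eta> (x - y))"
          using gx_le \<kappa>(1) by (intro AE_I2) (simp add: abs_mult mult_right_mono)
      qed measurable
      have "conv b \<eta> x = conv (\<lambda>y. b' y + gx y + g x) \<eta> x"
      proof (rule conv_cong_near[OF \<eta>])
        fix y assume "norm (x - y) \<le> \<epsilon>"
        then show "b y = b' y + gx y + g x" using near by (simp add: b'_def gx_def)
      qed
      also have "\<dots> = conv b' \<eta> x + conv gx \<eta> x + conv (\<lambda>y. g x) \<eta> x"
      proof -
        have 1: "integrable lborel (\<lambda>y. b' y * \<eta> (x - y))" by (rule conv_integrable[OF b'_int \<eta>c \<eta>s])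
        have 2: "integrable lborel (\<lambda>y. g x * \<eta> (x - y))"
          by (intro integrable_mult_right conv_mollifier_kernel_integrable[OF \<eta>])
        show ?thesis
          unfolding conv_def distrib_right
            Bochner_Integration.integral_add[OF Bochner_Integration.integrable_add[OF 1 gxi] 2]
            Bochner_Integration.integral_add[OF 1 gxi] ..
      qed
      finally have "conv b \<eta> x - b x - conv b' \<eta> x + (b x - g x) = conv gx \<eta> x"
        by (simp add: conv_mollifier_const[OF \<eta>])
      moreover have "\<bar>conv gx \<eta> x\<bar> \<le> \<kappa>"
        by (rule conv_bounded[OF \<eta>]) (use gx_le in auto)
      ultimately show ?thesis by simp
    qed
    define I where "I f = (\<integral>\<^sup>+x. ennreal (\<bar>f x\<bar> ^ p) * indicator (cball 0 R) x \<partial>lborel)" for f :: "real ^ 'n \<Rightarrow> real"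
    have split: "I (\<lambda>x. f x + h x) \<le> 2 * (I f + I h)"
      if "f \<in> borel_measurable borel" "h \<in> borel_measurable borel" for f h
      unfolding I_def by (rule nn_integral_abs_add_power_le[OF _ _ p]) (use that in auto)
    define r where "r x = conv b \<eta> x - b x - conv b' \<eta> x + (b x - g x)" for x
    have [measurable]: "r \<in> borel_measurable borel" unfolding r_def by measurable
    have Ir: "I r \<le> ennreal (\<delta> / 12)"
    proof -
      have "I r \<le> (\<integral>\<^sup>+x. ennreal \<kappa> * indicator (cball 0 R :: (real ^ 'n) set) x \<partial>lborel)"
        unfolding I_def
      proof (intro nn_integral_mono)
        fix x
        have "\<bar>r x\<bar> ^ p \<le> \<kappa>" if "x \<in> cball 0 R"
          using power_mono[OF main[OF that], of p] \<kappa>p by (simp add: r_def)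
        then show "ennreal (\<bar>r x\<bar> ^ p) * indicator (cball 0 R) x \<le> ennreal \<kappa> * indicator (cball 0 R) x"
          by (auto simp: indicator_def ennreal_leI)
      qed
      also have "\<dots> = ennreal (\<kappa> * V)" using \<kappa>(1) by (simp add: nn_integral_cmult_indicator V ennreal_mult')
      also have "\<dots> \<le> ennreal (\<delta> / 12)" by (intro ennreal_leI \<kappa>)
      finally show ?thesis .
    qed
    have Ib: "I (\<lambda>x. - (b x - g x)) \<le> ennreal (\<delta> / 12)"
    proof -
      have "I (\<lambda>x. - (b x - g x)) \<le> (\<integral>\<^sup>+x. ennreal (\<bar>b x - g x\<bar> ^ p) * indicator (cball 0 (R + 1)) x \<partial>lborel)"
        unfolding I_def by (intro nn_integral_mono) (auto simp: indicator_def abs_minus_commute)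
      then show ?thesis using gb by (rule order_trans)
    qed
    have Ib': "I (conv b' \<eta>) \<le> ennreal (\<delta> / 12)"
    proof -
      have "I (conv b' \<eta>) \<le> (\<integral>\<^sup>+x. ennreal (\<bar>conv b' \<eta> x\<bar> ^ p) \<partial>lborel)"
        unfolding I_def by (intro nn_integral_mono) (auto simp: indicator_def)
      also have "\<dots> \<le> (\<integral>\<^sup>+x. ennreal (\<bar>b' x\<bar> ^ p) \<partial>lborel)" by (rule conv_contraction[OF \<eta> _ p]) measurable
      also have "\<dots> = (\<integral>\<^sup>+x. ennreal (\<bar>b x - g x\<bar> ^ p) * indicator (cball 0 (R + 1)) x \<partial>lborel)"
        using p0 by (intro nn_integral_cong) (auto simp: b'_def indicator_def zero_power)
      finally show ?thesis using gb by (rule order_trans)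
    qed
    have "(\<lambda>x. conv b \<eta> x - b x) = (\<lambda>x. (r x + - (b x - g x)) + conv b' \<eta> x)" by (simp add: r_def)
    then have "I (\<lambda>x. conv b \<eta> x - b x) \<le> 2 * (I (\<lambda>x. r x + - (b x - g x)) + I (conv b' \<eta>))"
      using split[of "\<lambda>x. r x + - (b x - g x)" "conv b' \<eta>"] by simp
    also have "\<dots> \<le> 2 * (2 * (I r + I (\<lambda>x. - (b x - g x))) + I (conv b' \<eta>))"
      by (intro mult_left_mono add_right_mono split) auto
    also have "\<dots> \<le> 2 * (2 * (ennreal (\<delta> / 12) + ennreal (\<delta> / 12)) + ennreal (\<delta> / 12))"
      by (intro mult_left_mono add_mono Ir Ib Ib') auto
    also have "\<dots> = ennreal (10 * \<delta> / 12)"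
      using \<delta> by (simp add: ennreal_plus[symmetric] del: ennreal_plus flip: ennreal_numeral ennreal_mult)
    also have "\<dots> \<le> ennreal \<delta>" using \<delta> by (intro ennreal_leI) simp
    finally show "(\<integral>\<^sup>+x. ennreal (\<bar>conv b \<eta> x - b x\<bar> ^ p) * indicator (cball 0 R) x \<partial>lborel) \<le> ennreal \<delta>"
      unfolding I_def .
  qed
qed

subsection \<open>Borel representatives\<close>

text \<open>Sobolev functions are Lebesgue measurable on an open set and irrelevant outside it,
  whereas convolution and Tonelli work with Borel functions on the whole space. A representative is
  a Borel version extended by zero.\<close>

definition borel_rep :: "(real ^ 'n::finite) set \<Rightarrow> (real ^ 'n \<Rightarrow> real) \<Rightarrow> (real ^ 'n \<Rightarrow> real) \<Rightarrow> bool" where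
  "borel_rep V f b \<longleftrightarrow> f \<in> borel_measurable (lebesgue_on V) \<and> b \<in> borel_measurable borel \<and>
     (AE x in lborel. x \<in> V \<longrightarrow> f x = b x) \<and> (\<forall>x. x \<notin> V \<longrightarrow> b x = 0)"

lemma borel_rep_exists:
  fixes f :: "real ^ 'n::finite \<Rightarrow> real"
  assumes V: "V \<in> sets borel" and f: "f \<in> borel_measurable (lebesgue_on V)"
  shows "\<exists>b. borel_rep V f b"
proof -
  have "(\<lambda>x. indicator V x *\<^sub>R f x) \<in> borel_measurable lebesgue"
    using f V by (subst (asm) borel_measurable_restrict_space_iff) auto
  from completion_ex_borel_measurable_real[OF this]
  obtain g where g: "g \<in> borel_measurable lborel" "AE x in lborel. indicator V x *\<^sub>R f x = g x" by auto
  have "borel_rep V f (\<lambda>x. indicator V x * g x)"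
    unfolding borel_rep_def
  proof (intro conjI f)
    show "AE x in lborel. x \<in> V \<longrightarrow> f x = indicator V x * g x"
      using g(2) by eventually_elim auto
    have [measurable]: "V \<in> sets borel" "g \<in> borel_measurable borel" using V g by auto
    show "(\<lambda>x. indicator V x * g x) \<in> borel_measurable borel" by measurable
  qed auto
  then show ?thesis by blast
qed

text \<open>The transformation \<open>F\<close> lets one statement cover the function itself, its
  square and its product with a kernel. The domain \<open>U\<close> may exceed \<open>V\<close>
  provided that the integrand vanishes on the difference, as it does for a kernel supported in
  \<open>V\<close>.\<close>

lemma borel_rep_lebesgue:
  fixes F :: "real \<Rightarrow> real ^ 'n::finite \<Rightarrow> real"
  assumes rep: "borel_rep V f b" and VU: "V \<subseteq> U" "V \<in> sets borel" "U \<in> sets borel"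
    and F: "(\<lambda>x. F (b x) x) \<in> borel_measurable borel"
    and h: "\<And>x. x \<in> V \<Longrightarrow> h x = F (f x) x" "\<And>x. x \<in> U - V \<Longrightarrow> h x = 0" "\<And>x. x \<notin> V \<Longrightarrow> F (b x) x = 0"
    and hm: "h \<in> borel_measurable (lebesgue_on U)"
  shows "integral\<^sup>L (lebesgue_on U) h = (LINT x|lborel. F (b x) x)"
    "integrable (lebesgue_on U) h \<longleftrightarrow> integrable lborel (\<lambda>x. F (b x) x)"
proof -
  have hm': "(\<lambda>x. indicator U x *\<^sub>R h x) \<in> borel_measurable lebesgue"
    using hm VU by (subst (asm) borel_measurable_restrict_space_iff) auto
  have Fm: "(\<lambda>x. F (b x) x) \<in> borel_measurable lebesgue" "(\<lambda>x. F (b x) x) \<in> borel_measurable lborel"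
    using F by (auto intro: measurable_completion)
  have "AE x in lebesgue. x \<in> V \<longrightarrow> f x = b x" using rep by (auto simp: borel_rep_def AE_completion_iff)
  then have ae: "AE x in lebesgue. indicator U x *\<^sub>R h x = F (b x) x"
  proof eventually_elim
    case (elim x)
    then show ?case using h(1)[of x] h(2)[of x] h(3)[of x] VU(1) by (cases "x \<in> V"; cases "x \<in> U") auto
  qed
  have "integral\<^sup>L (lebesgue_on U) h = integral\<^sup>L lebesgue (\<lambda>x. indicator U x *\<^sub>R h x)"
    using VU by (intro Bochner_Integration.integral_restrict_space) auto
  also have "\<dots> = integral\<^sup>L lebesgue (\<lambda>x. F (b x) x)"
    by (rule Bochner_Integration.integral_cong_AE[OF hm' Fm(1) ae])
  also have "\<dots> = (LINT x|lborel. F (b x) x)" by (rule integral_completion[OF Fm(2)])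
  finally show "integral\<^sup>L (lebesgue_on U) h = (LINT x|lborel. F (b x) x)" .
  have "integrable (lebesgue_on U) h \<longleftrightarrow> integrable lebesgue (\<lambda>x. indicator U x *\<^sub>R h x)"
    using VU by (intro Bochner_Integration.integrable_restrict_space) auto
  also have "\<dots> \<longleftrightarrow> integrable lebesgue (\<lambda>x. F (b x) x)"
    by (rule integrable_cong_AE[OF hm' Fm(1) ae])
  also have "\<dots> \<longleftrightarrow> integrable lborel (\<lambda>x. F (b x) x)" by (rule integrable_completion[OF Fm(2)])
  finally show "integrable (lebesgue_on U) h \<longleftrightarrow> integrable lborel (\<lambda>x. F (b x) x)" .
qed

lemma borel_rep_measurable_extend:
  assumes "f \<in> borel_measurable (lebesgue_on V)" "V \<subseteq> U" "V \<in> sets borel" "U \<in> sets borel"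
    "\<psi> \<in> borel_measurable borel" "\<And>x. x \<in> U - V \<Longrightarrow> \<psi> x = (0::real)"
  shows "(\<lambda>x. f x * \<psi> x) \<in> borel_measurable (lebesgue_on U)"
proof -
  have "(\<lambda>x. indicator V x *\<^sub>R f x) \<in> borel_measurable lebesgue"
    using assms(1,3) by (subst (asm) borel_measurable_restrict_space_iff) auto
  moreover have "\<psi> \<in> borel_measurable lebesgue" using assms(5) by (auto intro: measurable_completion)
  ultimately have "(\<lambda>x. (indicator V x *\<^sub>R f x) * \<psi> x) \<in> borel_measurable lebesgue" by (rule borel_measurable_times)
  then have "(\<lambda>x. (indicator V x *\<^sub>R f x) * \<psi> x) \<in> borel_measurable (lebesgue_on U)" by (rule measurable_restrict_space1)
  moreover have "f x * \<psi> x = (indicator V x *\<^sub>R f x) * \<psi> x" if "x \<in> space (lebesgue_on U)" for x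
    using that assms(6)[of x] by (auto simp: indicator_def)
  ultimately show ?thesis by (subst measurable_cong) auto
qed

lemma borel_rep_conv:
  fixes f :: "real ^ 'n::finite \<Rightarrow> real"
  assumes rep: "borel_rep V f b" and V: "V \<subseteq> U" "V \<in> sets borel" "U \<in> sets borel"
    and \<psi>: "\<psi> \<in> borel_measurable borel" "\<And>y. y \<notin> V \<Longrightarrow> \<psi> (x - y) = 0"
  shows "(LINT y|lebesgue_on U. f y * \<psi> (x - y)) = conv b \<psi> x"
  unfolding conv_def
proof (rule borel_rep_lebesgue(1)[OF rep V, where F = "\<lambda>t y. t * \<psi> (x - y)"])
  have [measurable]: "b \<in> borel_measurable borel" using rep by (simp add: borel_rep_def)
  note [measurable] = \<psi>(1)
  have m: "(\<lambda>y. \<psi> (x - y)) \<in> borel_measurable borel" by measurable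
  show "(\<lambda>y. b y * \<psi> (x - y)) \<in> borel_measurable borel" by measurable
  show "(\<lambda>y. f y * \<psi> (x - y)) \<in> borel_measurable (lebesgue_on U)"
    by (rule borel_rep_measurable_extend[OF _ V m]) (use rep \<psi> in \<open>auto simp: borel_rep_def\<close>)
qed (use \<psi>(2) rep in \<open>auto simp: borel_rep_def\<close>)

subsection \<open>Weak derivatives and mollification\<close>

lemma partial_reflect:
  fixes f :: "real ^ 'n::finite \<Rightarrow> real"
  assumes "\<And>z. f differentiable (at z)"
  shows "(\<lambda>y. c * f (x - y)) differentiable (at y)"
    "partial i (\<lambda>y. c * f (x - y)) y = - c * partial i f (x - y)"
proof -
  have "((\<lambda>y. x - y) has_derivative (\<lambda>h. - h)) (at y)" by (auto intro!: derivative_eq_intros)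
  from has_derivative_mult_right[OF has_derivative_compose[OF this has_derivative_partial[OF assms]], of c]
  have D: "((\<lambda>y. c * f (x - y)) has_derivative (\<lambda>h. c * (\<Sum>i\<in>UNIV. (- h) $ i *\<^sub>R partial i f (x - y)))) (at y)" .
  then show "(\<lambda>y. c * f (x - y)) differentiable (at y)" unfolding differentiable_def by blast
  have "c * (\<Sum>i\<in>UNIV. (- h) $ i *\<^sub>R partial i f (x - y)) = (\<Sum>i\<in>UNIV. h $ i *\<^sub>R (- c * partial i f (x - y)))" for h
    by (simp add: sum_distrib_left mult_ac)
  with D show "partial i (\<lambda>y. c * f (x - y)) y = - c * partial i f (x - y)"
    by (intro partial_eq_sum) simp
qed

lemma foldr_partial_reflect:
  fixes f :: "real ^ 'n::finite \<Rightarrow> real"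
  assumes "smooth_on UNIV f"
  shows "foldr partial is (\<lambda>y. f (x - y)) = (\<lambda>y. (- 1) ^ length is * foldr partial is f (x - y))"
proof (induction "is")
  case (Cons i "is")
  have "partial i (\<lambda>y. (- 1) ^ length is * foldr partial is f (x - y)) y = - ((- 1) ^ length is) * partial i (foldr partial is f) (x - y)" for y
    by (rule partial_reflect(2)) (use smooth_on_foldr_differentiable[OF assms] in auto)
  then show ?case using Cons.IH by auto
qed simp

lemma smooth_on_reflect:
  fixes f :: "real ^ 'n::finite \<Rightarrow> real"
  assumes "smooth_on UNIV f"
  shows "smooth_on UNIV (\<lambda>y. f (x - y))"
  unfolding smooth_on_def foldr_partial_reflect[OF assms] differentiable_on_def
proof (intro conjI allI ballI)
  fix "is" :: "'n list" and y
  show "(\<lambda>y. (- 1) ^ length is * foldr partial is f (x - y)) differentiable (at y within UNIV)"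
    by (rule partial_reflect(1)) (use smooth_on_foldr_differentiable[OF assms] in auto)
qed simp

lemma mollifier_test_function:
  assumes \<eta>: "mollifier \<epsilon> \<eta>" and "cball x \<epsilon> \<subseteq> U"
  shows "test_function U (\<lambda>y. \<eta> (x - y))"
  unfolding test_function_def
proof (intro conjI exI[of _ "cball x \<epsilon>"] allI impI)
  show "smooth_on UNIV (\<lambda>y. \<eta> (x - y))" using \<eta> by (intro smooth_on_reflect) (simp add: mollifier_def)
  show "\<eta> (x - y) = 0" if "y \<notin> cball x \<epsilon>" for y
    using \<eta> that by (auto simp: mollifier_def dist_norm not_le)
qed (use assms in auto)

lemma mi_partial_reflect:
  fixes \<eta> :: "real ^ 'n::finite \<Rightarrow> real"
  assumes "smooth_on UNIV \<eta>"
  shows "mi_partial (mi_of_list is) (\<lambda>y. \<eta> (x - y)) y = (- 1) ^ length is * foldr partial is \<eta> (x - y)"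
proof -
  have "mi_partial (mi_of_list is) (\<lambda>y. \<eta> (x - y)) y = foldr partial is (\<lambda>y. \<eta> (x - y)) y"
    using smooth_on_reflect[OF assms] by (intro mi_partial_eq_foldr[where U = UNIV]) (auto simp: smooth_on_ck)
  then show ?thesis by (simp add: foldr_partial_reflect[OF assms])
qed

lemma mollifier_foldr_support:
  assumes "mollifier \<epsilon> \<eta>" "\<epsilon> < norm x"
  shows "foldr partial is \<eta> x = 0"
  by (rule foldr_partial_support[OF _ assms(2)]) (use assms(1) in \<open>auto simp: mollifier_def\<close>)

lemma smooth_on_measurable: "smooth_on UNIV f \<Longrightarrow> f \<in> borel_measurable borel"
  for f :: "real ^ 'n::finite \<Rightarrow> real"
  by (intro borel_measurable_continuous_onI smooth_on_continuous)

text \<open>The reflected kernel \<open>y\<close> \<mapsto> \<open>\<eta> (x - y)\<close> is a test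
  function as long as its ball lies in \<open>U\<close>. The sign produced by the reflection cancels
  the sign in \<open>is_weak_partial\<close>. The set \<open>V\<close> is a compact part of
  \<open>U\<close> when only local integrability is available, and \<open>U\<close> itself for
  Sobolev functions.\<close>

lemma weak_partial_conv:
  fixes u g :: "real ^ 'n::finite \<Rightarrow> real"
  assumes weak: "is_weak_partial U (mi_of_list is) u g" and \<eta>: "mollifier \<epsilon> \<eta>" and x: "cball x \<epsilon> \<subseteq> V"
    and V: "V \<subseteq> U" "V \<in> sets borel" "U \<in> sets borel"
    and u: "borel_rep V u bu" and g: "borel_rep V g bg"
  shows "conv bu (foldr partial is \<eta>) x = conv bg \<eta> x"
proof -
  have sm: "smooth_on UNIV \<eta>" using \<eta> by (simp add: mollifier_def)
  have xU: "cball x \<epsilon> \<subseteq> U" using x V by auto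
  have zero: "foldr partial js \<eta> (x - y) = 0" if "y \<notin> V" for js y
    by (rule mollifier_foldr_support[OF \<eta>]) (use that x in \<open>auto simp: subset_iff dist_norm not_le\<close>)
  have "(LINT y|lebesgue_on U. u y * mi_partial (mi_of_list is) (\<lambda>y. \<eta> (x - y)) y) =
        (- 1) ^ mi_order (mi_of_list is) * (LINT y|lebesgue_on U. g y * \<eta> (x - y))"
    using weak mollifier_test_function[OF \<eta> xU] unfolding is_weak_partial_def by blast
  moreover have "(\<lambda>y. u y * mi_partial (mi_of_list is) (\<lambda>y. \<eta> (x - y)) y)
      = (\<lambda>y. (- 1) ^ length is * (u y * foldr partial is \<eta> (x - y)))"
    by (simp add: mi_partial_reflect[OF sm] mult_ac)
  ultimately have "(LINT y|lebesgue_on U. u y * foldr partial is \<eta> (x - y)) = (LINT y|lebesgue_on U. g y * \<eta> (x - y))"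
    by (simp add: mi_order_mi_of_list)
  moreover have "(LINT y|lebesgue_on U. u y * foldr partial is \<eta> (x - y)) = conv bu (foldr partial is \<eta>) x"
    by (rule borel_rep_conv[OF u V smooth_on_measurable[OF smooth_on_foldr[OF sm]] zero])
  moreover have "(LINT y|lebesgue_on U. g y * \<eta> (x - y)) = conv bg \<eta> x"
    by (rule borel_rep_conv[OF g V smooth_on_measurable[OF sm]]) (use zero[of _ "[]"] in simp)
  ultimately show ?thesis by simp
qed

lemma foldr_partial_conv_mollifier:
  fixes u g :: "real ^ 'n::finite \<Rightarrow> real"
  assumes weak: "is_weak_partial U (mi_of_list is) u g" and \<eta>: "mollifier \<epsilon> \<eta>" and x: "cball x \<epsilon> \<subseteq> U"
    and U: "open U" and u: "borel_rep U u bu" "integrable lborel bu" and g: "borel_rep U g bg"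
  shows "foldr partial is (conv bu \<eta>) x = conv bg \<eta> x"
proof -
  have "foldr partial is (conv bu \<eta>) = conv bu (foldr partial is \<eta>)"
    by (rule foldr_partial_conv[OF u(2), where R = \<epsilon>]) (use \<eta> in \<open>auto simp: mollifier_def\<close>)
  then show ?thesis
    using weak_partial_conv[OF weak \<eta> x _ _ _ u(1) g] U by simp
qed

lemma locally_integrable_borel_rep:
  fixes u :: "real ^ 'n::finite \<Rightarrow> real"
  assumes "u locally_integrable_on U" "compact K" "K \<subseteq> U"
  shows "\<exists>b. borel_rep K u b \<and> integrable lborel b"
proof -
  have int: "integrable (lebesgue_on K) u"
    using assms unfolding locally_integrable_on_def by (metis absolutely_integrable_imp_integrable borel_compact sets_completionI_sets sets_lborel)
  then obtain b where b: "borel_rep K u b"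
    using borel_rep_exists[of K u] assms(2) by (auto simp: borel_compact)
  have "integrable lborel b"
  proof (rule borel_rep_lebesgue(2)[OF b order.refl, where F = "\<lambda>t y. t" and h = u, THEN iffD1])
    show "K \<in> sets borel" "K \<in> sets borel" using assms(2) by (auto simp: borel_compact)
  qed (use b int in \<open>auto simp: borel_rep_def\<close>)
  with b show ?thesis by blast
qed

section \<open>Uniqueness of weak derivatives\<close>

lemma open_Union_compact:
  fixes U :: "'a::euclidean_space set"
  assumes "open U"
  obtains C :: "nat \<Rightarrow> 'a set" where "\<And>n. compact (C n)" "\<And>n. C n \<subseteq> U" "U = (\<Union>n. C n)"
  using open_Union_compact_subsets[OF assms] by metis

lemma compact_enlarge:
  fixes K :: "'a::euclidean_space set"
  assumes "compact K" "open U" "K \<subseteq> U"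
  obtains r where "0 < r" "compact (\<Union>x\<in>K. cball x r)" "(\<Union>x\<in>K. cball x r) \<subseteq> U"
proof -
  obtain e where e: "0 < e" "(\<Union>x\<in>K. ball x e) \<subseteq> U"
    using compact_subset_open_imp_ball_epsilon_subset[OF assms] by blast
  have "(\<Union>x\<in>K. cball x (e / 2)) = {x + y | x y. x \<in> K \<and> y \<in> cball 0 (e / 2)}"
  proof (intro equalityI subsetI)
    fix z assume "z \<in> (\<Union>x\<in>K. cball x (e / 2))"
    then obtain x where "x \<in> K" "dist x z \<le> e / 2" by auto
    then show "z \<in> {x + y | x y. x \<in> K \<and> y \<in> cball 0 (e / 2)}"
      by (intro CollectI exI[of _ x] exI[of _ "z - x"]) (auto simp: dist_norm norm_minus_commute)
  qed (force simp: dist_norm)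
  then have "compact (\<Union>x\<in>K. cball x (e / 2))"
    using compact_sums[OF assms(1) compact_cball[of 0 "e / 2"]] by simp
  moreover have "(\<Union>x\<in>K. cball x (e / 2)) \<subseteq> U" using e by (force simp: subset_iff)
  ultimately show thesis using e that[of "e / 2"] by simp
qed

text \<open>The difference of two weak derivatives has zero convolution with every small mollifier,
  yet these convolutions approximate it in \<open>L1\<close>. This settles compact subsets, and
  countably many of them cover \<open>U\<close>.\<close>

lemma weak_partial_unique:
  fixes u :: "real ^ 'n::finite \<Rightarrow> real"
  assumes U: "open U" and weak: "is_weak_partial U \<alpha> u g1" "is_weak_partial U \<alpha> u g2"
  shows "AE x in lborel. x \<in> U \<longrightarrow> g1 x = g2 x"
proof -
  have on_compact: "AE x in lborel. x \<in> K \<longrightarrow> g1 x = g2 x" if K: "compact K" "K \<subseteq> U" for K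
  proof -
    obtain r where r: "0 < r" "compact (\<Union>x\<in>K. cball x r)" "(\<Union>x\<in>K. cball x r) \<subseteq> U"
      using compact_enlarge[OF K(1) U K(2)] by blast
    define K' where "K' = (\<Union>x\<in>K. cball x r)"
    have K': "compact K'" "K' \<subseteq> U" "K \<subseteq> K'" "K' \<in> sets borel" "K \<in> sets borel"
      using r K by (auto simp: K'_def borel_compact)
    obtain b1 where b1: "borel_rep K' g1 b1" "integrable lborel b1"
      using locally_integrable_borel_rep[OF _ K'(1,2)] weak(1) unfolding is_weak_partial_def by blast
    obtain b2 where b2: "borel_rep K' g2 b2" "integrable lborel b2"
      using locally_integrable_borel_rep[OF _ K'(1,2)] weak(2) unfolding is_weak_partial_def by blast
    obtain b0 where b0: "borel_rep K' u b0" "integrable lborel b0"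
      using locally_integrable_borel_rep[OF _ K'(1,2)] weak(1) unfolding is_weak_partial_def by blast
    define b where "b x = b1 x - b2 x" for x
    have bi: "integrable lborel b" unfolding b_def using b1 b2 by simp
    have [measurable]: "b \<in> borel_measurable borel" using bi by simp
    have conv0: "conv b \<eta> x = 0" if \<eta>: "mollifier \<epsilon> \<eta>" and "\<epsilon> \<le> r" "x \<in> K" for \<epsilon> \<eta> x
    proof -
      have x: "cball x \<epsilon> \<subseteq> K'" using that by (auto simp: K'_def)
      have "conv b1 \<eta> x = conv b2 \<eta> x"
        using weak_partial_conv[of U "list_of_mi \<alpha>" u g1, OF _ \<eta> x K'(2,4) _ b0(1) b1(1)]
          weak_partial_conv[of U "list_of_mi \<alpha>" u g2, OF _ \<eta> x K'(2,4) _ b0(1) b2(1)] weak U by simp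
      moreover have "integrable lborel (\<lambda>y. b1 y * \<eta> (x - y))" "integrable lborel (\<lambda>y. b2 y * \<eta> (x - y))"
        using \<eta> by (auto intro!: conv_integrable[where R = \<epsilon>] b1 b2 smooth_on_continuous simp: mollifier_def)
      ultimately show ?thesis by (simp add: conv_def b_def left_diff_distrib)
    qed
    obtain R where R: "K \<subseteq> cball 0 R" using compact_imp_bounded[OF K(1)] by (meson bounded_pos mem_cball_0 subsetI)
    have small: "(\<integral>\<^sup>+x. ennreal \<bar>b x\<bar> * indicator K x \<partial>lborel) \<le> 0 + ennreal \<delta>" if \<delta>: "0 < \<delta>" for \<delta>
    proof -
      have fin: "(\<integral>\<^sup>+x. ennreal (\<bar>b x\<bar> ^ 1) \<partial>lborel) < \<infinity>"
        using bi by (auto simp: integrable_iff_bounded)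
      obtain \<epsilon>0 where \<epsilon>0: "0 < \<epsilon>0" "\<And>\<epsilon> \<eta>. \<epsilon> \<le> \<epsilon>0 \<Longrightarrow> mollifier \<epsilon> \<eta> \<Longrightarrow>
          (\<integral>\<^sup>+x. ennreal (\<bar>conv b \<eta> x - b x\<bar> ^ 1) * indicator (cball 0 R) x \<partial>lborel) \<le> ennreal \<delta>"
        using conv_tendsto_Lp[OF bi _ fin \<delta>, of R] by blast
      define \<epsilon> where "\<epsilon> = min \<epsilon>0 r"
      obtain \<eta> :: "real ^ 'n \<Rightarrow> real" where \<eta>: "mollifier \<epsilon> \<eta>"
        using mollifier_exists[of \<epsilon>] \<epsilon>0 r by (auto simp: \<epsilon>_def)
      have "(\<integral>\<^sup>+x. ennreal \<bar>b x\<bar> * indicator K x \<partial>lborel) \<le> (\<integral>\<^sup>+x. ennreal (\<bar>conv b \<eta> x - b x\<bar> ^ 1) * indicator (cball 0 R) x \<partial>lborel)"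
      proof (rule nn_integral_mono)
        fix x
        show "ennreal \<bar>b x\<bar> * indicator K x \<le> ennreal (\<bar>conv b \<eta> x - b x\<bar> ^ 1) * indicator (cball 0 R) x"
          using conv0[OF \<eta>, of x] R by (cases "x \<in> K") (auto simp: \<epsilon>_def)
      qed
      also have "\<dots> \<le> ennreal \<delta>" by (rule \<epsilon>0(2)[OF _ \<eta>]) (simp add: \<epsilon>_def)
      finally show ?thesis by simp
    qed
    have "(\<integral>\<^sup>+x. ennreal \<bar>b x\<bar> * indicator K x \<partial>lborel) \<le> 0"
      by (rule ennreal_le_epsilon) (use small in auto)
    then have "(\<integral>\<^sup>+x. ennreal \<bar>b x\<bar> * indicator K x \<partial>lborel) = 0" by simp
    then have "AE x in lborel. ennreal \<bar>b x\<bar> * indicator K x = 0"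
      using K'(5) by (subst (asm) nn_integral_0_iff_AE) auto
    moreover have "AE x in lborel. x \<in> K' \<longrightarrow> g1 x = b1 x" "AE x in lborel. x \<in> K' \<longrightarrow> g2 x = b2 x"
      using b1 b2 by (auto simp: borel_rep_def)
    ultimately show ?thesis
      by eventually_elim (use K' in \<open>auto simp: b_def\<close>)
  qed
  obtain C :: "nat \<Rightarrow> (real ^ 'n) set" where C: "\<And>n. compact (C n)" "\<And>n. C n \<subseteq> U" "U = (\<Union>n. C n)"
    using open_Union_compact[OF U] by blast
  have "AE x in lborel. x \<in> C n \<longrightarrow> g1 x = g2 x" for n
    by (rule on_compact[OF C(1,2)])
  then have "AE x in lborel. \<forall>n. x \<in> C n \<longrightarrow> g1 x = g2 x"
    unfolding AE_all_countable by blast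
  then show ?thesis by eventually_elim (use C in auto)
qed

section \<open>Sobolev functions and their Borel representatives\<close>

lemma locally_integrable_measurable:
  fixes u :: "real ^ 'n::finite \<Rightarrow> real"
  assumes U: "open U" and u: "u locally_integrable_on U"
  shows "u \<in> borel_measurable (lebesgue_on U)"
proof -
  obtain C :: "nat \<Rightarrow> (real ^ 'n) set" where C: "\<And>n. compact (C n)" "\<And>n. C n \<subseteq> U" "U = (\<Union>n. C n)"
    using open_Union_compact[OF U] by blast
  have m: "u \<in> borel_measurable (lebesgue_on (C n))" for n
    using u C(1,2)[of n] unfolding locally_integrable_on_def
    by (metis absolutely_integrable_imp_integrable borel_compact borel_measurable_integrable sets_completionI_sets sets_lborel)
  have "(\<lambda>x. indicator U x *\<^sub>R u x) \<in> borel_measurable lebesgue"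
  proof (rule measurable_piecewise_restrict[of "insert (- U) (range C)"])
    show "countable (insert (- U) (range C))" by auto
    show "\<Omega> \<inter> space lebesgue \<in> sets lebesgue" if "\<Omega> \<in> insert (- U) (range C)" for \<Omega>
      using that C(1) U by (auto simp: borel_compact)
    show "space lebesgue \<subseteq> \<Union> (insert (- U) (range C))" using C(3) by auto
    show "(\<lambda>x. indicator U x *\<^sub>R u x) \<in> measurable (lebesgue_on \<Omega>) borel" if \<Omega>: "\<Omega> \<in> insert (- U) (range C)" for \<Omega>
    proof -
      consider "\<Omega> = - U" | n where "\<Omega> = C n" using \<Omega> by auto
      then show ?thesis
      proof cases
        case 1 then show ?thesis by (subst measurable_cong[of _ _ "\<lambda>_. 0"]) auto
      next
        case 2
        then show ?thesis using C(2)[of n] m[of n] by (subst measurable_cong[of _ _ u]) auto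
      qed
    qed
  qed
  then show ?thesis using U by (subst borel_measurable_restrict_space_iff) auto
qed

lemma is_weak_partial_0: "u locally_integrable_on U \<Longrightarrow> is_weak_partial U 0 u u"
proof -
  have "mi_partial 0 \<phi> = \<phi>" for \<phi> :: "real ^ 'a \<Rightarrow> real"
  proof -
    have "foldr (\<lambda>i. partial i ^^ (0 :: nat ^ 'a) $ i) xs \<phi> = \<phi>" for xs by (induction xs) auto
    then show ?thesis by (simp add: mi_partial_def)
  qed
  then show "u locally_integrable_on U \<Longrightarrow> is_weak_partial U 0 u u"
    by (simp add: is_weak_partial_def mi_order_def)
qed

lemma is_weak_partial_0_AE:
  assumes "open U" "is_weak_partial U 0 u g"
  shows "AE x in lborel. x \<in> U \<longrightarrow> u x = g x"
proof -
  have "is_weak_partial U 0 u u" using assms(2) by (intro is_weak_partial_0) (simp add: is_weak_partial_def)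
  then show ?thesis using weak_partial_unique assms by blast
qed

text \<open>\<open>weak_partial\<close> is chosen among all weak derivatives, not among those in
  \<open>X\<close>. By uniqueness it agrees almost everywhere with a member of \<open>X\<close>, and
  so inherits square integrability or essential boundedness.\<close>

lemma sobolev_weak_partial:
  assumes U: "open U" and u: "u \<in> sobolev X U k" and \<alpha>: "mi_order \<alpha> \<le> k"
  obtains g b where "g \<in> X" "is_weak_partial U \<alpha> u (weak_partial U \<alpha> u)" "is_weak_partial U \<alpha> u g"
    "AE x in lborel. x \<in> U \<longrightarrow> weak_partial U \<alpha> u x = g x" "borel_rep U (weak_partial U \<alpha> u) b"
proof -
  obtain g where g: "g \<in> X" "is_weak_partial U \<alpha> u g" using u \<alpha> by (auto simp: sobolev_def)
  have w: "is_weak_partial U \<alpha> u (weak_partial U \<alpha> u)"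
    unfolding weak_partial_def by (rule someI[where P = "is_weak_partial U \<alpha> u", OF g(2)])
  have "weak_partial U \<alpha> u \<in> borel_measurable (lebesgue_on U)"
    using locally_integrable_measurable[OF U] w by (simp add: is_weak_partial_def)
  from borel_rep_exists[OF borel_open[OF U] this]
  obtain b where b: "borel_rep U (weak_partial U \<alpha> u) b" ..
  show thesis by (rule that[OF g(1) w g(2) weak_partial_unique[OF U w g(2)] b])
qed

text \<open>On a bounded set the constant 1 is integrable, and an absolute value is at most the
  square plus 1.\<close>

lemma integrable_of_square_integrable:
  fixes b :: "real ^ 'n::finite \<Rightarrow> real"
  assumes "b \<in> borel_measurable borel" "integrable lborel (\<lambda>x. (b x)\<^sup>2)" "bounded U" "\<And>x. x \<notin> U \<Longrightarrow> b x = 0"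
  shows "integrable lborel b"
proof -
  obtain R where R: "U \<subseteq> cball 0 R" using assms(3) by (meson bounded_pos mem_cball_0 subsetI)
  have "emeasure lborel (cball 0 R :: (real ^ 'n) set) < \<infinity>" by (intro emeasure_compact_finite) simp
  then have i: "integrable lborel (indicator (cball 0 R) :: real ^ 'n \<Rightarrow> real)" by simp
  show ?thesis
  proof (rule Bochner_Integration.integrable_bound)
    show "integrable lborel (\<lambda>x. (b x)\<^sup>2 + indicator (cball 0 R) x)"
      by (intro Bochner_Integration.integrable_add assms i)
    show "AE x in lborel. norm (b x) \<le> norm ((b x)\<^sup>2 + indicator (cball 0 R) x)"
    proof (rule AE_I2)
      fix x
      have "\<bar>t\<bar> \<le> t\<^sup>2 + 1" for t :: real
        using sum_squares_bound[of "\<bar>t\<bar>" 1] by (simp add: power2_eq_square abs_mult_self_eq)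
      then show "norm (b x) \<le> norm ((b x)\<^sup>2 + indicator (cball 0 R) x)"
        using assms(4)[of x] R by (cases "x \<in> U") (auto simp: subset_iff)
    qed
  qed (use assms(1) in simp)
qed

lemma sobolev_L2_weak_partial:
  fixes u :: "real ^ 'n::finite \<Rightarrow> real"
  assumes U: "open U" "bounded U" and u: "u \<in> sobolev (L2_space U) U k" and \<alpha>: "mi_order \<alpha> \<le> k"
  obtains b where "is_weak_partial U \<alpha> u (weak_partial U \<alpha> u)" "borel_rep U (weak_partial U \<alpha> u) b"
    "integrable lborel b" "integrable lborel (\<lambda>x. (b x)\<^sup>2)"
    "(LINT x|lborel. (b x)\<^sup>2) = (L2_norm U (weak_partial U \<alpha> u))\<^sup>2"
proof -
  obtain g b where g: "g \<in> L2_space U" and w: "is_weak_partial U \<alpha> u (weak_partial U \<alpha> u)"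
    and ae: "AE x in lborel. x \<in> U \<longrightarrow> weak_partial U \<alpha> u x = g x" and b: "borel_rep U (weak_partial U \<alpha> u) b"
    using sobolev_weak_partial[OF U(1) u \<alpha>] by metis
  have Ub: "U \<in> sets borel" using U by simp
  have bm[measurable]: "b \<in> borel_measurable borel" using b by (simp add: borel_rep_def)
  have gm: "g \<in> borel_measurable (lebesgue_on U)" and gi: "integrable (lebesgue_on U) (\<lambda>x. (g x)\<^sup>2)"
    using g by (auto simp: L2_space_def)
  have wm: "weak_partial U \<alpha> u \<in> borel_measurable (lebesgue_on U)" using b by (simp add: borel_rep_def)
  have bg: "borel_rep U g b"
    unfolding borel_rep_def
  proof (intro conjI gm bm)
    show "AE x in lborel. x \<in> U \<longrightarrow> g x = b x"
      using ae b unfolding borel_rep_def by (auto elim: eventually_elim2)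
  qed (use b in \<open>simp add: borel_rep_def\<close>)
  have sq: "integrable lborel (\<lambda>x. (b x)\<^sup>2)"
    using borel_rep_lebesgue(2)[OF bg order.refl Ub Ub, of "\<lambda>t y. t\<^sup>2" "\<lambda>x. (g x)\<^sup>2"] gi b gm
    by (auto simp: borel_rep_def)
  have "(L2_norm U (weak_partial U \<alpha> u))\<^sup>2 = (LINT x|lebesgue_on U. (weak_partial U \<alpha> u x)\<^sup>2)"
    unfolding L2_norm_def by (subst real_sqrt_pow2) (auto intro: integral_nonneg_AE)
  also have "\<dots> = (LINT x|lborel. (b x)\<^sup>2)"
    by (rule borel_rep_lebesgue(1)[OF b order.refl Ub Ub]) (use b wm in \<open>auto simp: borel_rep_def\<close>)
  finally show thesis
    using that[OF w b _ sq] integrable_of_square_integrable[OF bm sq U(2)] b by (auto simp: borel_rep_def)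
qed

subsection \<open>Change of variables for an arbitrary finite index type\<close>

text \<open>The library proves the change of variables formula for well-ordered index types only, so
  the index type is replaced by an initial segment of the natural numbers of the same size.\<close>
typedef (overloaded) 'n wo = "{..<CARD('n::finite)}"
  morphisms nat_of_wo wo_of_nat
  by (auto intro!: exI[of _ 0])

instantiation wo :: (finite) "{finite, wellorder}"
begin

definition "x \<le> y \<longleftrightarrow> nat_of_wo x \<le> nat_of_wo y"
definition "x < y \<longleftrightarrow> nat_of_wo x < nat_of_wo y"

instance
proof
  have "(UNIV :: 'a wo set) = wo_of_nat ` {..<CARD('a)}"
  proof (intro equalityI subsetI)
    fix x :: "'a wo"
    have "x = wo_of_nat (nat_of_wo x)" by (simp add: nat_of_wo_inverse)
    then show "x \<in> wo_of_nat ` {..<CARD('a)}" using nat_of_wo[of x] by (rule image_eqI)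
  qed simp
  then show "finite (UNIV :: 'a wo set)" by (metis finite_imageI finite_lessThan)
  fix x y z :: "'a wo"
  show "(x < y) = (x \<le> y \<and> \<not> y \<le> x)" by (auto simp: less_eq_wo_def less_wo_def)
  show "x \<le> x" by (simp add: less_eq_wo_def)
  show "x \<le> y \<Longrightarrow> y \<le> z \<Longrightarrow> x \<le> z" by (simp add: less_eq_wo_def)
  show "x \<le> y \<Longrightarrow> y \<le> x \<Longrightarrow> x = y" by (simp add: less_eq_wo_def nat_of_wo_inject)
  show "x \<le> y \<or> y \<le> x" by (auto simp: less_eq_wo_def)
  fix P :: "'a wo \<Rightarrow> bool" and a :: "'a wo"
  assume *: "\<And>x. (\<And>y. y < x \<Longrightarrow> P y) \<Longrightarrow> P x"
  show "P a"
    by (induction a rule: measure_induct_rule[of nat_of_wo]) (use * in \<open>auto simp: less_wo_def\<close>)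
qed

end

lemma wo_bij_exists: "\<exists>\<pi> :: 'n::finite wo \<Rightarrow> 'n. bij \<pi>"
proof -
  have "card (UNIV :: 'n wo set) = CARD('n)"
    using type_definition.card[OF type_definition_wo[where 'n = 'n]] by simp
  then obtain \<pi> where "bij_betw \<pi> (UNIV :: 'n wo set) (UNIV :: 'n set)"
    by (metis finite finite_same_card_bij)
  then show ?thesis by blast
qed

text \<open>A conjugate of a transposition is again a transposition. This makes signs of
  permutations independent of the naming of the indices, even across types.\<close>

lemma swapidseq_conjugate:
  assumes "bij \<pi>" "swapidseq n p"
  shows "swapidseq n (inv \<pi> \<circ> p \<circ> \<pi>)"
  using assms(2)
proof (induction rule: swapidseq.induct)
  case id
  have "inv \<pi> \<circ> id \<circ> \<pi> = id" using assms(1) by (auto simp: bij_is_inj)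
  then show ?case by (simp only: swapidseq.id)
next
  case (comp_Suc n p a b)
  have ab: "\<pi> (inv \<pi> x) = x" "inv \<pi> (\<pi> y) = y" for x y
    using assms(1) by (auto simp: bij_is_surj surj_f_inv_f bij_is_inj)
  have "inv \<pi> \<circ> (Transposition.transpose a b \<circ> p) \<circ> \<pi> = Transposition.transpose (inv \<pi> a) (inv \<pi> b) \<circ> (inv \<pi> \<circ> p \<circ> \<pi>)"
  proof
    fix x
    have "inv \<pi> (Transposition.transpose a b z) = Transposition.transpose (inv \<pi> a) (inv \<pi> b) (inv \<pi> z)" for z
      using ab by (auto simp: Transposition.transpose_def) (metis ab)+
    then show "(inv \<pi> \<circ> (Transposition.transpose a b \<circ> p) \<circ> \<pi>) x = (Transposition.transpose (inv \<pi> a) (inv \<pi> b) \<circ> (inv \<pi> \<circ> p \<circ> \<pi>)) x"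
      by simp
  qed
  moreover have "inv \<pi> a \<noteq> inv \<pi> b" using comp_Suc(2) ab by metis
  ultimately show ?case using swapidseq.comp_Suc[OF comp_Suc(3)] by metis
qed

text \<open>Conjugation by \<pi> matches the summands of the two Leibniz formulas and preserves the
  sign.\<close>

lemma det_reindex:
  fixes A :: "real ^ 'n::finite ^ 'n" and \<pi> :: "'m::finite \<Rightarrow> 'n"
  assumes \<pi>: "bij \<pi>"
  shows "det (\<chi> a b. A $ \<pi> a $ \<pi> b) = det A"
proof -
  have ab: "\<pi> (inv \<pi> x) = x" "inv \<pi> (\<pi> y) = y" for x y
    using \<pi> by (auto simp: bij_is_surj surj_f_inv_f bij_is_inj)
  have conj_perm: "inv \<pi> \<circ> p \<circ> \<pi> permutes UNIV" if "p permutes UNIV" for p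
    using permutes_bij[OF that] by (auto intro!: bij_imp_permutes bij_comp bij_imp_bij_inv \<pi>)
  have perm: "permutation p" if "p permutes (UNIV :: 'n set)" for p unfolding permutation_permutes using that by (intro exI[of _ UNIV]) auto
  have sgn: "sign (inv \<pi> \<circ> p \<circ> \<pi>) = sign p" if p: "p permutes (UNIV :: 'n set)" for p
  proof -
    obtain n where n: "swapidseq n p" using perm[OF p] by (auto simp: permutation_def)
    show ?thesis
      using evenperm_unique[OF n refl] evenperm_unique[OF swapidseq_conjugate[OF \<pi> n] refl] by (simp add: sign_def)
  qed
  have "det A = (\<Sum>p | p permutes (UNIV :: 'n set). of_int (sign (inv \<pi> \<circ> p \<circ> \<pi>)) * (\<Prod>a\<in>UNIV. A $ \<pi> a $ \<pi> ((inv \<pi> \<circ> p \<circ> \<pi>) a)))"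
    unfolding det_def
  proof (intro sum.cong refl)
    fix p assume "p \<in> {p. p permutes (UNIV :: 'n set)}"
    moreover have "(\<Prod>i\<in>UNIV. A $ i $ p i) = (\<Prod>a\<in>UNIV. A $ \<pi> a $ p (\<pi> a))"
      using prod.reindex_bij_betw[OF \<pi>, of "\<lambda>i. A $ i $ p i"] by simp
    ultimately show "of_int (sign p) * (\<Prod>i\<in>UNIV. A $ i $ p i) = of_int (sign (inv \<pi> \<circ> p \<circ> \<pi>)) * (\<Prod>a\<in>UNIV. A $ \<pi> a $ \<pi> ((inv \<pi> \<circ> p \<circ> \<pi>) a))"
      using sgn ab by simp
  qed
  also have "\<dots> = (\<Sum>q | q permutes (UNIV :: 'm set). of_int (sign q) * (\<Prod>a\<in>UNIV. A $ \<pi> a $ \<pi> (q a)))"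
  proof (rule sum.reindex_bij_witness[of _ "\<lambda>q. \<pi> \<circ> q \<circ> inv \<pi>" "\<lambda>p. inv \<pi> \<circ> p \<circ> \<pi>"])
    show "\<pi> \<circ> q \<circ> inv \<pi> \<in> {p. p permutes UNIV}" if "q \<in> {q. q permutes UNIV}" for q
      using that \<pi> by (auto intro!: bij_imp_permutes bij_comp bij_imp_bij_inv dest: permutes_bij)
  qed (use ab conj_perm in \<open>auto simp: fun_eq_iff\<close>)
  also have "\<dots> = det (\<chi> a b. A $ \<pi> a $ \<pi> b)" by (simp add: det_def)
  finally show ?thesis ..
qed

lemma change_of_variables_wo:
  fixes g :: "real ^ 'm::{finite,wellorder} \<Rightarrow> real ^ 'm::_" and F :: "real ^ 'm::_ \<Rightarrow> real"
  assumes K: "compact K" and der: "\<And>x. x \<in> K \<Longrightarrow> (g has_derivative g' x) (at x within K)"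
    and inj: "inj_on g K" and F: "continuous_on (g ` K) F" "\<And>y. y \<in> g ` K \<Longrightarrow> 0 \<le> F y"
    and det: "continuous_on K (\<lambda>x. \<bar>det (matrix (g' x))\<bar>)"
  shows "(\<integral>\<^sup>+y. ennreal (F y) * indicator (g ` K) y \<partial>lborel) =
         (\<integral>\<^sup>+x. ennreal (\<bar>det (matrix (g' x))\<bar> * F (g x)) * indicator K x \<partial>lborel)"
proof -
  let ?J = "\<lambda>x. \<bar>det (matrix (g' x))\<bar>"
  have gc: "continuous_on K g"
    using der by (meson continuous_on_eq_continuous_within has_derivative_continuous)
  have gK: "compact (g ` K)" by (rule compact_continuous_image[OF gc K])
  have Fg: "continuous_on K (\<lambda>x. ?J x * F (g x))"
    by (intro continuous_on_mult det continuous_on_compose2[OF F(1) gc]) auto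
  have abs: "h absolutely_integrable_on S" if "compact S" "continuous_on S h" for S and h :: "real ^ 'm::_ \<Rightarrow> real"
    using borel_integrable_compact[OF that] unfolding set_integrable_def
    by (subst integrable_completion) auto
  have nn: "(\<integral>\<^sup>+x. ennreal (h x) * indicator S x \<partial>lborel) = ennreal (integral S h)"
    if S: "compact S" "continuous_on S h" and pos: "\<And>x. x \<in> S \<Longrightarrow> 0 \<le> h x" for S and h :: "real ^ 'm::_ \<Rightarrow> real"
  proof -
    have i: "integrable lborel (\<lambda>x. indicator S x *\<^sub>R h x)" by (rule borel_integrable_compact[OF S])
    have "(\<integral>\<^sup>+x. ennreal (h x) * indicator S x \<partial>lborel) = (\<integral>\<^sup>+x. ennreal (indicator S x *\<^sub>R h x) \<partial>lborel)"
      by (intro nn_integral_cong) (auto simp: indicator_def)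
    also have "\<dots> = ennreal (LINT x|lborel. indicator S x *\<^sub>R h x)"
      by (intro nn_integral_eq_integral i AE_I2) (use pos in \<open>auto simp: indicator_def\<close>)
    also have "(LINT x|lborel. indicator S x *\<^sub>R h x) = (LINT x:S|lebesgue. h x)"
      unfolding set_lebesgue_integral_def using i by (subst integral_completion) auto
    also have "\<dots> = integral S h" by (rule set_lebesgue_integral_eq_integral(2)[OF abs[OF S]])
    finally show ?thesis .
  qed
  \<comment> \<open>The change of variables theorem is stated for vector-valued integrands, so
    \<open>F\<close> passes through one-dimensional vectors.\<close>
  have "integral (g ` K) (\<lambda>y. vec (F y) :: real ^ 1) = integral K (\<lambda>x. ?J x *\<^sub>R (vec (F (g x)) :: real ^ 1))"
  proof (rule integral_change_of_variables[OF _ der inj])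
    show "K \<in> sets lebesgue" using K by (simp add: borel_compact)
    have "(\<lambda>y. vec (F y) :: real ^ 1) absolutely_integrable_on g ` K"
      using abs[OF gK F(1)] by (simp add: absolutely_integrable_on_1_iff)
    then show "(\<lambda>y. vec (F y) :: real ^ 1) absolutely_integrable_on g ` K \<or> (\<lambda>x. ?J x *\<^sub>R (vec (F (g x)) :: real ^ 1)) absolutely_integrable_on K" ..
  qed
  then have "integral (g ` K) F = integral K (\<lambda>x. ?J x * F (g x))"
    by (simp add: integral_on_1_eq vec_eq_iff)
  then show ?thesis
    using nn[OF gK F(1,2)] nn[OF K Fg] F(2) by simp
qed

lemma prod_Basis_cart: "(\<Prod>b\<in>Basis. f b) = (\<Prod>i\<in>UNIV. f (axis i (1::real) :: real ^ 'n::finite))"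
proof -
  have B: "Basis = range (\<lambda>i :: 'n. axis i (1::real))" by (auto simp: Basis_vec_def)
  have "inj (\<lambda>i :: 'n. axis i (1::real))" by (auto simp: inj_on_def axis_eq_axis)
  then show ?thesis unfolding B by (simp add: prod.reindex)
qed

text \<open>Relabelling the coordinates carries the problem to the well-ordered index type. The
  relabelling preserves Lebesgue measure, and by \<open>det_reindex\<close> it preserves the
  Jacobian determinant.\<close>

lemma change_of_variables_compact:
  fixes \<Phi> :: "real ^ 'n::finite \<Rightarrow> real ^ 'n" and F :: "real ^ 'n \<Rightarrow> real"
  assumes K: "compact K" and der: "\<And>x. x \<in> K \<Longrightarrow> (\<Phi> has_derivative D x) (at x within K)"
    and inj: "inj_on \<Phi> K" and F: "continuous_on (\<Phi> ` K) F" "\<And>y. y \<in> \<Phi> ` K \<Longrightarrow> 0 \<le> F y"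
    and det: "continuous_on K (\<lambda>x. \<bar>det (matrix (D x))\<bar>)"
  shows "(\<integral>\<^sup>+y. ennreal (F y) * indicator (\<Phi> ` K) y \<partial>lborel) =
         (\<integral>\<^sup>+x. ennreal (\<bar>det (matrix (D x))\<bar> * F (\<Phi> x)) * indicator K x \<partial>lborel)"
proof -
  obtain \<pi> :: "'n wo \<Rightarrow> 'n" where \<pi>: "bij \<pi>" using wo_bij_exists by blast
  have ab: "\<pi> (inv \<pi> x) = x" "inv \<pi> (\<pi> y) = y" for x y
    using \<pi> by (auto simp: bij_is_surj surj_f_inv_f bij_is_inj)
  define T :: "real ^ 'n \<Rightarrow> real ^ 'n wo" where "T x = (\<chi> a. x $ \<pi> a)" for x
  define S :: "real ^ 'n wo \<Rightarrow> real ^ 'n" where "S y = (\<chi> i. y $ inv \<pi> i)" for y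
  have ST: "S (T x) = x" "T (S y) = y" for x y
    by (auto simp: S_def T_def vec_eq_iff ab)
  have lin: "linear T" "linear S" by (auto simp: T_def S_def intro!: linearI simp: vec_eq_iff)
  then have blin: "bounded_linear T" "bounded_linear S" by (auto simp: linear_conv_bounded_linear)
  have cont: "continuous_on A T" "continuous_on B S" for A B
    using blin by (auto intro: bounded_linear.continuous_on continuous_on_id)
  have Sm[measurable]: "S \<in> borel_measurable borel" by (rule borel_measurable_continuous_onI[OF cont(2)])
  \<comment> \<open>Boxes go to boxes with the same side lengths, and Lebesgue measure is determined
    by its values on boxes.\<close>
  have lborel_S: "lborel = distr lborel borel S"
  proof (rule lborel_eqI)
    fix l u :: "real ^ 'n" assume lu: "\<And>b. b \<in> Basis \<Longrightarrow> l \<bullet> b \<le> u \<bullet> b"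
    then have le: "l $ i \<le> u $ i" for i by (simp add: Basis_vec_def inner_axis) (metis inner_axis' inner_commute inner_real_def mult.right_neutral)
    have "S -` box l u = box (T l) (T u)"
    proof (intro equalityI subsetI)
      fix y assume "y \<in> S -` box l u"
      then have "l $ i < y $ inv \<pi> i \<and> y $ inv \<pi> i < u $ i" for i by (auto simp: mem_box_cart S_def)
      then show "y \<in> box (T l) (T u)" unfolding mem_box_cart T_def using ab(2) by (metis vec_lambda_beta)
    next
      fix y assume "y \<in> box (T l) (T u)"
      then have "l $ \<pi> a < y $ a \<and> y $ a < u $ \<pi> a" for a by (auto simp: mem_box_cart T_def)
      then show "y \<in> S -` box l u" unfolding vimage_eq mem_box_cart S_def using ab(1) by (metis vec_lambda_beta)
    qed
    then have "emeasure (distr lborel borel S) (box l u) = emeasure lborel (box (T l) (T u))"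
      by (simp add: emeasure_distr)
    also have "\<dots> = ennreal (\<Prod>b\<in>Basis. (T u - T l) \<bullet> b)"
      by (rule emeasure_lborel_box) (auto simp: Basis_vec_def inner_axis T_def le)
    also have "(\<Prod>b\<in>Basis. (T u - T l) \<bullet> b) = (\<Prod>a\<in>UNIV. u $ \<pi> a - l $ \<pi> a)"
      by (simp add: prod_Basis_cart T_def inner_axis)
    also have "\<dots> = (\<Prod>i\<in>UNIV. u $ i - l $ i)"
      using prod.reindex_bij_betw[OF \<pi>, of "\<lambda>i. u $ i - l $ i"] by simp
    also have "\<dots> = (\<Prod>b\<in>Basis. (u - l) \<bullet> b)" by (simp add: prod_Basis_cart inner_axis)
    finally show "emeasure (distr lborel borel S) (box l u) = (\<Prod>b\<in>Basis. (u - l) \<bullet> b)" .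
  qed simp
  have nn: "(\<integral>\<^sup>+x. f x \<partial>lborel) = (\<integral>\<^sup>+y. f (S y) \<partial>lborel)" if "f \<in> borel_measurable borel" for f :: "real ^ 'n \<Rightarrow> ennreal"
    using that by (subst lborel_S) (simp add: nn_integral_distr)
  define g where "g y = T (\<Phi> (S y))" for y
  define g' where "g' y h = T (D (S y) (S h))" for y h
  have imS: "S ` T ` A = A" for A by (auto simp: image_image ST)
  have memT: "y \<in> T ` A \<longleftrightarrow> S y \<in> A" for y A using ST by (metis imageE imageI)
  have gim: "g ` T ` K = T ` \<Phi> ` K" by (auto simp: g_def image_image ST)
  have detg: "det (matrix (g' y)) = det (matrix (D (S y)))" for y
  proof -
    have axis: "S (axis b 1) = axis (\<pi> b) 1" for b
      by (auto simp: S_def axis_def vec_eq_iff ab)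
    have "matrix (g' y) = (\<chi> a b. matrix (D (S y)) $ \<pi> a $ \<pi> b)"
      by (simp add: matrix_def g'_def axis vec_eq_iff T_def)
    then show ?thesis using det_reindex[OF \<pi>] by simp
  qed
  have gc: "continuous_on K \<Phi>" using der by (meson continuous_on_eq_continuous_within has_derivative_continuous)
  have \<Phi>K: "compact (\<Phi> ` K)" by (rule compact_continuous_image[OF gc K])
  have m: "(\<lambda>x. ennreal (h x) * indicator A x) \<in> borel_measurable borel"
    if "compact A" "continuous_on A h" "\<And>x. x \<in> A \<Longrightarrow> 0 \<le> h x" for A and h :: "real ^ 'n \<Rightarrow> real"
  proof -
    have "(\<lambda>x. indicator A x *\<^sub>R h x) \<in> borel_measurable borel"
      by (intro borel_measurable_continuous_on_indicator that borel_compact)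
    then have "(\<lambda>x. ennreal (indicator A x *\<^sub>R h x)) \<in> borel_measurable borel" by simp
    moreover have "ennreal (indicator A x *\<^sub>R h x) = ennreal (h x) * indicator A x" for x by (auto simp: indicator_def)
    ultimately show ?thesis by (simp only:)
  qed
  have "(\<integral>\<^sup>+y. ennreal (F y) * indicator (\<Phi> ` K) y \<partial>lborel) = (\<integral>\<^sup>+y. ennreal (F (S y)) * indicator (\<Phi> ` K) (S y) \<partial>lborel)"
    by (rule nn[OF m[OF \<Phi>K F]])
  also have "\<dots> = (\<integral>\<^sup>+y. ennreal (F (S y)) * indicator (g ` T ` K) y \<partial>lborel)"
    unfolding gim by (intro nn_integral_cong) (auto simp: indicator_def memT)
  also have "\<dots> = (\<integral>\<^sup>+x. ennreal (\<bar>det (matrix (g' x))\<bar> * F (S (g x))) * indicator (T ` K) x \<partial>lborel)"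
  proof (rule change_of_variables_wo)
    show "compact (T ` K)" by (rule compact_continuous_image[OF cont(1) K])
    show "(g has_derivative g' y) (at y within T ` K)" if "y \<in> T ` K" for y
    proof -
      have S: "(S has_derivative S) (at y within T ` K)" using blin(2) by (rule bounded_linear_imp_has_derivative)
      have "(\<Phi> has_derivative D (S y)) (at (S y) within S ` T ` K)" using der that by (simp add: imS memT)
      from has_derivative_in_compose[OF S this]
      have "((\<lambda>y. \<Phi> (S y)) has_derivative (\<lambda>h. D (S y) (S h))) (at y within T ` K)" .
      from bounded_linear.has_derivative[OF blin(1) this] show ?thesis by (simp add: g_def[abs_def] g'_def[abs_def])
    qed
    show "inj_on g (T ` K)"
      using inj ST unfolding inj_on_def g_def by (metis memT)
    show "continuous_on (g ` T ` K) (\<lambda>y. F (S y))" unfolding gim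
      by (rule continuous_on_compose2[OF F(1) cont(2)]) (auto simp: imS ST)
    show "0 \<le> F (S y)" if "y \<in> g ` T ` K" for y using that F(2) unfolding gim by (auto simp: ST)
    show "continuous_on (T ` K) (\<lambda>x. \<bar>det (matrix (g' x))\<bar>)" unfolding detg
      by (rule continuous_on_compose2[OF det cont(2)]) (auto simp: ST)
  qed
  also have "\<dots> = (\<integral>\<^sup>+y. ennreal (\<bar>det (matrix (D (S y)))\<bar> * F (\<Phi> (S y))) * indicator K (S y) \<partial>lborel)"
    by (intro nn_integral_cong) (auto simp: detg g_def ST indicator_def memT)
  also have "\<dots> = (\<integral>\<^sup>+x. ennreal (\<bar>det (matrix (D x))\<bar> * F (\<Phi> x)) * indicator K x \<partial>lborel)"
  proof (rule nn[symmetric], rule m[OF K])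
    show "continuous_on K (\<lambda>x. \<bar>det (matrix (D x))\<bar> * F (\<Phi> x))"
      by (intro continuous_on_mult det continuous_on_compose2[OF F(1) gc]) auto
  qed (use F(2) in auto)
  finally show ?thesis .
qed

subsection \<open>Orthogonal projection onto a finite-dimensional space of functions\<close>

definition sq_integrable :: "'a measure \<Rightarrow> ('a \<Rightarrow> real) \<Rightarrow> bool" where
  "sq_integrable M f \<longleftrightarrow> f \<in> borel_measurable M \<and> integrable M (\<lambda>x. (f x)\<^sup>2)"

lemma sq_integrable_mult:
  assumes "sq_integrable M f" "sq_integrable M g"
  shows "integrable M (\<lambda>x. f x * g x)"
proof (rule Bochner_Integration.integrable_bound)
  show "integrable M (\<lambda>x. (f x)\<^sup>2 + (g x)\<^sup>2)" using assms by (auto simp: sq_integrable_def)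
  show "AE x in M. norm (f x * g x) \<le> norm ((f x)\<^sup>2 + (g x)\<^sup>2)"
  proof (rule AE_I2)
    fix x
    have "2 * (\<bar>f x\<bar> * \<bar>g x\<bar>) \<le> (f x)\<^sup>2 + (g x)\<^sup>2"
      using sum_squares_bound[of "\<bar>f x\<bar>" "\<bar>g x\<bar>"] by (simp add: mult.assoc)
    then show "norm (f x * g x) \<le> norm ((f x)\<^sup>2 + (g x)\<^sup>2)"
      by (simp add: abs_mult) (smt (verit) mult_nonneg_nonneg abs_ge_zero)
  qed
qed (use assms in \<open>auto simp: sq_integrable_def\<close>)

lemma sq_integrable_cmul: "sq_integrable M f \<Longrightarrow> sq_integrable M (\<lambda>x. c * f x)"
  by (auto simp: sq_integrable_def power_mult_distrib)

lemma sq_integrable_add: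
  assumes "sq_integrable M f" "sq_integrable M g"
  shows "sq_integrable M (\<lambda>x. f x + g x)"
proof -
  have "integrable M (\<lambda>x. (f x)\<^sup>2 + (g x)\<^sup>2 + 2 * (f x * g x))"
    using assms sq_integrable_mult[OF assms] unfolding sq_integrable_def
    by (intro Bochner_Integration.integrable_add integrable_mult_right) auto
  moreover have "(\<lambda>x. (f x + g x)\<^sup>2) = (\<lambda>x. (f x)\<^sup>2 + (g x)\<^sup>2 + 2 * (f x * g x))"
    by (simp add: power2_sum mult.assoc)
  ultimately show ?thesis using assms by (auto simp: sq_integrable_def)
qed

lemma sq_integrable_diff: "sq_integrable M f \<Longrightarrow> sq_integrable M g \<Longrightarrow> sq_integrable M (\<lambda>x. f x - g x)"
  using sq_integrable_add[OF _ sq_integrable_cmul[of M g "-1"]] by simp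

lemma sq_integrable_sum:
  "finite I \<Longrightarrow> (\<And>i. i \<in> I \<Longrightarrow> sq_integrable M (f i)) \<Longrightarrow> sq_integrable M (\<lambda>x. \<Sum>i\<in>I. f i x)"
proof (induction rule: finite_induct)
  case empty then show ?case by (simp add: sq_integrable_def)
next
  case (insert i I) then show ?case by (simp add: sq_integrable_add)
qed

lemma sq_integrable_indicator:
  assumes "sq_integrable M f" "A \<in> sets M"
  shows "integrable M (\<lambda>x. indicator A x * (f x)\<^sup>2)"
  using integrable_mult_indicator[OF assms(2), of "\<lambda>x. (f x)\<^sup>2"] assms(1) by (simp add: sq_integrable_def)

definition lin_closed :: "('a \<Rightarrow> real) set \<Rightarrow> bool" where
  "lin_closed V \<longleftrightarrow> (\<lambda>x. 0) \<in> V \<and> (\<forall>f\<in>V. \<forall>g\<in>V. \<forall>c. (\<lambda>x. f x + c * g x) \<in> V)"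

lemma lin_closedD: "lin_closed V \<Longrightarrow> f \<in> V \<Longrightarrow> g \<in> V \<Longrightarrow> (\<lambda>x. f x + c * g x) \<in> V"
  by (simp add: lin_closed_def)

lemma lin_closed_sum:
  assumes "lin_closed V" "finite I" "\<And>i. i \<in> I \<Longrightarrow> f i \<in> V"
  shows "(\<lambda>x. \<Sum>i\<in>I. c i * f i x) \<in> V"
  using assms(2,3)
proof (induction rule: finite_induct)
  case empty then show ?case using assms(1) by (simp add: lin_closed_def)
next
  case (insert i I)
  then have "(\<lambda>x. (\<Sum>i\<in>I. c i * f i x) + c i * f i x) \<in> V"
    by (intro lin_closedD[OF assms(1)]) auto
  then show ?case using insert by (simp add: add.commute)
qed

definition orthonormal_fun :: "'a measure \<Rightarrow> nat \<Rightarrow> (nat \<Rightarrow> 'a \<Rightarrow> real) \<Rightarrow> bool" where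
  "orthonormal_fun M k e \<longleftrightarrow> (\<forall>j<k. sq_integrable M (e j)) \<and>
     (\<forall>i<k. \<forall>j<k. (LINT x|M. e i x * e j x) = (if i = j then 1 else 0))"

lemma LINT_mult_sum:
  fixes f :: "'a \<Rightarrow> real" and e :: "'j \<Rightarrow> 'a \<Rightarrow> real"
  assumes "\<And>j. j \<in> J \<Longrightarrow> integrable M (\<lambda>x. f x * e j x)" "finite J"
  shows "(LINT x|M. f x * (\<Sum>j\<in>J. c j * e j x)) = (\<Sum>j\<in>J. c j * (LINT x|M. f x * e j x))"
proof -
  have "(\<lambda>x. f x * (\<Sum>j\<in>J. c j * e j x)) = (\<lambda>x. \<Sum>j\<in>J. c j * (f x * e j x))"
    by (simp add: sum_distrib_left mult_ac)
  then show ?thesis using assms by (simp add: Bochner_Integration.integral_sum)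
qed

text \<open>Gram-Schmidt; functions whose residual vanishes almost everywhere are skipped.\<close>
lemma gram_schmidt:
  fixes m :: nat
  assumes V: "lin_closed V" and b: "\<And>i. i < m \<Longrightarrow> b i \<in> V \<and> sq_integrable M (b i)"
  shows "\<exists>k e. orthonormal_fun M k e \<and> (\<forall>j<k. e j \<in> V) \<and>
    (\<forall>i<m. \<exists>c. AE x in M. b i x = (\<Sum>j<k. c j * e j x))"
  using b
proof (induction m)
  case 0
  show ?case by (rule exI[of _ 0]) (simp add: orthonormal_fun_def)
next
  case (Suc m)
  then obtain k e where on: "orthonormal_fun M k e" and eV: "\<forall>j<k. e j \<in> V"
    and sp: "\<forall>i<m. \<exists>c. AE x in M. b i x = (\<Sum>j<k. c j * e j x)" by force
  have esq: "sq_integrable M (e j)" if "j < k" for j using on that by (simp add: orthonormal_fun_def)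
  have bm: "b m \<in> V" "sq_integrable M (b m)" using Suc.prems by auto
  define a where "a j = (LINT x|M. b m x * e j x)" for j
  define r where "r x = b m x - (\<Sum>j<k. a j * e j x)" for x
  have s: "sq_integrable M (\<lambda>x. \<Sum>j<k. a j * e j x)" by (intro sq_integrable_sum sq_integrable_cmul esq) auto
  have rsq: "sq_integrable M r" unfolding r_def by (intro sq_integrable_diff bm s)
  have rV: "r \<in> V"
  proof -
    have "(\<lambda>x. \<Sum>j<k. a j * e j x) \<in> V" by (rule lin_closed_sum[OF V]) (use eV in auto)
    then have "(\<lambda>x. b m x + (- 1) * (\<Sum>j<k. a j * e j x)) \<in> V" using lin_closedD[OF V bm(1)] by blast
    then show ?thesis by (simp add: r_def[abs_def])
  qed
  have orth: "(LINT x|M. e i x * r x) = 0" if i: "i < k" for i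
  proof -
    have "(LINT x|M. e i x * r x) = (LINT x|M. e i x * b m x - e i x * (\<Sum>j<k. a j * e j x))"
      by (simp add: r_def right_diff_distrib)
    also have "\<dots> = (LINT x|M. e i x * b m x) - (LINT x|M. e i x * (\<Sum>j<k. a j * e j x))"
      by (intro Bochner_Integration.integral_diff sq_integrable_mult esq bm s i)
    also have "(LINT x|M. e i x * (\<Sum>j<k. a j * e j x)) = (\<Sum>j<k. a j * (LINT x|M. e i x * e j x))"
      by (rule LINT_mult_sum) (auto intro: sq_integrable_mult esq i)
    also have "\<dots> = (\<Sum>j<k. if j = i then a i else 0)"
      using on i by (intro sum.cong) (auto simp: orthonormal_fun_def)
    also have "\<dots> = a i" using i by simp
    finally show ?thesis by (simp add: a_def mult.commute)
  qed
  define n where "n = (LINT x|M. (r x)\<^sup>2)"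
  have n0: "0 \<le> n" by (simp add: n_def)
  show ?case
  proof (cases "n = 0")
    case True
    have "AE x in M. (r x)\<^sup>2 = 0"
      using integral_nonneg_eq_0_iff_AE[of M "\<lambda>x. (r x)\<^sup>2"] True rsq by (simp add: n_def sq_integrable_def)
    then have ae: "AE x in M. b m x = (\<Sum>j<k. a j * e j x)" by eventually_elim (simp add: r_def)
    show ?thesis
    proof (intro exI[of _ k] exI[of _ e] conjI on eV allI impI)
      fix i assume "i < Suc m"
      then show "\<exists>c. AE x in M. b i x = (\<Sum>j<k. c j * e j x)" using sp ae by (cases "i = m") auto
    qed
  next
    case False
    then have npos: "0 < n" using n0 by simp
    define e' where "e' j = (if j = k then (\<lambda>x. (1 / sqrt n) * r x) else e j)" for j
    have e'k: "e' k = (\<lambda>x. (1 / sqrt n) * r x)" and e'j: "\<And>j. j < k \<Longrightarrow> e' j = e j" by (auto simp: e'_def)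
    have kk: "(LINT x|M. e' k x * e' k x) = 1"
    proof -
      have "(LINT x|M. e' k x * e' k x) = (LINT x|M. (1 / n) * (r x)\<^sup>2)"
        unfolding e'k using npos by (intro Bochner_Integration.integral_cong) (auto simp: power2_eq_square)
      then show ?thesis using npos by (simp add: n_def)
    qed
    have ik: "(LINT x|M. e' i x * e' k x) = 0" "(LINT x|M. e' k x * e' i x) = 0" if "i < k" for i
    proof -
      have "(LINT x|M. e' i x * e' k x) = (LINT x|M. (1 / sqrt n) * (e i x * r x))"
        unfolding e'k e'j[OF that] by (simp add: mult_ac)
      also have "\<dots> = 0" using orth[OF that] by simp
      finally show "(LINT x|M. e' i x * e' k x) = 0" .
      then show "(LINT x|M. e' k x * e' i x) = 0" by (simp add: mult.commute)
    qed
    have on': "orthonormal_fun M (Suc k) e'"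
      unfolding orthonormal_fun_def
    proof (intro conjI allI impI)
      show "sq_integrable M (e' j)" if "j < Suc k" for j
        using that esq sq_integrable_cmul[OF rsq, of "1 / sqrt n"] by (auto simp: e'_def)
      fix i j assume "i < Suc k" "j < Suc k"
      then consider "i < k" "j < k" | "i < k" "j = k" | "i = k" "j < k" | "i = k" "j = k" by linarith
      then show "(LINT x|M. e' i x * e' j x) = (if i = j then 1 else 0)"
        using kk ik on by cases (auto simp: e'j orthonormal_fun_def)
    qed
    have "(\<lambda>x. 0 + (1 / sqrt n) * r x) \<in> V"
      using V by (intro lin_closedD[OF V _ rV]) (simp add: lin_closed_def)
    then have eV': "\<forall>j<Suc k. e' j \<in> V" using eV by (auto simp: e'_def)
    show ?thesis
    proof (intro exI[of _ "Suc k"] exI[of _ e'] conjI on' eV' allI impI)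
      fix i assume i: "i < Suc m"
      show "\<exists>c. AE x in M. b i x = (\<Sum>j<Suc k. c j * e' j x)"
      proof (cases "i = m")
        case True
        have "b m x = (\<Sum>j<Suc k. (a(k := sqrt n)) j * e' j x)" for x
          using npos by (simp add: e'k e'j r_def)
        then show ?thesis using True by blast
      next
        case False
        then obtain c where "AE x in M. b i x = (\<Sum>j<k. c j * e j x)" using sp i by (meson less_SucE)
        moreover have "(\<Sum>j<k. c j * e j x) = (\<Sum>j<Suc k. (c(k := 0)) j * e' j x)" for x by (simp add: e'j)
        ultimately have "AE x in M. b i x = (\<Sum>j<Suc k. (c(k := 0)) j * e' j x)" by (simp only:)
        then show ?thesis by (rule exI[of _ "c(k := 0)"])
      qed
    qed
  qed
qed

text \<open>Elements of \<open>V\<close> may differ arbitrarily outside the space of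
  \<open>M\<close>, so finite dimension is expressed by a finite family that spans \<open>V\<close>
  up to almost everywhere equality.\<close>

locale fin_dim_L2 =
  fixes M :: "'a measure" and V :: "('a \<Rightarrow> real) set" and m :: nat and b :: "nat \<Rightarrow> 'a \<Rightarrow> real"
  assumes V_lin: "lin_closed V" and V_sq: "\<And>P. P \<in> V \<Longrightarrow> sq_integrable M P"
    and b_V: "\<And>i. i < m \<Longrightarrow> b i \<in> V"
    and V_span: "\<And>P. P \<in> V \<Longrightarrow> \<exists>c. AE x in M. P x = (\<Sum>i<m. c i * b i x)"
begin

lemma V_diff: "P \<in> V \<Longrightarrow> Q \<in> V \<Longrightarrow> (\<lambda>x. P x - Q x) \<in> V"
proof -
  assume "P \<in> V" "Q \<in> V"
  then have "(\<lambda>x. P x + (- 1) * Q x) \<in> V" by (intro lin_closedD[OF V_lin])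
  then show ?thesis by simp
qed

lemma orthonormal_basis:
  obtains k e where "orthonormal_fun M k e" "\<And>j. j < k \<Longrightarrow> e j \<in> V"
    "\<And>P. P \<in> V \<Longrightarrow> \<exists>c. AE x in M. P x = (\<Sum>j<k. c j * e j x)"
proof -
  obtain k e where on: "orthonormal_fun M k e" and eV: "\<forall>j<k. e j \<in> V"
    and sp: "\<forall>i<m. \<exists>c. AE x in M. b i x = (\<Sum>j<k. c j * e j x)"
    using gram_schmidt[OF V_lin, of m b M] b_V V_sq by blast
  have "\<exists>c. AE x in M. P x = (\<Sum>j<k. c j * e j x)" if P: "P \<in> V" for P
  proof -
    obtain c where c: "AE x in M. P x = (\<Sum>i<m. c i * b i x)" using V_span[OF P] by blast
    obtain d where d: "\<And>i. i < m \<Longrightarrow> AE x in M. b i x = (\<Sum>j<k. d i j * e j x)" using sp by metis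
    have "AE x in M. \<forall>i\<in>{..<m}. b i x = (\<Sum>j<k. d i j * e j x)"
      by (rule AE_finite_allI) (use d in auto)
    with c have "AE x in M. P x = (\<Sum>j<k. (\<Sum>i<m. c i * d i j) * e j x)"
    proof eventually_elim
      case (elim x)
      have "P x = (\<Sum>i<m. c i * (\<Sum>j<k. d i j * e j x))" using elim by simp
      also have "\<dots> = (\<Sum>j<k. (\<Sum>i<m. c i * d i j) * e j x)"
        unfolding sum_distrib_left sum_distrib_right by (subst sum.swap) (simp add: mult.assoc)
      finally show ?case .
    qed
    then show ?thesis by (rule exI[of _ "\<lambda>j. \<Sum>i<m. c i * d i j"])
  qed
  then show thesis using that on eV by blast
qed

lemma projection_exists:
  assumes u: "sq_integrable M u"
  shows "\<exists>q\<in>V. \<forall>P\<in>V. (LINT x|M. (u x - q x) * P x) = 0"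
proof -
  obtain k e where on: "orthonormal_fun M k e" and eV: "\<And>j. j < k \<Longrightarrow> e j \<in> V"
    and sp: "\<And>P. P \<in> V \<Longrightarrow> \<exists>c. AE x in M. P x = (\<Sum>j<k. c j * e j x)" using orthonormal_basis by blast
  define a where "a j = (LINT x|M. u x * e j x)" for j
  define q where "q x = (\<Sum>j<k. a j * e j x)" for x
  have qV: "q \<in> V" unfolding q_def by (rule lin_closed_sum[OF V_lin]) (use eV in auto)
  have r: "sq_integrable M (\<lambda>x. u x - q x)" by (intro sq_integrable_diff u V_sq qV)
  have orth: "(LINT x|M. (u x - q x) * e i x) = 0" if i: "i < k" for i
  proof -
    have "(LINT x|M. (u x - q x) * e i x) = (LINT x|M. u x * e i x - e i x * q x)"
      by (simp add: algebra_simps)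
    also have "\<dots> = a i - (LINT x|M. e i x * q x)"
      unfolding a_def by (intro Bochner_Integration.integral_diff sq_integrable_mult V_sq eV u qV i)
    also have "(LINT x|M. e i x * q x) = (\<Sum>j<k. a j * (LINT x|M. e i x * e j x))"
      unfolding q_def by (rule LINT_mult_sum) (auto intro: sq_integrable_mult V_sq eV i)
    also have "\<dots> = (\<Sum>j<k. if j = i then a i else 0)"
      using on i by (intro sum.cong) (auto simp: orthonormal_fun_def)
    also have "\<dots> = a i" using i by simp
    finally show ?thesis by simp
  qed
  have "(LINT x|M. (u x - q x) * P x) = 0" if P: "P \<in> V" for P
  proof -
    obtain c where c: "AE x in M. P x = (\<Sum>j<k. c j * e j x)" using sp[OF P] by blast
    have m: "(\<lambda>x. (u x - q x) * P x) \<in> borel_measurable M"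
      "(\<lambda>x. (u x - q x) * (\<Sum>j<k. c j * e j x)) \<in> borel_measurable M"
      using r V_sq[OF P] V_sq[OF eV] by (auto simp: sq_integrable_def intro!: borel_measurable_times borel_measurable_sum)
    have "(LINT x|M. (u x - q x) * P x) = (LINT x|M. (u x - q x) * (\<Sum>j<k. c j * e j x))"
      by (rule Bochner_Integration.integral_cong_AE[OF m]) (use c in eventually_elim, simp)
    also have "\<dots> = (\<Sum>j<k. c j * (LINT x|M. (u x - q x) * e j x))"
      by (rule LINT_mult_sum) (auto intro!: sq_integrable_mult[OF r] V_sq eV)
    also have "\<dots> = 0" using orth by simp
    finally show ?thesis .
  qed
  then show ?thesis using qV by blast
qed

text \<open>Pythagoras: \<open>u - q\<close> is orthogonal to \<open>q - P\<close>.\<close>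

lemma projection_best:
  assumes u: "sq_integrable M u" and q: "q \<in> V" "\<And>P. P \<in> V \<Longrightarrow> (LINT x|M. (u x - q x) * P x) = 0" and P: "P \<in> V"
  shows "(LINT x|M. (u x - q x)\<^sup>2) \<le> (LINT x|M. (u x - P x)\<^sup>2)"
proof -
  have r: "sq_integrable M (\<lambda>x. u x - q x)" by (intro sq_integrable_diff u V_sq q)
  have d: "sq_integrable M (\<lambda>x. q x - P x)" by (intro sq_integrable_diff V_sq q P)
  have "(LINT x|M. (u x - P x)\<^sup>2) = (LINT x|M. (u x - q x)\<^sup>2 + 2 * ((u x - q x) * (q x - P x)) + (q x - P x)\<^sup>2)"
    by (intro Bochner_Integration.integral_cong) (auto simp: power2_eq_square algebra_simps)
  also have "\<dots> = (LINT x|M. (u x - q x)\<^sup>2) + 2 * (LINT x|M. (u x - q x) * (q x - P x)) + (LINT x|M. (q x - P x)\<^sup>2)"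
    using r d sq_integrable_mult[OF r d] by (simp add: sq_integrable_def)
  also have "(LINT x|M. (u x - q x) * (q x - P x)) = 0" by (rule q(2)[OF V_diff[OF q(1) P]])
  finally show ?thesis by simp
qed

lemma small_tail:
  assumes E: "\<And>n::nat. E n \<in> sets M" "AE x in M. \<forall>\<^sub>F n in sequentially. x \<in> E n" and f: "sq_integrable M f"
  shows "(\<lambda>n. LINT x|M. indicator (space M - E n) x * (f x)\<^sup>2) \<longlonglongrightarrow> 0"
proof -
  have "(\<lambda>n. LINT x|M. indicator (space M - E n) x * (f x)\<^sup>2) \<longlonglongrightarrow> (LINT x|M. 0)"
  proof (rule integral_dominated_convergence[where w = "\<lambda>x. (f x)\<^sup>2"])
    show "AE x in M. (\<lambda>n. indicator (space M - E n) x * (f x)\<^sup>2) \<longlonglongrightarrow> 0"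
      using E(2)
    proof eventually_elim
      case (elim x)
      then have "\<forall>\<^sub>F n in sequentially. indicator (space M - E n) x * (f x)\<^sup>2 = 0" by eventually_elim simp
      then show ?case by (rule tendsto_eventually)
    qed
    show "AE x in M. norm (indicator (space M - E n) x * (f x)\<^sup>2) \<le> (f x)\<^sup>2" for n
      by (intro AE_I2) (auto simp: indicator_def)
    have [measurable]: "f \<in> borel_measurable M" using f by (simp add: sq_integrable_def)
    note [measurable] = E(1)
    show "(\<lambda>x. indicator (space M - E n) x * (f x)\<^sup>2) \<in> borel_measurable M" for n by measurable
  qed (use f in \<open>auto simp: sq_integrable_def\<close>)
  then show ?thesis by simp
qed

text \<open>The given \<open>P\<close> depends on \<open>n\<close> and \<delta>, and its behaviour
  outside \<open>E n\<close> is not controlled by assumption. Finite dimension supplies the control: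
  the tail of \<open>P\<close> is at most its total mass times the sum of the tails of an
  orthonormal basis, and that sum tends to 0. So for large \<open>n\<close> a \<open>P\<close> that
  is good on \<open>E n\<close> is good everywhere, and the projection is at least as good.\<close>

lemma projection_exhaustion:
  assumes E: "\<And>n::nat. E n \<in> sets M" "AE x in M. \<forall>\<^sub>F n in sequentially. x \<in> E n" and B: "0 \<le> B"
    and u: "sq_integrable M u" and q: "q \<in> V" "\<And>P. P \<in> V \<Longrightarrow> (LINT x|M. (u x - q x) * P x) = 0"
    and approx: "\<And>n \<delta>. 0 < \<delta> \<Longrightarrow> \<exists>P\<in>V. (LINT x|M. indicator (E n) x * (u x - P x)\<^sup>2) \<le> B + \<delta>"
  shows "(LINT x|M. (u x - q x)\<^sup>2) \<le> B"
proof (rule field_le_epsilon)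
  fix \<epsilon> :: real assume \<epsilon>: "0 < \<epsilon>"
  obtain k e where on: "orthonormal_fun M k e" and eV: "\<And>j. j < k \<Longrightarrow> e j \<in> V"
    and sp: "\<And>P. P \<in> V \<Longrightarrow> \<exists>c. AE x in M. P x = (\<Sum>j<k. c j * e j x)" using orthonormal_basis by blast
  define U where "U = (LINT x|M. (u x)\<^sup>2)"
  have U: "0 \<le> U" by (simp add: U_def)
  \<comment> \<open>At most 1/2 so that a tail can be absorbed into the total mass of
    \<open>P\<close>; the other bound makes the tail terms
    \<open>2 * \<kappa> + 2 * (\<kappa> * (4 * (B + 1 + U)))\<close> at the end amount to at most
    half of \<epsilon>.\<close>
  define \<kappa> where "\<kappa> = min (1/2) (\<epsilon> / (2 * (10 + 8 * (B + U))))"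
  have \<kappa>: "0 < \<kappa>" "\<kappa> \<le> 1 / 2" "\<kappa> * (10 + 8 * (B + U)) \<le> \<epsilon> / 2"
  proof -
    show "0 < \<kappa>" using \<epsilon> B U by (auto simp: \<kappa>_def)
    show "\<kappa> \<le> 1 / 2" unfolding \<kappa>_def by (rule min.cobounded1)
    have "\<kappa> * (10 + 8 * (B + U)) \<le> (\<epsilon> / (2 * (10 + 8 * (B + U)))) * (10 + 8 * (B + U))"
      using B U by (intro mult_right_mono) (auto simp: \<kappa>_def)
    also have "\<dots> = \<epsilon> / 2" using B U nonzero_mult_divide_mult_cancel_right[of "10 + 8 * (B + U)" \<epsilon> 2] by simp
    finally show "\<kappa> * (10 + 8 * (B + U)) \<le> \<epsilon> / 2" .
  qed
  define \<delta> where "\<delta> = min 1 (\<epsilon> / 2)"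
  have \<delta>: "0 < \<delta>" "\<delta> \<le> 1" "\<delta> \<le> \<epsilon> / 2" using \<epsilon> by (auto simp: \<delta>_def)
  let ?R = "\<lambda>n. space M - E n"
  define \<tau> where "\<tau> n = (\<Sum>j<k. LINT x|M. indicator (?R n) x * (e j x)\<^sup>2) + (LINT x|M. indicator (?R n) x * (u x)\<^sup>2)" for n
  have "\<tau> \<longlonglongrightarrow> (\<Sum>j<k. 0) + 0"
    unfolding \<tau>_def by (intro tendsto_add tendsto_sum small_tail E u V_sq eV) auto
  then have "\<forall>\<^sub>F n in sequentially. \<tau> n < \<kappa>" using \<kappa>(1) by (intro order_tendstoD(2)) auto
  then obtain n where n: "\<tau> n < \<kappa>" by (auto simp: eventually_sequentially)
  have nn: "0 \<le> (LINT x|M. indicator (?R n) x * (f x)\<^sup>2)" for f :: "'a \<Rightarrow> real"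
    by (rule Bochner_Integration.integral_nonneg) simp
  have e_tail: "(\<Sum>j<k. LINT x|M. indicator (?R n) x * (e j x)\<^sup>2) \<le> \<kappa>" using n nn[of u] unfolding \<tau>_def by linarith
  have u_tail: "(LINT x|M. indicator (?R n) x * (u x)\<^sup>2) \<le> \<kappa>"
  proof -
    have "0 \<le> (\<Sum>j<k. LINT x|M. indicator (?R n) x * (e j x)\<^sup>2)" by (intro sum_nonneg nn)
    then show ?thesis using n unfolding \<tau>_def by linarith
  qed
  obtain P where P: "P \<in> V" and PE: "(LINT x|M. indicator (E n) x * (u x - P x)\<^sup>2) \<le> B + \<delta>"
    using approx[OF \<delta>(1)] by blast
  have Psq: "sq_integrable M P" by (rule V_sq[OF P])
  have Rm: "?R n \<in> sets M" using E(1) by auto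
  have split: "(LINT x|M. (f x)\<^sup>2) = (LINT x|M. indicator (E n) x * (f x)\<^sup>2) + (LINT x|M. indicator (?R n) x * (f x)\<^sup>2)"
    if f: "sq_integrable M f" for f
  proof -
    have "(LINT x|M. (f x)\<^sup>2) = (LINT x|M. indicator (E n) x * (f x)\<^sup>2 + indicator (?R n) x * (f x)\<^sup>2)"
      by (intro Bochner_Integration.integral_cong) (auto simp: indicator_def)
    then show ?thesis using sq_integrable_indicator[OF f] E(1) Rm by simp
  qed
  have two: "(LINT x|M. indicator A x * (f x + g x)\<^sup>2) \<le> 2 * (LINT x|M. indicator A x * (f x)\<^sup>2) + 2 * (LINT x|M. indicator A x * (g x)\<^sup>2)"
    if f: "sq_integrable M f" and g: "sq_integrable M g" and A: "A \<in> sets M" for f g A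
  proof -
    have "(LINT x|M. indicator A x * (f x + g x)\<^sup>2) \<le> (LINT x|M. 2 * (indicator A x * (f x)\<^sup>2) + 2 * (indicator A x * (g x)\<^sup>2))"
    proof (rule Bochner_Integration.integral_mono)
      show "integrable M (\<lambda>x. indicator A x * (f x + g x)\<^sup>2)" by (rule sq_integrable_indicator[OF sq_integrable_add[OF f g] A])
      show "integrable M (\<lambda>x. 2 * (indicator A x * (f x)\<^sup>2) + 2 * (indicator A x * (g x)\<^sup>2))"
        by (intro Bochner_Integration.integrable_add integrable_mult_right sq_integrable_indicator f g A)
      fix x
      have "(f x + g x)\<^sup>2 \<le> 2 * (f x)\<^sup>2 + 2 * (g x)\<^sup>2" using sum_squares_bound[of "f x" "g x"] by (simp add: power2_sum)
      then show "indicator A x * (f x + g x)\<^sup>2 \<le> 2 * (indicator A x * (f x)\<^sup>2) + 2 * (indicator A x * (g x)\<^sup>2)"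
        by (auto simp: indicator_def)
    qed
    also have "\<dots> = 2 * (LINT x|M. indicator A x * (f x)\<^sup>2) + 2 * (LINT x|M. indicator A x * (g x)\<^sup>2)"
      using sq_integrable_indicator[OF f A] sq_integrable_indicator[OF g A] by simp
    finally show ?thesis .
  qed
  \<comment> \<open>\<open>P\<close> is replaced by its expansion \<open>Q\<close> in the
    orthonormal basis. Cauchy-Schwarz applied to the coefficients separates them from the basis, and
    their squares sum to the mass of \<open>Q\<close>.\<close>
  have P_tail: "(LINT x|M. indicator (?R n) x * (P x)\<^sup>2) \<le> \<kappa> * (LINT x|M. (P x)\<^sup>2)"
  proof -
    obtain c where c: "AE x in M. P x = (\<Sum>j<k. c j * e j x)" using sp[OF P] by blast
    define Q where "Q x = (\<Sum>j<k. c j * e j x)" for x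
    have QV: "Q \<in> V" unfolding Q_def by (rule lin_closed_sum[OF V_lin]) (use eV in auto)
    have cj: "(LINT x|M. Q x * e i x) = c i" if i: "i < k" for i
    proof -
      have "(LINT x|M. e i x * Q x) = (\<Sum>j<k. c j * (LINT x|M. e i x * e j x))"
        unfolding Q_def by (rule LINT_mult_sum) (auto intro: sq_integrable_mult V_sq eV i)
      also have "\<dots> = (\<Sum>j<k. if j = i then c i else 0)"
        using on i by (intro sum.cong) (auto simp: orthonormal_fun_def)
      finally show ?thesis using i by (simp add: mult.commute)
    qed
    have "(LINT x|M. (Q x)\<^sup>2) = (LINT x|M. Q x * (\<Sum>j<k. c j * e j x))"
      by (simp add: Q_def power2_eq_square)
    also have "\<dots> = (\<Sum>j<k. c j * (LINT x|M. Q x * e j x))"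
      by (rule LINT_mult_sum) (auto intro: sq_integrable_mult V_sq eV QV)
    also have "\<dots> = (\<Sum>j<k. (c j)\<^sup>2)" using cj by (simp add: power2_eq_square)
    finally have Q2: "(LINT x|M. (Q x)\<^sup>2) = (\<Sum>j<k. (c j)\<^sup>2)" .
    have "(LINT x|M. indicator (?R n) x * (Q x)\<^sup>2) \<le> (LINT x|M. (\<Sum>j<k. (c j)\<^sup>2) * (\<Sum>j<k. indicator (?R n) x * (e j x)\<^sup>2))"
    proof (rule Bochner_Integration.integral_mono)
      show "integrable M (\<lambda>x. indicator (?R n) x * (Q x)\<^sup>2)" by (rule sq_integrable_indicator[OF V_sq[OF QV] Rm])
      show "integrable M (\<lambda>x. (\<Sum>j<k. (c j)\<^sup>2) * (\<Sum>j<k. indicator (?R n) x * (e j x)\<^sup>2))"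
        by (intro integrable_mult_right Bochner_Integration.integrable_sum sq_integrable_indicator V_sq eV Rm) auto
      fix x
      have "(Q x)\<^sup>2 \<le> (\<Sum>j<k. (c j)\<^sup>2) * (\<Sum>j<k. (e j x)\<^sup>2)"
        unfolding Q_def by (rule Cauchy_Schwarz_ineq_sum)
      then show "indicator (?R n) x * (Q x)\<^sup>2 \<le> (\<Sum>j<k. (c j)\<^sup>2) * (\<Sum>j<k. indicator (?R n) x * (e j x)\<^sup>2)"
        by (auto simp: indicator_def)
    qed
    also have "\<dots> = (\<Sum>j<k. (c j)\<^sup>2) * (\<Sum>j<k. LINT x|M. indicator (?R n) x * (e j x)\<^sup>2)"
    proof -
      have "(LINT x|M. (\<Sum>j<k. indicator (?R n) x * (e j x)\<^sup>2)) = (\<Sum>j<k. LINT x|M. indicator (?R n) x * (e j x)\<^sup>2)"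
        by (rule Bochner_Integration.integral_sum) (intro sq_integrable_indicator V_sq eV Rm, simp)
      then show ?thesis by (simp only: integral_mult_right_zero)
    qed
    also have "\<dots> \<le> (\<Sum>j<k. (c j)\<^sup>2) * \<kappa>" by (intro mult_left_mono e_tail sum_nonneg) auto
    finally have Qt: "(LINT x|M. indicator (?R n) x * (Q x)\<^sup>2) \<le> \<kappa> * (LINT x|M. (Q x)\<^sup>2)" by (simp add: Q2 mult.commute)
    have [measurable]: "P \<in> borel_measurable M" "Q \<in> borel_measurable M"
      using V_sq[OF P] V_sq[OF QV] by (auto simp: sq_integrable_def)
    note [measurable] = Rm
    have ae: "AE x in M. P x = Q x" using c by (simp add: Q_def)
    have "(LINT x|M. indicator (?R n) x * (P x)\<^sup>2) = (LINT x|M. indicator (?R n) x * (Q x)\<^sup>2)"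
      by (rule Bochner_Integration.integral_cong_AE) (use ae in \<open>measurable, auto elim: eventually_mono\<close>)
    moreover have "(LINT x|M. (P x)\<^sup>2) = (LINT x|M. (Q x)\<^sup>2)"
      by (rule Bochner_Integration.integral_cong_AE) (use ae in \<open>measurable, auto elim: eventually_mono\<close>)
    ultimately show ?thesis using Qt by simp
  qed
  \<comment> \<open>The tail carries at most half the mass of \<open>P\<close>, so the mass is at
    most twice that on \<open>E n\<close>, where \<open>P\<close> is close to \<open>u\<close>.
    Hence the bound does not depend on \<open>n\<close>.\<close>
  have P_bound: "(LINT x|M. (P x)\<^sup>2) \<le> 4 * (B + 1 + U)"
  proof -
    let ?p = "LINT x|M. (P x)\<^sup>2"
    have p0: "0 \<le> ?p" by simp
    have "?p \<le> (LINT x|M. indicator (E n) x * (P x)\<^sup>2) + \<kappa> * ?p" using split[OF Psq] P_tail by simp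
    moreover have "\<kappa> * ?p \<le> (1 / 2) * ?p" using \<kappa>(2) p0 by (intro mult_right_mono)
    ultimately have "?p \<le> 2 * (LINT x|M. indicator (E n) x * (P x)\<^sup>2)" by simp
    also have "(LINT x|M. indicator (E n) x * (P x)\<^sup>2) = (LINT x|M. indicator (E n) x * ((P x - u x) + u x)\<^sup>2)" by simp
    also have "\<dots> \<le> 2 * (LINT x|M. indicator (E n) x * (P x - u x)\<^sup>2) + 2 * (LINT x|M. indicator (E n) x * (u x)\<^sup>2)"
      by (rule two[OF sq_integrable_diff[OF Psq u] u E(1)])
    also have "(LINT x|M. indicator (E n) x * (P x - u x)\<^sup>2) = (LINT x|M. indicator (E n) x * (u x - P x)\<^sup>2)"
      by (simp add: power2_commute)
    also have "2 * (2 * (LINT x|M. indicator (E n) x * (u x - P x)\<^sup>2) + 2 * (LINT x|M. indicator (E n) x * (u x)\<^sup>2)) \<le> 4 * (B + 1 + U)"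
    proof -
      have *: "2 * (2 * a + 2 * y) \<le> 4 * (B + 1 + z)" if "a \<le> B + d" "z = y + c" "0 \<le> c" "d \<le> 1" for a y c z d :: real
      proof -
        have "a \<le> B + 1" "y \<le> z" using that by simp_all
        then have "4 * (a + y) \<le> 4 * ((B + 1) + z)" by (intro mult_left_mono add_mono) auto
        then show ?thesis by (simp add: algebra_simps)
      qed
      show ?thesis unfolding U_def by (rule *[OF PE split[OF u] nn \<delta>(2)])
    qed
    finally show ?thesis by simp
  qed
  have "(LINT x|M. (u x - q x)\<^sup>2) \<le> (LINT x|M. (u x - P x)\<^sup>2)" by (rule projection_best[OF u q P])
  also have "\<dots> = (LINT x|M. indicator (E n) x * (u x - P x)\<^sup>2) + (LINT x|M. indicator (?R n) x * (u x - P x)\<^sup>2)"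
    by (rule split[OF sq_integrable_diff[OF u Psq]])
  also have "\<dots> \<le> (B + \<delta>) + (2 * \<kappa> + 2 * (\<kappa> * (4 * (B + 1 + U))))"
  proof (rule add_mono[OF PE])
    have "(LINT x|M. indicator (?R n) x * (u x + - 1 * P x)\<^sup>2) \<le> 2 * (LINT x|M. indicator (?R n) x * (u x)\<^sup>2) + 2 * (LINT x|M. indicator (?R n) x * (- 1 * P x)\<^sup>2)"
      by (rule two[OF u sq_integrable_cmul[OF Psq] Rm])
    then have "(LINT x|M. indicator (?R n) x * (u x - P x)\<^sup>2) \<le> 2 * (LINT x|M. indicator (?R n) x * (u x)\<^sup>2) + 2 * (LINT x|M. indicator (?R n) x * (P x)\<^sup>2)"
      by simp
    moreover have "\<kappa> * (LINT x|M. (P x)\<^sup>2) \<le> \<kappa> * (4 * (B + 1 + U))" using P_bound \<kappa>(1) by (intro mult_left_mono) auto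
    ultimately show "(LINT x|M. indicator (?R n) x * (u x - P x)\<^sup>2) \<le> 2 * \<kappa> + 2 * (\<kappa> * (4 * (B + 1 + U)))"
      using u_tail P_tail by linarith
  qed
  also have "\<dots> = B + \<delta> + \<kappa> * (10 + 8 * (B + U))" by (simp add: algebra_simps)
  also have "\<dots> \<le> B + \<epsilon>" using \<delta>(3) \<kappa>(3) by simp
  finally show "(LINT x|M. (u x - q x)\<^sup>2) \<le> B + \<epsilon>" .
qed

end

subsection \<open>Mollifying a product\<close>

lemma conv_measurable:
  assumes [measurable]: "b \<in> borel_measurable borel" "\<eta> \<in> borel_measurable borel"
  shows "conv b \<eta> \<in> borel_measurable borel"
  unfolding conv_def[abs_def] by measurable

lemma sq_add_le: "(a + b)\<^sup>2 \<le> 2 * a\<^sup>2 + 2 * b\<^sup>2" for a b :: real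
  using sum_squares_bound[of a b] by (simp add: power2_sum)

lemma sum_sq_le:
  fixes f :: "'i \<Rightarrow> real"
  shows "(\<Sum>i\<in>I. f i)\<^sup>2 \<le> real (card I) * (\<Sum>i\<in>I. (f i)\<^sup>2)"
  using Cauchy_Schwarz_ineq_sum[of f "\<lambda>_. 1" I] by (simp add: mult.commute)

lemma ennreal_le_mult_sum:
  assumes "X \<le> c * (\<Sum>j\<in>J. f j)" "0 \<le> c" "\<And>j. j \<in> J \<Longrightarrow> 0 \<le> f j"
  shows "ennreal X \<le> ennreal c * (\<Sum>j\<in>J. ennreal (f j))"
proof -
  have "ennreal X \<le> ennreal (c * (\<Sum>j\<in>J. f j))" by (rule ennreal_leI[OF assms(1)])
  also have "\<dots> = ennreal c * ennreal (\<Sum>j\<in>J. f j)" by (rule ennreal_mult'[OF assms(2)])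
  also have "ennreal (\<Sum>j\<in>J. f j) = (\<Sum>j\<in>J. ennreal (f j))" using assms(3) by (simp add: sum_ennreal)
  finally show ?thesis .
qed

text \<open>The error is \<open>W * (V - v) + (W - w) * v\<close>, with capitals for the mollified
  functions. The first term is harmless since \<open>W\<close> obeys the bound \<open>wn\<close> of
  \<open>w\<close>. In the second, \<open>v\<close> is unbounded and \<open>W - w\<close> is small
  only in mean square, so \<open>v\<close> is truncated: the bounded part is paired with smallness
  of \<open>W - w\<close>, the rest with its boundedness.\<close>

lemma conv_product_tendsto:
  fixes bw bv :: "real ^ 'n::finite \<Rightarrow> real"
  assumes bw: "integrable lborel bw" "AE x in lborel. \<bar>bw x\<bar> \<le> wn"
    and bv: "integrable lborel bv" "(\<integral>\<^sup>+x. ennreal (\<bar>bv x\<bar> ^ 2) \<partial>lborel) < \<infinity>" and \<delta>: "0 < \<delta>"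
  shows "\<exists>\<epsilon>\<^sub>0>0. \<forall>\<epsilon> \<eta>. \<epsilon> \<le> \<epsilon>\<^sub>0 \<longrightarrow> mollifier \<epsilon> \<eta> \<longrightarrow>
    (\<integral>\<^sup>+x. ennreal ((conv bw \<eta> x * conv bv \<eta> x - bw x * bv x)\<^sup>2) * indicator (cball 0 R) x \<partial>lborel) \<le> ennreal \<delta>"
proof -
  have [measurable]: "bw \<in> borel_measurable borel" "bv \<in> borel_measurable borel" using bw bv by auto
  have [measurable]: "(cball 0 R :: (real ^ 'n) set) \<in> sets borel" by simp
  have wn: "0 \<le> wn"
  proof (rule ccontr)
    assume "\<not> 0 \<le> wn"
    then have "AE x in (lborel :: (real ^ 'n) measure). False" using bw(2) by (elim eventually_mono) auto
    then have "UNIV = ({} :: (real ^ 'n) set)"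
      by (intro open_null_imp_empty AE_completion) (auto elim: eventually_mono)
    then show False by simp
  qed
  have fin_bw: "(\<integral>\<^sup>+x. ennreal (\<bar>bw x\<bar> ^ 2) \<partial>lborel) < \<infinity>"
  proof -
    have "(\<integral>\<^sup>+x. ennreal (\<bar>bw x\<bar> ^ 2) \<partial>lborel) \<le> (\<integral>\<^sup>+x. ennreal wn * ennreal \<bar>bw x\<bar> \<partial>lborel)"
    proof (rule nn_integral_mono_AE)
      show "AE x in lborel. ennreal (\<bar>bw x\<bar> ^ 2) \<le> ennreal wn * ennreal \<bar>bw x\<bar>"
        using bw(2)
      proof eventually_elim
        case (elim x)
        then have "\<bar>bw x\<bar> ^ 2 \<le> wn * \<bar>bw x\<bar>" unfolding power2_eq_square by (intro mult_right_mono) auto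
        then show ?case using wn by (simp add: ennreal_mult[symmetric] ennreal_leI)
      qed
    qed
    also have "\<dots> = ennreal wn * (\<integral>\<^sup>+x. ennreal \<bar>bw x\<bar> \<partial>lborel)" by (rule nn_integral_cmult) measurable
    also have "\<dots> < \<infinity>" using bw(1) by (auto simp: integrable_iff_bounded ennreal_mult_less_top)
    finally show ?thesis .
  qed
  \<comment> \<open>The order of choices matters: \<open>d3\<close> determines the truncation height
    \<open>m\<close>, and only then can \<open>d2\<close> be chosen small against \<open>m\<close>
    squared. The terms with \<open>d1\<close>, \<open>d2\<close> and \<open>d3\<close> contribute at
    most a third of \<delta> each.\<close>
  define d3 where "d3 = \<delta> / (48 * (wn\<^sup>2 + 1))"
  have d3: "0 < d3" "16 * wn\<^sup>2 * d3 \<le> \<delta> / 3"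
  proof -
    have w: "0 < wn\<^sup>2 + 1" by (simp add: add_nonneg_pos)
    then show "0 < d3" using \<delta> by (simp add: d3_def)
    have "16 * wn\<^sup>2 * d3 \<le> 16 * (wn\<^sup>2 + 1) * d3" using \<open>0 < d3\<close> by (intro mult_right_mono mult_left_mono) auto
    also have "\<dots> = \<delta> / 3" using w by (simp add: d3_def field_simps)
    finally show "16 * wn\<^sup>2 * d3 \<le> \<delta> / 3" .
  qed
  obtain m :: nat where m: "(\<integral>\<^sup>+x. ennreal (\<bar>bv x - clamp_real (real m) (bv x)\<bar> ^ 2) \<partial>lborel) \<le> ennreal d3"
    using clamp_approx_Lp[OF _ _ bv(2) d3(1)] by auto
  define d1 where "d1 = \<delta> / (6 * (wn\<^sup>2 + 1))"
  have d1: "0 < d1" "2 * wn\<^sup>2 * d1 \<le> \<delta> / 3"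
  proof -
    have w: "0 < wn\<^sup>2 + 1" by (simp add: add_nonneg_pos)
    then show "0 < d1" using \<delta> by (simp add: d1_def)
    have "2 * wn\<^sup>2 * d1 \<le> 2 * (wn\<^sup>2 + 1) * d1" using \<open>0 < d1\<close> by (intro mult_right_mono mult_left_mono) auto
    also have "\<dots> = \<delta> / 3" using w by (simp add: d1_def field_simps)
    finally show "2 * wn\<^sup>2 * d1 \<le> \<delta> / 3" .
  qed
  define d2 where "d2 = \<delta> / (12 * ((real m)\<^sup>2 + 1))"
  have d2: "0 < d2" "4 * (real m)\<^sup>2 * d2 \<le> \<delta> / 3"
  proof -
    have w: "0 < (real m)\<^sup>2 + 1" by (simp add: add_nonneg_pos)
    then show "0 < d2" using \<delta> by (simp add: d2_def)
    have "4 * (real m)\<^sup>2 * d2 \<le> 4 * ((real m)\<^sup>2 + 1) * d2" using \<open>0 < d2\<close> by (intro mult_right_mono mult_left_mono) auto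
    also have "\<dots> = \<delta> / 3" using w by (simp add: d2_def field_simps)
    finally show "4 * (real m)\<^sup>2 * d2 \<le> \<delta> / 3" .
  qed
  obtain e1 where e1: "0 < e1" "\<And>\<epsilon> \<eta>. \<epsilon> \<le> e1 \<Longrightarrow> mollifier \<epsilon> \<eta> \<Longrightarrow>
     (\<integral>\<^sup>+x. ennreal (\<bar>conv bv \<eta> x - bv x\<bar> ^ 2) * indicator (cball 0 R) x \<partial>lborel) \<le> ennreal d1"
    using conv_tendsto_Lp[OF bv(1) _ bv(2) d1(1), of R] by auto
  obtain e2 where e2: "0 < e2" "\<And>\<epsilon> \<eta>. \<epsilon> \<le> e2 \<Longrightarrow> mollifier \<epsilon> \<eta> \<Longrightarrow>
     (\<integral>\<^sup>+x. ennreal (\<bar>conv bw \<eta> x - bw x\<bar> ^ 2) * indicator (cball 0 R) x \<partial>lborel) \<le> ennreal d2"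
    using conv_tendsto_Lp[OF bw(1) _ fin_bw d2(1), of R] by auto
  show ?thesis
  proof (intro exI[of _ "min e1 e2"] conjI allI impI)
    show "0 < min e1 e2" using e1 e2 by simp
    fix \<epsilon> and \<eta> :: "real ^ 'n \<Rightarrow> real"
    assume \<epsilon>: "\<epsilon> \<le> min e1 e2" and \<eta>: "mollifier \<epsilon> \<eta>"
    have \<eta>m: "\<eta> \<in> borel_measurable borel" using mollifier_measurable[OF \<eta>] .
    have [measurable]: "conv bw \<eta> \<in> borel_measurable borel" "conv bv \<eta> \<in> borel_measurable borel"
      by (auto intro!: conv_measurable \<eta>m)
    have [measurable]: "clamp_real m \<in> borel_measurable borel"
      by (rule borel_measurable_continuous_onI[OF continuous_clamp_real])
    have w\<epsilon>: "\<bar>conv bw \<eta> x\<bar> \<le> wn" for x by (rule conv_bounded[OF \<eta> bw(2)]) measurable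
    let ?I = "indicator (cball 0 R) :: real ^ 'n \<Rightarrow> ennreal"
    have "(\<integral>\<^sup>+x. ennreal ((conv bw \<eta> x * conv bv \<eta> x - bw x * bv x)\<^sup>2) * ?I x \<partial>lborel) \<le>
      (\<integral>\<^sup>+x. (ennreal (2 * wn\<^sup>2) * (ennreal (\<bar>conv bv \<eta> x - bv x\<bar> ^ 2) * ?I x)
         + ennreal (4 * (real m)\<^sup>2) * (ennreal (\<bar>conv bw \<eta> x - bw x\<bar> ^ 2) * ?I x))
         + ennreal (16 * wn\<^sup>2) * ennreal (\<bar>bv x - clamp_real m (bv x)\<bar> ^ 2) \<partial>lborel)"
    proof (rule nn_integral_mono_AE)
      show "AE x in lborel. ennreal ((conv bw \<eta> x * conv bv \<eta> x - bw x * bv x)\<^sup>2) * ?I x \<le>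
         (ennreal (2 * wn\<^sup>2) * (ennreal (\<bar>conv bv \<eta> x - bv x\<bar> ^ 2) * ?I x)
         + ennreal (4 * (real m)\<^sup>2) * (ennreal (\<bar>conv bw \<eta> x - bw x\<bar> ^ 2) * ?I x))
         + ennreal (16 * wn\<^sup>2) * ennreal (\<bar>bv x - clamp_real m (bv x)\<bar> ^ 2)"
        using bw(2)
      proof eventually_elim
        case (elim x)
        define W where "W = conv bw \<eta> x"
        define w where "w = bw x"
        define V where "V = conv bv \<eta> x"
        define v where "v = bv x"
        define c where "c = clamp_real m v"
        have W: "\<bar>W\<bar> \<le> wn" "\<bar>w\<bar> \<le> wn" "\<bar>c\<bar> \<le> real m"
          using w\<epsilon>[of x] elim clamp_real_bound[of m v] by (auto simp: W_def w_def c_def)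
        have "(W * V - w * v)\<^sup>2 = (W * (V - v) + (W - w) * v)\<^sup>2" by (simp add: algebra_simps)
        also have "\<dots> \<le> 2 * (W * (V - v))\<^sup>2 + 2 * ((W - w) * v)\<^sup>2" by (rule sq_add_le)
        also have "((W - w) * v)\<^sup>2 = ((W - w) * c + (W - w) * (v - c))\<^sup>2" by (simp add: algebra_simps)
        also have "\<dots> \<le> 2 * ((W - w) * c)\<^sup>2 + 2 * ((W - w) * (v - c))\<^sup>2" by (rule sq_add_le)
        finally have "(W * V - w * v)\<^sup>2 \<le> 2 * (W\<^sup>2 * (V - v)\<^sup>2) + 4 * (c\<^sup>2 * (W - w)\<^sup>2) + 4 * ((W - w)\<^sup>2 * (v - c)\<^sup>2)"
          by (simp add: power_mult_distrib mult_ac)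
        also have "\<dots> \<le> 2 * (wn\<^sup>2 * (V - v)\<^sup>2) + 4 * ((real m)\<^sup>2 * (W - w)\<^sup>2) + 4 * ((2 * wn)\<^sup>2 * (v - c)\<^sup>2)"
        proof (intro add_mono mult_left_mono mult_right_mono)
          show "W\<^sup>2 \<le> wn\<^sup>2" using power_mono[OF W(1), of 2] by simp
          show "c\<^sup>2 \<le> (real m)\<^sup>2" using power_mono[OF W(3), of 2] by simp
          have "\<bar>W - w\<bar> \<le> 2 * wn" using W by linarith
          then show "(W - w)\<^sup>2 \<le> (2 * wn)\<^sup>2" using power_mono[of "\<bar>W - w\<bar>" "2 * wn" 2] by simp
        qed auto
        finally have "(W * V - w * v)\<^sup>2 \<le> (2 * wn\<^sup>2) * \<bar>V - v\<bar>\<^sup>2 + (4 * (real m)\<^sup>2) * \<bar>W - w\<bar>\<^sup>2 + (16 * wn\<^sup>2) * \<bar>v - c\<bar>\<^sup>2"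
          by (simp add: power_mult_distrib)
        then have "ennreal ((W * V - w * v)\<^sup>2) \<le> ennreal ((2 * wn\<^sup>2) * \<bar>V - v\<bar>\<^sup>2 + (4 * (real m)\<^sup>2) * \<bar>W - w\<bar>\<^sup>2 + (16 * wn\<^sup>2) * \<bar>v - c\<bar>\<^sup>2)"
          by (rule ennreal_leI)
        also have "\<dots> = ennreal (2 * wn\<^sup>2) * ennreal (\<bar>V - v\<bar>\<^sup>2) + ennreal (4 * (real m)\<^sup>2) * ennreal (\<bar>W - w\<bar>\<^sup>2) + ennreal (16 * wn\<^sup>2) * ennreal (\<bar>v - c\<bar>\<^sup>2)"
          by (subst ennreal_plus; (subst ennreal_plus)?; simp add: ennreal_mult)
        finally show ?case
          unfolding W_def w_def V_def v_def c_def by (auto simp: indicator_def)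
      qed
    qed
    also have "\<dots> = ennreal (2 * wn\<^sup>2) * (\<integral>\<^sup>+x. ennreal (\<bar>conv bv \<eta> x - bv x\<bar> ^ 2) * ?I x \<partial>lborel)
         + ennreal (4 * (real m)\<^sup>2) * (\<integral>\<^sup>+x. ennreal (\<bar>conv bw \<eta> x - bw x\<bar> ^ 2) * ?I x \<partial>lborel)
         + ennreal (16 * wn\<^sup>2) * (\<integral>\<^sup>+x. ennreal (\<bar>bv x - clamp_real m (bv x)\<bar> ^ 2) \<partial>lborel)"
    proof -
      have m1: "(\<lambda>x. ennreal (\<bar>conv bv \<eta> x - bv x\<bar> ^ 2) * ?I x) \<in> borel_measurable lborel" by measurable
      have m2: "(\<lambda>x. ennreal (\<bar>conv bw \<eta> x - bw x\<bar> ^ 2) * ?I x) \<in> borel_measurable lborel" by measurable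
      have m3: "(\<lambda>x. ennreal (\<bar>bv x - clamp_real m (bv x)\<bar> ^ 2)) \<in> borel_measurable lborel" by measurable
      show ?thesis by (simp add: nn_integral_add nn_integral_cmult m1 m2 m3)
    qed
    also have "\<dots> \<le> ennreal (2 * wn\<^sup>2) * ennreal d1 + ennreal (4 * (real m)\<^sup>2) * ennreal d2 + ennreal (16 * wn\<^sup>2) * ennreal d3"
      using \<epsilon> by (intro add_mono mult_left_mono m e1(2)[OF _ \<eta>] e2(2)[OF _ \<eta>]) auto
    also have "\<dots> = ennreal (2 * wn\<^sup>2 * d1 + 4 * (real m)\<^sup>2 * d2 + 16 * wn\<^sup>2 * d3)"
      using d1(1) d2(1) d3(1) by (simp add: ennreal_mult[symmetric] ennreal_plus[symmetric] del: ennreal_plus)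
    also have "\<dots> \<le> ennreal \<delta>" using d1(2) d2(2) d3(2) by (intro ennreal_leI) linarith
    finally show "(\<integral>\<^sup>+x. ennreal ((conv bw \<eta> x * conv bv \<eta> x - bw x * bv x)\<^sup>2) * ?I x \<partial>lborel) \<le> ennreal \<delta>" .
  qed
qed

lemma conv_product_sum_tendsto:
  fixes bw bv :: "'m::finite \<Rightarrow> real ^ 'n::finite \<Rightarrow> real"
  assumes bw: "\<And>j. integrable lborel (bw j)" "\<And>j. AE x in lborel. \<bar>bw j x\<bar> \<le> wn"
    and bv: "\<And>j. integrable lborel (bv j)" "\<And>j. (\<integral>\<^sup>+x. ennreal (\<bar>bv j x\<bar> ^ 2) \<partial>lborel) < \<infinity>" and \<delta>: "0 < \<delta>"
  shows "\<exists>\<epsilon>\<^sub>0>0. \<forall>\<epsilon> \<eta>. \<epsilon> \<le> \<epsilon>\<^sub>0 \<longrightarrow> mollifier \<epsilon> \<eta> \<longrightarrow>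
    (\<integral>\<^sup>+x. ennreal (((\<Sum>j\<in>UNIV. conv (bw j) \<eta> x * conv (bv j) \<eta> x) - (\<Sum>j\<in>UNIV. bw j x * bv j x))\<^sup>2) * indicator (cball 0 R) x \<partial>lborel) \<le> ennreal \<delta>"
proof -
  \<comment> \<open>One factor of the number of summands is lost in Cauchy-Schwarz for the sum,
    another in adding up the integrals.\<close>
  define d where "d = \<delta> / (real CARD('m))\<^sup>2"
  have d: "0 < d" using \<delta> by (simp add: d_def)
  have [measurable]: "bw j \<in> borel_measurable borel" "bv j \<in> borel_measurable borel" for j using bw bv by auto
  have [measurable]: "(cball 0 R :: (real ^ 'n) set) \<in> sets borel" by simp
  define Q where "Q j e \<longleftrightarrow> (\<forall>\<epsilon> \<eta>. \<epsilon> \<le> e \<longrightarrow> mollifier \<epsilon> \<eta> \<longrightarrow>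
    (\<integral>\<^sup>+x. ennreal ((conv (bw j) \<eta> x * conv (bv j) \<eta> x - bw j x * bv j x)\<^sup>2) * indicator (cball 0 R) x \<partial>lborel) \<le> ennreal d)" for j e
  have "\<exists>e>0. Q j e" for j
    unfolding Q_def by (rule conv_product_tendsto[OF bw bv d])
  then obtain e where e0: "\<And>j. 0 < e j \<and> Q j (e j)" by metis
  have e: "0 < e j" "\<epsilon> \<le> e j \<Longrightarrow> mollifier \<epsilon> \<eta> \<Longrightarrow>
    (\<integral>\<^sup>+x. ennreal ((conv (bw j) \<eta> x * conv (bv j) \<eta> x - bw j x * bv j x)\<^sup>2) * indicator (cball 0 R) x \<partial>lborel) \<le> ennreal d" for j \<epsilon> \<eta>
    using e0[of j] unfolding Q_def by auto
  show ?thesis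
  proof (intro exI[of _ "Min (range e)"] conjI allI impI)
    show "0 < Min (range e)" using e(1) by simp
    fix \<epsilon> and \<eta> :: "real ^ 'n \<Rightarrow> real"
    assume \<epsilon>: "\<epsilon> \<le> Min (range e)" and \<eta>: "mollifier \<epsilon> \<eta>"
    have [measurable]: "conv (bw j) \<eta> \<in> borel_measurable borel" "conv (bv j) \<eta> \<in> borel_measurable borel" for j
      by (auto intro!: conv_measurable mollifier_measurable[OF \<eta>])
    let ?D = "\<lambda>j x. conv (bw j) \<eta> x * conv (bv j) \<eta> x - bw j x * bv j x"
    have "(\<integral>\<^sup>+x. ennreal (((\<Sum>j\<in>UNIV. conv (bw j) \<eta> x * conv (bv j) \<eta> x) - (\<Sum>j\<in>UNIV. bw j x * bv j x))\<^sup>2) * indicator (cball 0 R) x \<partial>lborel)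
       \<le> (\<integral>\<^sup>+x. ennreal (real CARD('m)) * (\<Sum>j\<in>UNIV. ennreal ((?D j x)\<^sup>2) * indicator (cball 0 R) x) \<partial>lborel)"
    proof (rule nn_integral_mono)
      fix x
      have "((\<Sum>j\<in>UNIV. conv (bw j) \<eta> x * conv (bv j) \<eta> x) - (\<Sum>j\<in>UNIV. bw j x * bv j x))\<^sup>2 \<le> real CARD('m) * (\<Sum>j\<in>UNIV. (?D j x)\<^sup>2)"
        unfolding sum_subtractf[symmetric] by (rule sum_sq_le)
      then have "ennreal (((\<Sum>j\<in>UNIV. conv (bw j) \<eta> x * conv (bv j) \<eta> x) - (\<Sum>j\<in>UNIV. bw j x * bv j x))\<^sup>2) \<le> ennreal (real CARD('m)) * (\<Sum>j\<in>UNIV. ennreal ((?D j x)\<^sup>2))"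
        by (rule ennreal_le_mult_sum) auto
      then show "ennreal (((\<Sum>j\<in>UNIV. conv (bw j) \<eta> x * conv (bv j) \<eta> x) - (\<Sum>j\<in>UNIV. bw j x * bv j x))\<^sup>2) * indicator (cball 0 R) x
         \<le> ennreal (real CARD('m)) * (\<Sum>j\<in>UNIV. ennreal ((?D j x)\<^sup>2) * indicator (cball 0 R) x)"
        by (cases "x \<in> cball 0 R") (auto simp: indicator_def)
    qed
    also have "\<dots> = ennreal (real CARD('m)) * (\<Sum>j\<in>UNIV. \<integral>\<^sup>+x. ennreal ((?D j x)\<^sup>2) * indicator (cball 0 R) x \<partial>lborel)"
    proof -
      have mD: "(\<lambda>x. ennreal ((?D j x)\<^sup>2) * indicator (cball 0 R) x) \<in> borel_measurable lborel" for j
        by measurable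
      have mS: "(\<lambda>x. \<Sum>j\<in>UNIV. ennreal ((?D j x)\<^sup>2) * indicator (cball 0 R) x) \<in> borel_measurable lborel"
        by measurable
      show ?thesis unfolding nn_integral_cmult[OF mS] by (subst nn_integral_sum[OF mD]) (rule refl)
    qed
    also have "\<dots> \<le> ennreal (real CARD('m)) * (\<Sum>j\<in>(UNIV::'m set). ennreal d)"
      using \<epsilon> by (intro mult_left_mono sum_mono e(2)[OF _ \<eta>]) auto
    also have "\<dots> = ennreal (real CARD('m) * (real CARD('m) * d))"
      using d by (simp add: ennreal_mult' ennreal_of_nat_eq_real_of_nat)
    also have "\<dots> = ennreal \<delta>" by (simp add: d_def power2_eq_square)
    finally show "(\<integral>\<^sup>+x. ennreal (((\<Sum>j\<in>UNIV. conv (bw j) \<eta> x * conv (bv j) \<eta> x) - (\<Sum>j\<in>UNIV. bw j x * bv j x))\<^sup>2) * indicator (cball 0 R) x \<partial>lborel) \<le> ennreal \<delta>" .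
  qed
qed

subsection \<open>Approximation by mapped polynomials on a compact part of the element\<close>

lemma jacobian_continuous:
  fixes \<Phi> :: "real ^ 'n::finite \<Rightarrow> real ^ 'n"
  assumes "smooth_on U \<Phi>" "S \<subseteq> U"
  shows "continuous_on S (jacobian \<Phi>)"
proof -
  have "continuous_on S (\<lambda>x. partial j \<Phi> x $ i)" for i j
    using assms smooth_on_continuous[OF smooth_on_foldr[OF assms(1), of "[j]"]]
    by (auto intro!: continuous_on_component intro: continuous_on_subset)
  then have "continuous_on S (\<lambda>x. \<Sum>p | p permutes (UNIV :: 'n set). of_int (sign p) * (\<Prod>i\<in>UNIV. partial (p i) \<Phi> x $ i))"
    by (intro continuous_on_sum continuous_on_mult continuous_on_const continuous_on_prod)
  then show ?thesis unfolding jacobian_def[abs_def] det_def by (simp add: matrix_def partial_def)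
qed

lemma smooth_on_has_derivative:
  fixes \<Phi> :: "real ^ 'n::finite \<Rightarrow> real ^ 'm::finite"
  assumes "smooth_on U \<Phi>" "x \<in> U"
  shows "(\<Phi> has_derivative frechet_derivative \<Phi> (at x)) (at x)"
proof -
  have "\<Phi> differentiable_on U" "open U" using assms(1) unfolding smooth_on_def by (metis foldr_Nil id_apply)+
  then show ?thesis using assms(2) frechet_derivative_works differentiable_on_openD by blast
qed

lemma change_of_variables_jacobian:
  fixes \<Phi> :: "real ^ 'n::finite \<Rightarrow> real ^ 'n" and F :: "real ^ 'n \<Rightarrow> real"
  assumes \<Phi>: "smooth_on U \<Phi>" "K \<subseteq> U" and K: "compact K" "inj_on \<Phi> K" and J: "\<And>x. x \<in> K \<Longrightarrow> 0 < jacobian \<Phi> x"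
    and F: "continuous_on (\<Phi> ` K) F" "\<And>y. y \<in> \<Phi> ` K \<Longrightarrow> 0 \<le> F y"
  shows "(\<integral>\<^sup>+y. ennreal (F y) * indicator (\<Phi> ` K) y \<partial>lborel) =
         (\<integral>\<^sup>+x. ennreal (jacobian \<Phi> x * F (\<Phi> x)) * indicator K x \<partial>lborel)"
proof -
  have "(\<integral>\<^sup>+y. ennreal (F y) * indicator (\<Phi> ` K) y \<partial>lborel) =
    (\<integral>\<^sup>+x. ennreal (\<bar>det (matrix (frechet_derivative \<Phi> (at x)))\<bar> * F (\<Phi> x)) * indicator K x \<partial>lborel)"
  proof (rule change_of_variables_compact[OF K(1) _ K(2) F])
    show "(\<Phi> has_derivative frechet_derivative \<Phi> (at x)) (at x within K)" if "x \<in> K" for x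
      using smooth_on_has_derivative[OF \<Phi>(1)] that \<Phi>(2) by (auto intro: has_derivative_at_withinI)
    show "continuous_on K (\<lambda>x. \<bar>det (matrix (frechet_derivative \<Phi> (at x)))\<bar>)"
      using jacobian_continuous[OF \<Phi>] unfolding jacobian_def[abs_def] by (intro continuous_intros)
  qed
  also have "\<dots> = (\<integral>\<^sup>+x. ennreal (jacobian \<Phi> x * F (\<Phi> x)) * indicator K x \<partial>lborel)"
    using J by (intro nn_integral_cong) (auto simp: indicator_def jacobian_def less_imp_le)
  finally show ?thesis .
qed

text \<open>The first factor counts the lists of length \<open>N + 1\<close> summed in
  \<open>absD\<close>, the product is the chain-rule constant of \<open>bd_compose\<close>, and the
  last factor combines the Leibniz constant of \<open>bd_mult\<close> with the number of summands in
  a row of the matrix-vector product.\<close>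

definition chain_const :: "nat \<Rightarrow> nat \<Rightarrow> real \<Rightarrow> real" where
  "chain_const d N C = real (d ^ Suc N) * (\<Prod>l<Suc N. (1 + real d * 2 ^ l * C)) * (real d * 2 ^ Suc N)"

lemma chain_const_nonneg: "0 \<le> C \<Longrightarrow> 0 \<le> chain_const d N C"
  unfolding chain_const_def by (intro mult_nonneg_nonneg prod_nonneg) auto

text \<open>The sum of products is bounded on the physical element with weight 1 and then pulled
  back by \<open>bd_compose\<close>, which brings the powers of \<open>h\<close>. The bound
  \<open>g\<close> is for the single point \<open>\<Phi> x\<close>: derivatives of \<open>v\<close>
  are controlled in mean square only, so it is integrated afterwards.\<close>

lemma absD_product_compose:
  fixes \<Phi> :: "real ^ 'n::finite \<Rightarrow> real ^ 'n" and w v :: "'n \<Rightarrow> real ^ 'n \<Rightarrow> real"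
  assumes \<Phi>: "smooth_on O1 \<Phi>" and x: "x \<in> O1" and h: "0 < h" and C: "0 \<le> C"
    and bound: "\<And>is j. 1 \<le> length is \<Longrightarrow> length is \<le> Suc N \<Longrightarrow> \<bar>foldr partial is (\<lambda>z. \<Phi> z $ j) x\<bar> \<le> C * h ^ length is"
    and wv: "\<And>j. smooth_on UNIV (w j)" "\<And>j. smooth_on UNIV (v j)"
    and wb: "\<And>is j. length is \<le> Suc N \<Longrightarrow> \<bar>foldr partial is (w j) (\<Phi> x)\<bar> \<le> wn"
    and vb: "\<And>is j. length is \<le> Suc N \<Longrightarrow> \<bar>foldr partial is (v j) (\<Phi> x)\<bar> \<le> g"
  shows "absD (Suc N) (\<lambda>x. \<Sum>j\<in>UNIV. w j (\<Phi> x) * v j (\<Phi> x)) x \<le> chain_const CARD('n) N C * h ^ Suc N * wn * g"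
proof -
  define u where "u z = (\<Sum>j\<in>UNIV. w j z * v j z)" for z
  have ck: "ck UNIV k (w j)" "ck UNIV k (v j)" for k j using wv by (auto simp: smooth_on_ck)
  have O1: "open O1" using \<Phi> by (simp add: smooth_on_def)
  have ck\<Phi>: "ck O1 k (\<lambda>z. \<Phi> z $ j)" for k j using smooth_on_vec_nth[OF \<Phi>] by (simp add: smooth_on_ck)
  have bj: "bd 1 (\<Phi> x) (Suc N) (2 ^ Suc N * (wn * g)) (0 + 0) (\<lambda>z. w j z * v j z)" for j
    by (rule bd_mult[where U = UNIV]) (use ck wb vb in \<open>auto simp: bd_foldr simp del: bd.simps ck.simps\<close>)
  have "bd 1 (\<Phi> x) (Suc N) (real (card (UNIV :: 'n set)) * (2 ^ Suc N * (wn * g))) 0 u"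
    unfolding u_def
    by (rule bd_sum[where U = UNIV]) (use bj ck_mult[OF open_UNIV ck] in \<open>auto simp del: bd.simps ck.simps\<close>)
  then have bu: "bd 1 (\<Phi> x) (Suc N) (real CARD('n) * (2 ^ Suc N * (wn * g))) 0 u" .
  define B where "B = (\<Prod>l<Suc N. (1 + real CARD('n) * 2 ^ l * C)) * (real CARD('n) * (2 ^ Suc N * (wn * g)))"
  have ckw: "ck UNIV (Suc N) u" unfolding u_def by (intro ck_sum ck_mult ck) auto
  have "bd h x (Suc N) B 0 (\<lambda>z. u (\<Phi> z))"
    unfolding B_def
  proof (rule bd_compose[OF O1 x open_UNIV _ h C ck\<Phi> ckw bu])
    show "bd h x (Suc N - 1) C 1 (partial i (\<lambda>z. \<Phi> z $ j))" for i j
      unfolding bd_foldr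
    proof (intro allI impI)
      fix "is" :: "'n list" assume "length is \<le> Suc N - 1"
      then show "\<bar>foldr partial is (partial i (\<lambda>z. \<Phi> z $ j)) x\<bar> \<le> C * h ^ (1 + length is)"
        using bound[of "is @ [i]" j] by simp
    qed
  qed simp
  then have le: "\<bar>foldr partial is (\<lambda>z. u (\<Phi> z)) x\<bar> \<le> B * h ^ Suc N" if "length is = Suc N" for "is"
    using that unfolding bd_foldr by (metis add_0 order_refl)
  have "absD (Suc N) (\<lambda>z. u (\<Phi> z)) x \<le> (\<Sum>is\<in>{is :: 'n list. length is = Suc N}. B * h ^ Suc N)"
    unfolding absD_def by (intro sum_mono le) simp
  also have "\<dots> = real (card {is :: 'n list. length is = Suc N}) * (B * h ^ Suc N)" by simp
  also have "card {is :: 'n list. length is = Suc N} = CARD('n) ^ Suc N"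
    using card_lists_length_eq[of "UNIV :: 'n set" "Suc N"] by simp
  finally show ?thesis
    unfolding u_def B_def chain_const_def by (simp add: mult_ac del: power_Suc prod.lessThan_Suc)
qed

text \<open>The outer 2 pays for splitting off the mollification error,
  \<open>\<rho> ^ (2 * Suc N) * 2 ^ d\<close> comes from \<open>smooth_poly_approx\<close>, and the
  last square counts the pairs of a component and a list over which derivatives of \<open>v\<close>
  are summed. The lists are counted over \<open>{..<d}\<close> so that the constant is a function of
  numbers rather than of an index type.\<close>

definition local_const :: "nat \<Rightarrow> nat \<Rightarrow> real \<Rightarrow> real \<Rightarrow> real" where
  "local_const d N C \<rho> = 2 * (\<rho> ^ (2 * Suc N) * 2 ^ d * (chain_const d N C)\<^sup>2 * (real d * real (card {is :: nat list. set is \<subseteq> {..<d} \<and> length is \<le> Suc N}))\<^sup>2)"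

lemma card_short_lists:
  "card {is :: 'n::finite list. length is \<le> k} = card {is :: nat list. set is \<subseteq> {..<CARD('n)} \<and> length is \<le> k}"
proof -
  have "card {is :: 'n list. set is \<subseteq> UNIV \<and> length is \<le> k} = (\<Sum>i\<le>k. CARD('n) ^ i)"
    by (rule card_lists_length_le) simp
  moreover have "card {is :: nat list. set is \<subseteq> {..<CARD('n)} \<and> length is \<le> k} = (\<Sum>i\<le>k. card {..<CARD('n)} ^ i)"
    by (rule card_lists_length_le) simp
  ultimately show ?thesis by simp
qed

lemma finite_short_lists: "finite {is :: 'n::finite list. length is \<le> k}"
  using finite_lists_length_le[of "UNIV :: 'n set" k] by simp

text \<open>The mollification radius is chosen after \<open>K\<close> and \<delta>, but the
  resulting bound does not contain it: mollification increases neither the essential bound of the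
  weights nor the \<open>L2\<close> norms of the derivatives of \<open>v\<close>. Of
  \<open>K\<close> only the diameter bound \<rho> enters, which makes the estimate uniform over an
  exhaustion.\<close>

lemma local_approximation:
  fixes \<Phi> :: "real ^ 'n::finite \<Rightarrow> real ^ 'n" and bw bv :: "'n \<Rightarrow> 'n list \<Rightarrow> real ^ 'n \<Rightarrow> real"
  assumes \<Phi>: "smooth_on O1 \<Phi>" and S: "O1 \<subseteq> S" "inj_on \<Phi> S"
    and K: "compact K" "convex K" "K \<subseteq> O1" "emeasure lborel K \<noteq> 0"
    and \<rho>: "\<And>x y. x \<in> K \<Longrightarrow> y \<in> K \<Longrightarrow> norm (x - y) \<le> \<rho>" "0 \<le> \<rho>"
    and h: "0 < h" and C: "0 \<le> C"
    and bound: "\<And>x is j. x \<in> O1 \<Longrightarrow> 1 \<le> length is \<Longrightarrow> length is \<le> Suc N \<Longrightarrow> \<bar>foldr partial is (\<lambda>z. \<Phi> z $ j) x\<bar> \<le> C * h ^ length is"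
    and J: "\<And>x. x \<in> O1 \<Longrightarrow> 0 < jacobian \<Phi> x" "\<And>x. x \<in> O1 \<Longrightarrow> sqrt (jacobian \<Phi> x) \<le> L1"
      "\<And>x. x \<in> O1 \<Longrightarrow> 1 / sqrt (jacobian \<Phi> x) \<le> L2" "0 \<le> L1" "0 \<le> L2"
    and V: "open V" "\<Phi> ` O1 \<subseteq> V"
    and bw: "\<And>j is. length is \<le> Suc N \<Longrightarrow> integrable lborel (bw j is)" "\<And>j is. length is \<le> Suc N \<Longrightarrow> AE x in lborel. \<bar>bw j is x\<bar> \<le> wn" "0 \<le> wn"
      "\<And>j is \<epsilon> \<eta> z. length is \<le> Suc N \<Longrightarrow> mollifier \<epsilon> \<eta> \<Longrightarrow> cball z \<epsilon> \<subseteq> V \<Longrightarrow> foldr partial is (conv (bw j []) \<eta>) z = conv (bw j is) \<eta> z"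
    and bv: "\<And>j is. length is \<le> Suc N \<Longrightarrow> integrable lborel (bv j is)" "\<And>j is. length is \<le> Suc N \<Longrightarrow> integrable lborel (\<lambda>x. (bv j is x)\<^sup>2)"
      "\<And>j is. length is \<le> Suc N \<Longrightarrow> (LINT x|lborel. (bv j is x)\<^sup>2) \<le> sv\<^sup>2"
      "\<And>j is \<epsilon> \<eta> z. length is \<le> Suc N \<Longrightarrow> mollifier \<epsilon> \<eta> \<Longrightarrow> cball z \<epsilon> \<subseteq> V \<Longrightarrow> foldr partial is (conv (bv j []) \<eta>) z = conv (bv j is) \<eta> z"
    and \<delta>: "0 < \<delta>"
  shows "\<exists>p\<in>polys N. (\<integral>\<^sup>+y. ennreal (((\<Sum>j\<in>UNIV. bw j [] y * bv j [] y) - p (inv_into S \<Phi> y))\<^sup>2) * indicator (\<Phi> ` K) y \<partial>lborel)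
     \<le> ennreal (local_const CARD('n) N C \<rho> * (h ^ Suc N * L1 * L2 * wn * sv)\<^sup>2 + \<delta>)"
proof -
  define T where "T = {is :: 'n list. length is \<le> Suc N}"
  have T: "finite T" "[] \<in> T" by (auto simp: T_def finite_short_lists)
  define q where "q = real CARD('n) * real (card T)"
  have O1: "open O1" using \<Phi> by (simp add: smooth_on_def)
  have injK: "inj_on \<Phi> K" using S K(3) by (meson inj_on_subset order_trans)
  have \<Phi>c: "continuous_on K \<Phi>" using smooth_on_continuous[OF \<Phi>] K(3) continuous_on_subset by blast
  have \<Phi>K: "compact (\<Phi> ` K)" by (rule compact_continuous_image[OF \<Phi>c K(1)])
  then have [measurable]: "\<Phi> ` K \<in> sets borel" by (rule borel_compact)
  have [measurable]: "K \<in> sets borel" using K(1) by (rule borel_compact)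
  have bv2: "(\<integral>\<^sup>+x. ennreal (\<bar>bv j is x\<bar> ^ 2) \<partial>lborel) \<le> ennreal (sv\<^sup>2)" if "length is \<le> Suc N" for j "is"
    using bv(2,3)[OF that] by (simp add: nn_integral_eq_integral ennreal_leI)
  have bv2fin: "(\<integral>\<^sup>+x. ennreal (\<bar>bv j [] x\<bar> ^ 2) \<partial>lborel) < \<infinity>" for j
    using bv2[of "[]" j] by (simp add: le_less_trans)
  obtain R where R: "\<Phi> ` K \<subseteq> cball 0 R" using compact_imp_bounded[OF \<Phi>K] by (meson bounded_pos mem_cball_0 subsetI)
  obtain r where r: "0 < r" "(\<Union>z\<in>\<Phi> ` K. cball z r) \<subseteq> V"
    using compact_enlarge[OF \<Phi>K V(1)] V(2) K(3) by (metis image_mono order_trans)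
  obtain \<epsilon>0 where \<epsilon>0: "0 < \<epsilon>0" "\<And>\<epsilon> \<eta>. \<epsilon> \<le> \<epsilon>0 \<Longrightarrow> mollifier \<epsilon> \<eta> \<Longrightarrow>
     (\<integral>\<^sup>+x. ennreal (((\<Sum>j\<in>UNIV. conv (bw j []) \<eta> x * conv (bv j []) \<eta> x) - (\<Sum>j\<in>UNIV. bw j [] x * bv j [] x))\<^sup>2) * indicator (cball 0 R) x \<partial>lborel) \<le> ennreal (\<delta> / 2)"
    using conv_product_sum_tendsto[of "\<lambda>j. bw j []" wn "\<lambda>j. bv j []" "\<delta> / 2" R] bw(1,2)[of "[]"] bv(1)[of "[]"] bv2fin \<delta> by auto
  define \<epsilon> where "\<epsilon> = min \<epsilon>0 r"
  obtain \<eta> :: "real ^ 'n \<Rightarrow> real" where \<eta>: "mollifier \<epsilon> \<eta>" using mollifier_exists[of \<epsilon>] \<epsilon>0(1) r(1) by (auto simp: \<epsilon>_def)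
  have \<eta>sm: "smooth_on UNIV \<eta>" and \<eta>s: "\<And>x. \<epsilon> < norm x \<Longrightarrow> \<eta> x = 0" using \<eta> by (auto simp: mollifier_def)
  have \<eta>m: "\<eta> \<in> borel_measurable borel" using mollifier_measurable[OF \<eta>] .
  have zV: "cball (\<Phi> x) \<epsilon> \<subseteq> V" if "x \<in> K" for x using r(2) that by (force simp: \<epsilon>_def)
  define w where "w j = conv (bw j []) \<eta>" for j
  define v where "v j = conv (bv j []) \<eta>" for j
  define u where "u z = (\<Sum>j\<in>UNIV. w j z * v j z)" for z
  have wv: "smooth_on UNIV (w j)" "smooth_on UNIV (v j)" for j
    unfolding w_def v_def by (rule conv_smooth[OF bw(1) \<eta>sm \<eta>s] conv_smooth[OF bv(1) \<eta>sm \<eta>s]; simp)+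
  have uc: "continuous_on A u" for A
    unfolding u_def using smooth_on_continuous[OF wv(1)] smooth_on_continuous[OF wv(2)]
    by (intro continuous_intros) (auto intro: continuous_on_subset)
  have [measurable]: "u \<in> borel_measurable borel" by (rule borel_measurable_continuous_onI[OF uc])
  \<comment> \<open>Dominates at each point all required derivatives of all mollified components of
    \<open>v\<close>, so that a single function has to be integrated.\<close>
  define g where "g z = (\<Sum>(j, is)\<in>UNIV \<times> T. \<bar>conv (bv j is) \<eta> z\<bar>)" for z
  have gc: "continuous_on A g" for A
    unfolding g_def case_prod_unfold
    by (intro continuous_on_sum continuous_on_rabs continuous_on_subset[OF smooth_on_continuous[OF conv_smooth[OF bv(1) \<eta>sm \<eta>s]]])
       (auto simp: T_def)
  have g0: "0 \<le> g z" for z unfolding g_def by (intro sum_nonneg) auto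
  define c where "c = chain_const CARD('n) N C"
  have c0: "0 \<le> c" unfolding c_def by (rule chain_const_nonneg[OF C])
  define f where "f x = u (\<Phi> x)" for x
  have fsm: "smooth_on O1 f"
  proof -
    have cku: "ck UNIV k u" for k unfolding u_def using wv by (intro ck_sum ck_mult) (auto simp: smooth_on_ck)
    have "ck O1 k (\<lambda>x. u (\<Phi> x))" for k
    proof -
      have "ck O1 k (\<lambda>z. \<Phi> z $ j)" for j using smooth_on_vec_nth[OF \<Phi>] by (simp add: smooth_on_ck)
      from ck_compose[OF O1 open_UNIV subset_UNIV this cku] show ?thesis .
    qed
    then show ?thesis using O1 by (simp add: smooth_on_ck f_def[abs_def])
  qed
  have pointwise: "absD (Suc N) f x \<le> c * h ^ Suc N * wn * g (\<Phi> x)" if x: "x \<in> K" for x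
    unfolding f_def[abs_def] u_def c_def
  proof (rule absD_product_compose[OF \<Phi> _ h C _ wv])
    show "x \<in> O1" using x K(3) by blast
    then show "\<bar>foldr partial is (\<lambda>z. \<Phi> z $ j) x\<bar> \<le> C * h ^ length is" if "1 \<le> length is" "length is \<le> Suc N" for "is" j
      by (rule bound[OF _ that])
    show "\<bar>foldr partial is (w j) (\<Phi> x)\<bar> \<le> wn" if "length is \<le> Suc N" for "is" j
      unfolding w_def bw(4)[OF that \<eta> zV[OF x]]
      by (rule conv_bounded[OF \<eta> bw(2)[OF that]]) (use bw(1)[OF that] in auto)
    show "\<bar>foldr partial is (v j) (\<Phi> x)\<bar> \<le> g (\<Phi> x)" if "length is \<le> Suc N" for "is" j
    proof -
      have "(\<lambda>(j, is). \<bar>conv (bv j is) \<eta> (\<Phi> x)\<bar>) (j, is) \<le> g (\<Phi> x)"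
        unfolding g_def by (rule member_le_sum) (use that T in \<open>auto simp: T_def\<close>)
      then show ?thesis unfolding v_def bv(4)[OF that \<eta> zV[OF x]] by simp
    qed
  qed
  obtain p where p: "p \<in> polys N" and pf: "(\<integral>\<^sup>+x. ennreal ((f x - p x)\<^sup>2) * indicator K x \<partial>lborel) \<le>
    ennreal (\<rho> ^ (2 * Suc N)) * 2 ^ CARD('n) * (\<integral>\<^sup>+x. ennreal ((absD (Suc N) f x)\<^sup>2) * indicator K x \<partial>lborel)"
    using smooth_poly_approx[OF fsm K(1,2,3,4) \<rho>(1), of N] by blast
  define G where "G = (\<integral>\<^sup>+z. ennreal ((g z)\<^sup>2) * indicator (\<Phi> ` K) z \<partial>lborel)"
  \<comment> \<open>One factor \<open>q\<close> comes from Cauchy-Schwarz for the sum defining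
    \<open>g\<close>, the other from the number of its terms, each of which
    \<open>conv_contraction\<close> bounds by the square of \<open>sv\<close>.\<close>
  have G: "G \<le> ennreal (q\<^sup>2 * sv\<^sup>2)"
  proof -
    have cm: "conv (bv j is) \<eta> \<in> borel_measurable borel" if "is \<in> T" for j "is"
      using bv(1)[of "is" j] that by (intro conv_measurable \<eta>m) (auto simp: T_def)
    have "G \<le> (\<integral>\<^sup>+z. ennreal q * (\<Sum>(j, is)\<in>UNIV \<times> T. ennreal (\<bar>conv (bv j is) \<eta> z\<bar> ^ 2)) \<partial>lborel)"
      unfolding G_def
    proof (rule nn_integral_mono)
      fix z
      have "(g z)\<^sup>2 \<le> real (card ((UNIV :: 'n set) \<times> T)) * (\<Sum>x\<in>UNIV \<times> T. ((\<lambda>(j, is). \<bar>conv (bv j is) \<eta> z\<bar>) x)\<^sup>2)"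
        unfolding g_def by (rule sum_sq_le)
      also have "real (card ((UNIV :: 'n set) \<times> T)) = q" by (simp add: card_cartesian_product q_def)
      finally have "ennreal ((g z)\<^sup>2) \<le> ennreal q * (\<Sum>(j, is)\<in>UNIV \<times> T. ennreal (\<bar>conv (bv j is) \<eta> z\<bar> ^ 2))"
        unfolding case_prod_unfold by (rule ennreal_le_mult_sum) (auto simp: q_def)
      then show "ennreal ((g z)\<^sup>2) * indicator (\<Phi> ` K) z \<le> ennreal q * (\<Sum>(j, is)\<in>UNIV \<times> T. ennreal (\<bar>conv (bv j is) \<eta> z\<bar> ^ 2))"
        by (auto simp: indicator_def)
    qed
    also have "\<dots> = ennreal q * (\<Sum>(j, is)\<in>UNIV \<times> T. \<integral>\<^sup>+z. ennreal (\<bar>conv (bv j is) \<eta> z\<bar> ^ 2) \<partial>lborel)"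
    proof -
      have m: "(\<lambda>z. ennreal (\<bar>conv (bv (fst x) (snd x)) \<eta> z\<bar> ^ 2)) \<in> borel_measurable lborel"
        if "x \<in> UNIV \<times> T" for x
      proof -
        have [measurable]: "conv (bv (fst x) (snd x)) \<eta> \<in> borel_measurable borel" using that by (intro cm) auto
        show ?thesis by measurable
      qed
      have mS: "(\<lambda>z. \<Sum>x\<in>UNIV \<times> T. ennreal (\<bar>conv (bv (fst x) (snd x)) \<eta> z\<bar> ^ 2)) \<in> borel_measurable lborel"
        by (rule borel_measurable_sum[OF m])
      show ?thesis unfolding case_prod_unfold nn_integral_cmult[OF mS] by (subst nn_integral_sum[OF m]) (auto intro: refl)
    qed
    also have "\<dots> \<le> ennreal q * (\<Sum>(j, is)\<in>(UNIV :: 'n set) \<times> T. ennreal (sv\<^sup>2))"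
    proof (intro mult_left_mono sum_mono)
      fix x :: "'n \<times> 'n list" assume "x \<in> UNIV \<times> T"
      then obtain j "is" where x: "x = (j, is)" "length is \<le> Suc N" by (auto simp: T_def)
      have "(\<integral>\<^sup>+z. ennreal (\<bar>conv (bv j is) \<eta> z\<bar> ^ 2) \<partial>lborel) \<le> (\<integral>\<^sup>+z. ennreal (\<bar>bv j is z\<bar> ^ 2) \<partial>lborel)"
        by (rule conv_contraction[OF \<eta>]) (use bv(1)[OF x(2), of j] in auto)
      also have "\<dots> \<le> ennreal (sv\<^sup>2)" by (rule bv2[OF x(2)])
      finally show "(case x of (j, is) \<Rightarrow> \<integral>\<^sup>+z. ennreal (\<bar>conv (bv j is) \<eta> z\<bar> ^ 2) \<partial>lborel) \<le> (case x of (j, is) \<Rightarrow> ennreal (sv\<^sup>2))"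
        using x by simp
    qed simp
    also have "\<dots> = ennreal (q * (q * sv\<^sup>2))"
      by (simp add: case_prod_unfold q_def ennreal_mult' card_cartesian_product ennreal_of_nat_eq_real_of_nat)
    finally show ?thesis by (simp add: power2_eq_square mult.assoc)
  qed
  define Fc where "Fc = c * h ^ Suc N * wn"
  have Fc0: "0 \<le> Fc" using c0 h bw(3) by (simp add: Fc_def)
  have absD_le: "(\<integral>\<^sup>+x. ennreal ((absD (Suc N) f x)\<^sup>2) * indicator K x \<partial>lborel) \<le> ennreal (Fc\<^sup>2 * L2\<^sup>2) * G"
  proof -
    have "(\<integral>\<^sup>+x. ennreal ((absD (Suc N) f x)\<^sup>2) * indicator K x \<partial>lborel) \<le>
      (\<integral>\<^sup>+x. ennreal (Fc\<^sup>2 * L2\<^sup>2) * (ennreal (jacobian \<Phi> x * (g (\<Phi> x))\<^sup>2) * indicator K x) \<partial>lborel)"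
    proof (rule nn_integral_mono)
      fix x
      have "(absD (Suc N) f x)\<^sup>2 \<le> (Fc\<^sup>2 * L2\<^sup>2) * (jacobian \<Phi> x * (g (\<Phi> x))\<^sup>2)" if x: "x \<in> K"
      proof -
        have xO: "x \<in> O1" using x K(3) by blast
        have "0 \<le> absD (Suc N) f x" unfolding absD_def by (intro sum_nonneg) auto
        then have "(absD (Suc N) f x)\<^sup>2 \<le> (Fc * g (\<Phi> x))\<^sup>2"
          using pointwise[OF x] by (intro power_mono) (simp_all add: Fc_def)
        also have "\<dots> = Fc\<^sup>2 * 1 * (g (\<Phi> x))\<^sup>2" by (simp add: power_mult_distrib)
        also have "\<dots> \<le> Fc\<^sup>2 * (L2\<^sup>2 * jacobian \<Phi> x) * (g (\<Phi> x))\<^sup>2"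
        proof (intro mult_right_mono mult_left_mono)
          \<comment> \<open>The Jacobian needed for returning to the physical element is inserted at
            the price of \<open>L2\<close> squared; in the opposite direction it is bounded by
            \<open>L1\<close> squared.\<close>
          have "1 = (1 / sqrt (jacobian \<Phi> x))\<^sup>2 * jacobian \<Phi> x"
            using J(1)[OF xO] by (simp add: power_divide)
          also have "\<dots> \<le> L2\<^sup>2 * jacobian \<Phi> x"
            using J(1)[OF xO] J(3)[OF xO] by (intro mult_right_mono power_mono) auto
          finally show "1 \<le> L2\<^sup>2 * jacobian \<Phi> x" .
        qed auto
        finally show ?thesis by (simp add: mult_ac)
      qed
      then show "ennreal ((absD (Suc N) f x)\<^sup>2) * indicator K x \<le> ennreal (Fc\<^sup>2 * L2\<^sup>2) * (ennreal (jacobian \<Phi> x * (g (\<Phi> x))\<^sup>2) * indicator K x)"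
        by (auto simp: indicator_def ennreal_leI ennreal_mult'[symmetric])
    qed
    also have "\<dots> = ennreal (Fc\<^sup>2 * L2\<^sup>2) * (\<integral>\<^sup>+x. ennreal (jacobian \<Phi> x * (g (\<Phi> x))\<^sup>2) * indicator K x \<partial>lborel)"
    proof (rule nn_integral_cmult)
      have "continuous_on K (\<lambda>x. jacobian \<Phi> x * (g (\<Phi> x))\<^sup>2)"
        by (intro continuous_intros jacobian_continuous[OF \<Phi> K(3)] continuous_on_compose2[OF gc[of UNIV] \<Phi>c]) auto
      then have "(\<lambda>x. indicator K x *\<^sub>R (jacobian \<Phi> x * (g (\<Phi> x))\<^sup>2)) \<in> borel_measurable borel"
        by (intro borel_measurable_continuous_on_indicator) auto
      then have "(\<lambda>x. ennreal (indicator K x *\<^sub>R (jacobian \<Phi> x * (g (\<Phi> x))\<^sup>2))) \<in> borel_measurable lborel" by simp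
      moreover have "ennreal (indicator K x *\<^sub>R (jacobian \<Phi> x * (g (\<Phi> x))\<^sup>2)) = ennreal (jacobian \<Phi> x * (g (\<Phi> x))\<^sup>2) * indicator K x" for x
        by (auto simp: indicator_def)
      ultimately show "(\<lambda>x. ennreal (jacobian \<Phi> x * (g (\<Phi> x))\<^sup>2) * indicator K x) \<in> borel_measurable lborel" by (simp only:)
    qed
    also have "(\<integral>\<^sup>+x. ennreal (jacobian \<Phi> x * (g (\<Phi> x))\<^sup>2) * indicator K x \<partial>lborel) = G"
      unfolding G_def using K(3) J(1)
      by (intro change_of_variables_jacobian[OF \<Phi> K(3,1) injK, symmetric] continuous_intros gc) auto
    finally show ?thesis .
  qed
  define P where "P y = p (inv_into S \<Phi> y)" for y
  have P\<Phi>: "P (\<Phi> x) = p x" if "x \<in> K" for x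
    unfolding P_def using inv_into_f_f[OF S(2)] that S(1) K(3) by (metis subsetD)
  have Pc: "continuous_on (\<Phi> ` K) P"
  proof -
    have "continuous_on (\<Phi> ` K) (inv_into K \<Phi>)" by (rule continuous_on_inv[OF \<Phi>c K(1)]) (use inv_into_f_f[OF injK] in auto)
    then have "continuous_on (\<Phi> ` K) (\<lambda>y. p (inv_into K \<Phi> y))"
      by (intro continuous_on_compose2[OF continuous_on_polys[OF p, of UNIV]]) auto
    moreover have "p (inv_into K \<Phi> y) = P y" if "y \<in> \<Phi> ` K" for y
      using that P\<Phi> inv_into_f_f[OF injK] by auto
    ultimately show ?thesis using continuous_on_cong by (metis (no_types, lifting))
  qed
  have u_P: "(\<integral>\<^sup>+y. ennreal ((u y - P y)\<^sup>2) * indicator (\<Phi> ` K) y \<partial>lborel) \<le> ennreal (L1\<^sup>2) * (\<integral>\<^sup>+x. ennreal ((f x - p x)\<^sup>2) * indicator K x \<partial>lborel)"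
  proof -
    have "(\<integral>\<^sup>+y. ennreal ((u y - P y)\<^sup>2) * indicator (\<Phi> ` K) y \<partial>lborel) = (\<integral>\<^sup>+x. ennreal (jacobian \<Phi> x * (u (\<Phi> x) - P (\<Phi> x))\<^sup>2) * indicator K x \<partial>lborel)"
      using K(3) J(1) by (intro change_of_variables_jacobian[OF \<Phi> K(3,1) injK] continuous_intros uc Pc) auto
    also have "\<dots> \<le> (\<integral>\<^sup>+x. ennreal (L1\<^sup>2) * (ennreal ((f x - p x)\<^sup>2) * indicator K x) \<partial>lborel)"
    proof (rule nn_integral_mono)
      fix x
      have "jacobian \<Phi> x * (u (\<Phi> x) - P (\<Phi> x))\<^sup>2 \<le> L1\<^sup>2 * (f x - p x)\<^sup>2" if x: "x \<in> K"
      proof -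
        have xO: "x \<in> O1" using x K(3) by blast
        have "jacobian \<Phi> x = (sqrt (jacobian \<Phi> x))\<^sup>2" using J(1)[OF xO] by simp
        also have "\<dots> \<le> L1\<^sup>2" using J(1,2)[OF xO] by (intro power_mono) auto
        finally show ?thesis unfolding P\<Phi>[OF x] f_def by (intro mult_right_mono) auto
      qed
      then show "ennreal (jacobian \<Phi> x * (u (\<Phi> x) - P (\<Phi> x))\<^sup>2) * indicator K x \<le> ennreal (L1\<^sup>2) * (ennreal ((f x - p x)\<^sup>2) * indicator K x)"
        by (auto simp: indicator_def ennreal_leI ennreal_mult'[symmetric])
    qed
    also have "\<dots> = ennreal (L1\<^sup>2) * (\<integral>\<^sup>+x. ennreal ((f x - p x)\<^sup>2) * indicator K x \<partial>lborel)"
    proof (rule nn_integral_cmult)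
      have "continuous_on K (\<lambda>x. (f x - p x)\<^sup>2)"
        using smooth_on_continuous[OF fsm] K(3) continuous_on_polys[OF p]
        by (intro continuous_intros) (auto intro: continuous_on_subset)
      then have "(\<lambda>x. indicator K x *\<^sub>R (f x - p x)\<^sup>2) \<in> borel_measurable borel"
        by (intro borel_measurable_continuous_on_indicator) auto
      then have "(\<lambda>x. ennreal (indicator K x *\<^sub>R (f x - p x)\<^sup>2)) \<in> borel_measurable lborel" by simp
      moreover have "ennreal (indicator K x *\<^sub>R (f x - p x)\<^sup>2) = ennreal ((f x - p x)\<^sup>2) * indicator K x" for x
        by (auto simp: indicator_def)
      ultimately show "(\<lambda>x. ennreal ((f x - p x)\<^sup>2) * indicator K x) \<in> borel_measurable lborel" by (simp only:)
    qed
    finally show ?thesis .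
  qed
  define B where "B = L1\<^sup>2 * (\<rho> ^ (2 * Suc N) * 2 ^ CARD('n) * (Fc\<^sup>2 * L2\<^sup>2 * (q\<^sup>2 * sv\<^sup>2)))"
  have B0: "0 \<le> B" unfolding B_def using \<rho>(2) by (intro mult_nonneg_nonneg) auto
  have uP_B: "(\<integral>\<^sup>+y. ennreal ((u y - P y)\<^sup>2) * indicator (\<Phi> ` K) y \<partial>lborel) \<le> ennreal B"
  proof -
    have "(\<integral>\<^sup>+x. ennreal ((absD (Suc N) f x)\<^sup>2) * indicator K x \<partial>lborel) \<le> ennreal (Fc\<^sup>2 * L2\<^sup>2) * ennreal (q\<^sup>2 * sv\<^sup>2)"
      using absD_le mult_left_mono[OF G, of "ennreal (Fc\<^sup>2 * L2\<^sup>2)"] by (meson order_trans zero_le)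
    then have "ennreal (\<rho> ^ (2 * Suc N)) * 2 ^ CARD('n) * (\<integral>\<^sup>+x. ennreal ((absD (Suc N) f x)\<^sup>2) * indicator K x \<partial>lborel)
      \<le> ennreal (\<rho> ^ (2 * Suc N)) * 2 ^ CARD('n) * (ennreal (Fc\<^sup>2 * L2\<^sup>2) * ennreal (q\<^sup>2 * sv\<^sup>2))"
      by (rule mult_left_mono) simp
    with pf have "(\<integral>\<^sup>+x. ennreal ((f x - p x)\<^sup>2) * indicator K x \<partial>lborel) \<le> ennreal (\<rho> ^ (2 * Suc N)) * 2 ^ CARD('n) * (ennreal (Fc\<^sup>2 * L2\<^sup>2) * ennreal (q\<^sup>2 * sv\<^sup>2))"
      by (rule order_trans)
    then have "ennreal (L1\<^sup>2) * (\<integral>\<^sup>+x. ennreal ((f x - p x)\<^sup>2) * indicator K x \<partial>lborel) \<le> ennreal (L1\<^sup>2) * (ennreal (\<rho> ^ (2 * Suc N)) * 2 ^ CARD('n) * (ennreal (Fc\<^sup>2 * L2\<^sup>2) * ennreal (q\<^sup>2 * sv\<^sup>2)))"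
      by (rule mult_left_mono) simp
    also have "\<dots> = ennreal B"
    proof -
      have "(2::ennreal) ^ CARD('n) = ennreal (2 ^ CARD('n))" by (simp flip: ennreal_power)
      then show ?thesis unfolding B_def using \<rho>(2) by (simp add: ennreal_mult' del: power_Suc mult_Suc_right)
    qed
    finally show ?thesis using u_P by (meson order_trans)
  qed
  define u0 where "u0 y = (\<Sum>j\<in>UNIV. bw j [] y * bv j [] y)" for y
  have [measurable]: "u0 \<in> borel_measurable borel"
    unfolding u0_def using bw(1)[of "[]"] bv(1)[of "[]"] by (intro borel_measurable_sum borel_measurable_times) auto
  have u_u0: "(\<integral>\<^sup>+y. ennreal ((u y - u0 y)\<^sup>2) * indicator (\<Phi> ` K) y \<partial>lborel) \<le> ennreal (\<delta> / 2)"
  proof -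
    have "(\<integral>\<^sup>+y. ennreal ((u y - u0 y)\<^sup>2) * indicator (\<Phi> ` K) y \<partial>lborel) \<le> (\<integral>\<^sup>+y. ennreal ((u y - u0 y)\<^sup>2) * indicator (cball 0 R) y \<partial>lborel)"
      using R by (intro nn_integral_mono) (auto simp: indicator_def)
    also have "\<dots> \<le> ennreal (\<delta> / 2)"
      using \<epsilon>0(2)[OF _ \<eta>] by (simp add: \<epsilon>_def u_def u0_def w_def v_def)
    finally show ?thesis .
  qed
  have Pm: "(\<lambda>y. ennreal ((u y - P y)\<^sup>2) * indicator (\<Phi> ` K) y) \<in> borel_measurable lborel"
  proof -
    have "continuous_on (\<Phi> ` K) (\<lambda>y. (u y - P y)\<^sup>2)" by (intro continuous_intros uc Pc)
    then have "(\<lambda>x. indicator (\<Phi> ` K) x *\<^sub>R (u x - P x)\<^sup>2) \<in> borel_measurable borel"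
      by (intro borel_measurable_continuous_on_indicator) auto
    then have "(\<lambda>x. ennreal (indicator (\<Phi> ` K) x *\<^sub>R (u x - P x)\<^sup>2)) \<in> borel_measurable lborel" by simp
    moreover have "ennreal (indicator (\<Phi> ` K) x *\<^sub>R (u x - P x)\<^sup>2) = ennreal ((u x - P x)\<^sup>2) * indicator (\<Phi> ` K) x" for x
      by (auto simp: indicator_def)
    ultimately show ?thesis by (simp only:)
  qed
  \<comment> \<open>The mollified product \<open>u\<close> stands between \<open>u0\<close> and
    \<open>P\<close>. The factor 2 turns the error \<delta>/2 into \<delta> and is the leading 2 of
    \<open>local_const\<close>.\<close>
  have "(\<integral>\<^sup>+y. ennreal ((u0 y - P y)\<^sup>2) * indicator (\<Phi> ` K) y \<partial>lborel)
    \<le> (\<integral>\<^sup>+y. 2 * (ennreal ((u y - u0 y)\<^sup>2) * indicator (\<Phi> ` K) y) + 2 * (ennreal ((u y - P y)\<^sup>2) * indicator (\<Phi> ` K) y) \<partial>lborel)"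
  proof (rule nn_integral_mono)
    fix y
    have "(u0 y - P y)\<^sup>2 = ((u y - P y) + - (u y - u0 y))\<^sup>2" by simp
    also have "\<dots> \<le> 2 * (u y - P y)\<^sup>2 + 2 * (- (u y - u0 y))\<^sup>2" by (rule sq_add_le)
    also have "\<dots> = 2 * (u y - u0 y)\<^sup>2 + 2 * (u y - P y)\<^sup>2" by (simp add: power2_commute)
    finally have "ennreal ((u0 y - P y)\<^sup>2) \<le> ennreal (2 * (u y - u0 y)\<^sup>2 + 2 * (u y - P y)\<^sup>2)" by (rule ennreal_leI)
    also have "\<dots> = 2 * ennreal ((u y - u0 y)\<^sup>2) + 2 * ennreal ((u y - P y)\<^sup>2)"
      by (subst ennreal_plus) (auto simp: ennreal_mult)
    finally show "ennreal ((u0 y - P y)\<^sup>2) * indicator (\<Phi> ` K) y \<le> 2 * (ennreal ((u y - u0 y)\<^sup>2) * indicator (\<Phi> ` K) y) + 2 * (ennreal ((u y - P y)\<^sup>2) * indicator (\<Phi> ` K) y)"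
      by (auto simp: indicator_def)
  qed
  also have "\<dots> = 2 * (\<integral>\<^sup>+y. ennreal ((u y - u0 y)\<^sup>2) * indicator (\<Phi> ` K) y \<partial>lborel) + 2 * (\<integral>\<^sup>+y. ennreal ((u y - P y)\<^sup>2) * indicator (\<Phi> ` K) y \<partial>lborel)"
    using Pm by (subst nn_integral_add; (subst nn_integral_cmult)?; (subst nn_integral_cmult)?) auto
  also have "\<dots> \<le> 2 * ennreal (\<delta> / 2) + 2 * ennreal B"
    by (intro add_mono mult_left_mono u_u0 uP_B) auto
  also have "\<dots> = ennreal (2 * B + \<delta>)"
    using B0 \<delta> by (simp add: ennreal_plus ennreal_mult' add.commute flip: ennreal_numeral) (simp flip: ennreal_mult' ennreal_numeral)
  also have "2 * B = local_const CARD('n) N C \<rho> * (h ^ Suc N * L1 * L2 * wn * sv)\<^sup>2"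
    unfolding B_def Fc_def local_const_def c_def q_def T_def card_short_lists
    by (simp add: power_mult_distrib mult_ac del: power_Suc mult_Suc_right)
  finally show ?thesis using p unfolding u0_def P_def by blast
qed

subsection \<open>Essential suprema and weights\<close>

text \<open>The bound \<open>c\<close>, of whatever size, together with measurability excludes an
  infinite essential supremum, which \<open>Linf_norm\<close> would turn into 0. The value minus
  infinity occurs only if the set is null, and then there is nothing to show.\<close>

lemma Linf_norm_AE:
  fixes f :: "real ^ 'n::finite \<Rightarrow> 'b::real_normed_vector"
  assumes m: "(\<lambda>x. norm (f x)) \<in> borel_measurable (lebesgue_on S)" and c: "AE x in lebesgue_on S. norm (f x) \<le> c"
  shows "AE x in lebesgue_on S. norm (f x) \<le> Linf_norm S f"
proof -
  define e where "e = esssup (lebesgue_on S) (\<lambda>x. ereal (norm (f x)))"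
  have ae: "AE x in lebesgue_on S. ereal (norm (f x)) \<le> e" unfolding e_def by (rule esssup_AE)
  have "e \<le> ereal c" unfolding e_def using m c by (intro esssup_I) auto
  then show ?thesis
  proof (cases e)
    case (real r)
    then show ?thesis using ae by (simp add: Linf_norm_def e_def[symmetric])
  next
    case MInf
    with ae have "AE x in lebesgue_on S. False" by simp
    then show ?thesis by (elim eventually_mono) simp
  qed auto
qed

text \<open>A function that is not measurable has essential supremum \<open>top\<close>, whose real
  value is 0. A negative essential supremum forces the set to be null and is then minus infinity,
  again with real value 0.\<close>

lemma Linf_norm_nonneg: "0 \<le> Linf_norm S f"
proof -
  define e where "e = esssup (lebesgue_on S) (\<lambda>x. ereal (norm (f x)))"
  show ?thesis
  proof (cases "0 \<le> e")
    case True then show ?thesis unfolding Linf_norm_def e_def[symmetric] by (simp add: real_of_ereal_pos)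
  next
    case False
    have m: "(\<lambda>x. ereal (norm (f x))) \<in> borel_measurable (lebesgue_on S)"
    proof (rule ccontr)
      assume "\<not> ?thesis"
      then have "e = top" unfolding e_def by (rule esssup_non_measurable)
      then show False using False by (simp add: top_ereal_def)
    qed
    have "AE x in lebesgue_on S. ereal (norm (f x)) \<le> e" unfolding e_def by (rule esssup_AE)
    then have "AE x in lebesgue_on S. False"
    proof eventually_elim
      case (elim x)
      have "0 \<le> ereal (norm (f x))" by simp
      then show ?case using elim False by (meson order_trans)
    qed
    then have "e \<le> - \<infinity>" unfolding e_def by (intro esssup_I m) (auto elim: eventually_mono)
    then show ?thesis unfolding Linf_norm_def e_def[symmetric] by simp
  qed
qed

text \<open>By continuity the bound could only fail on an open set, and a null open set is empty.
  The almost everywhere bound thus holds at every interior point.\<close>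

lemma Linf_norm_pointwise:
  fixes f :: "real ^ 'n::finite \<Rightarrow> 'b::real_normed_vector"
  assumes S: "compact S" and f: "continuous_on S f" and x: "x \<in> interior S"
  shows "norm (f x) \<le> Linf_norm S f"
proof -
  have c: "continuous_on S (\<lambda>x. norm (f x))" by (intro continuous_intros f)
  have Sm: "S \<in> sets lebesgue" using S by (simp add: borel_compact)
  have m: "(\<lambda>x. norm (f x)) \<in> borel_measurable (lebesgue_on S)"
    by (rule continuous_imp_measurable_on_sets_lebesgue[OF c Sm])
  obtain B where "\<And>x. x \<in> S \<Longrightarrow> norm (f x) \<le> B"
    using compact_imp_bounded[OF compact_continuous_image[OF f S]] unfolding bounded_iff by auto
  then have "AE x in lebesgue_on S. norm (f x) \<le> Linf_norm S f"
    using Sm by (intro Linf_norm_AE[OF m, of B] AE_I2) auto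
  then have ae: "AE x in lebesgue. x \<in> S \<longrightarrow> norm (f x) \<le> Linf_norm S f"
    using Sm by (subst (asm) AE_restrict_space_iff) auto
  define G where "G = {x \<in> interior S. Linf_norm S f < norm (f x)}"
  have "open G"
  proof -
    have "continuous_on (interior S) (\<lambda>x. norm (f x))" using c interior_subset continuous_on_subset by blast
    then have "open ((\<lambda>x. norm (f x)) -` {Linf_norm S f<..} \<inter> interior S)"
      by (rule continuous_on_open_vimage[OF open_interior, THEN iffD1, rule_format]) simp
    moreover have "(\<lambda>x. norm (f x)) -` {Linf_norm S f<..} \<inter> interior S = G" by (auto simp: G_def)
    ultimately show ?thesis by simp
  qed
  moreover have "AE x in lebesgue. x \<notin> G"
    using ae by eventually_elim (use interior_subset in \<open>auto simp: G_def\<close>)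
  ultimately have "G = {}" by (rule open_null_imp_empty)
  then show ?thesis using x by (auto simp: G_def not_less)
qed

section \<open>Spectral norms and essential bounds for matrix weights\<close>

lemma matrix_entry_le_spectral_norm: "\<bar>A $ i $ j\<bar> \<le> spectral_norm A"
  for A :: "real ^ 'm::finite ^ 'm"
proof -
  have "(A *v axis j 1) $ i = A $ i $ j"
    by (simp add: matrix_vector_mult_def axis_def if_distrib cong: if_cong)
  then have "\<bar>A $ i $ j\<bar> \<le> norm (A *v axis j 1)" using component_le_norm_cart[of "A *v axis j 1" i] by simp
  also have "\<dots> \<le> onorm ((*v) A) * norm (axis j (1::real) :: real ^ 'm)"
    by (rule onorm) (rule matrix_vector_mul_bounded_linear)
  finally show ?thesis by (simp add: spectral_norm_def)
qed

lemma spectral_norm_diff_le: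
  fixes A B :: "real ^ 'm::finite ^ 'm"
  shows "spectral_norm A - spectral_norm B \<le> (\<Sum>i\<in>UNIV. \<Sum>j\<in>UNIV. \<bar>(A - B) $ i $ j\<bar>)"
proof -
  have "(*v) A = (\<lambda>x. B *v x + (A - B) *v x)" by (simp add: fun_eq_iff matrix_vector_mult_diff_rdistrib)
  then have "onorm ((*v) A) \<le> onorm ((*v) B) + onorm ((*v) (A - B))"
    using onorm_triangle[OF matrix_vector_mul_bounded_linear matrix_vector_mul_bounded_linear, of B "A - B"] by simp
  then show ?thesis using onorm_le_matrix_component_sum[of "A - B"] by (simp add: spectral_norm_def)
qed

lemma continuous_spectral_norm: "continuous_on UNIV (spectral_norm :: real ^ 'm::finite ^ 'm \<Rightarrow> real)"
  unfolding continuous_on_eq_continuous_at[OF open_UNIV]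
proof
  fix B :: "real ^ 'm ^ 'm"
  have "((\<lambda>A. \<Sum>i\<in>UNIV. \<Sum>j\<in>UNIV. \<bar>(A - B) $ i $ j\<bar>) \<longlongrightarrow> (\<Sum>i\<in>UNIV. \<Sum>j\<in>UNIV. \<bar>(B - B) $ i $ j\<bar>)) (at B)"
    by (intro tendsto_intros)
  then have lim: "((\<lambda>A. \<Sum>i\<in>UNIV. \<Sum>j\<in>UNIV. \<bar>(A - B) $ i $ j\<bar>) \<longlongrightarrow> 0) (at B)" by simp
  have "((\<lambda>A. spectral_norm A - spectral_norm B) \<longlongrightarrow> 0) (at B)"
  proof (rule Lim_null_comparison[OF always_eventually lim], rule allI)
    fix A
    have "(\<Sum>i\<in>UNIV. \<Sum>j\<in>UNIV. \<bar>(B - A) $ i $ j\<bar>) = (\<Sum>i\<in>UNIV. \<Sum>j\<in>UNIV. \<bar>(A - B) $ i $ j\<bar>)"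
      by (intro sum.cong) (auto simp: abs_minus_commute)
    then show "norm (spectral_norm A - spectral_norm B) \<le> (\<Sum>i\<in>UNIV. \<Sum>j\<in>UNIV. \<bar>(A - B) $ i $ j\<bar>)"
      using spectral_norm_diff_le[of A B] spectral_norm_diff_le[of B A] unfolding real_norm_def by (intro abs_leI) simp_all
  qed
  then show "isCont spectral_norm B" by (simp add: isCont_def LIM_zero_iff)
qed

lemma spectral_norm_measurable:
  fixes w :: "'m::finite \<Rightarrow> 'm \<Rightarrow> 'a \<Rightarrow> real"
  assumes "\<And>i j. w i j \<in> borel_measurable M"
  shows "(\<lambda>x. spectral_norm (\<chi> i j. w i j x)) \<in> borel_measurable M"
proof -
  have "(\<lambda>x. (\<chi> i j. w i j x) :: real ^ 'm ^ 'm) \<in> borel_measurable M"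
  proof (rule borel_measurable_euclidean_space[THEN iffD2], rule ballI)
    fix B :: "real ^ 'm ^ 'm" assume "B \<in> Basis"
    then obtain i u where u: "B = axis i u" "u \<in> Basis" unfolding Basis_vec_def[where 'b='m and 'a="real ^ 'm"] by blast
    obtain j where j: "u = axis j 1" using u(2) unfolding Basis_vec_def by auto
    have B: "B = axis i (axis j 1)" using u(1) j by simp
    show "(\<lambda>x. (\<chi> i j. w i j x) \<bullet> B) \<in> borel_measurable M"
      unfolding B inner_axis using assms[of i j] by (simp add: inner_axis)
  qed
  then show ?thesis
    by (rule measurable_compose) (rule borel_measurable_continuous_onI[OF continuous_spectral_norm])
qed

text \<open>The entries are essentially bounded by some constants \<open>c\<close>, which serve only
  to show that the essential supremum of the spectral norm is finite. Once that is known, an entry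
  is at most the spectral norm, hence at most its \<open>Linf_norm\<close>, which is one of the
  terms in \<open>weight_norm\<close>.\<close>

lemma weight_bound:
  fixes W :: "real ^ 'n::finite \<Rightarrow> real ^ 'm::finite ^ 'm"
  assumes U: "open U" and W: "\<And>i j. (\<lambda>x. W x $ i $ j) \<in> sobolev (Linf_space U) U k" and \<alpha>: "mi_order \<alpha> \<le> k"
  shows "AE x in lborel. x \<in> U \<longrightarrow> \<bar>weak_partial U \<alpha> (\<lambda>x. W x $ i $ j) x\<bar> \<le> weight_norm U k W"
proof -
  have Um: "U \<in> sets lebesgue" using U by simp
  define w where "w i j = weak_partial U \<alpha> (\<lambda>x. W x $ i $ j)" for i j
  have wm: "w i j \<in> borel_measurable (lebesgue_on U)" for i j
    using sobolev_weak_partial[OF U W \<alpha>, of i j] by (auto simp: borel_rep_def w_def)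
  have "\<exists>c. AE x in lborel. x \<in> U \<longrightarrow> \<bar>w i j x\<bar> \<le> c" for i j
  proof -
    obtain g where g: "g \<in> Linf_space U" "AE x in lborel. x \<in> U \<longrightarrow> w i j x = g x"
      using sobolev_weak_partial[OF U W \<alpha>, of i j] unfolding w_def by auto
    then obtain c where "AE x in lebesgue_on U. \<bar>g x\<bar> \<le> c" by (auto simp: Linf_space_def)
    then have "AE x in lborel. x \<in> U \<longrightarrow> \<bar>g x\<bar> \<le> c"
      using Um by (simp add: AE_restrict_space_iff AE_completion_iff)
    with g(2) have "AE x in lborel. x \<in> U \<longrightarrow> \<bar>w i j x\<bar> \<le> c" by eventually_elim auto
    then show ?thesis by blast
  qed
  then have "\<forall>i. \<exists>c. \<forall>j. AE x in lborel. x \<in> U \<longrightarrow> \<bar>w i j x\<bar> \<le> c j" by (intro allI choice)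
  then obtain c where c: "\<And>i j. AE x in lborel. x \<in> U \<longrightarrow> \<bar>w i j x\<bar> \<le> c i j"
    by (auto dest!: choice)
  let ?S = "\<lambda>x. spectral_norm (weak_partial_mat U \<alpha> W x)"
  have S: "weak_partial_mat U \<alpha> W = (\<lambda>x. \<chi> i j. w i j x)" by (simp add: fun_eq_iff weak_partial_mat_def w_def)
  have "AE x in lborel. \<forall>i\<in>UNIV. \<forall>j\<in>UNIV. x \<in> U \<longrightarrow> \<bar>w i j x\<bar> \<le> c i j"
    by (intro AE_finite_allI) (use c in auto)
  then have "AE x in lebesgue. x \<in> U \<longrightarrow> norm (?S x) \<le> (\<Sum>i\<in>UNIV. \<Sum>j\<in>UNIV. c i j)"
    unfolding AE_completion_iff
  proof eventually_elim
    case (elim x)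
    have "0 \<le> ?S x" unfolding spectral_norm_def by (intro onorm_pos_le matrix_vector_mul_bounded_linear)
    moreover have "?S x \<le> (\<Sum>i\<in>UNIV. \<Sum>j\<in>UNIV. \<bar>w i j x\<bar>)"
      unfolding S spectral_norm_def using onorm_le_matrix_component_sum[of "\<chi> i j. w i j x"] by simp
    moreover have "(\<Sum>i\<in>UNIV. \<Sum>j\<in>UNIV. \<bar>w i j x\<bar>) \<le> (\<Sum>i\<in>UNIV. \<Sum>j\<in>UNIV. c i j)" if "x \<in> U"
      using elim that by (intro sum_mono) auto
    ultimately show ?case by auto
  qed
  then have "AE x in lebesgue_on U. norm (?S x) \<le> (\<Sum>i\<in>UNIV. \<Sum>j\<in>UNIV. c i j)"
    using Um by (simp add: AE_restrict_space_iff)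
  moreover have "(\<lambda>x. norm (?S x)) \<in> borel_measurable (lebesgue_on U)"
    unfolding S using spectral_norm_measurable[of w, OF wm] by simp
  ultimately have "AE x in lebesgue_on U. norm (?S x) \<le> Linf_norm U ?S" by (intro Linf_norm_AE)
  then have ae: "AE x in lborel. x \<in> U \<longrightarrow> norm (?S x) \<le> Linf_norm U ?S"
    using Um by (simp add: AE_restrict_space_iff AE_completion_iff)
  have "(Linf_norm U ?S)\<^sup>2 \<le> (\<Sum>\<alpha> | mi_order \<alpha> \<le> k. (Linf_norm U (\<lambda>x. spectral_norm (weak_partial_mat U \<alpha> W x)))\<^sup>2)"
    using \<alpha> finite_mi_order_le[of k] by (intro member_le_sum[of \<alpha>]) auto
  then have le: "Linf_norm U ?S \<le> weight_norm U k W"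
    unfolding weight_norm_def by (rule real_le_rsqrt)
  show ?thesis
    using ae
  proof eventually_elim
    case (elim x)
    have "\<bar>w i j x\<bar> \<le> ?S x" using matrix_entry_le_spectral_norm[of "weak_partial_mat U \<alpha> W x" i j] by (simp add: weak_partial_mat_def w_def)
    then show ?case using elim le unfolding w_def by auto
  qed
qed

lemma weight_norm_nonneg: "0 \<le> weight_norm U k W"
  unfolding weight_norm_def by (intro real_sqrt_ge_zero sum_nonneg) simp

subsection \<open>Representatives of all weak derivatives\<close>

lemma mi_of_list_Nil: "mi_of_list [] = 0"
  by (simp add: mi_of_list_def vec_eq_iff)

lemma borel_rep_weak_partial_0:
  assumes U: "open U" and w: "is_weak_partial U 0 u (weak_partial U 0 u)" and b: "borel_rep U (weak_partial U 0 u) b"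
  shows "borel_rep U u b"
  unfolding borel_rep_def
proof (intro conjI)
  show "u \<in> borel_measurable (lebesgue_on U)"
    using w by (intro locally_integrable_measurable[OF U]) (simp add: is_weak_partial_def)
  have "AE x in lborel. x \<in> U \<longrightarrow> u x = weak_partial U 0 u x" by (rule is_weak_partial_0_AE[OF U w])
  moreover have "AE x in lborel. x \<in> U \<longrightarrow> weak_partial U 0 u x = b x" using b by (simp add: borel_rep_def)
  ultimately show "AE x in lborel. x \<in> U \<longrightarrow> u x = b x" by eventually_elim auto
qed (use b in \<open>auto simp: borel_rep_def\<close>)

text \<open>One family, indexed by lists, represents \<open>u\<close> and all its weak derivatives,
  and it is compatible with mollification. The property \<open>Q\<close> stands for the
  square-integral bound on components of \<open>v\<close> or the essential bound on entries of the
  weight.\<close>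

lemma sobolev_representatives:
  fixes u :: "real ^ 'n::finite \<Rightarrow> real"
  assumes U: "open U" and
    ex: "\<And>is :: 'n list. length is \<le> k \<Longrightarrow> \<exists>b. is_weak_partial U (mi_of_list is) u (weak_partial U (mi_of_list is) u) \<and>
      borel_rep U (weak_partial U (mi_of_list is) u) b \<and> integrable lborel b \<and> Q is b"
  shows "\<exists>b :: 'n list \<Rightarrow> real ^ 'n \<Rightarrow> real. borel_rep U u (b []) \<and> (\<forall>is. length is \<le> k \<longrightarrow> integrable lborel (b is) \<and> Q is (b is)) \<and>
    (\<forall>is \<epsilon> \<eta> z. length is \<le> k \<longrightarrow> mollifier \<epsilon> \<eta> \<longrightarrow> cball z \<epsilon> \<subseteq> U \<longrightarrow> foldr partial is (conv (b []) \<eta>) z = conv (b is) \<eta> z)"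
proof -
  obtain b where b: "\<And>is :: 'n list. length is \<le> k \<Longrightarrow> is_weak_partial U (mi_of_list is) u (weak_partial U (mi_of_list is) u) \<and>
      borel_rep U (weak_partial U (mi_of_list is) u) (b is) \<and> integrable lborel (b is) \<and> Q is (b is)"
    using choice[of "\<lambda>is b. length is \<le> k \<longrightarrow> is_weak_partial U (mi_of_list is) u (weak_partial U (mi_of_list is) u) \<and>
      borel_rep U (weak_partial U (mi_of_list is) u) b \<and> integrable lborel b \<and> Q is b"] ex by auto
  have b1: "is_weak_partial U 0 u (weak_partial U 0 u)" "borel_rep U (weak_partial U 0 u) (b [])" "integrable lborel (b [])"
    using b[of "[]"] by (simp_all add: mi_of_list_Nil)
  have b0: "borel_rep U u (b [])" by (rule borel_rep_weak_partial_0[OF U b1(1,2)])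
  have comm: "foldr partial is (conv (b []) \<eta>) z = conv (b is) \<eta> z"
    if l: "length is \<le> k" and m: "mollifier \<epsilon> \<eta>" "cball z \<epsilon> \<subseteq> U" for "is" \<epsilon> \<eta> z
  proof -
    have w: "is_weak_partial U (mi_of_list is) u (weak_partial U (mi_of_list is) u)"
      and br: "borel_rep U (weak_partial U (mi_of_list is) u) (b is)"
      using b[OF l] by simp_all
    show ?thesis by (rule foldr_partial_conv_mollifier[OF w m U b0 b1(3) br])
  qed
  show ?thesis
  proof (intro exI[of _ b] conjI allI impI b0 comm)
    fix "is" :: "'n list" assume "length is \<le> k"
    from b[OF this] show "integrable lborel (b is)" "Q is (b is)" by simp_all
  qed
qed

lemma sobolev_L2_representatives:
  fixes u :: "real ^ 'n::finite \<Rightarrow> real"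
  assumes U: "open U" "bounded U" and u: "u \<in> sobolev (L2_space U) U k"
  shows "\<exists>b :: 'n list \<Rightarrow> real ^ 'n \<Rightarrow> real. borel_rep U u (b []) \<and> (\<forall>is. length is \<le> k \<longrightarrow> integrable lborel (b is) \<and>
      (integrable lborel (\<lambda>x. (b is x)\<^sup>2) \<and> (LINT x|lborel. (b is x)\<^sup>2) \<le> (sobolev_norm U k u)\<^sup>2)) \<and>
    (\<forall>is \<epsilon> \<eta> z. length is \<le> k \<longrightarrow> mollifier \<epsilon> \<eta> \<longrightarrow> cball z \<epsilon> \<subseteq> U \<longrightarrow> foldr partial is (conv (b []) \<eta>) z = conv (b is) \<eta> z)"
proof (rule sobolev_representatives[OF U(1)])
  fix "is" :: "'n list" assume "length is \<le> k"
  then have \<alpha>: "mi_order (mi_of_list is) \<le> k" by (simp add: mi_order_mi_of_list)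
  obtain b where b: "is_weak_partial U (mi_of_list is) u (weak_partial U (mi_of_list is) u)" "borel_rep U (weak_partial U (mi_of_list is) u) b"
    "integrable lborel b" "integrable lborel (\<lambda>x. (b x)\<^sup>2)"
    "(LINT x|lborel. (b x)\<^sup>2) = (L2_norm U (weak_partial U (mi_of_list is) u))\<^sup>2"
    using sobolev_L2_weak_partial[OF U u \<alpha>] by blast
  have "(L2_norm U (weak_partial U (mi_of_list is) u))\<^sup>2 \<le> (\<Sum>\<alpha> | mi_order \<alpha> \<le> k. (L2_norm U (weak_partial U \<alpha> u))\<^sup>2)"
    using \<alpha> finite_mi_order_le[of k] by (intro member_le_sum[of "mi_of_list is"]) auto
  also have "\<dots> = (sobolev_norm U k u)\<^sup>2" unfolding sobolev_norm_def by (simp add: sum_nonneg)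
  finally show "\<exists>b. is_weak_partial U (mi_of_list is) u (weak_partial U (mi_of_list is) u) \<and>
      borel_rep U (weak_partial U (mi_of_list is) u) b \<and> integrable lborel b \<and>
      (integrable lborel (\<lambda>x. (b x)\<^sup>2) \<and> (LINT x|lborel. (b x)\<^sup>2) \<le> (sobolev_norm U k u)\<^sup>2)"
    using b by auto
qed

lemma sobolev_weight_representatives:
  fixes W :: "real ^ 'n::finite \<Rightarrow> real ^ 'm::finite ^ 'm"
  assumes U: "open U" "bounded U" and W: "\<And>i j. (\<lambda>x. W x $ i $ j) \<in> sobolev (Linf_space U) U k"
  shows "\<exists>b :: 'n list \<Rightarrow> real ^ 'n \<Rightarrow> real. borel_rep U (\<lambda>x. W x $ i $ j) (b []) \<and> (\<forall>is. length is \<le> k \<longrightarrow> integrable lborel (b is) \<and>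
      (AE x in lborel. \<bar>b is x\<bar> \<le> weight_norm U k W)) \<and>
    (\<forall>is \<epsilon> \<eta> z. length is \<le> k \<longrightarrow> mollifier \<epsilon> \<eta> \<longrightarrow> cball z \<epsilon> \<subseteq> U \<longrightarrow> foldr partial is (conv (b []) \<eta>) z = conv (b is) \<eta> z)"
proof (rule sobolev_representatives[OF U(1)])
  fix "is" :: "'n list" assume "length is \<le> k"
  then have \<alpha>: "mi_order (mi_of_list is) \<le> k" by (simp add: mi_order_mi_of_list)
  let ?w = "weak_partial U (mi_of_list is) (\<lambda>x. W x $ i $ j)"
  obtain b where w: "is_weak_partial U (mi_of_list is) (\<lambda>x. W x $ i $ j) ?w" and b: "borel_rep U ?w b"
    by (rule sobolev_weak_partial[OF U(1) W[of i j] \<alpha>])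
  have ae: "AE x in lborel. \<bar>b x\<bar> \<le> weight_norm U k W"
  proof -
    have "AE x in lborel. x \<in> U \<longrightarrow> ?w x = b x" using b by (simp add: borel_rep_def)
    with weight_bound[OF U(1) W \<alpha>, of i j] show ?thesis
    proof eventually_elim
      case (elim x)
      then show ?case using b weight_norm_nonneg[of U k W] by (cases "x \<in> U") (auto simp: borel_rep_def)
    qed
  qed
  obtain R where R: "U \<subseteq> cball 0 R" using U(2) by (meson bounded_pos mem_cball_0 subsetI)
  have "integrable lborel b"
  proof (rule Bochner_Integration.integrable_bound)
    have "emeasure lborel (cball 0 R :: (real ^ 'n) set) < \<infinity>" by (intro emeasure_compact_finite) simp
    then show "integrable lborel (\<lambda>x :: real ^ 'n. weight_norm U k W * indicator (cball 0 R) x)"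
      by (intro integrable_mult_right) simp
    show "AE x in lborel. norm (b x) \<le> norm (weight_norm U k W * indicator (cball 0 R) x)"
      using ae
    proof eventually_elim
      case (elim x)
      then show ?case using b R weight_norm_nonneg[of U k W] by (cases "x \<in> U") (auto simp: borel_rep_def)
    qed
  qed (use b in \<open>simp add: borel_rep_def\<close>)
  then show "\<exists>b. is_weak_partial U (mi_of_list is) (\<lambda>x. W x $ i $ j) ?w \<and> borel_rep U ?w b \<and> integrable lborel b \<and>
      (AE x in lborel. \<bar>b x\<bar> \<le> weight_norm U k W)"
    using w b ae by blast
qed

lemma sobolev_norm_le_vec: "(sobolev_norm U k (\<lambda>x. v x $ j))\<^sup>2 \<le> (sobolev_norm_vec U k v)\<^sup>2"
  unfolding sobolev_norm_vec_def
  by (subst real_sqrt_pow2) (auto intro: sum_nonneg member_le_sum)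

subsection \<open>Geometry of the reference element\<close>

lemma full_simplex_interior:
  fixes S :: "(real ^ 'n::finite) set"
  assumes "int CARD('n) simplex S"
  shows "compact S" "convex S" "interior S \<noteq> {}"
proof -
  show "compact S" "convex S" using assms compact_simplex convex_simplex by auto
  have d: "aff_dim S = int CARD('n)" using assms by (simp add: aff_dim_simplex)
  then have "S \<noteq> {}" by (auto simp: aff_dim_empty)
  then show "interior S \<noteq> {}"
    using d \<open>convex S\<close> interior_rel_interior_gen[of S] rel_interior_eq_empty[of S] by simp
qed

text \<open>Homothetic copies of \<open>S\<close> about the interior point \<open>c\<close>, with
  ratios \<open>t n\<close> tending to 1. They stay convex, as Taylor's formula demands, and each
  contains a ball, as the averaging argument behind \<open>smooth_poly_approx\<close>
  demands.\<close>

lemma convex_shrink_exhaustion: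
  fixes S :: "'a::euclidean_space set"
  assumes S: "compact S" "convex S" and c: "c \<in> interior S"
  obtains K :: "nat \<Rightarrow> 'a set" where "\<And>n. compact (K n)" "\<And>n. convex (K n)" "\<And>n. K n \<subseteq> interior S"
    "\<And>n. emeasure lborel (K n) \<noteq> 0" "\<And>x. x \<in> interior S \<Longrightarrow> \<forall>\<^sub>F n in sequentially. x \<in> K n"
proof -
  define t where "t n = real (Suc n) / real (Suc (Suc n))" for n
  have t: "0 < t n" "t n < 1" for n by (auto simp: t_def)
  define K where "K n = (\<lambda>x. (1 - t n) *\<^sub>R c + t n *\<^sub>R x) ` S" for n
  obtain e where e: "0 < e" "ball c e \<subseteq> S" using c by (auto simp: mem_interior)
  have memK: "y \<in> K n" if "c + (1 / t n) *\<^sub>R (y - c) \<in> S" for y n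
  proof -
    have "y = (1 - t n) *\<^sub>R c + t n *\<^sub>R (c + (1 / t n) *\<^sub>R (y - c))"
      using t(1)[of n] by (simp add: algebra_simps)
    then show ?thesis unfolding K_def using that by blast
  qed
  show thesis
  proof (rule that[of K])
    show "compact (K n)" for n unfolding K_def by (intro compact_continuous_image continuous_intros S)
    show "convex (K n)" for n unfolding K_def using convex_affinity[OF S(2)] by blast
    show "K n \<subseteq> interior S" for n
    proof
      fix y assume "y \<in> K n"
      then obtain x where x: "x \<in> S" "y = (1 - t n) *\<^sub>R c + t n *\<^sub>R x" by (auto simp: K_def)
      have "x - (1 - t n) *\<^sub>R (x - c) \<in> interior S"
        by (rule mem_interior_convex_shrink[OF S(2) c x(1)]) (use t[of n] in auto)
      then show "y \<in> interior S" by (simp add: x algebra_simps)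
    qed
    show "emeasure lborel (K n) \<noteq> 0" for n
    proof
      assume 0: "emeasure lborel (K n) = 0"
      have sub: "ball c (t n * e) \<subseteq> K n"
      proof
        fix y assume y: "y \<in> ball c (t n * e)"
        have "dist c (c + (1 / t n) *\<^sub>R (y - c)) = (1 / t n) * dist c y"
          using t(1)[of n] by (simp add: dist_norm norm_minus_commute)
        also have "\<dots> < e" using y t(1)[of n] by (simp add: divide_less_eq mult.commute)
        finally show "y \<in> K n" using e(2) by (intro memK) auto
      qed
      have "compact (K n)" unfolding K_def by (intro compact_continuous_image continuous_intros S)
      then have "K n \<in> null_sets lborel" using 0 by (intro null_setsI) (auto simp: borel_compact)
      then have "AE x in lborel. x \<notin> K n" by (rule AE_not_in)
      then have "AE x in lborel. x \<notin> ball c (t n * e)" by eventually_elim (use sub in blast)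
      then have "ball c (t n * e) = {}" by (intro open_null_imp_empty AE_completion) auto
      then show False using mult_pos_pos[OF t(1)[of n] e(1)] by simp
    qed
    fix x assume x: "x \<in> interior S"
    \<comment> \<open>By \<open>memK\<close> a point belongs to \<open>K n\<close> as soon as its
      dilation by \<open>1 / t n\<close> about \<open>c\<close> lies in \<open>S\<close>; these
      dilations converge to \<open>x\<close>, which is interior.\<close>
    have "(\<lambda>n. c + (1 / t n) *\<^sub>R (x - c)) \<longlonglongrightarrow> c + (1 / 1) *\<^sub>R (x - c)"
    proof (intro tendsto_intros)
      have "(\<lambda>n. 1 + inverse (real (Suc n))) \<longlonglongrightarrow> 1 + 0" by (intro tendsto_intros LIMSEQ_inverse_real_of_nat)
      moreover have "1 + inverse (real (Suc n)) = 1 / t n" for n by (simp add: t_def field_simps)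
      ultimately have "(\<lambda>n. 1 / t n) \<longlonglongrightarrow> 1" by simp
      then have "(\<lambda>n. inverse (1 / t n)) \<longlonglongrightarrow> inverse 1" by (intro tendsto_inverse) auto
      then show "t \<longlonglongrightarrow> 1" by simp
    qed auto
    then have "(\<lambda>n. c + (1 / t n) *\<^sub>R (x - c)) \<longlonglongrightarrow> x" by simp
    then have "\<forall>\<^sub>F n in sequentially. c + (1 / t n) *\<^sub>R (x - c) \<in> interior S"
      using x by (rule topological_tendstoD[OF _ open_interior])
    then show "\<forall>\<^sub>F n in sequentially. x \<in> K n"
      by eventually_elim (use memK interior_subset in blast)
  qed
qed

subsection \<open>Curved elements\<close>

locale curved_element =
  fixes S :: "(real ^ 'n::finite) set" and \<Phi> :: "real ^ 'n \<Rightarrow> real ^ 'n"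
  assumes S: "compact S" "convex S" "interior S \<noteq> {}" and element: "element_map S \<Phi>"
begin

lemma smooth_neighbourhood:
  obtains U where "S \<subseteq> U" "smooth_on U \<Phi>"
  using element unfolding element_map_def by blast

lemma inj: "inj_on \<Phi> S"
  using element by (simp add: element_map_def)

lemma inv_map [simp]: "x \<in> S \<Longrightarrow> inv_into S \<Phi> (\<Phi> x) = x"
  by (rule inv_into_f_f[OF inj])

lemma smooth_interior: "smooth_on (interior S) \<Phi>"
proof -
  obtain U where U: "S \<subseteq> U" "smooth_on U \<Phi>" by (rule smooth_neighbourhood)
  show ?thesis
    unfolding smooth_on_def
  proof (intro conjI allI)
    fix "is"
    have "foldr partial is \<Phi> differentiable_on U" using U(2) by (simp add: smooth_on_def)
    then show "foldr partial is \<Phi> differentiable_on interior S"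
      using U(1) interior_subset by (blast intro: differentiable_on_subset)
  qed simp
qed

lemma continuous: "continuous_on S \<Phi>"
proof -
  obtain U where U: "S \<subseteq> U" "smooth_on U \<Phi>" by (rule smooth_neighbourhood)
  show ?thesis by (rule continuous_on_subset[OF smooth_on_continuous[OF U(2)] U(1)])
qed

lemma compact_image: "compact (\<Phi> ` S)"
  by (rule compact_continuous_image[OF continuous S(1)])

lemma image_lebesgue [simp]: "\<Phi> ` S \<in> sets lebesgue"
  using lmeasurable_compact[OF compact_image] by (rule fmeasurableD)

lemma image_interior: "\<Phi> ` interior S \<subseteq> interior (\<Phi> ` S)" "open (\<Phi> ` interior S)"
proof -
  show "open (\<Phi> ` interior S)"
    by (rule invariance_of_domain[OF continuous_on_subset[OF continuous interior_subset] open_interior inj_on_subset[OF inj interior_subset]])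
  then show "\<Phi> ` interior S \<subseteq> interior (\<Phi> ` S)" by (intro interior_maximal image_mono interior_subset)
qed

lemma inv_continuous: "continuous_on (\<Phi> ` S) (inv_into S \<Phi>)"
  by (rule continuous_on_inv[OF continuous S(1)]) simp

text \<open>The frontier of a convex set is null, and a differentiable map preserves null sets.
  Sobolev data live on the open interior of the element while the projection integrates over the
  closed element, so the boundary has to be negligible.\<close>

lemma AE_image_interior: "AE y in lebesgue. y \<in> \<Phi> ` S \<longrightarrow> y \<in> \<Phi> ` interior S"
proof -
  obtain U where U: "S \<subseteq> U" "smooth_on U \<Phi>" by (rule smooth_neighbourhood)
  have "foldr partial [] \<Phi> differentiable_on U" using U(2) unfolding smooth_on_def by blast
  then have d: "\<Phi> differentiable_on frontier S"
    using U(1) compact_imp_closed[OF S(1)] frontier_subset_closed[of S] by (auto intro: differentiable_on_subset)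
  have "negligible (\<Phi> ` frontier S)"
    by (rule negligible_differentiable_image_negligible[OF order.refl negligible_convex_frontier[OF S(2)] d])
  then have "AE y in lebesgue. y \<notin> \<Phi> ` frontier S" by (simp add: negligible_iff_null_sets AE_not_in)
  then show ?thesis
  proof eventually_elim
    case (elim y)
    then show ?case using compact_imp_closed[OF S(1)] by (auto simp: frontier_def)
  qed
qed

lemma diameter_pos: "0 < diameter (\<Phi> ` S)"
proof -
  obtain c where "c \<in> \<Phi> ` interior S" using S(3) by auto
  then obtain e where e: "0 < e" "ball c e \<subseteq> \<Phi> ` interior S" using image_interior(2) by (auto simp: open_contains_ball)
  \<comment> \<open>Any coordinate direction will do.\<close>
  define d :: "real ^ 'n" where "d = (e / 2) *\<^sub>R axis undefined 1"
  have d: "norm d = e / 2" using e(1) by (simp add: d_def norm_axis_1)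
  have "c \<in> ball c e" "c + d \<in> ball c e" using e(1) d by (simp_all add: dist_norm)
  then have "c \<in> \<Phi> ` S" "c + d \<in> \<Phi> ` S" using e(2) image_mono[OF interior_subset, of \<Phi> S] by blast+
  then have "dist c (c + d) \<le> diameter (\<Phi> ` S)"
    by (rule diameter_bounded_bound[OF compact_imp_bounded[OF compact_image]])
  then show ?thesis using e(1) d by (simp add: dist_norm)
qed

lemma jacobian_pos: "x \<in> S \<Longrightarrow> 0 < jacobian \<Phi> x"
  using element by (simp add: element_map_def)

lemma element_jacobian_image: "x \<in> S \<Longrightarrow> element_jacobian S \<Phi> (\<Phi> x) = jacobian \<Phi> x"
  by (simp add: element_jacobian_def)

lemma jacobian_continuous_image: "continuous_on (\<Phi> ` S) (element_jacobian S \<Phi>)"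
proof -
  obtain U where U: "S \<subseteq> U" "smooth_on U \<Phi>" by (rule smooth_neighbourhood)
  have "continuous_on (\<Phi> ` S) (\<lambda>y. jacobian \<Phi> (inv_into S \<Phi> y))"
    by (rule continuous_on_compose2[OF jacobian_continuous[OF U(2,1)] inv_continuous]) auto
  then show ?thesis unfolding element_jacobian_def .
qed

lemma jacobian_bounds:
  assumes x: "x \<in> interior S"
  shows "sqrt (jacobian \<Phi> x) \<le> Linf_norm (\<Phi> ` S) (\<lambda>y. sqrt (element_jacobian S \<Phi> y))"
    and "1 / sqrt (jacobian \<Phi> x) \<le> Linf_norm (\<Phi> ` S) (\<lambda>y. 1 / sqrt (element_jacobian S \<Phi> y))"
proof -
  have xS: "x \<in> S" and yi: "\<Phi> x \<in> interior (\<Phi> ` S)" using x interior_subset image_interior(1) by auto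
  have c: "continuous_on (\<Phi> ` S) (\<lambda>y. sqrt (element_jacobian S \<Phi> y))"
    by (intro continuous_intros jacobian_continuous_image)
  have c': "continuous_on (\<Phi> ` S) (\<lambda>y. 1 / sqrt (element_jacobian S \<Phi> y))"
    by (intro continuous_intros jacobian_continuous_image) (auto simp: element_jacobian_image dest!: jacobian_pos)
  show "sqrt (jacobian \<Phi> x) \<le> Linf_norm (\<Phi> ` S) (\<lambda>y. sqrt (element_jacobian S \<Phi> y))"
    using Linf_norm_pointwise[OF compact_image c yi] jacobian_pos[OF xS] by (simp add: element_jacobian_image[OF xS])
  show "1 / sqrt (jacobian \<Phi> x) \<le> Linf_norm (\<Phi> ` S) (\<lambda>y. 1 / sqrt (element_jacobian S \<Phi> y))"
    using Linf_norm_pointwise[OF compact_image c' yi] jacobian_pos[OF xS] by (simp add: element_jacobian_image[OF xS])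
qed

text \<open>\<open>quasi_regular\<close> gives a bound on an essential supremum, which continuity
  makes pointwise. The given constant \<open>C\<^sub>0\<close> may be any real number;
  \<open>max C\<^sub>0 0\<close> supplies the nonnegative constant that the chain rule
  needs.\<close>

lemma derivative_bound:
  assumes qr: "quasi_regular N C\<^sub>0 S \<Phi>" and x: "x \<in> interior S" and l: "1 \<le> length is" "length is \<le> Suc N"
  shows "\<bar>foldr partial is (\<lambda>z. \<Phi> z $ j) x\<bar> \<le> max C\<^sub>0 0 * diameter (\<Phi> ` S) ^ length is"
proof -
  obtain U where U: "S \<subseteq> U" "smooth_on U \<Phi>" by (rule smooth_neighbourhood)
  define \<alpha> where "\<alpha> = mi_of_list is"
  have o: "mi_order \<alpha> = length is" by (simp add: \<alpha>_def mi_order_mi_of_list)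
  have sm: "smooth_on (interior S) (\<lambda>z. \<Phi> z $ j)" by (rule smooth_on_vec_nth[OF smooth_interior])
  have "foldr partial is (\<lambda>z. \<Phi> z $ j) x = mi_partial \<alpha> (\<lambda>z. \<Phi> z $ j) x"
    unfolding \<alpha>_def using sm x by (intro mi_partial_eq_foldr[symmetric]) (auto simp: smooth_on_ck)
  also have "\<dots> = mi_partial \<alpha> \<Phi> x $ j"
    unfolding mi_partial_list_of_mi by (rule foldr_partial_vec_nth[OF smooth_interior x, symmetric])
  finally have eq: "foldr partial is (\<lambda>z. \<Phi> z $ j) x = mi_partial \<alpha> \<Phi> x $ j" .
  have "foldr partial (list_of_mi \<alpha>) \<Phi> differentiable_on U" using U(2) by (simp add: smooth_on_def)
  then have "continuous_on S (mi_partial \<alpha> \<Phi>)"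
    unfolding mi_partial_list_of_mi using U(1) by (blast intro: differentiable_imp_continuous_on continuous_on_subset)
  then have "norm (mi_partial \<alpha> \<Phi> x) \<le> Linf_norm S (mi_partial \<alpha> \<Phi>)" by (rule Linf_norm_pointwise[OF S(1) _ x])
  moreover have "\<bar>mi_partial \<alpha> \<Phi> x $ j\<bar> \<le> norm (mi_partial \<alpha> \<Phi> x)" by (rule component_le_norm_cart)
  moreover have "Linf_norm S (mi_partial \<alpha> \<Phi>) \<le> C\<^sub>0 * diameter (\<Phi> ` S) ^ length is"
    using qr l unfolding quasi_regular_def o[symmetric] by simp
  moreover have "C\<^sub>0 * diameter (\<Phi> ` S) ^ length is \<le> max C\<^sub>0 0 * diameter (\<Phi> ` S) ^ length is"
    using diameter_pos by (intro mult_right_mono) auto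
  ultimately show ?thesis unfolding eq by linarith
qed

lemma mapped_polysI: "p \<in> polys N \<Longrightarrow> (\<lambda>y. p (inv_into S \<Phi> y)) \<in> mapped_polys N S \<Phi>"
  unfolding mapped_polys_def by auto

lemma mapped_polysE:
  assumes "P \<in> mapped_polys N S \<Phi>"
  obtains p where "p \<in> polys N" "\<And>y. y \<in> \<Phi> ` S \<Longrightarrow> P y = p (inv_into S \<Phi> y)"
proof -
  obtain p where p: "p \<in> polys N" "\<And>x. x \<in> S \<Longrightarrow> P (\<Phi> x) = p x" using assms unfolding mapped_polys_def by blast
  show thesis by (rule that[OF p(1)]) (auto simp: p(2))
qed

lemma mapped_polys_lin_closed: "lin_closed (mapped_polys N S \<Phi>)"
  unfolding lin_closed_def
proof (intro conjI ballI allI)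
  show "(\<lambda>x. 0) \<in> mapped_polys N S \<Phi>" using mapped_polysI[OF polys_zero] by simp
  fix f g c assume "f \<in> mapped_polys N S \<Phi>" "g \<in> mapped_polys N S \<Phi>"
  then obtain p q where p: "p \<in> polys N" "\<And>x. x \<in> S \<Longrightarrow> f (\<Phi> x) = p x" and q: "q \<in> polys N" "\<And>x. x \<in> S \<Longrightarrow> g (\<Phi> x) = q x"
    unfolding mapped_polys_def by blast
  have "(\<lambda>x. p x + c * q x) \<in> polys N" by (intro polys_add polys_cmul p q)
  then show "(\<lambda>x. f x + c * g x) \<in> mapped_polys N S \<Phi>"
    unfolding mapped_polys_def using p q by auto
qed

lemma mapped_polys_sq_integrable:
  assumes "P \<in> mapped_polys N S \<Phi>"
  shows "sq_integrable (lebesgue_on (\<Phi> ` S)) P"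
proof -
  interpret fin: finite_measure "lebesgue_on (\<Phi> ` S)"
    by (rule finite_measure_lebesgue_on[OF lmeasurable_compact[OF compact_image]])
  obtain p where p: "p \<in> polys N" "\<And>y. y \<in> \<Phi> ` S \<Longrightarrow> P y = p (inv_into S \<Phi> y)"
    using assms by (rule mapped_polysE) blast
  have "continuous_on (\<Phi> ` S) (\<lambda>y. p (inv_into S \<Phi> y))"
    by (rule continuous_on_compose2[OF continuous_on_polys[OF p(1), of UNIV] inv_continuous]) simp
  then have c: "continuous_on (\<Phi> ` S) P" using p(2) by (simp cong: continuous_on_cong)
  have m: "P \<in> borel_measurable (lebesgue_on (\<Phi> ` S))" by (rule continuous_imp_measurable_on_sets_lebesgue[OF c]) simp
  obtain B where B: "\<And>y. y \<in> \<Phi> ` S \<Longrightarrow> norm (P y) \<le> B"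
    using compact_imp_bounded[OF compact_continuous_image[OF c compact_image]] unfolding bounded_iff by auto
  have "norm ((P y)\<^sup>2) \<le> B\<^sup>2" if "y \<in> \<Phi> ` S" for y
    using power_mono[OF B[OF that], of 2] by simp
  then have "integrable (lebesgue_on (\<Phi> ` S)) (\<lambda>y. (P y)\<^sup>2)"
    using m by (intro fin.integrable_const_bound[of _ "B\<^sup>2"] AE_I2) auto
  with m show ?thesis by (simp add: sq_integrable_def)
qed

lemma fin_dim_mapped_polys: "\<exists>m b. fin_dim_L2 (lebesgue_on (\<Phi> ` S)) (mapped_polys N S \<Phi>) m b"
proof -
  obtain en where en: "bij_betw en {..<card {\<alpha> :: nat ^ 'n. mi_order \<alpha> \<le> N}} {\<alpha> :: nat ^ 'n. mi_order \<alpha> \<le> N}"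
    using ex_bij_betw_nat_finite[OF finite_mi_order_le[of N]] unfolding atLeast0LessThan by blast
  define m where "m = card {\<alpha> :: nat ^ 'n. mi_order \<alpha> \<le> N}"
  define b where "b i y = monom_at (en i) (inv_into S \<Phi> y)" for i y
  have "fin_dim_L2 (lebesgue_on (\<Phi> ` S)) (mapped_polys N S \<Phi>) m b"
  proof
    show "lin_closed (mapped_polys N S \<Phi>)" by (rule mapped_polys_lin_closed)
    show "sq_integrable (lebesgue_on (\<Phi> ` S)) P" if "P \<in> mapped_polys N S \<Phi>" for P
      using that by (rule mapped_polys_sq_integrable)
    show "b i \<in> mapped_polys N S \<Phi>" if "i < m" for i
    proof -
      have "mi_order (en i) \<le> N" using bij_betwE[OF en] that by (auto simp: m_def)
      from mapped_polysI[OF monom_at_polys[OF this]] show ?thesis unfolding b_def .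
    qed
    show "\<exists>c. AE y in lebesgue_on (\<Phi> ` S). P y = (\<Sum>i<m. c i * b i y)" if P: "P \<in> mapped_polys N S \<Phi>" for P
    proof -
      obtain p where p: "p \<in> polys N" "\<And>y. y \<in> \<Phi> ` S \<Longrightarrow> P y = p (inv_into S \<Phi> y)"
        using P by (rule mapped_polysE) blast
      obtain c where c: "p = (\<lambda>x. \<Sum>\<alpha> | mi_order \<alpha> \<le> N. c \<alpha> * monom_at \<alpha> x)" using p(1) unfolding polys_eq by blast
      have "p x = (\<Sum>i<m. c (en i) * monom_at (en i) x)" for x
        unfolding c m_def by (rule sum.reindex_bij_betw[OF en, symmetric])
      then have "AE y in lebesgue_on (\<Phi> ` S). P y = (\<Sum>i<m. c (en i) * b i y)"
        using p(2) by (intro AE_I2) (auto simp: b_def)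
      then show ?thesis by (rule exI[of _ "\<lambda>i. c (en i)"])
    qed
  qed
  then show ?thesis by blast
qed

text \<open>The choice in \<open>L2_proj\<close> becomes usable because orthogonal projections onto
  a finite-dimensional space exist.\<close>

lemma L2_proj:
  assumes "sq_integrable (lebesgue_on (\<Phi> ` S)) u"
  shows "L2_proj N S \<Phi> u \<in> mapped_polys N S \<Phi>"
    and "P \<in> mapped_polys N S \<Phi> \<Longrightarrow> (LINT x|lebesgue_on (\<Phi> ` S). (u x - L2_proj N S \<Phi> u x) * P x) = 0"
proof -
  obtain m b where "fin_dim_L2 (lebesgue_on (\<Phi> ` S)) (mapped_polys N S \<Phi>) m b" using fin_dim_mapped_polys by blast
  then interpret fin_dim_L2 "lebesgue_on (\<Phi> ` S)" "mapped_polys N S \<Phi>" m b .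
  have "\<exists>q. q \<in> mapped_polys N S \<Phi> \<and> (\<forall>p\<in>mapped_polys N S \<Phi>. (LINT x|lebesgue_on (\<Phi> ` S). (u x - q x) * p x) = 0)"
    using projection_exists[OF assms] by blast
  from someI_ex[OF this] have *: "L2_proj N S \<Phi> u \<in> mapped_polys N S \<Phi> \<and>
    (\<forall>p\<in>mapped_polys N S \<Phi>. (LINT x|lebesgue_on (\<Phi> ` S). (u x - L2_proj N S \<Phi> u x) * p x) = 0)"
    unfolding L2_proj_def .
  show "L2_proj N S \<Phi> u \<in> mapped_polys N S \<Phi>" using * by blast
  show "P \<in> mapped_polys N S \<Phi> \<Longrightarrow> (LINT x|lebesgue_on (\<Phi> ` S). (u x - L2_proj N S \<Phi> u x) * P x) = 0" using * by blast
qed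

end

section \<open>The projection error of one row of the weighted function\<close>

context curved_element
begin

text \<open>The bounds are uniform in the component \<open>j\<close>, as
  \<open>local_approximation\<close> expects: the full \<open>weight_norm\<close> and the full
  vector norm replace the norms of single entries and components.\<close>

lemma row_representatives:
  assumes W: "\<And>i j. (\<lambda>x. W x $ i $ j) \<in> sobolev (Linf_space (interior (\<Phi> ` S))) (interior (\<Phi> ` S)) (N + 1)"
    and v: "\<And>j. (\<lambda>x. v x $ j) \<in> sobolev (L2_space (interior (\<Phi> ` S))) (interior (\<Phi> ` S)) (N + 1)"
  obtains bw bv :: "'n \<Rightarrow> 'n list \<Rightarrow> real ^ 'n \<Rightarrow> real" where
    "\<And>j. borel_rep (interior (\<Phi> ` S)) (\<lambda>x. W x $ i $ j) (bw j [])"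
    "\<And>j is. length is \<le> Suc N \<Longrightarrow> integrable lborel (bw j is)"
    "\<And>j is. length is \<le> Suc N \<Longrightarrow> AE x in lborel. \<bar>bw j is x\<bar> \<le> weight_norm (interior (\<Phi> ` S)) (N + 1) W"
    "\<And>j is \<epsilon> \<eta> z. length is \<le> Suc N \<Longrightarrow> mollifier \<epsilon> \<eta> \<Longrightarrow> cball z \<epsilon> \<subseteq> interior (\<Phi> ` S) \<Longrightarrow> foldr partial is (conv (bw j []) \<eta>) z = conv (bw j is) \<eta> z"
    "\<And>j. borel_rep (interior (\<Phi> ` S)) (\<lambda>x. v x $ j) (bv j [])"
    "\<And>j is. length is \<le> Suc N \<Longrightarrow> integrable lborel (bv j is)"
    "\<And>j is. length is \<le> Suc N \<Longrightarrow> integrable lborel (\<lambda>x. (bv j is x)\<^sup>2)"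
    "\<And>j is. length is \<le> Suc N \<Longrightarrow> (LINT x|lborel. (bv j is x)\<^sup>2) \<le> (sobolev_norm_vec (interior (\<Phi> ` S)) (N + 1) v)\<^sup>2"
    "\<And>j is \<epsilon> \<eta> z. length is \<le> Suc N \<Longrightarrow> mollifier \<epsilon> \<eta> \<Longrightarrow> cball z \<epsilon> \<subseteq> interior (\<Phi> ` S) \<Longrightarrow> foldr partial is (conv (bv j []) \<eta>) z = conv (bv j is) \<eta> z"
proof -
  define U where "U = interior (\<Phi> ` S)"
  have U: "open U" "bounded U" unfolding U_def using compact_imp_bounded[OF compact_image] by (auto intro: bounded_subset interior_subset)
  have W': "\<And>i j. (\<lambda>x. W x $ i $ j) \<in> sobolev (Linf_space U) U (Suc N)"
    and v': "\<And>j. (\<lambda>x. v x $ j) \<in> sobolev (L2_space U) U (Suc N)" using W v by (simp_all add: U_def)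
  have "\<forall>j. \<exists>b. borel_rep U (\<lambda>x. W x $ i $ j) (b []) \<and> (\<forall>is. length is \<le> Suc N \<longrightarrow> integrable lborel (b is) \<and>
      (AE x in lborel. \<bar>b is x\<bar> \<le> weight_norm U (Suc N) W)) \<and>
    (\<forall>is \<epsilon> \<eta> z. length is \<le> Suc N \<longrightarrow> mollifier \<epsilon> \<eta> \<longrightarrow> cball z \<epsilon> \<subseteq> U \<longrightarrow> foldr partial is (conv (b []) \<eta>) z = conv (b is) \<eta> z)" (is "\<forall>j. \<exists>b. ?P j b")
    by (intro allI sobolev_weight_representatives[OF U W'])
  from choice[OF this] obtain bw where bw0: "\<forall>j. ?P j (bw j)" ..
  have bw: "borel_rep U (\<lambda>x. W x $ i $ j) (bw j [])"
    "length is \<le> Suc N \<Longrightarrow> integrable lborel (bw j is)"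
    "length is \<le> Suc N \<Longrightarrow> AE x in lborel. \<bar>bw j is x\<bar> \<le> weight_norm U (Suc N) W"
    "length is \<le> Suc N \<Longrightarrow> mollifier \<epsilon> \<eta> \<Longrightarrow> cball z \<epsilon> \<subseteq> U \<Longrightarrow> foldr partial is (conv (bw j []) \<eta>) z = conv (bw j is) \<eta> z" for j "is" \<epsilon> \<eta> z
    using spec[OF bw0, of j] by auto
  have "\<forall>j. \<exists>b. borel_rep U (\<lambda>x. v x $ j) (b []) \<and> (\<forall>is. length is \<le> Suc N \<longrightarrow> integrable lborel (b is) \<and>
      (integrable lborel (\<lambda>x. (b is x)\<^sup>2) \<and> (LINT x|lborel. (b is x)\<^sup>2) \<le> (sobolev_norm U (Suc N) (\<lambda>x. v x $ j))\<^sup>2)) \<and>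
    (\<forall>is \<epsilon> \<eta> z. length is \<le> Suc N \<longrightarrow> mollifier \<epsilon> \<eta> \<longrightarrow> cball z \<epsilon> \<subseteq> U \<longrightarrow> foldr partial is (conv (b []) \<eta>) z = conv (b is) \<eta> z)" (is "\<forall>j. \<exists>b. ?P j b")
    by (intro allI sobolev_L2_representatives[OF U v'])
  from choice[OF this] obtain bv where bv0: "\<forall>j. ?P j (bv j)" ..
  have bv: "borel_rep U (\<lambda>x. v x $ j) (bv j [])"
    "length is \<le> Suc N \<Longrightarrow> integrable lborel (bv j is)"
    "length is \<le> Suc N \<Longrightarrow> integrable lborel (\<lambda>x. (bv j is x)\<^sup>2)"
    "length is \<le> Suc N \<Longrightarrow> (LINT x|lborel. (bv j is x)\<^sup>2) \<le> (sobolev_norm U (Suc N) (\<lambda>x. v x $ j))\<^sup>2"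
    "length is \<le> Suc N \<Longrightarrow> mollifier \<epsilon> \<eta> \<Longrightarrow> cball z \<epsilon> \<subseteq> U \<Longrightarrow> foldr partial is (conv (bv j []) \<eta>) z = conv (bv j is) \<eta> z" for j "is" \<epsilon> \<eta> z
    using spec[OF bv0, of j] by auto
  have bv4: "(LINT x|lborel. (bv j is x)\<^sup>2) \<le> (sobolev_norm_vec U (Suc N) v)\<^sup>2" if "length is \<le> Suc N" for j "is"
    by (rule order_trans[OF bv(4)[OF that] sobolev_norm_le_vec])
  show thesis
  proof (rule that[of bw bv, folded U_def, unfolded Suc_eq_plus1[symmetric]])
  qed (rule bw bv(1-3,5) bv4; assumption)+
qed

lemma sq_integrable_row:
  fixes g u :: "real ^ 'n \<Rightarrow> real"
  assumes g: "sq_integrable lborel g" and ae: "AE y in lebesgue. y \<in> \<Phi> ` S \<longrightarrow> u y = g y"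
  shows "sq_integrable (lebesgue_on (\<Phi> ` S)) u"
proof -
  let ?D = "\<Phi> ` S"
  have gm: "g \<in> borel_measurable borel" and gi: "integrable lborel (\<lambda>y. (g y)\<^sup>2)" using g by (simp_all add: sq_integrable_def)
  have gl: "g \<in> borel_measurable lebesgue" using gm by (simp add: measurable_completion)
  then have "(\<lambda>y. if y \<in> ?D then g y else 0) \<in> borel_measurable lebesgue"
    by (intro measurable_If_set) simp_all
  moreover have "AE y in lebesgue. (if y \<in> ?D then g y else 0) = (if y \<in> ?D then u y else 0)"
    using ae by eventually_elim auto
  ultimately have "(\<lambda>y. if y \<in> ?D then u y else 0) \<in> borel_measurable lebesgue" by (rule borel_measurable_AE)
  then have m: "u \<in> borel_measurable (lebesgue_on ?D)" by (rule borel_measurable_if_D)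
  have "integrable lebesgue (\<lambda>y. (g y)\<^sup>2)" using gi gm by (subst integrable_completion) auto
  then have "integrable lebesgue (\<lambda>y. indicator ?D y *\<^sub>R (g y)\<^sup>2)" by (intro integrable_mult_indicator) simp_all
  then have i: "integrable (lebesgue_on ?D) (\<lambda>y. (g y)\<^sup>2)" by (simp add: integrable_restrict_space)
  have "AE y in lebesgue_on ?D. (g y)\<^sup>2 = (u y)\<^sup>2"
    unfolding AE_restrict_space_iff[of ?D lebesgue, simplified] using ae by eventually_elim auto
  then have "integrable (lebesgue_on ?D) (\<lambda>y. (u y)\<^sup>2)"
    using m by (intro integrable_cong_AE_imp[OF i]) auto
  with m show ?thesis by (simp add: sq_integrable_def)
qed

lemma projection_estimate:
  fixes N :: nat and W :: "real ^ 'n \<Rightarrow> real ^ 'n ^ 'n" and v :: "real ^ 'n \<Rightarrow> real ^ 'n"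
  defines "h \<equiv> diameter (\<Phi> ` S)"
  defines "L1 \<equiv> Linf_norm (\<Phi> ` S) (\<lambda>y. sqrt (element_jacobian S \<Phi> y))"
  defines "L2 \<equiv> Linf_norm (\<Phi> ` S) (\<lambda>y. 1 / sqrt (element_jacobian S \<Phi> y))"
  defines "wn \<equiv> weight_norm (interior (\<Phi> ` S)) (N + 1) W"
  defines "sv \<equiv> sobolev_norm_vec (interior (\<Phi> ` S)) (N + 1) v"
  assumes qr: "quasi_regular N C\<^sub>0 S \<Phi>"
    and W: "\<And>i j. (\<lambda>x. W x $ i $ j) \<in> sobolev (Linf_space (interior (\<Phi> ` S))) (interior (\<Phi> ` S)) (N + 1)"
    and v: "\<And>j. (\<lambda>x. v x $ j) \<in> sobolev (L2_space (interior (\<Phi> ` S))) (interior (\<Phi> ` S)) (N + 1)"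
  shows "sq_integrable (lebesgue_on (\<Phi> ` S)) (\<lambda>y. (W y *v v y) $ i)"
    and "(LINT y|lebesgue_on (\<Phi> ` S). ((W y *v v y) $ i - L2_proj N S \<Phi> (\<lambda>y. (W y *v v y) $ i) y)\<^sup>2)
      \<le> local_const CARD('n) N (max C\<^sub>0 0) (diameter S) * (h ^ Suc N * L1 * L2 * wn * sv)\<^sup>2"
proof -
  let ?D = "\<Phi> ` S" and ?U = "interior (\<Phi> ` S)"
  obtain bw bv where bw: "\<And>j. borel_rep ?U (\<lambda>x. W x $ i $ j) (bw j [])"
    "\<And>j is. length is \<le> Suc N \<Longrightarrow> integrable lborel (bw j is)"
    "\<And>j is. length is \<le> Suc N \<Longrightarrow> AE x in lborel. \<bar>bw j is x\<bar> \<le> wn"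
    "\<And>j is \<epsilon> \<eta> z. length is \<le> Suc N \<Longrightarrow> mollifier \<epsilon> \<eta> \<Longrightarrow> cball z \<epsilon> \<subseteq> ?U \<Longrightarrow> foldr partial is (conv (bw j []) \<eta>) z = conv (bw j is) \<eta> z"
    and bv: "\<And>j. borel_rep ?U (\<lambda>x. v x $ j) (bv j [])"
    "\<And>j is. length is \<le> Suc N \<Longrightarrow> integrable lborel (bv j is)"
    "\<And>j is. length is \<le> Suc N \<Longrightarrow> integrable lborel (\<lambda>x. (bv j is x)\<^sup>2)"
    "\<And>j is. length is \<le> Suc N \<Longrightarrow> (LINT x|lborel. (bv j is x)\<^sup>2) \<le> sv\<^sup>2"
    "\<And>j is \<epsilon> \<eta> z. length is \<le> Suc N \<Longrightarrow> mollifier \<epsilon> \<eta> \<Longrightarrow> cball z \<epsilon> \<subseteq> ?U \<Longrightarrow> foldr partial is (conv (bv j []) \<eta>) z = conv (bv j is) \<eta> z"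
    using row_representatives[OF W v, of i] unfolding wn_def sv_def by blast
  define g where "g y = (\<Sum>j\<in>UNIV. bw j [] y * bv j [] y)" for y
  define u where "u y = (W y *v v y) $ i" for y
  have bwm: "bw j [] \<in> borel_measurable borel" and bvm: "bv j [] \<in> borel_measurable borel" for j
    using bw(1)[of j] bv(1)[of j] by (simp_all add: borel_rep_def)
  have gm: "g \<in> borel_measurable borel" unfolding g_def using bwm bvm by measurable
  have wn0: "0 \<le> wn" unfolding wn_def by (rule weight_norm_nonneg)
  have "sq_integrable lborel (\<lambda>y. bw j [] y * bv j [] y)" for j
    unfolding sq_integrable_def
  proof (intro conjI)
    show "(\<lambda>y. bw j [] y * bv j [] y) \<in> borel_measurable lborel" using bwm[of j] bvm[of j] by simp
    show "integrable lborel (\<lambda>y. (bw j [] y * bv j [] y)\<^sup>2)"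
    proof (rule Bochner_Integration.integrable_bound)
      show "integrable lborel (\<lambda>y. wn\<^sup>2 * (bv j [] y)\<^sup>2)" using bv(3)[of "[]" j] by simp
      show "(\<lambda>y. (bw j [] y * bv j [] y)\<^sup>2) \<in> borel_measurable lborel" using bwm[of j] bvm[of j] by simp
      have "AE y in lborel. \<bar>bw j [] y\<bar> \<le> wn" by (rule bw(3)) simp
      then show "AE y in lborel. norm ((bw j [] y * bv j [] y)\<^sup>2) \<le> norm (wn\<^sup>2 * (bv j [] y)\<^sup>2)"
      proof eventually_elim
        case (elim y)
        have "(bw j [] y)\<^sup>2 \<le> wn\<^sup>2" using power_mono[OF elim, of 2] by simp
        then have "(bw j [] y)\<^sup>2 * (bv j [] y)\<^sup>2 \<le> wn\<^sup>2 * (bv j [] y)\<^sup>2" by (rule mult_right_mono) simp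
        then show ?case by (simp add: power_mult_distrib)
      qed
    qed
  qed
  then have gsq: "sq_integrable lborel g" unfolding g_def by (intro sq_integrable_sum) auto
  have "AE y in lborel. \<forall>j\<in>UNIV. y \<in> ?U \<longrightarrow> W y $ i $ j = bw j [] y \<and> v y $ j = bv j [] y"
  proof (rule AE_finite_allI)
    fix j :: 'n
    have "AE y in lborel. y \<in> ?U \<longrightarrow> W y $ i $ j = bw j [] y" "AE y in lborel. y \<in> ?U \<longrightarrow> v y $ j = bv j [] y"
      using bw(1)[of j] bv(1)[of j] by (simp_all add: borel_rep_def)
    then show "AE y in lborel. y \<in> ?U \<longrightarrow> W y $ i $ j = bw j [] y \<and> v y $ j = bv j [] y" by eventually_elim auto
  qed simp
  then have "AE y in lebesgue. \<forall>j\<in>UNIV. y \<in> ?U \<longrightarrow> W y $ i $ j = bw j [] y \<and> v y $ j = bv j [] y" by (rule AE_completion)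
  \<comment> \<open>The representatives agree with the data almost everywhere in the interior; since
    the image of the frontier is null, the identity extends to the closed element.\<close>
  then have ug: "AE y in lebesgue. y \<in> ?D \<longrightarrow> u y = g y"
    using AE_image_interior
  proof eventually_elim
    case (elim y)
    show ?case
    proof
      assume "y \<in> ?D"
      then have "y \<in> ?U" using elim(2) image_interior(1) by blast
      then show "u y = g y" using elim(1) by (simp add: u_def g_def matrix_vector_mult_def)
    qed
  qed
  have usq: "sq_integrable (lebesgue_on ?D) u" by (rule sq_integrable_row[OF gsq ug])
  then show "sq_integrable (lebesgue_on (\<Phi> ` S)) (\<lambda>y. (W y *v v y) $ i)" by (simp add: u_def[abs_def])
  \<comment> \<open>The same for all sets of the exhaustion, which is why the diameter of the full
    reference element enters as \<rho>.\<close>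
  define B where "B = local_const CARD('n) N (max C\<^sub>0 0) (diameter S) * (h ^ Suc N * L1 * L2 * wn * sv)\<^sup>2"
  have d0: "0 \<le> diameter S" by (rule diameter_ge_0[OF compact_imp_bounded[OF S(1)]])
  have B: "0 \<le> B" unfolding B_def local_const_def using d0 by simp
  obtain c where c: "c \<in> interior S" using S(3) by auto
  obtain K :: "nat \<Rightarrow> (real ^ 'n) set" where K: "\<And>n. compact (K n)" "\<And>n. convex (K n)" "\<And>n. K n \<subseteq> interior S"
    "\<And>n. emeasure lborel (K n) \<noteq> 0" "\<And>x. x \<in> interior S \<Longrightarrow> \<forall>\<^sub>F n in sequentially. x \<in> K n"
    using convex_shrink_exhaustion[OF S(1,2) c] by blast
  have KS: "K n \<subseteq> S" for n using K(3) interior_subset by blast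
  have Ecomp: "compact (\<Phi> ` K n)" for n by (rule compact_continuous_image[OF continuous_on_subset[OF continuous KS] K(1)])
  obtain m b where "fin_dim_L2 (lebesgue_on ?D) (mapped_polys N S \<Phi>) m b" using fin_dim_mapped_polys by blast
  then interpret fin_dim_L2 "lebesgue_on ?D" "mapped_polys N S \<Phi>" m b .
  have "(LINT y|lebesgue_on ?D. (u y - L2_proj N S \<Phi> u y)\<^sup>2) \<le> B"
  proof (rule projection_exhaustion[where E = "\<lambda>n. \<Phi> ` K n"])
    show "\<Phi> ` K n \<in> sets (lebesgue_on ?D)" for n
      using borel_compact[OF Ecomp[of n]] KS[of n] by (auto simp: sets_restrict_space_iff)
    have "AE y in lebesgue. y \<in> ?D \<longrightarrow> (\<forall>\<^sub>F n in sequentially. y \<in> \<Phi> ` K n)"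
      using AE_image_interior
    proof eventually_elim
      case (elim y)
      show ?case
      proof
        assume "y \<in> ?D"
        then obtain x where x: "x \<in> interior S" "y = \<Phi> x" using elim by blast
        show "\<forall>\<^sub>F n in sequentially. y \<in> \<Phi> ` K n" using K(5)[OF x(1)] by eventually_elim (auto simp: x(2))
      qed
    qed
    then show "AE y in lebesgue_on ?D. \<forall>\<^sub>F n in sequentially. y \<in> \<Phi> ` K n" by (simp add: AE_restrict_space_iff)
    show "0 \<le> B" by (rule B)
    show "sq_integrable (lebesgue_on ?D) u" by (rule usq)
    show "L2_proj N S \<Phi> u \<in> mapped_polys N S \<Phi>" by (rule L2_proj(1)[OF usq])
    show "(LINT y|lebesgue_on ?D. (u y - L2_proj N S \<Phi> u y) * P y) = 0" if "P \<in> mapped_polys N S \<Phi>" for P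
      by (rule L2_proj(2)[OF usq that])
    fix n and \<delta> :: real assume \<delta>: "0 < \<delta>"
    have "\<exists>p\<in>polys N. (\<integral>\<^sup>+y. ennreal (((\<Sum>j\<in>UNIV. bw j [] y * bv j [] y) - p (inv_into S \<Phi> y))\<^sup>2) * indicator (\<Phi> ` K n) y \<partial>lborel)
     \<le> ennreal (local_const CARD('n) N (max C\<^sub>0 0) (diameter S) * (h ^ Suc N * L1 * L2 * wn * sv)\<^sup>2 + \<delta>)"
    proof (rule local_approximation[where ?O1.0 = "interior S" and V = ?U])
      show "norm (x - y) \<le> diameter S" if "x \<in> K n" "y \<in> K n" for x y
        using diameter_bounded_bound[OF compact_imp_bounded[OF S(1)], of x y] KS[of n] that by (auto simp: dist_norm)
      show "\<bar>foldr partial is (\<lambda>z. \<Phi> z $ j) x\<bar> \<le> max C\<^sub>0 0 * h ^ length is"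
        if "x \<in> interior S" "1 \<le> length is" "length is \<le> Suc N" for x "is" j
        unfolding h_def by (rule derivative_bound[OF qr that])
      show "0 < jacobian \<Phi> x" if "x \<in> interior S" for x using that interior_subset by (blast intro: jacobian_pos)
      show "sqrt (jacobian \<Phi> x) \<le> L1" "1 / sqrt (jacobian \<Phi> x) \<le> L2" if "x \<in> interior S" for x
        unfolding L1_def L2_def by (rule jacobian_bounds[OF that])+
      show "0 \<le> L1" "0 \<le> L2" unfolding L1_def L2_def by (rule Linf_norm_nonneg)+
      show "0 < h" unfolding h_def by (rule diameter_pos)
    qed (fact smooth_interior interior_subset inj K d0 image_interior open_interior bw bv wn0 \<delta> max.cobounded2)+
    then obtain p where p: "p \<in> polys N"
      and le: "(\<integral>\<^sup>+y. ennreal ((g y - p (inv_into S \<Phi> y))\<^sup>2) * indicator (\<Phi> ` K n) y \<partial>lborel) \<le> ennreal (B + \<delta>)"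
      unfolding g_def[symmetric] B_def[symmetric] by blast
    define P where "P y = p (inv_into S \<Phi> y)" for y
    have PV: "P \<in> mapped_polys N S \<Phi>" using mapped_polysI[OF p] unfolding P_def[abs_def] .
    have "sq_integrable (lebesgue_on ?D) (\<lambda>y. u y - P y)" by (intro sq_integrable_diff usq V_sq PV)
    then have mm: "(\<lambda>y. indicator (\<Phi> ` K n) y * (u y - P y)\<^sup>2) \<in> borel_measurable (lebesgue_on ?D)"
      using \<open>\<And>n. \<Phi> ` K n \<in> sets (lebesgue_on ?D)\<close> by (intro borel_measurable_integrable sq_integrable_indicator)
    have "(\<integral>\<^sup>+y. ennreal (indicator (\<Phi> ` K n) y * (u y - P y)\<^sup>2) \<partial>lebesgue_on ?D)
      = (\<integral>\<^sup>+y. ennreal (indicator (\<Phi> ` K n) y * (u y - P y)\<^sup>2) * indicator ?D y \<partial>lebesgue)"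
      by (rule nn_integral_restrict_space) simp
    also have "\<dots> = (\<integral>\<^sup>+y. ennreal ((g y - p (inv_into S \<Phi> y))\<^sup>2) * indicator (\<Phi> ` K n) y \<partial>lebesgue)"
    proof (rule nn_integral_cong_AE)
      show "AE y in lebesgue. ennreal (indicator (\<Phi> ` K n) y * (u y - P y)\<^sup>2) * indicator ?D y
        = ennreal ((g y - p (inv_into S \<Phi> y))\<^sup>2) * indicator (\<Phi> ` K n) y"
        using ug
      proof eventually_elim
        case (elim y)
        show ?case
        proof (cases "y \<in> \<Phi> ` K n")
          case True
          then have "y \<in> ?D" using KS[of n] by blast
          then show ?thesis using elim True by (simp add: P_def)
        qed simp
      qed
    qed
    also have "\<dots> = (\<integral>\<^sup>+y. ennreal ((g y - p (inv_into S \<Phi> y))\<^sup>2) * indicator (\<Phi> ` K n) y \<partial>lborel)" by (rule nn_integral_completion)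
    also note le
    finally have "(LINT y|lebesgue_on ?D. indicator (\<Phi> ` K n) y * (u y - P y)\<^sup>2) \<le> B + \<delta>"
      using B \<delta> by (subst integral_eq_nn_integral[OF mm]) (auto intro!: enn2real_leI)
    then show "\<exists>P\<in>mapped_polys N S \<Phi>. (LINT y|lebesgue_on ?D. indicator (\<Phi> ` K n) y * (u y - P y)\<^sup>2) \<le> B + \<delta>"
      using PV by blast
  qed
  then show "(LINT y|lebesgue_on (\<Phi> ` S). ((W y *v v y) $ i - L2_proj N S \<Phi> (\<lambda>y. (W y *v v y) $ i) y)\<^sup>2)
      \<le> local_const CARD('n) N (max C\<^sub>0 0) (diameter S) * (h ^ Suc N * L1 * L2 * wn * sv)\<^sup>2"
    unfolding u_def[abs_def] B_def .
qed

end

text \<open>Positive definiteness makes the kernel trivial, so a two-sided inverse exists and the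
  choice in \<open>matrix_inv\<close> yields one.\<close>

lemma spd_matrix_inv:
  fixes A :: "real ^ 'm::finite ^ 'm"
  assumes "spd_matrix A"
  shows "matrix_inv A *v (A *v x) = x"
proof -
  have "\<xi> = 0" if "A *v \<xi> = 0" for \<xi>
  proof (rule ccontr)
    assume "\<xi> \<noteq> 0"
    then have "\<xi> \<bullet> (A *v \<xi>) > 0" using assms by (simp add: spd_matrix_def)
    then show False using that by simp
  qed
  then obtain B where "B ** A = mat 1" using matrix_left_invertible_ker[of A] by blast
  then have "A ** B = mat 1 \<and> B ** A = mat 1" using matrix_left_right_inverse by blast
  then have "matrix_inv A ** A = mat 1"
    unfolding matrix_inv_def by (rule someI2) simp
  then show ?thesis by (simp add: matrix_vector_mul_assoc)
qed

section \<open>From the rows to the weighted error\<close>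

context curved_element
begin

lemma weighted_projection_estimate:
  fixes N :: nat and W :: "real ^ 'n \<Rightarrow> real ^ 'n ^ 'n" and v :: "real ^ 'n \<Rightarrow> real ^ 'n"
  defines "X \<equiv> diameter (\<Phi> ` S) ^ Suc N * Linf_norm (\<Phi> ` S) (\<lambda>y. sqrt (element_jacobian S \<Phi> y))
    * Linf_norm (\<Phi> ` S) (\<lambda>y. 1 / sqrt (element_jacobian S \<Phi> y))
    * weight_norm (interior (\<Phi> ` S)) (N + 1) W * sobolev_norm_vec (interior (\<Phi> ` S)) (N + 1) v"
  assumes qr: "quasi_regular N C\<^sub>0 S \<Phi>"
    and W: "\<And>i j. (\<lambda>x. W x $ i $ j) \<in> sobolev (Linf_space (interior (\<Phi> ` S))) (interior (\<Phi> ` S)) (N + 1)"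
    and spd: "\<And>x. x \<in> \<Phi> ` S \<Longrightarrow> spd_matrix (W x)"
    and wt: "\<And>x. x \<in> \<Phi> ` S \<Longrightarrow> spectral_norm (matrix_inv (W x)) \<le> wt" "0 \<le> wt"
    and v: "\<And>j. (\<lambda>x. v x $ j) \<in> sobolev (L2_space (interior (\<Phi> ` S))) (interior (\<Phi> ` S)) (N + 1)"
  shows "0 \<le> X" and "L2_norm (\<Phi> ` S) (\<lambda>x. v x - matrix_inv (W x) *v L2_proj_vec N S \<Phi> (\<lambda>y. W y *v v y) x)
    \<le> sqrt (real CARD('n) * local_const CARD('n) N (max C\<^sub>0 0) (diameter S)) * X * wt"
proof -
  let ?M = "lebesgue_on (\<Phi> ` S)"
  define A where "A = local_const CARD('n) N (max C\<^sub>0 0) (diameter S)"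
  have sv: "0 \<le> sobolev_norm_vec (interior (\<Phi> ` S)) (N + 1) v"
    unfolding sobolev_norm_vec_def by (intro real_sqrt_ge_zero sum_nonneg) simp
  show X: "0 \<le> X"
    unfolding X_def using diameter_pos by (intro mult_nonneg_nonneg Linf_norm_nonneg weight_norm_nonneg sv) simp
  define r where "r i y = (W y *v v y) $ i - L2_proj N S \<Phi> (\<lambda>y. (W y *v v y) $ i) y" for i y
  define e where "e x = v x - matrix_inv (W x) *v L2_proj_vec N S \<Phi> (\<lambda>y. W y *v v y) x" for x
  have usq: "sq_integrable ?M (\<lambda>y. (W y *v v y) $ i)" for i by (rule projection_estimate(1)[OF qr W v])
  have rsq: "sq_integrable ?M (r i)" for i
    unfolding r_def by (intro sq_integrable_diff usq mapped_polys_sq_integrable[OF L2_proj(1)])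
  have r: "(LINT y|?M. (r i y)\<^sup>2) \<le> A * X\<^sup>2" for i
    using projection_estimate(2)[OF qr W v, of i] unfolding r_def A_def X_def .
  have e: "(norm (e y))\<^sup>2 \<le> wt\<^sup>2 * (\<Sum>i\<in>UNIV. (r i y)\<^sup>2)" if y: "y \<in> \<Phi> ` S" for y
  proof -
    have "e y = matrix_inv (W y) *v (W y *v v y) - matrix_inv (W y) *v L2_proj_vec N S \<Phi> (\<lambda>y. W y *v v y) y"
      by (simp add: e_def spd_matrix_inv[OF spd[OF y]])
    also have "\<dots> = matrix_inv (W y) *v (\<chi> i. r i y)"
      unfolding matrix_vector_mult_diff_distrib[symmetric] by (simp add: r_def L2_proj_vec_def minus_vec_def)
    finally have "norm (e y) \<le> spectral_norm (matrix_inv (W y)) * norm (\<chi> i. r i y)"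
      unfolding spectral_norm_def by (simp add: onorm[OF matrix_vector_mul_bounded_linear])
    also have "\<dots> \<le> wt * norm (\<chi> i. r i y)" using wt(1)[OF y] by (intro mult_right_mono) simp_all
    finally have "(norm (e y))\<^sup>2 \<le> (wt * norm (\<chi> i. r i y))\<^sup>2" by (intro power_mono) simp_all
    also have "\<dots> = wt\<^sup>2 * (\<Sum>i\<in>UNIV. (r i y)\<^sup>2)"
      unfolding power_mult_distrib power2_norm_eq_inner inner_vec_def by (simp add: power2_eq_square)
    finally show ?thesis .
  qed
  have "(LINT y|?M. (norm (e y))\<^sup>2) \<le> wt\<^sup>2 * (real CARD('n) * (A * X\<^sup>2))"
  proof -
    have int: "integrable ?M (\<lambda>y. wt\<^sup>2 * (\<Sum>i\<in>UNIV. (r i y)\<^sup>2))"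
      using rsq by (intro integrable_mult_right Bochner_Integration.integrable_sum) (simp add: sq_integrable_def)
    have "(LINT y|?M. (norm (e y))\<^sup>2) \<le> (LINT y|?M. wt\<^sup>2 * (\<Sum>i\<in>UNIV. (r i y)\<^sup>2))"
    \<comment> \<open>Integrability of the squared error is not established. If it fails, the
      left-hand integral is 0 by convention and the inequality is trivial.\<close>
    proof (cases "integrable ?M (\<lambda>y. (norm (e y))\<^sup>2)")
      case True
      then show ?thesis using int by (rule Bochner_Integration.integral_mono) (simp add: e)
    next
      case False
      then show ?thesis by (simp add: not_integrable_integral_eq sum_nonneg)
    qed
    also have "\<dots> = wt\<^sup>2 * (\<Sum>i\<in>UNIV. LINT y|?M. (r i y)\<^sup>2)"
      using rsq by (simp add: Bochner_Integration.integral_sum sq_integrable_def)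
    also have "\<dots> \<le> wt\<^sup>2 * (\<Sum>i\<in>(UNIV :: 'n set). A * X\<^sup>2)" by (intro mult_left_mono sum_mono r) simp
    finally show ?thesis by simp
  qed
  then have "L2_norm (\<Phi> ` S) e \<le> sqrt (wt\<^sup>2 * (real CARD('n) * (A * X\<^sup>2)))"
    unfolding L2_norm_def by (rule real_sqrt_le_mono)
  also have "\<dots> = sqrt (real CARD('n) * A) * X * wt" using X wt(2) by (simp add: real_sqrt_mult)
  finally show "L2_norm (\<Phi> ` S) (\<lambda>x. v x - matrix_inv (W x) *v L2_proj_vec N S \<Phi> (\<lambda>y. W y *v v y) x)
    \<le> sqrt (real CARD('n) * local_const CARD('n) N (max C\<^sub>0 0) (diameter S)) * X * wt"
    unfolding e_def[abs_def] A_def .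
qed

end

theorem theorem4p3:
  fixes Dhat :: "(real ^ 'n::finite) set" and N :: nat and C\<^sub>0 :: real
  assumes "int CARD('n) simplex Dhat"
  shows "\<exists>C>0. \<forall>(\<Phi> :: real ^ 'n \<Rightarrow> real ^ 'n) (Dk :: (real ^ 'n) set) (h :: real)
      (W :: real ^ 'n \<Rightarrow> real ^ 'n ^ 'n) (v :: real ^ 'n \<Rightarrow> real ^ 'n)
      (w_min :: real) (w_max :: real) (wt_min :: real) (wt_max :: real).
    element_map Dhat \<Phi> \<longrightarrow>
    Dk = \<Phi> ` Dhat \<longrightarrow>
    h = diameter Dk \<longrightarrow>
    quasi_regular N C\<^sub>0 Dhat \<Phi> \<longrightarrow>
    (\<forall>i j. (\<lambda>x. W x $ i $ j) \<in> sobolev (Linf_space (interior Dk)) (interior Dk) (N + 1)) \<longrightarrow>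
    (\<forall>x\<in>Dk. spd_matrix (W x)) \<longrightarrow>
    0 < w_min \<longrightarrow>
    (\<forall>x\<in>Dk. w_min \<le> spectral_norm (W x) \<and> spectral_norm (W x) \<le> w_max) \<longrightarrow>
    0 < wt_min \<longrightarrow>
    (\<forall>x\<in>Dk. wt_min \<le> spectral_norm (matrix_inv (W x)) \<and> spectral_norm (matrix_inv (W x)) \<le> wt_max) \<longrightarrow>
    (\<forall>i. (\<lambda>x. v x $ i) \<in> sobolev (L2_space (interior Dk)) (interior Dk) (N + 1)) \<longrightarrow>
    L2_norm Dk (\<lambda>x. v x - matrix_inv (W x) *v L2_proj_vec N Dhat \<Phi> (\<lambda>y. W y *v v y) x)
      \<le> C * h ^ (N + 1)
          * Linf_norm Dk (\<lambda>y. sqrt (element_jacobian Dhat \<Phi> y))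
          * Linf_norm Dk (\<lambda>y. 1 / sqrt (element_jacobian Dhat \<Phi> y))
          * wt_max
          * weight_norm (interior Dk) (N + 1) W
          * sobolev_norm_vec (interior Dk) (N + 1) v"
proof -
  have S: "compact Dhat" "convex Dhat" "interior Dhat \<noteq> {}" using full_simplex_interior[OF assms] by auto
  \<comment> \<open>The added 1 makes the constant strictly positive. Besides \<open>N\<close>, the
    dimension and \<open>C\<^sub>0\<close> it depends only on the diameter of the reference
    element.\<close>
  define C where "C = sqrt (real CARD('n) * local_const CARD('n) N (max C\<^sub>0 0) (diameter Dhat)) + 1"
  have "0 \<le> local_const CARD('n) N (max C\<^sub>0 0) (diameter Dhat)"
    unfolding local_const_def using diameter_ge_0[OF compact_imp_bounded[OF S(1)]] by simp
  then have C: "0 < C" unfolding C_def by (intro add_nonneg_pos real_sqrt_ge_zero mult_nonneg_nonneg) simp_all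
  show ?thesis
  proof (intro exI[of _ C] conjI allI impI C)
    fix \<Phi> :: "real ^ 'n \<Rightarrow> real ^ 'n" and Dk h and W :: "real ^ 'n \<Rightarrow> real ^ 'n ^ 'n" and v :: "real ^ 'n \<Rightarrow> real ^ 'n"
      and w_min w_max wt_min wt_max
    assume \<Phi>: "element_map Dhat \<Phi>" and Dk: "Dk = \<Phi> ` Dhat" and h: "h = diameter Dk" and qr: "quasi_regular N C\<^sub>0 Dhat \<Phi>"
      and W: "\<forall>i j. (\<lambda>x. W x $ i $ j) \<in> sobolev (Linf_space (interior Dk)) (interior Dk) (N + 1)"
      and spd: "\<forall>x\<in>Dk. spd_matrix (W x)" and "0 < w_min"
      and "\<forall>x\<in>Dk. w_min \<le> spectral_norm (W x) \<and> spectral_norm (W x) \<le> w_max"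
      and wt0: "0 < wt_min" and wt: "\<forall>x\<in>Dk. wt_min \<le> spectral_norm (matrix_inv (W x)) \<and> spectral_norm (matrix_inv (W x)) \<le> wt_max"
      and v: "\<forall>i. (\<lambda>x. v x $ i) \<in> sobolev (L2_space (interior Dk)) (interior Dk) (N + 1)"
    interpret curved_element Dhat \<Phi> using S \<Phi> by unfold_locales
    define X where "X = diameter Dk ^ Suc N * Linf_norm Dk (\<lambda>y. sqrt (element_jacobian Dhat \<Phi> y))
      * Linf_norm Dk (\<lambda>y. 1 / sqrt (element_jacobian Dhat \<Phi> y))
      * weight_norm (interior Dk) (N + 1) W * sobolev_norm_vec (interior Dk) (N + 1) v"
    \<comment> \<open>The element is nonempty, so the bounds on the inverse at one of its points
      force \<open>wt_max\<close> to be at least the positive \<open>wt_min\<close>.\<close>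
    obtain x where "x \<in> Dk" using S(3) interior_subset unfolding Dk by blast
    then have "wt_min \<le> wt_max" using wt by (meson order_trans)
    then have wt_max: "0 \<le> wt_max" using wt0 by simp
    have wt': "\<And>x. x \<in> \<Phi> ` Dhat \<Longrightarrow> spectral_norm (matrix_inv (W x)) \<le> wt_max"
      and spd': "\<And>x. x \<in> \<Phi> ` Dhat \<Longrightarrow> spd_matrix (W x)" using wt spd unfolding Dk by blast+
    note est = weighted_projection_estimate[OF qr W[rule_format, unfolded Dk] spd' wt' wt_max v[rule_format, unfolded Dk], folded Dk, folded X_def]
    have "L2_norm Dk (\<lambda>x. v x - matrix_inv (W x) *v L2_proj_vec N Dhat \<Phi> (\<lambda>y. W y *v v y) x) \<le> (C - 1) * X * wt_max"
      using est(2) by (simp add: C_def)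
    also have "\<dots> \<le> C * X * wt_max" using est(1) wt_max by (intro mult_right_mono) simp_all
    also have "\<dots> = C * h ^ (N + 1) * Linf_norm Dk (\<lambda>y. sqrt (element_jacobian Dhat \<Phi> y))
      * Linf_norm Dk (\<lambda>y. 1 / sqrt (element_jacobian Dhat \<Phi> y)) * wt_max * weight_norm (interior Dk) (N + 1) W
      * sobolev_norm_vec (interior Dk) (N + 1) v"
      by (simp add: X_def h)
    finally show "L2_norm Dk (\<lambda>x. v x - matrix_inv (W x) *v L2_proj_vec N Dhat \<Phi> (\<lambda>y. W y *v v y) x)
      \<le> C * h ^ (N + 1) * Linf_norm Dk (\<lambda>y. sqrt (element_jacobian Dhat \<Phi> y))
          * Linf_norm Dk (\<lambda>y. 1 / sqrt (element_jacobian Dhat \<Phi> y))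
          * wt_max * weight_norm (interior Dk) (N + 1) W * sobolev_norm_vec (interior Dk) (N + 1) v" .
  qed
qed

end
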